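(* Let $A$ and $B$ be sectorial operators in a complex Banach space $X$ with dense domain and dense range, of angles $\omega_A$ and $\omega_B$ with $\omega_A+\omega_B<\pi$, whose resolvents commute. In addition, let $A$ and $B$ be $\gamma$-sectorial in $X$ of angles $\omega_A^\gamma$ and $\omega_B^\gamma$, respectively, and assume $\omega_A^\gamma+\omega_B^\gamma<\pi$ and $\rho\in(\omega_A^\gamma,\pi-\omega_B^\gamma)$. Assume that $A$ has square function estimates and dual square function estimates associated with the two functions $$\varphi_\pm(z)=\frac{z^{1/4}}{(-e^{\pm i\rho}+z)^{1/2}}.$$ Then $A+B$ with $D(A+B)=D(A)\cap D(B)$ is closed, and $A(A+B)^{-1}$ extends to a bounded operator on $X$.
   Context: Sectors: $\Sigma_\sigma=\{z\in\mathbb C\setminus\{0\}:|\arg z|<\sigma\}$, $\Sigma_0=(0,\infty)$. $R(\lambda,A)=(\lambda-A)^{-1}$. A closed operator $A$ is sectorial of angle $\omega_A\in[0,\pi)$ if its spectrum is contained in $\overline{\Sigma_{\omega_A}}$ and $\sup\{\|\lambda R(\lambda,A)\|:\lambda\in\mathbb C\setminus\overline{\Sigma_\sigma}\}<\infty$ for every $\sigma\in(\omega_A,\pi)$. The square root in $\varphi_\pm$ is a holomorphic branch on $\Sigma_\rho$ (the sign is irrelevant); $\varphi_\pm$ belongs to $H^\infty_0(\Sigma_{\sigma})$ for every $\sigma<\rho$, where $H_0^\infty(\Sigma_\sigma)$ is the space of holomorphic functions on $\Sigma_\sigma$ bounded by $C\min\{|z|^\varepsilon,|z|^{-\varepsilon}\}$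 for some $C,\varepsilon>0$, and $\varphi_\pm(tA)$, $t>0$, is given by the usual holomorphic functional calculus. A set $\mathcal T$ of bounded operators on $X$ is $\gamma$-bounded if there is $C$ such that $\mathbb E\|\sum_{n=1}^N\gamma_nT_nx_n\|^2\le C^2\,\mathbb E\|\sum_{n=1}^N\gamma_nx_n\|^2$ for all $N\ge1$, $T_n\in\mathcal T$, $x_n\in X$, where $(\gamma_n)$ is an i.i.d. sequence of (standard) Gaussian random variables. $A$ is $\gamma$-sectorial of angle $\omega$ if for each $\varepsilon>0$ the set $\{\lambda R(\lambda,A):\lambda\notin\Sigma_{\omega+\varepsilon},\ \lambda\neq0\}$ is $\gamma$-bounded. For a separable Hilbert space $H$, $\gamma(H;X)$ is the Banach space of $\gamma$-radonifying operators $T:H\to X$, i.e. those for which $\sum_n\gamma_nTh_n$ converges in $L^2(\Omega;X)$ for some (equivalently every) orthonormal basis $(h_n)$, with norm $(\mathbb E\|\sum_n\gamma_nTh_n\|^2)^{1/2}$. $\gamma'(H;X')$ denotes its dual under trace duality. Here $H=L^2((0,\infty),\frac{dt}{t})$; concretely, $\gamma'(H;X')$ consists of the bounded operators $V:H\to X'$ for which $\|V\|_{\gamma'}:=\sup|\sum_j\langle x_j,Vg_j\rangle|<\infty$, the supremum being over all finite-rank $U:g\mapsto\sum_j\big(\int_0^\infty g\,g_j\,\frac{dt}{t}\big)x_j$ (finite sums, $g_j\in H$, $x_j\in X$) with $\|U\|_{\gamma(H;X)}\le1$. Given $\phi\in H_0^\infty(\Sigma_\sigma)$ with $\sigma>\omega_A$,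 consider for $x\in X$ the operator $T_x:H\to X$, $T_xg=\big(\int_0^\infty g(t)\phi(t\,\cdot)\frac{dt}{t}\big)(A)x$, symbolically $T_xg=\int_0^\infty g(t)\phi(tA)x\,\frac{dt}{t}$ (the formula holding literally for $x\in D(A)\cap R(A)$, which is dense in $X$), and for $x'\in X'$ the operator $T^d_{x'}:H\to X'$, $T^d_{x'}g=\big(\big(\int_0^\infty g(t)\phi(t\,\cdot)\frac{dt}{t}\big)(A)\big)'x'$, i.e. $\langle x,T^d_{x'}g\rangle=\int_0^\infty g(t)\langle\phi(tA)x,x'\rangle\frac{dt}{t}$ for $x\in D(A)\cap R(A)$. $A$ has square function estimates associated with $\phi$ if $x\mapsto T_x$ is bounded from $X$ to $\gamma(H;X)$ (i.e. $\|T_x\|_{\gamma(H;X)}\le C\|x\|$), and dual square function estimates associated with $\phi$ if $x'\mapsto T^d_{x'}$ is bounded from $X'$ to $\gamma'(H;X')$. *)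

theory Defs
  imports "HOL-Probability.Probability"
begin

section \<open>Complex Banach spaces and bounded operators\<close>

class complex_normed_vector = real_normed_vector +
  fixes scaleC :: "complex \<Rightarrow> 'a \<Rightarrow> 'a" (infixr "*\<^sub>C" 75)
  assumes scaleC_add_right: "c *\<^sub>C (x + y) = c *\<^sub>C x + c *\<^sub>C y"
    and scaleC_add_left: "(c + d) *\<^sub>C x = c *\<^sub>C x + d *\<^sub>C x"
    and scaleC_scaleC: "c *\<^sub>C (d *\<^sub>C x) = (c * d) *\<^sub>C x"
    and scaleC_of_real: "complex_of_real r *\<^sub>C x = r *\<^sub>R x"
    and norm_scaleC: "norm (c *\<^sub>C x) = cmod c * norm x"

class complex_banach = complex_normed_vector + banach

instantiation complex :: complex_normed_vector
begin

definition scaleC_complex :: "complex \<Rightarrow> complex \<Rightarrow> complex" where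
  "scaleC_complex c z = c * z"

instance
  by standard (simp_all add: scaleC_complex_def algebra_simps norm_mult scaleR_conv_of_real)

end

instance complex :: complex_banach ..

text \<open>The dual \<open>X'\<close> consists of the functions \<open>x' :: 'a \<Rightarrow> complex\<close> with
  \<open>bounded_clinear x'\<close>; its norm is \<open>onorm\<close>.\<close>

definition bounded_clinear ::
  "('a::complex_normed_vector \<Rightarrow> 'b::complex_normed_vector) \<Rightarrow> bool" where
  "bounded_clinear f \<longleftrightarrow> bounded_linear f \<and> (\<forall>c x. f (c *\<^sub>C x) = c *\<^sub>C f x)"

section \<open>Unbounded operators, spectrum, sectoriality\<close>

text \<open>An operator is a pair of a domain \<open>D\<close> and a function \<open>A\<close>, whose values outside
  \<open>D\<close> are irrelevant.\<close>

definition linear_op :: "'a::complex_normed_vector set \<Rightarrow> ('a \<Rightarrow> 'a) \<Rightarrow> bool" where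
  "linear_op D A \<longleftrightarrow>
     0 \<in> D \<and>
     (\<forall>x\<in>D. \<forall>y\<in>D. x + y \<in> D \<and> A (x + y) = A x + A y) \<and>
     (\<forall>c. \<forall>x\<in>D. c *\<^sub>C x \<in> D \<and> A (c *\<^sub>C x) = c *\<^sub>C A x)"

definition closed_op :: "'a::complex_normed_vector set \<Rightarrow> ('a \<Rightarrow> 'a) \<Rightarrow> bool" where
  "closed_op D A \<longleftrightarrow> linear_op D A \<and> closed {(x, A x) |x. x \<in> D}"

definition resolvent ::
  "'a::complex_normed_vector set \<Rightarrow> ('a \<Rightarrow> 'a) \<Rightarrow> complex \<Rightarrow> 'a \<Rightarrow> 'a" where
  "resolvent D A l = inv_into D (\<lambda>x. l *\<^sub>C x - A x)"

definition resolvent_set :: "'a::complex_normed_vector set \<Rightarrow> ('a \<Rightarrow> 'a) \<Rightarrow> complex set" where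
  "resolvent_set D A =
     {l. bij_betw (\<lambda>x. l *\<^sub>C x - A x) D UNIV \<and> bounded_clinear (resolvent D A l)}"

definition op_spectrum :: "'a::complex_normed_vector set \<Rightarrow> ('a \<Rightarrow> 'a) \<Rightarrow> complex set" where
  "op_spectrum D A = - resolvent_set D A"

definition sector :: "real \<Rightarrow> complex set" where
  "sector \<sigma> = (if \<sigma> = 0 then complex_of_real ` {0<..} else {z. z \<noteq> 0 \<and> \<bar>Arg z\<bar> < \<sigma>})"

definition sectorial :: "'a::complex_normed_vector set \<Rightarrow> ('a \<Rightarrow> 'a) \<Rightarrow> real \<Rightarrow> bool" where
  "sectorial D A \<omega> \<longleftrightarrow>
     0 \<le> \<omega> \<and> \<omega> < pi \<and> closed_op D A \<and>
     op_spectrum D A \<subseteq> closure (sector \<omega>) \<and>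
     (\<forall>\<sigma>\<in>{\<omega><..<pi}.
        bdd_above ((\<lambda>l. onorm (\<lambda>x. l *\<^sub>C resolvent D A l x)) ` (- closure (sector \<sigma>))))"

definition commuting_resolvents ::
  "'a::complex_normed_vector set \<Rightarrow> ('a \<Rightarrow> 'a) \<Rightarrow> 'a set \<Rightarrow> ('a \<Rightarrow> 'a) \<Rightarrow> bool" where
  "commuting_resolvents DA A DB B \<longleftrightarrow>
     (\<forall>l\<in>resolvent_set DA A. \<forall>m\<in>resolvent_set DB B. \<forall>x.
        resolvent DA A l (resolvent DB B m x) = resolvent DB B m (resolvent DA A l x))"

section \<open>Gaussian sequences and gamma-boundedness\<close>

text \<open>The scalar field being complex, the i.i.d. standard Gaussians are the complex ones,
  \<open>(g + \<i> g') / sqrt 2\<close> with independent \<open>g, g' \<sim> N(0,1)\<close>. (This makes the norm of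
  \<open>\<gamma>(H;X)\<close> independent of the orthonormal basis of the complex Hilbert space \<open>H\<close>; real
  Gaussians lead to the same notions with equivalent constants.) They are realised as the
  coordinates of an infinite product space; only their joint law matters.\<close>

definition gauss_space :: "(nat \<Rightarrow> real \<times> real) measure" where
  "gauss_space = (\<Pi>\<^sub>M n\<in>UNIV. std_normal_distribution \<Otimes>\<^sub>M std_normal_distribution)"

definition gauss :: "nat \<Rightarrow> (nat \<Rightarrow> real \<times> real) \<Rightarrow> complex" where
  "gauss n w = Complex (fst (w n)) (snd (w n)) / complex_of_real (sqrt 2)"

definition gamma_bounded :: "('a::complex_normed_vector \<Rightarrow> 'a) set \<Rightarrow> bool" where
  "gamma_bounded \<T> \<longleftrightarrow>
     (\<forall>T\<in>\<T>. bounded_clinear T) \<and>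
     (\<exists>C. \<forall>N\<ge>1. \<forall>T x. (\<forall>n<N. T n \<in> \<T>) \<longrightarrow>
        (\<integral>w. (norm (\<Sum>n<N. gauss n w *\<^sub>C T n (x n)))\<^sup>2 \<partial>gauss_space)
          \<le> C\<^sup>2 * (\<integral>w. (norm (\<Sum>n<N. gauss n w *\<^sub>C x n))\<^sup>2 \<partial>gauss_space))"

text \<open>That the set below consists of resolvents includes that the relevant \<open>l\<close> belong to the
  resolvent set.\<close>

definition gamma_sectorial :: "'a::complex_normed_vector set \<Rightarrow> ('a \<Rightarrow> 'a) \<Rightarrow> real \<Rightarrow> bool" where
  "gamma_sectorial D A \<omega> \<longleftrightarrow>
     0 \<le> \<omega> \<and> \<omega> < pi \<and>
     (\<forall>\<epsilon>>0. {l. l \<notin> sector (\<omega> + \<epsilon>) \<and> l \<noteq> 0} \<subseteq> resolvent_set D A \<and>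
        gamma_bounded {(\<lambda>x. l *\<^sub>C resolvent D A l x) |l. l \<notin> sector (\<omega> + \<epsilon>) \<and> l \<noteq> 0})"

section \<open>Holomorphic functional calculus\<close>

definition H0inf :: "real \<Rightarrow> (complex \<Rightarrow> complex) set" where
  "H0inf \<sigma> = {f. f holomorphic_on sector \<sigma> \<and>
     (\<exists>C>0. \<exists>\<epsilon>>0. \<forall>z\<in>sector \<sigma>. cmod (f z) \<le> C * min (cmod z powr \<epsilon>) (cmod z powr (- \<epsilon>)))}"

text \<open>\<open>(1 / (2 \<pi> \<i>)) \<integral> f(z) R(z,A) x dz\<close> over the boundary of \<open>sector \<nu>\<close>, oriented from
  \<open>\<infinity> e\<^sup>i\<^sup>\<nu>\<close> through \<open>0\<close> to \<open>\<infinity> e\<^sup>-\<^sup>i\<^sup>\<nu>\<close>, i.e. with the spectrum on the left.\<close>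

definition contour_calc ::
  "'a::complex_banach set \<Rightarrow> ('a \<Rightarrow> 'a) \<Rightarrow> real \<Rightarrow> (complex \<Rightarrow> complex) \<Rightarrow> 'a \<Rightarrow> 'a" where
  "contour_calc D A \<nu> f x =
     (1 / (2 * complex_of_real pi * \<i>)) *\<^sub>C
       integral {0<..} (\<lambda>r::real.
           (f (rcis r (- \<nu>)) * cis (- \<nu>)) *\<^sub>C resolvent D A (rcis r (- \<nu>)) x
         - (f (rcis r \<nu>) * cis \<nu>) *\<^sub>C resolvent D A (rcis r \<nu>) x)"

text \<open>Any angle strictly between some angle of sectoriality of \<open>A\<close> and \<open>\<sigma>\<close>; by Cauchy's theorem
  the calculus on \<open>sector \<sigma>\<close> does not depend on the choice.\<close>

definition calc_angle :: "'a::complex_normed_vector set \<Rightarrow> ('a \<Rightarrow> 'a) \<Rightarrow> real \<Rightarrow> real" where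
  "calc_angle D A \<sigma> = (SOME \<nu>. \<exists>\<omega>. sectorial D A \<omega> \<and> \<omega> < \<nu> \<and> \<nu> < \<sigma>)"

definition H0_calc ::
  "'a::complex_banach set \<Rightarrow> ('a \<Rightarrow> 'a) \<Rightarrow> real \<Rightarrow> (complex \<Rightarrow> complex) \<Rightarrow> 'a \<Rightarrow> 'a" where
  "H0_calc D A \<sigma> f = contour_calc D A (calc_angle D A \<sigma>) f"

text \<open>For a bounded holomorphic function \<open>f\<close> on \<open>sector \<sigma>\<close>, possibly without decay at \<open>0\<close> and
  \<open>\<infinity>\<close>, \<open>f(A)\<close> is the closed operator \<open>\<psi>(A)\<^sup>-\<^sup>1 (f \<psi>)(A)\<close> with the regulariser
  \<open>\<psi>(z) = z / (1 + z)\<^sup>2\<close> (\<open>\<psi>(A)\<close> is injective with range \<open>D(A) \<inter> R(A)\<close> when \<open>A\<close> has dense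
  domain and dense range). On \<open>H0inf \<sigma>\<close> it agrees with \<open>H0_calc\<close>.\<close>

definition regulariser :: "complex \<Rightarrow> complex" where
  "regulariser z = z / (1 + z)\<^sup>2"

definition calc_rel ::
  "'a::complex_banach set \<Rightarrow> ('a \<Rightarrow> 'a) \<Rightarrow> real \<Rightarrow> (complex \<Rightarrow> complex) \<Rightarrow> 'a \<Rightarrow> 'a \<Rightarrow> bool" where
  "calc_rel D A \<sigma> f x y \<longleftrightarrow>
     H0_calc D A \<sigma> regulariser y = H0_calc D A \<sigma> (\<lambda>z. f z * regulariser z) x"

definition calc_dom ::
  "'a::complex_banach set \<Rightarrow> ('a \<Rightarrow> 'a) \<Rightarrow> real \<Rightarrow> (complex \<Rightarrow> complex) \<Rightarrow> 'a set" where
  "calc_dom D A \<sigma> f = {x. \<exists>y. calc_rel D A \<sigma> f x y}"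

definition calc ::
  "'a::complex_banach set \<Rightarrow> ('a \<Rightarrow> 'a) \<Rightarrow> real \<Rightarrow> (complex \<Rightarrow> complex) \<Rightarrow> 'a \<Rightarrow> 'a" where
  "calc D A \<sigma> f x = (THE y. calc_rel D A \<sigma> f x y)"

text \<open>The Banach space adjoint \<open>S'\<close> of a densely defined operator \<open>S\<close> with domain \<open>E\<close>.\<close>

definition adjoint_rel ::
  "'a::complex_banach set \<Rightarrow> ('a \<Rightarrow> 'a) \<Rightarrow> ('a \<Rightarrow> complex) \<Rightarrow> ('a \<Rightarrow> complex) \<Rightarrow> bool" where
  "adjoint_rel E S x' v \<longleftrightarrow> bounded_clinear x' \<and> bounded_clinear v \<and> (\<forall>x\<in>E. v x = x' (S x))"

definition adjoint_dom :: "'a::complex_banach set \<Rightarrow> ('a \<Rightarrow> 'a) \<Rightarrow> ('a \<Rightarrow> complex) set" where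
  "adjoint_dom E S = {x'. \<exists>v. adjoint_rel E S x' v}"

definition adjoint_op ::
  "'a::complex_banach set \<Rightarrow> ('a \<Rightarrow> 'a) \<Rightarrow> ('a \<Rightarrow> complex) \<Rightarrow> ('a \<Rightarrow> complex)" where
  "adjoint_op E S x' = (THE v. adjoint_rel E S x' v)"

section \<open>Gamma-radonifying operators on \<open>H = L\<^sup>2((0,\<infinity>), dt/t)\<close> and trace duality\<close>

definition haar :: "real measure" where
  "haar = density lborel (\<lambda>t. ennreal (indicator {0<..} t / t))"

text \<open>Elements of \<open>H\<close> are represented by functions. An operator on \<open>H\<close> that is bounded with
  respect to the seminorm \<open>H_norm\<close> respects almost everywhere equality.\<close>

definition H_space :: "(real \<Rightarrow> complex) set" where
  "H_space = {g \<in> borel_measurable borel. integrable haar (\<lambda>t. (cmod (g t))\<^sup>2)}"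

definition H_norm :: "(real \<Rightarrow> complex) \<Rightarrow> real" where
  "H_norm g = sqrt (\<integral>t. (cmod (g t))\<^sup>2 \<partial>haar)"

definition H_onb :: "(nat \<Rightarrow> real \<Rightarrow> complex) \<Rightarrow> bool" where
  "H_onb h \<longleftrightarrow>
     (\<forall>n. h n \<in> H_space) \<and>
     (\<forall>m n. (\<integral>t. h m t * cnj (h n t) \<partial>haar) = (if m = n then 1 else 0)) \<and>
     (\<forall>g\<in>H_space. (\<forall>n. (\<integral>t. g t * cnj (h n t) \<partial>haar) = 0) \<longrightarrow> (AE t in haar. g t = 0))"

definition H_bounded_op :: "((real \<Rightarrow> complex) \<Rightarrow> 'a::complex_normed_vector) \<Rightarrow> bool" where
  "H_bounded_op T \<longleftrightarrow>
     (\<forall>g\<in>H_space. \<forall>h\<in>H_space. T (\<lambda>t. g t + h t) = T g + T h) \<and>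
     (\<forall>c. \<forall>g\<in>H_space. T (\<lambda>t. c * g t) = c *\<^sub>C T g) \<and>
     (\<exists>K. \<forall>g\<in>H_space. norm (T g) \<le> K * H_norm g)"

text \<open>\<open>S\<close> is the sum of the series \<open>\<Sum>n. \<gamma>\<^sub>n T h\<^sub>n\<close> in \<open>L\<^sup>2(\<Omega>;X)\<close>.\<close>

definition gamma_sums ::
  "(nat \<Rightarrow> real \<Rightarrow> complex) \<Rightarrow> ((real \<Rightarrow> complex) \<Rightarrow> 'a::complex_normed_vector) \<Rightarrow>
     ((nat \<Rightarrow> real \<times> real) \<Rightarrow> 'a) \<Rightarrow> bool" where
  "gamma_sums h T S \<longleftrightarrow>
     S \<in> borel_measurable gauss_space \<and>
     (\<lambda>N. \<integral>\<^sup>+ w. ennreal ((norm (S w - (\<Sum>n<N. gauss n w *\<^sub>C T (h n))))\<^sup>2) \<partial>gauss_space)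
       \<longlonglongrightarrow> 0"

definition gamma_radonifying :: "((real \<Rightarrow> complex) \<Rightarrow> 'a::complex_normed_vector) \<Rightarrow> bool" where
  "gamma_radonifying T \<longleftrightarrow> H_bounded_op T \<and> (\<exists>h S. H_onb h \<and> gamma_sums h T S)"

text \<open>The value does not depend on the choice of the orthonormal basis.\<close>

definition gamma_norm :: "((real \<Rightarrow> complex) \<Rightarrow> 'a::complex_normed_vector) \<Rightarrow> real" where
  "gamma_norm T = (SOME r. \<exists>h S. H_onb h \<and> gamma_sums h T S \<and>
     r = sqrt (\<integral>w. (norm (S w))\<^sup>2 \<partial>gauss_space))"

definition finite_rank_op ::
  "nat \<Rightarrow> (nat \<Rightarrow> real \<Rightarrow> complex) \<Rightarrow> (nat \<Rightarrow> 'a) \<Rightarrow> (real \<Rightarrow> complex) \<Rightarrow> 'a::complex_normed_vector"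
  where
  "finite_rank_op n g x u = (\<Sum>j<n. (\<integral>t. u t * g j t \<partial>haar) *\<^sub>C x j)"

definition dual_pairings ::
  "((real \<Rightarrow> complex) \<Rightarrow> 'a::complex_normed_vector \<Rightarrow> complex) \<Rightarrow> real set" where
  "dual_pairings V = {cmod (\<Sum>j<n. V (g j) (x j)) |n g x.
     (\<forall>j<n. g j \<in> H_space) \<and> gamma_norm (finite_rank_op n g x) \<le> 1}"

definition H_bounded_dual_op ::
  "((real \<Rightarrow> complex) \<Rightarrow> 'a::complex_normed_vector \<Rightarrow> complex) \<Rightarrow> bool" where
  "H_bounded_dual_op V \<longleftrightarrow>
     (\<forall>g\<in>H_space. bounded_clinear (V g)) \<and>
     (\<forall>g\<in>H_space. \<forall>h\<in>H_space. \<forall>x. V (\<lambda>t. g t + h t) x = V g x + V h x) \<and>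
     (\<forall>c. \<forall>g\<in>H_space. \<forall>x. V (\<lambda>t. c * g t) x = c * V g x) \<and>
     (\<exists>K. \<forall>g\<in>H_space. onorm (V g) \<le> K * H_norm g)"

definition in_gamma_dual ::
  "((real \<Rightarrow> complex) \<Rightarrow> 'a::complex_normed_vector \<Rightarrow> complex) \<Rightarrow> bool" where
  "in_gamma_dual V \<longleftrightarrow> H_bounded_dual_op V \<and> bdd_above (dual_pairings V)"

definition gamma_dual_norm ::
  "((real \<Rightarrow> complex) \<Rightarrow> 'a::complex_normed_vector \<Rightarrow> complex) \<Rightarrow> real" where
  "gamma_dual_norm V = Sup (dual_pairings V)"

section \<open>Square function estimates\<close>

text \<open>The function \<open>z \<mapsto> \<integral> g(t) \<phi>(t z) dt/t\<close>; it is bounded and holomorphic on \<open>sector \<sigma>\<close> for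
  \<open>\<phi> \<in> H0inf \<sigma>\<close> and \<open>g \<in> H\<close>, but in general not in \<open>H0inf \<sigma>\<close>.\<close>

definition sq_symbol :: "(complex \<Rightarrow> complex) \<Rightarrow> (real \<Rightarrow> complex) \<Rightarrow> complex \<Rightarrow> complex" where
  "sq_symbol \<phi> g z = (\<integral>t. g t * \<phi> (complex_of_real t * z) \<partial>haar)"

definition sq_op ::
  "'a::complex_banach set \<Rightarrow> ('a \<Rightarrow> 'a) \<Rightarrow> real \<Rightarrow> (complex \<Rightarrow> complex) \<Rightarrow> 'a \<Rightarrow>
     (real \<Rightarrow> complex) \<Rightarrow> 'a" where
  "sq_op D A \<sigma> \<phi> x g = calc D A \<sigma> (sq_symbol \<phi> g) x"

definition dual_sq_op ::
  "'a::complex_banach set \<Rightarrow> ('a \<Rightarrow> 'a) \<Rightarrow> real \<Rightarrow> (complex \<Rightarrow> complex) \<Rightarrow> ('a \<Rightarrow> complex) \<Rightarrow>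
     (real \<Rightarrow> complex) \<Rightarrow> 'a \<Rightarrow> complex" where
  "dual_sq_op D A \<sigma> \<phi> x' g =
     adjoint_op (calc_dom D A \<sigma> (sq_symbol \<phi> g)) (calc D A \<sigma> (sq_symbol \<phi> g)) x'"

text \<open>\<open>\<sigma>\<close> is admissible for \<open>\<phi>\<close> if \<open>\<phi>(tA)\<close> can be defined using \<open>sector \<sigma>\<close>. The operators
  above do not depend on the choice of an admissible \<open>\<sigma>\<close>.\<close>

definition admissible_angle ::
  "'a::complex_normed_vector set \<Rightarrow> ('a \<Rightarrow> 'a) \<Rightarrow> (complex \<Rightarrow> complex) \<Rightarrow> real \<Rightarrow> bool" where
  "admissible_angle D A \<phi> \<sigma> \<longleftrightarrow> \<sigma> < pi \<and> (\<exists>\<omega><\<sigma>. sectorial D A \<omega>) \<and> \<phi> \<in> H0inf \<sigma>"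

definition square_function_estimates ::
  "'a::complex_banach set \<Rightarrow> ('a \<Rightarrow> 'a) \<Rightarrow> (complex \<Rightarrow> complex) \<Rightarrow> bool" where
  "square_function_estimates D A \<phi> \<longleftrightarrow>
     (\<exists>\<sigma>. admissible_angle D A \<phi> \<sigma> \<and>
       (\<exists>C. \<forall>x.
          (\<forall>g\<in>H_space. x \<in> calc_dom D A \<sigma> (sq_symbol \<phi> g)) \<and>
          gamma_radonifying (sq_op D A \<sigma> \<phi> x) \<and>
          gamma_norm (sq_op D A \<sigma> \<phi> x) \<le> C * norm x))"

definition dual_square_function_estimates ::
  "'a::complex_banach set \<Rightarrow> ('a \<Rightarrow> 'a) \<Rightarrow> (complex \<Rightarrow> complex) \<Rightarrow> bool" where
  "dual_square_function_estimates D A \<phi> \<longleftrightarrow>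
     (\<exists>\<sigma>. admissible_angle D A \<phi> \<sigma> \<and>
       (\<exists>C. \<forall>x'. bounded_clinear x' \<longrightarrow>
          (\<forall>g\<in>H_space.
             x' \<in> adjoint_dom (calc_dom D A \<sigma> (sq_symbol \<phi> g)) (calc D A \<sigma> (sq_symbol \<phi> g))) \<and>
          in_gamma_dual (dual_sq_op D A \<sigma> \<phi> x') \<and>
          gamma_dual_norm (dual_sq_op D A \<sigma> \<phi> x') \<le> C * onorm x'))"

text \<open>\<open>z\<^sup>1\<^sup>/\<^sup>4 / (- e\<^sup>i\<^sup>\<theta> + z)\<^sup>1\<^sup>/\<^sup>2\<close>. For \<open>0 < \<bar>\<theta>\<bar> < \<pi>\<close> the principal branches are holomorphic on
  \<open>sector \<bar>\<theta>\<bar>\<close>: \<open>- e\<^sup>i\<^sup>\<theta> + z = - s\<close> with \<open>s \<ge> 0\<close> means \<open>z = e\<^sup>i\<^sup>\<theta> - s\<close>, and then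
  \<open>\<bar>Arg z\<bar> \<ge> \<bar>\<theta>\<bar>\<close>.\<close>

definition phi_fun :: "real \<Rightarrow> complex \<Rightarrow> complex" where
  "phi_fun \<theta> z = z powr (1/4) / csqrt (- cis \<theta> + z)"

end

theory Submission
  imports Defs "HOL-Complex_Analysis.Complex_Analysis"
begin

text \<open>
  Put \<open>P z = (z + B)\<^sup>-\<^sup>1\<close>. Formally \<open>A (A + B)\<^sup>-\<^sup>1\<close> is the contour integral
  of \<open>z\<^sup>1\<^sup>/\<^sup>2 P z A\<^sup>1\<^sup>/\<^sup>2 R(z,A)\<close> over the two rays \<open>arg z = \<rho>\<close> and \<open>arg z = - \<rho>\<close>, and there
  \<open>\<phi>(tA)\<^sup>2\<close> with \<open>t = 1 / |z|\<close> is \<open>z\<^sup>1\<^sup>/\<^sup>2 A\<^sup>1\<^sup>/\<^sup>2 R(z,A)\<close> up to a unimodular factor. So the integral, tested with \<open>x'\<close>,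
  is the integral of \<open>\<langle>z P z \<phi>(tA) x, \<phi>(tA)' x'\<rangle>\<close> against \<open>dt/t\<close>, which the two square function estimates and the
  \<open>\<gamma>\<close>-boundedness of \<open>z P z\<close> bound by \<open>C \<parallel>x\<parallel> \<parallel>x'\<parallel>\<close>: the normalised indicators of short intervals are
  orthonormal in \<open>H\<close>, and they turn Riemann sums of the integral into finite \<open>\<gamma>\<close>-norm pairings. All identities
  are established after multiplication with \<open>(A (1 + A)\<^sup>-\<^sup>2)\<^sup>2\<close>, which is injective with dense range. The resulting
  bounded \<open>S\<close> satisfies \<open>S (A + B) y = A y\<close>, and this a-priori estimate makes \<open>A + B\<close> closed and injective.
\<close>

section \<open>Complex scalar multiplication\<close>

text \<open>The hypotheses speak of operators on \<open>H\<close> and never of a single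
  \<open>\<phi>(tA)\<close>. The integral is therefore approached by averages over cells of length
  \<open>dl\<close> in the variable \<open>ln t\<close>: replacing \<open>\<phi>(tA)\<close> by a
  normalised average costs O(dl^2) per cell, O(dl) in all, while the Gaussian bounds do not depend
  on the number of cells. They require that finite orthonormal systems be compared with a norm that
  its definition ties to an unspecified basis. This is a contraction principle for Gaussian sums,
  proved by rotating pairs of complex Gaussians. Since X may be nonseparable, measurability of
  X-valued sums is obtained directly, and X-valued contour integrals are gauge integrals identified
  through functionals. All contours are handled in the coordinate w = log z: sectors become strips,
  rays horizontal lines, and decay at 0 and infinity becomes exponential decay. The decisive
  estimate is by the norm of the regularised vector and not of the vector itself, so it defines an
  operator on the dense range of the regulariser. Each of the two square functions brings one
  regulariser, hence the square in the overview.\<close>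

lemma bounded_bilinear_scaleC:
 "bounded_bilinear (scaleC :: complex => 'a::complex_normed_vector => 'a)"
proof
 fix r a and b :: 'a
 show "(r *\<^sub>R a) *\<^sub>C b = r *\<^sub>R (a *\<^sub>C b)"
  by (metis scaleC_of_real scaleC_scaleC scaleR_conv_of_real)
 show "a *\<^sub>C (r *\<^sub>R b) = r *\<^sub>R (a *\<^sub>C b)"
  by (metis mult.commute scaleC_of_real scaleC_scaleC)
 show "\<exists>K. \<forall>a (b::'a). norm (a *\<^sub>C b) \<le> norm a * norm b * K"
  by (rule exI[of _ 1]) (simp add: norm_scaleC)
qed (simp_all add: scaleC_add_left scaleC_add_right)

interpretation scaleC: bounded_bilinear "scaleC :: complex => 'a::complex_normed_vector => 'a"
 by (rule bounded_bilinear_scaleC)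

lemmas [simp] = scaleC.zero_left scaleC.zero_right

lemma scaleC_one [simp]: "1 *\<^sub>C (x::'a::complex_normed_vector) = x"
 by (metis of_real_1 scaleC_of_real scaleR_one)

lemma scaleC_minus1: "(-1) *\<^sub>C (x::'a::complex_normed_vector) = - x"
 by (simp add: scaleC.minus_left)

section \<open>Gaussian expectations as iterated integrals\<close>

text \<open>One countable base suffices: an open \<open>W\<close> is the union, over
  \<open>V\<close> in a base of the second factor, of \<open>G V \<times> V\<close> with
  \<open>G V\<close> the largest open set such that \<open>G V \<times> V \<subseteq> W\<close>.
  This makes X-valued Gaussian sums measurable although X may be nonseparable.\<close>

lemma borel_measurable_continuous_Pair_snd:
 fixes f :: "'a::topological_space \<times> 'b::second_countable_topology => 'c::topological_space"
 assumes "continuous_on UNIV f"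
 shows "f \<in> borel_measurable (borel \<Otimes>\<^sub>M borel)"
proof (rule borel_measurableI)
 fix U :: "'c set" assume "open U"
 define W where "W = f -` U"
 have oW: "open W"
  using assms \<open>open U\<close> unfolding W_def by (simp add: open_vimage)
 obtain B :: "'b set set" where B: "countable B" "topological_basis B"
  using ex_countable_basis by blast
 define G where "G V = \<Union>{G. open G \<and> G \<times> V \<subseteq> W}" for V
 have "W = (\<Union>V\<in>B. G V \<times> V)"
 proof (intro equalityI subsetI)
  fix p assume "p \<in> W"
  then obtain A1 B1 where AB: "open A1" "open B1" "fst p \<in> A1" "snd p \<in> B1" "A1 \<times> B1 \<subseteq> W"
   using oW by (metis open_prod_elim mem_Times_iff)
  then obtain V where "V \<in> B" "snd p \<in> V" "V \<subseteq> B1"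
   using B(2) topological_basisE by metis
  then have "A1 \<times> V \<subseteq> W" using AB by blast
  then have "fst p \<in> G V" unfolding G_def using AB by blast
  then show "p \<in> (\<Union>V\<in>B. G V \<times> V)"
   using \<open>V \<in> B\<close> \<open>snd p \<in> V\<close> by (auto simp: mem_Times_iff)
 next
  fix p assume "p \<in> (\<Union>V\<in>B. G V \<times> V)"
  then obtain V where "fst p \<in> G V" "snd p \<in> V" by (auto simp: mem_Times_iff)
  then obtain A where "fst p \<in> A" "A \<times> V \<subseteq> W" unfolding G_def by blast
  then show "p \<in> W" using \<open>snd p \<in> V\<close> by (metis mem_Times_iff subsetD)
 qed
 also have "\<dots> \<in> sets (borel \<Otimes>\<^sub>M borel)"
 proof (rule sets.countable_UN'[OF B(1)], clarify)
  fix V assume "V \<in> B"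
  then have "open V" using B(2) by (simp add: topological_basis_open)
  moreover have "open (G V)" unfolding G_def by blast
  ultimately show "G V \<times> V \<in> sets (borel \<Otimes>\<^sub>M borel)" by (intro pair_measureI) auto
 qed
 finally show "f -` U \<inter> space (borel \<Otimes>\<^sub>M borel) \<in> sets (borel \<Otimes>\<^sub>M borel)"
  by (simp add: W_def space_pair_measure)
qed

text \<open>Addition need not be measurable on the product of two nonseparable spaces. With the
  vector \<open>y\<close> fixed, the second coordinate is only the complex number
  \<open>c w\<close>, and the preceding lemma applies.\<close>

lemma borel_measurable_add_scaleC:
 fixes z :: "'m => 'a::complex_normed_vector"
 assumes "z \<in> borel_measurable M" "c \<in> borel_measurable M"
 shows "(%w. z w + c w *\<^sub>C y) \<in> borel_measurable M"
proof -
 have "continuous_on UNIV (%p::'a \<times> complex. fst p + snd p *\<^sub>C y)"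
  by (intro continuous_intros scaleC.continuous_on)
 then have "(%p::'a \<times> complex. fst p + snd p *\<^sub>C y) \<in> borel_measurable (borel \<Otimes>\<^sub>M borel)"
  by (rule borel_measurable_continuous_Pair_snd)
 moreover have "(%w. (z w, c w)) \<in> measurable M (borel \<Otimes>\<^sub>M borel)"
  using assms by measurable
 ultimately show ?thesis
  using measurable_compose[of "%w. (z w, c w)" M "borel \<Otimes>\<^sub>M borel" "%p. fst p + snd p *\<^sub>C y" borel]
  by simp
qed

lemma borel_measurable_add_sum_scaleC:
 fixes z :: "'m => 'a::complex_normed_vector" and N :: nat
 assumes "z \<in> borel_measurable M" "\<And>n. n < N ==> c n \<in> borel_measurable M"
 shows "(%w. z w + (\<Sum>n<N. c n w *\<^sub>C y n)) \<in> borel_measurable M"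
 using assms(2)
proof (induct N)
 case 0 show ?case using assms(1) by simp
next
 case (Suc N)
 then have "(%w. (z w + (\<Sum>n<N. c n w *\<^sub>C y n)) + c N w *\<^sub>C y N) \<in> borel_measurable M"
  by (intro borel_measurable_add_scaleC) (auto simp: less_SucI)
 then show ?case by (simp add: add.assoc)
qed

section \<open>Unitary invariance of pairs of complex Gaussians\<close>

definition gauss_pair :: "(real \<times> real) measure" where
 "gauss_pair = std_normal_distribution \<Otimes>\<^sub>M std_normal_distribution"

definition cplx :: "real \<times> real => complex" where
 "cplx c = Complex (fst c) (snd c) / complex_of_real (sqrt 2)"

text \<open>Complex multiplication carried out on \<open>real \<times> real\<close>, the space on
  which the Gaussian law has a Lebesgue density.\<close>

definition cmul :: "complex => real \<times> real => real \<times> real" where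
 "cmul a c = (Re a * fst c - Im a * snd c, Re a * snd c + Im a * fst c)"

lemma cplx_cmul: "cplx (cmul a c) = a * cplx c"
proof -
 have "Complex (fst (cmul a c)) (snd (cmul a c)) = a * Complex (fst c) (snd c)"
  by (simp add: cmul_def complex_eq_iff)
 then show ?thesis by (simp add: cplx_def)
qed

lemma cplx_add: "cplx (c + d) = cplx c + cplx d"
proof -
 have "Complex (fst (c + d)) (snd (c + d)) = Complex (fst c) (snd c) + Complex (fst d) (snd d)"
  by (simp add: complex_eq_iff)
 then show ?thesis by (simp add: cplx_def add_divide_distrib)
qed

lemma continuous_on_cplx: "continuous_on UNIV cplx"
proof -
 have "cplx = (%c. (of_real (fst c) + \<i> * of_real (snd c)) / of_real (sqrt 2))"
  by (rule ext) (simp add: cplx_def Complex_eq)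
 show ?thesis unfolding \<open>cplx = _\<close> by (intro continuous_intros) simp
qed

lemma borel_measurable_cplx [measurable]: "cplx \<in> borel_measurable borel"
 by (rule borel_measurable_continuous_onI[OF continuous_on_cplx])

lemma continuous_on_cmul: "continuous_on UNIV (cmul a)"
 unfolding cmul_def by (intro continuous_intros)

lemma borel_measurable_cmul [measurable]: "cmul a \<in> borel_measurable borel"
 by (rule borel_measurable_continuous_onI[OF continuous_on_cmul])

interpretation gauss_pair: prob_space gauss_pair
proof -
 interpret N: prob_space std_normal_distribution
  using prob_space_normal_density[of 1 0] by simp
 interpret pair_prob_space std_normal_distribution std_normal_distribution ..
 show "prob_space gauss_pair" unfolding gauss_pair_def by unfold_locales
qed

lemma sets_gauss_pair [measurable_cong, simp]: "sets gauss_pair = sets borel"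
 unfolding gauss_pair_def by (simp add: borel_prod[symmetric])

lemma space_gauss_pair [simp]: "space gauss_pair = UNIV"
 using sets_eq_imp_space_eq[OF sets_gauss_pair] by simp

text \<open>Written this way, the density visibly depends on \<open>cmod (cplx c)\<close> alone;
  this is the source of the unitary invariance below.\<close>

lemma gauss_pair_density:
 "gauss_pair = density lborel (%c. ennreal (exp (- (cmod (cplx c))\<^sup>2) / (2 * pi)))"
proof -
 interpret N: prob_space std_normal_distribution
  using prob_space_normal_density[of 1 0] by simp
 have "gauss_pair = density (lborel \<Otimes>\<^sub>M lborel)
  (%(x, y). ennreal (std_normal_density x) * ennreal (std_normal_density y))"
  unfolding gauss_pair_def
  by (rule pair_measure_density) (auto intro: sigma_finite_lborel N.sigma_finite_measure_axioms)
 also have "\<dots> = density lborel (%c. ennreal (exp (- (cmod (cplx c))\<^sup>2) / (2 * pi)))"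
  unfolding lborel_prod
 proof (rule arg_cong[where f = "density lborel"], rule ext, clarify)
  fix x y :: real
  have "(cmod (cplx (x, y)))\<^sup>2 = x\<^sup>2 / 2 + y\<^sup>2 / 2"
   by (simp add: cplx_def cmod_power2 power_divide)
  then have "std_normal_density x * std_normal_density y = exp (- (cmod (cplx (x, y)))\<^sup>2) / (2 * pi)"
   by (simp add: std_normal_density_def exp_add[symmetric] real_sqrt_mult[symmetric])
  then show "ennreal (std_normal_density x) * ennreal (std_normal_density y) =
   ennreal (exp (- (cmod (cplx (x, y)))\<^sup>2) / (2 * pi))"
   by (simp add: ennreal_mult[symmetric] normal_density_nonneg)
 qed
 finally show ?thesis .
qed

lemma nn_integral_gauss_pair:
 assumes [measurable]: "f \<in> borel_measurable borel"
 shows "(\<integral>\<^sup>+c. f c \<partial>gauss_pair) = (\<integral>\<^sup>+c. ennreal (exp (- (cmod (cplx c))\<^sup>2) / (2 * pi)) * f c \<partial>lborel)"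
 unfolding gauss_pair_density by (subst nn_integral_density) simp_all

lemma nn_integral_translate:
 fixes f :: "'a::euclidean_space => ennreal"
 assumes [measurable]: "f \<in> borel_measurable borel"
 shows "(\<integral>\<^sup>+x. f (x + t) \<partial>lborel) = (\<integral>\<^sup>+x. f x \<partial>lborel)"
proof -
 have "(\<integral>\<^sup>+x. f x \<partial>lborel) = (\<integral>\<^sup>+x. f x \<partial>distr lborel borel ((+) t))"
  by (simp add: lborel_distr_plus)
 also have "\<dots> = (\<integral>\<^sup>+x. f (t + x) \<partial>lborel)" by (subst nn_integral_distr) simp_all
 finally show ?thesis by (simp add: add.commute)
qed

text \<open>Fubini and translation invariance of the inner integral. Shears are the only changes of
  variables that the rotation of Gaussians will require.\<close>

lemma nn_integral_shear:
 fixes H :: "'a::euclidean_space \<times> 'a => ennreal"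
 assumes H: "H \<in> borel_measurable borel" and g: "continuous_on UNIV g"
 shows "(\<integral>\<^sup>+p. H (fst p + g (snd p), snd p) \<partial>lborel) = (\<integral>\<^sup>+p. H p \<partial>lborel)"
  and "(\<integral>\<^sup>+p. H (fst p, snd p + g (fst p)) \<partial>lborel) = (\<integral>\<^sup>+p. H p \<partial>lborel)"
proof -
 have [measurable]: "g \<in> borel_measurable borel" "H \<in> borel_measurable (borel \<Otimes>\<^sub>M borel)"
  using borel_measurable_continuous_onI[OF g] H by (simp_all add: borel_prod)
 have "(\<integral>\<^sup>+p. H (fst p + g (snd p), snd p) \<partial>lborel) =
   (\<integral>\<^sup>+p. H (fst p + g (snd p), snd p) \<partial>(lborel \<Otimes>\<^sub>M lborel))"
  by (simp add: lborel_prod)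
 also have "\<dots> = (\<integral>\<^sup>+y. \<integral>\<^sup>+x. H (x + g y, y) \<partial>lborel \<partial>lborel)"
  by (subst lborel_pair.nn_integral_snd[symmetric]) simp_all
 also have "\<dots> = (\<integral>\<^sup>+y. \<integral>\<^sup>+x. H (x, y) \<partial>lborel \<partial>lborel)"
  by (rule nn_integral_cong) (rule nn_integral_translate, simp)
 also have "\<dots> = (\<integral>\<^sup>+p. H p \<partial>(lborel \<Otimes>\<^sub>M lborel))"
  by (subst lborel_pair.nn_integral_snd[symmetric]) simp_all
 finally show "(\<integral>\<^sup>+p. H (fst p + g (snd p), snd p) \<partial>lborel) = (\<integral>\<^sup>+p. H p \<partial>lborel)"
  by (simp add: lborel_prod)
 have "(\<integral>\<^sup>+p. H (fst p, snd p + g (fst p)) \<partial>lborel) =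
   (\<integral>\<^sup>+p. H (fst p, snd p + g (fst p)) \<partial>(lborel \<Otimes>\<^sub>M lborel))"
  by (simp add: lborel_prod)
 also have "\<dots> = (\<integral>\<^sup>+x. \<integral>\<^sup>+y. H (x, y + g x) \<partial>lborel \<partial>lborel)"
  by (subst lborel.nn_integral_fst[symmetric]) simp_all
 also have "\<dots> = (\<integral>\<^sup>+x. \<integral>\<^sup>+y. H (x, y) \<partial>lborel \<partial>lborel)"
  by (rule nn_integral_cong) (rule nn_integral_translate, simp)
 also have "\<dots> = (\<integral>\<^sup>+p. H p \<partial>(lborel \<Otimes>\<^sub>M lborel))"
  by (subst lborel.nn_integral_fst[symmetric]) simp_all
 finally show "(\<integral>\<^sup>+p. H (fst p, snd p + g (fst p)) \<partial>lborel) = (\<integral>\<^sup>+p. H p \<partial>lborel)"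
  by (simp add: lborel_prod)
qed

text \<open>The expectation of the squared norm of \<open>z\<close> plus a Gaussian sum, as an
  iterated integral whose outermost variable belongs to the head of the list. Recursion over the
  list lets the Gaussians be treated one at a time, and the shift \<open>z\<close> absorbs those
  already integrated.\<close>

primrec gauss_nn :: "'a::complex_normed_vector list => 'a => ennreal" where
 "gauss_nn [] z = ennreal ((norm z)\<^sup>2)"
| "gauss_nn (y # ys) z = (\<integral>\<^sup>+c. gauss_nn ys (z + cplx c *\<^sub>C y) \<partial>gauss_pair)"

lemma borel_measurable_gauss_nn [measurable]:
 "gauss_nn ys \<in> borel_measurable (borel :: 'a::complex_normed_vector measure)"
proof (induction ys)
 case Nil
 have "(%z::'a. (norm z)\<^sup>2) \<in> borel_measurable borel"
  by (intro borel_measurable_continuous_onI continuous_intros)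
 then show ?case by (simp only: gauss_nn.simps) measurable
next
 case (Cons y ys)
 have "(%p::'a \<times> real \<times> real. fst p + cplx (snd p) *\<^sub>C y) \<in> borel_measurable (borel \<Otimes>\<^sub>M gauss_pair)"
  by (rule borel_measurable_add_scaleC) simp_all
 then have "(%p. gauss_nn ys (fst p + cplx (snd p) *\<^sub>C y)) \<in> borel_measurable (borel \<Otimes>\<^sub>M gauss_pair)"
  using Cons measurable_compose by blast
 then show ?case
  unfolding gauss_nn.simps
  by (intro gauss_pair.borel_measurable_nn_integral) (simp add: case_prod_beta)
qed

lemma borel_measurable_gauss_nn_add:
 assumes "c \<in> borel_measurable M"
 shows "(%w. gauss_nn ys (z + c w *\<^sub>C y)) \<in> borel_measurable M"
 using measurable_compose[OF borel_measurable_add_scaleC[OF measurable_const assms] borel_measurable_gauss_nn]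
 by simp

text \<open>The matrix with rows (a, b) and (- cnj b, cnj a), a general element of SU(2) when
  \<open>(cmod a)\<^sup>2 + (cmod b)\<^sup>2 = 1\<close>, acting on a pair of complex
  Gaussians.\<close>

definition utrans :: "complex => complex => (real \<times> real) \<times> (real \<times> real) => (real \<times> real) \<times> (real \<times> real)" where
 "utrans a b p = (cmul a (fst p) + cmul b (snd p), cmul (- cnj b) (fst p) + cmul (cnj a) (snd p))"

lemma cmul_simps: "cmul a (c + d) = cmul a c + cmul a d" "cmul (a + b) c = cmul a c + cmul b c"
  "cmul a (cmul b c) = cmul (a * b) c" "cmul 1 c = c" "cmul 0 c = 0"
 by (simp_all add: cmul_def algebra_simps prod_eq_iff)

text \<open>A matrix of determinant 1 whose lower left entry is nonzero is a product of three
  shears, upper, lower, upper, and each shear preserves Lebesgue measure.\<close>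

lemma nn_integral_lborel_utrans:
 assumes H: "H \<in> borel_measurable borel" and ab: "(cmod a)\<^sup>2 + (cmod b)\<^sup>2 = 1" and b: "b \<noteq> 0"
 shows "(\<integral>\<^sup>+p. H (utrans a b p) \<partial>lborel) = (\<integral>\<^sup>+p. H p \<partial>lborel)"
proof -
 \<comment> \<open>The product of the shears has the rows (1 + x y, x' + x (1 + y x')) and (y, 1 + y
   x'). The lower left entry and the diagonal determine \<open>y\<close>, \<open>x\<close>,
   \<open>x'\<close>; the upper right entry then agrees because the determinant is 1.\<close>
 define y where "y = - cnj b"
 define x where "x = (a - 1) / y"
 define x' where "x' = (cnj a - 1) / y"
 define S where "S t p = (fst p + cmul t (snd p), snd p)" for t and p :: "(real \<times> real) \<times> (real \<times> real)"
 define S' where "S' p = (fst p, snd p + cmul y (fst p))" for p :: "(real \<times> real) \<times> (real \<times> real)"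
 have y: "y \<noteq> 0" using b by (simp add: y_def)
 have ab': "a * cnj a + b * cnj b = 1"
  using ab by (metis complex_norm_square of_real_1 of_real_add)
 have 1: "1 + x * y = a" "1 + y * x' = cnj a" using y by (simp_all add: x_def x'_def)
 have 2: "x' + x * cnj a = b"
 proof -
  have "(x' + x * cnj a) * y = a * cnj a - 1"
   using y by (simp add: x_def x'_def field_simps)
  also have "\<dots> = b * y" using ab' by (simp add: y_def algebra_simps)
  finally show ?thesis using y by simp
 qed
 have U: "utrans a b p = S x (S' (S x' p))" for p
 proof -
  have "snd (S' (S x' p)) = cmul y (fst p) + cmul (1 + y * x') (snd p)"
   by (simp only: S_def S'_def fst_conv snd_conv cmul_simps add.commute add.left_commute)
  moreover have "fst (S x (S' (S x' p))) = cmul (1 + x * y) (fst p) + cmul (x' + x * (1 + y * x')) (snd p)"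
   by (simp only: S_def S'_def fst_conv snd_conv cmul_simps add.commute add.left_commute add.assoc
     ring_distribs mult_1_right mult.assoc)
  ultimately show ?thesis
   unfolding 1 2 by (simp add: utrans_def S_def S'_def y_def prod_eq_iff)
 qed
 have cS: "continuous_on UNIV (S t)" "continuous_on UNIV S'" for t
  unfolding S_def S'_def using continuous_on_cmul
  by (auto intro!: continuous_intros intro: continuous_on_compose2[OF continuous_on_cmul])
 have m: "(%p. H (S t p)) \<in> borel_measurable borel" "(%p. H (S t (S' p))) \<in> borel_measurable borel" for t
  using measurable_compose[OF borel_measurable_continuous_onI[OF cS(1)] H]
   measurable_compose[OF borel_measurable_continuous_onI[OF continuous_on_compose2[OF cS]] H]
  by auto
 have "(\<integral>\<^sup>+p. H (utrans a b p) \<partial>lborel) = (\<integral>\<^sup>+p. H (S x (S' (S x' p))) \<partial>lborel)" by (simp add: U)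
 also have "\<dots> = (\<integral>\<^sup>+p. H (S x (S' p)) \<partial>lborel)"
  using nn_integral_shear(1)[OF m(2) continuous_on_cmul] by (simp add: S_def)
 also have "\<dots> = (\<integral>\<^sup>+p. H (S x p) \<partial>lborel)"
  using nn_integral_shear(2)[OF m(1) continuous_on_cmul] by (simp add: S'_def)
 also have "\<dots> = (\<integral>\<^sup>+p. H p \<partial>lborel)"
  using nn_integral_shear(1)[OF H continuous_on_cmul] by (simp add: S_def)
 finally show ?thesis .
qed

lemma continuous_on_utrans: "continuous_on UNIV (utrans a b)"
 unfolding utrans_def
 by (auto intro!: continuous_intros intro: continuous_on_compose2[OF continuous_on_cmul])

lemma nn_integral_gauss_pair2:
 assumes F: "F \<in> borel_measurable borel"
 shows "(\<integral>\<^sup>+c. \<integral>\<^sup>+d. F (c, d) \<partial>gauss_pair \<partial>gauss_pair) =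
  (\<integral>\<^sup>+p. ennreal (exp (- (cmod (cplx (fst p)))\<^sup>2 - (cmod (cplx (snd p)))\<^sup>2) / (2 * pi)\<^sup>2) * F p \<partial>lborel)"
proof -
 have [measurable]: "F \<in> borel_measurable (borel \<Otimes>\<^sub>M borel)" using F by (simp add: borel_prod)
 define w where "w c = exp (- (cmod (cplx c))\<^sup>2) / (2 * pi)" for c
 have w[measurable]: "w \<in> borel_measurable borel" unfolding w_def by measurable
 have wn: "w c \<ge> 0" for c by (simp add: w_def)
 have "(\<integral>\<^sup>+c. \<integral>\<^sup>+d. F (c, d) \<partial>gauss_pair \<partial>gauss_pair) =
  (\<integral>\<^sup>+c. ennreal (w c) * (\<integral>\<^sup>+d. ennreal (w d) * F (c, d) \<partial>lborel) \<partial>lborel)"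
  by (simp add: nn_integral_gauss_pair w_def)
 also have "\<dots> = (\<integral>\<^sup>+c. \<integral>\<^sup>+d. ennreal (w c * w d) * F (c, d) \<partial>lborel \<partial>lborel)"
  by (simp add: nn_integral_cmult[symmetric] ennreal_mult wn mult.assoc)
 also have "\<dots> = (\<integral>\<^sup>+p. ennreal (w (fst p) * w (snd p)) * F p \<partial>(lborel \<Otimes>\<^sub>M lborel))"
  by (subst lborel.nn_integral_fst[symmetric]) simp_all
 also have "\<dots> = (\<integral>\<^sup>+p. ennreal (exp (- (cmod (cplx (fst p)))\<^sup>2 - (cmod (cplx (snd p)))\<^sup>2) / (2 * pi)\<^sup>2) * F p \<partial>lborel)"
  unfolding lborel_prod
  by (simp add: w_def power2_eq_square mult_exp_exp)
 finally show ?thesis .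
qed

text \<open>Lebesgue measure is preserved by the shear decomposition, and the density because a
  unitary matrix preserves the sum of the squared moduli.\<close>

lemma nn_integral_gauss_utrans:
 assumes F: "F \<in> borel_measurable borel" and ab: "(cmod a)\<^sup>2 + (cmod b)\<^sup>2 = 1" and b: "b \<noteq> 0"
 shows "(\<integral>\<^sup>+c. \<integral>\<^sup>+d. F (utrans a b (c, d)) \<partial>gauss_pair \<partial>gauss_pair) =
  (\<integral>\<^sup>+c. \<integral>\<^sup>+d. F (c, d) \<partial>gauss_pair \<partial>gauss_pair)"
proof -
 define W where "W p = exp (- (cmod (cplx (fst p)))\<^sup>2 - (cmod (cplx (snd p)))\<^sup>2) / (2 * pi)\<^sup>2"
  for p :: "(real \<times> real) \<times> (real \<times> real)"
 have ab': "a * cnj a + b * cnj b = 1"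
  using ab by (metis complex_norm_square of_real_1 of_real_add)
 have id: "(cmod (a * u + b * v))\<^sup>2 + (cmod (cnj a * v - cnj b * u))\<^sup>2 = (cmod u)\<^sup>2 + (cmod v)\<^sup>2" for u v
 proof -
  have "(a * u + b * v) * cnj (a * u + b * v) + (cnj a * v - cnj b * u) * cnj (cnj a * v - cnj b * u)
   = (a * cnj a + b * cnj b) * (u * cnj u + v * cnj v)"
   by (simp add: algebra_simps)
  then have "complex_of_real ((cmod (a * u + b * v))\<^sup>2 + (cmod (cnj a * v - cnj b * u))\<^sup>2) =
   complex_of_real ((cmod u)\<^sup>2 + (cmod v)\<^sup>2)"
   by (simp only: ab' of_real_add complex_norm_square mult_1_left)
  then show ?thesis using of_real_eq_iff by blast
 qed
 have WU: "W (utrans a b p) = W p" for p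
  using id[of "cplx (fst p)" "cplx (snd p)"]
  by (simp add: W_def utrans_def cplx_add cplx_cmul algebra_simps del: minus_add_distrib)
 have W[measurable]: "W \<in> borel_measurable (borel \<Otimes>\<^sub>M borel)"
  unfolding W_def[abs_def] by measurable
 have mU: "(%p. F (utrans a b p)) \<in> borel_measurable borel"
  using measurable_compose[OF borel_measurable_continuous_onI[OF continuous_on_utrans] F] by simp
 have mWF: "(%p. ennreal (W p) * F p) \<in> borel_measurable borel"
  using W F by (auto simp: borel_prod intro!: borel_measurable_times_ennreal)
 have "(\<integral>\<^sup>+c. \<integral>\<^sup>+d. F (utrans a b (c, d)) \<partial>gauss_pair \<partial>gauss_pair) =
  (\<integral>\<^sup>+p. ennreal (W (utrans a b p)) * F (utrans a b p) \<partial>lborel)"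
  by (subst nn_integral_gauss_pair2[OF mU]) (simp add: WU, simp add: W_def)
 also have "\<dots> = (\<integral>\<^sup>+p. ennreal (W p) * F p \<partial>lborel)"
  by (rule nn_integral_lborel_utrans[OF mWF ab b])
 finally show ?thesis by (simp add: nn_integral_gauss_pair2[OF F] W_def)
qed

text \<open>Rotating the two outermost Gaussians by \<open>utrans\<close> does not change their law;
  moving the matrix over to the vectors transposes it.\<close>

lemma gauss_nn_rotate:
 fixes y1 y2 :: "'a::complex_normed_vector"
 assumes ab: "(cmod a)\<^sup>2 + (cmod b)\<^sup>2 = 1"
 shows "gauss_nn ((a *\<^sub>C y1 - cnj b *\<^sub>C y2) # (b *\<^sub>C y1 + cnj a *\<^sub>C y2) # ys) z = gauss_nn (y1 # y2 # ys) z"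
proof -
 have *: "gauss_nn ((a *\<^sub>C y1 - cnj b *\<^sub>C y2) # (b *\<^sub>C y1 + cnj a *\<^sub>C y2) # ys) z = gauss_nn (y1 # y2 # ys) z"
  if ab: "(cmod a)\<^sup>2 + (cmod b)\<^sup>2 = 1" and b: "b \<noteq> 0" for a b and y1 y2 :: 'a
 proof -
  define F where "F p = gauss_nn ys (z + cplx (fst p) *\<^sub>C y1 + cplx (snd p) *\<^sub>C y2)" for p
  have 1: "(%p. z + cplx (fst p) *\<^sub>C y1 + cplx (snd p) *\<^sub>C y2) \<in> borel_measurable (borel \<Otimes>\<^sub>M borel)"
   by (intro borel_measurable_add_scaleC) simp_all
  have F: "F \<in> borel_measurable borel"
   using measurable_compose[OF 1 borel_measurable_gauss_nn] by (simp add: F_def[abs_def] borel_prod)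
  have "F (utrans a b (c, d)) = gauss_nn ys
   (z + cplx c *\<^sub>C (a *\<^sub>C y1 - cnj b *\<^sub>C y2) + cplx d *\<^sub>C (b *\<^sub>C y1 + cnj a *\<^sub>C y2))" for c d
   unfolding F_def utrans_def
   by (rule arg_cong[where f = "gauss_nn ys"])
    (simp add: cplx_add cplx_cmul scaleC_add_left scaleC_add_right scaleC.diff_right scaleC.minus_left
     scaleC.diff_left scaleC_scaleC mult.commute algebra_simps)
  then show ?thesis
   using nn_integral_gauss_utrans[OF F ab b] by (simp add: F_def)
 qed
 show ?thesis
 proof (cases "b = 0")
  case False then show ?thesis using * ab by blast
 next
  case True
  then have a: "cmod a = 1" using ab norm_ge_zero[of a] by (auto simp: power2_eq_1_iff)
  \<comment> \<open>The shear decomposition excludes \<open>b = 0\<close>. A diagonal rotation is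
    the product of two rotations with zero diagonal.\<close>
  have "gauss_nn (y1 # y2 # ys) z = gauss_nn ((- y2) # y1 # ys) z"
   using *[of 0 1 y1 y2] by simp
  also have "\<dots> = gauss_nn (a *\<^sub>C y1 # cnj a *\<^sub>C y2 # ys) z"
   using *[of 0 "- cnj a" "- y2" y1] a norm_zero by (cases "a = 0") (auto simp: scaleC.minus_left scaleC.minus_right)
  finally show ?thesis using True by simp
 qed
qed

lemma gauss_nn_zero: "gauss_nn (0 # ys) z = gauss_nn ys z"
 using gauss_pair.emeasure_space_1 by simp

text \<open>A change of phase is a diagonal rotation whose second vector is
  \<open>0\<close>.\<close>

lemma gauss_nn_phase:
 assumes "cmod a = 1" shows "gauss_nn (a *\<^sub>C y # ys) z = gauss_nn (y # ys) z"
proof -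
 have "gauss_nn (y # 0 # ys) z = gauss_nn (a *\<^sub>C y # 0 # ys) z"
  using gauss_nn_rotate[of a 0 y 0 ys z] assms by simp
 then show ?thesis using gauss_nn_zero[of ys] by (simp only: gauss_nn.simps(2))
qed

text \<open>Jensen's inequality by symmetry: the terms with \<open>y\<close> and \<open>- y\<close>
  have the same expectation, and by convexity of the squared norm their mean dominates the value at
  \<open>z\<close>.\<close>

lemma gauss_nn_Nil_le: "gauss_nn [] z \<le> gauss_nn ys z"
proof (induction ys arbitrary: z)
 case (Cons y ys)
 have m: "(%c. gauss_nn [] (z + cplx c *\<^sub>C u)) \<in> borel_measurable gauss_pair" for u
  by (rule borel_measurable_gauss_nn_add) simp
 have "2 * gauss_nn [] z = (\<integral>\<^sup>+c. 2 * gauss_nn [] z \<partial>gauss_pair)"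
  using gauss_pair.emeasure_space_1 by simp
 also have "\<dots> \<le> (\<integral>\<^sup>+c. gauss_nn [] (z + cplx c *\<^sub>C y) + gauss_nn [] (z + cplx c *\<^sub>C ((-1) *\<^sub>C y)) \<partial>gauss_pair)"
 proof (rule nn_integral_mono)
  fix c
  have "norm (2 *\<^sub>R z) \<le> norm (z + cplx c *\<^sub>C y) + norm (z - cplx c *\<^sub>C y)"
   using norm_triangle_ineq[of "z + cplx c *\<^sub>C y" "z - cplx c *\<^sub>C y"] by (simp add: scaleR_2)
  then have "(2 * norm z)\<^sup>2 \<le> (norm (z + cplx c *\<^sub>C y) + norm (z - cplx c *\<^sub>C y))\<^sup>2"
   by (intro power_mono) auto
  also have "\<dots> \<le> 2 * (norm (z + cplx c *\<^sub>C y))\<^sup>2 + 2 * (norm (z - cplx c *\<^sub>C y))\<^sup>2"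
   using sum_squares_bound[of "norm (z + cplx c *\<^sub>C y)" "norm (z - cplx c *\<^sub>C y)"]
   by (simp add: power2_sum)
  finally have "2 * (norm z)\<^sup>2 \<le> (norm (z + cplx c *\<^sub>C y))\<^sup>2 + (norm (z - cplx c *\<^sub>C y))\<^sup>2"
   by (simp add: power_mult_distrib)
  then have "ennreal (2 * (norm z)\<^sup>2) \<le> ennreal ((norm (z + cplx c *\<^sub>C y))\<^sup>2 + (norm (z - cplx c *\<^sub>C y))\<^sup>2)"
   by (rule ennreal_leI)
  then show "2 * gauss_nn [] z \<le> gauss_nn [] (z + cplx c *\<^sub>C y) + gauss_nn [] (z + cplx c *\<^sub>C ((-1) *\<^sub>C y))"
   by (simp add: scaleC.minus_right scaleC_minus1 ennreal_plus ennreal_mult)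
 qed
 also have "\<dots> = gauss_nn [y] z + gauss_nn [(-1) *\<^sub>C y] z"
  by (subst nn_integral_add[OF m m]) simp
 also have "gauss_nn [(-1) *\<^sub>C y] z = gauss_nn [y] z" by (rule gauss_nn_phase) simp
 finally have "2 * gauss_nn [] z \<le> 2 * gauss_nn [y] z" by (simp add: mult_2)
 then have "gauss_nn [] z \<le> gauss_nn [y] z"
  by (subst (asm) ennreal_mult_le_mult_iff) auto
 also have "\<dots> = (\<integral>\<^sup>+c. gauss_nn [] (z + cplx c *\<^sub>C y) \<partial>gauss_pair)" by simp
 also have "\<dots> \<le> (\<integral>\<^sup>+c. gauss_nn ys (z + cplx c *\<^sub>C y) \<partial>gauss_pair)"
  by (intro nn_integral_mono Cons.IH)
 finally show ?case by simp
qed simp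

text \<open>Givens elimination. A list of pairs (functional, vector) represents the map sending
  \<open>f\<close> to the sum of \<open>l f *\<^sub>C y\<close>. Vectors are rotated by a unitary
  matrix and functionals by its complex conjugate, so the represented map, the sum of squares and
  the Gaussian expectation are all preserved, while the values at \<open>e\<close> are pushed into
  the head.\<close>

lemma gauss_nn_rotate_to_head:
 fixes L :: "(('v => complex) \<times> 'a::complex_normed_vector) list"
 assumes "L \<noteq> []" "\<forall>p\<in>set L. Q (fst p)"
  and Q: "\<And>l l' c c'. Q l ==> Q l' ==> Q (%f. c * l f + c' * l' f)"
 obtains l1 y1 M where "\<And>z. gauss_nn (y1 # map snd M) z = gauss_nn (map snd L) z"
  "\<And>f. (\<Sum>(l, y)\<leftarrow>(l1, y1) # M. l f *\<^sub>C y) = (\<Sum>(l, y)\<leftarrow>L. l f *\<^sub>C y)"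
  "\<And>f. (\<Sum>(l, y)\<leftarrow>(l1, y1) # M. (cmod (l f))\<^sup>2) = (\<Sum>(l, y)\<leftarrow>L. (cmod (l f))\<^sup>2)"
  "\<forall>p\<in>set ((l1, y1) # M). Q (fst p)" "\<forall>p\<in>set M. fst p e = 0"
proof -
 have "\<exists>l1 y1 M. (\<forall>z. gauss_nn (y1 # map snd M) z = gauss_nn (map snd L) z) \<and>
  (\<forall>f. (\<Sum>(l, y)\<leftarrow>(l1, y1) # M. l f *\<^sub>C y) = (\<Sum>(l, y)\<leftarrow>L. l f *\<^sub>C y)) \<and>
  (\<forall>f. (\<Sum>(l, y)\<leftarrow>(l1, y1) # M. (cmod (l f))\<^sup>2) = (\<Sum>(l, y)\<leftarrow>L. (cmod (l f))\<^sup>2)) \<and>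
  (\<forall>p\<in>set ((l1, y1) # M). Q (fst p)) \<and> (\<forall>p\<in>set M. fst p e = 0)"
  using assms(1,2)
 proof (induction L rule: induct_list012)
  case (2 x)
  then show ?case
   by (intro exI[of _ "fst x"] exI[of _ "snd x"] exI[of _ "[]"]) (auto simp: case_prod_beta)
 next
  case (3 x x' L')
  obtain l y where x: "x = (l, y)" by (cases x)
  have ne: "x' # L' \<noteq> []" and Q': "\<forall>p\<in>set (x' # L'). Q (fst p)" using "3.prems" by auto
  obtain l1 y1 M where M: "\<And>z. gauss_nn (y1 # map snd M) z = gauss_nn (map snd (x' # L')) z"
   "\<And>f. (\<Sum>(l, y)\<leftarrow>(l1, y1) # M. l f *\<^sub>C y) = (\<Sum>(l, y)\<leftarrow>x' # L'. l f *\<^sub>C y)"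
   "\<And>f. (\<Sum>(l, y)\<leftarrow>(l1, y1) # M. (cmod (l f))\<^sup>2) = (\<Sum>(l, y)\<leftarrow>x' # L'. (cmod (l f))\<^sup>2)"
   "\<forall>p\<in>set ((l1, y1) # M). Q (fst p)" "\<forall>p\<in>set M. fst p e = 0"
   using "3.IH"(2)[OF ne Q'] by blast
  \<comment> \<open>The rotation is chosen so that the new second functional \<open>l1'\<close>
    vanishes at \<open>e\<close>; if both values at \<open>e\<close> vanish already, it is the
    identity.\<close>
  define r where "r = sqrt ((cmod (l e))\<^sup>2 + (cmod (l1 e))\<^sup>2)"
  define a where "a = (if r = 0 then 1 else l e / of_real r)"
  define b where "b = (if r = 0 then 0 else - cnj (l1 e) / of_real r)"
  have r2: "r\<^sup>2 = (cmod (l e))\<^sup>2 + (cmod (l1 e))\<^sup>2" by (simp add: r_def)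
  have ab: "(cmod a)\<^sup>2 + (cmod b)\<^sup>2 = 1"
  proof (cases "r = 0")
   case False
   then have "(cmod a)\<^sup>2 + (cmod b)\<^sup>2 = ((cmod (l e))\<^sup>2 + (cmod (l1 e))\<^sup>2) / r\<^sup>2"
    by (simp add: a_def b_def norm_divide power_divide add_divide_distrib)
   then show ?thesis using False by (simp add: r2[symmetric])
  qed (simp add: a_def b_def)
  have ab': "a * cnj a + b * cnj b = 1"
   using ab by (metis complex_norm_square of_real_1 of_real_add)
  define l' where "l' f = cnj a * l f + (- b) * l1 f" for f
  define l1' where "l1' f = cnj b * l f + a * l1 f" for f
  define y' where "y' = a *\<^sub>C y - cnj b *\<^sub>C y1"
  define y1' where "y1' = b *\<^sub>C y + cnj a *\<^sub>C y1"
  have s1: "l' f *\<^sub>C y' + l1' f *\<^sub>C y1' = l f *\<^sub>C y + l1 f *\<^sub>C y1" for f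
  proof -
   have "l' f *\<^sub>C y' + l1' f *\<^sub>C y1' =
     ((a * cnj a + b * cnj b) * l f) *\<^sub>C y + ((a * cnj a + b * cnj b) * l1 f) *\<^sub>C y1"
    unfolding l'_def l1'_def y'_def y1'_def
    by (simp add: scaleC_add_left scaleC_add_right scaleC.diff_right scaleC.minus_left scaleC.diff_left
      scaleC_scaleC algebra_simps)
   then show ?thesis by (simp add: ab')
  qed
  have s2: "(cmod (l' f))\<^sup>2 + (cmod (l1' f))\<^sup>2 = (cmod (l f))\<^sup>2 + (cmod (l1 f))\<^sup>2" for f
  proof -
   have "l' f * cnj (l' f) + l1' f * cnj (l1' f) =
     (a * cnj a + b * cnj b) * (l f * cnj (l f) + l1 f * cnj (l1 f))"
    by (simp add: l'_def l1'_def algebra_simps)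
   then have "complex_of_real ((cmod (l' f))\<^sup>2 + (cmod (l1' f))\<^sup>2) =
    complex_of_real ((cmod (l f))\<^sup>2 + (cmod (l1 f))\<^sup>2)"
    by (simp only: ab' of_real_add complex_norm_square mult_1_left)
   then show ?thesis using of_real_eq_iff by blast
  qed
  have z: "l1' e = 0"
  proof (cases "r = 0")
   case True
   then have "l e = 0" "l1 e = 0"
    using r2 by (simp_all add: sum_power2_eq_zero_iff)
   then show ?thesis by (simp add: l1'_def)
  qed (simp add: l1'_def a_def b_def field_simps)
  have "gauss_nn (y' # map snd ((l1', y1') # M)) z = gauss_nn (map snd (x # x' # L')) z" for z
  proof -
   have "gauss_nn (y' # map snd ((l1', y1') # M)) z = gauss_nn (y # y1 # map snd M) z"
    unfolding y'_def y1'_def using gauss_nn_rotate[OF ab] by simp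
   also have "\<dots> = gauss_nn (map snd (x # x' # L')) z"
    using M(1) by (simp add: x)
   finally show ?thesis .
  qed
  moreover have "(\<Sum>(l, y)\<leftarrow>(l', y') # (l1', y1') # M. l f *\<^sub>C y) = (\<Sum>(l, y)\<leftarrow>x # x' # L'. l f *\<^sub>C y)" for f
   using M(2)[of f] s1[of f] by (simp add: x add.assoc[symmetric])
  moreover have "(\<Sum>(l, y)\<leftarrow>(l', y') # (l1', y1') # M. (cmod (l f))\<^sup>2) = (\<Sum>(l, y)\<leftarrow>x # x' # L'. (cmod (l f))\<^sup>2)" for f
   using M(3)[of f] s2[of f] by (simp add: x)
  moreover have "Q l'" "Q l1'"
   using "3.prems"(2) M(4) x Q[of l l1 "cnj a" "- b"] Q[of l l1 "cnj b" a]
   unfolding l'_def[abs_def] l1'_def[abs_def] by auto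
  ultimately show ?case using M(4,5) z
   by (intro exI[of _ l'] exI[of _ y'] exI[of _ "(l1', y1') # M"]) auto
 qed simp
 then show ?thesis using that by blast
qed

text \<open>A carrier set and a form that may be degenerate: elements of \<open>H_space\<close> are
  functions that are not identified almost everywhere, and the defect forms below vanish on some
  vectors. \<open>lc f c g\<close> stands for f + c g.\<close>

locale semi_inner =
 fixes V :: "'v set" and lc :: "'v => complex => 'v => 'v" and ip :: "'v => 'v => complex"
 assumes lc: "f \<in> V ==> g \<in> V ==> lc f c g \<in> V"
  and ip_lc: "f \<in> V ==> g \<in> V ==> h \<in> V ==> ip (lc f c g) h = ip f h + c * ip g h"
  and ip_cnj: "f \<in> V ==> g \<in> V ==> ip g f = cnj (ip f g)"
  and ip_pos: "f \<in> V ==> Re (ip f f) \<ge> 0"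
begin

lemma ip_self: "f \<in> V ==> ip f f = complex_of_real (Re (ip f f))"
 using ip_cnj[of f f] by (simp add: complex_eq_iff)

lemma ip_lc_right: "f \<in> V ==> g \<in> V ==> h \<in> V ==> ip h (lc f c g) = ip h f + cnj c * ip h g"
 using ip_cnj[of "lc f c g" h] ip_cnj[of f h] ip_cnj[of g h] ip_lc[of f g h c] lc[of f g c] by simp

lemma Cauchy_Schwarz:
 assumes f: "f \<in> V" and g: "g \<in> V"
 shows "(cmod (ip f g))\<^sup>2 \<le> Re (ip f f) * Re (ip g g)"
proof -
 define A B C where "A = Re (ip f f)" and "B = Re (ip g g)" and "C = (cmod (ip f g))\<^sup>2"
 \<comment> \<open>Positivity of the form at f - t <f,g> g. If \<open>B > 0\<close>, the optimal
   choice is \<open>t = 1 / B\<close>; if \<open>B = 0\<close>, the expression is linear in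
   \<open>t\<close> and a large \<open>t\<close> forces \<open>C = 0\<close>.\<close>
 have q: "0 \<le> A - 2 * t * C + t\<^sup>2 * C * B" for t :: real
 proof -
  define c where "c = - of_real t * ip f g"
  have "ip (lc f c g) (lc f c g) = ip f f + c * ip g f + cnj c * (ip f g + c * ip g g)"
   using f g by (simp add: ip_lc ip_lc_right lc algebra_simps)
  also have "\<dots> = of_real A - 2 * of_real t * (ip f g * cnj (ip f g)) + (of_real t)\<^sup>2 * (ip f g * cnj (ip f g)) * of_real B"
   unfolding A_def B_def c_def using ip_self[OF f, symmetric] ip_self[OF g, symmetric] ip_cnj[OF f g]
   by (simp add: power2_eq_square algebra_simps)
  also have "\<dots> = of_real (A - 2 * t * C + t\<^sup>2 * C * B)"
   by (simp add: C_def complex_norm_square[symmetric])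
  finally show ?thesis using ip_pos[OF lc[OF f g, of c]] by simp
 qed
 have A: "A \<ge> 0" "B \<ge> 0" "C \<ge> 0" using ip_pos f g by (auto simp: A_def B_def C_def)
 have "C \<le> A * B"
 proof (cases "B = 0")
  case False
  then have B: "B > 0" using A by simp
  have "0 \<le> A - 2 * (1 / B) * C + (1 / B)\<^sup>2 * C * B" by (rule q)
  also have "\<dots> = A - C / B" using B by (simp add: power2_eq_square field_simps)
  finally show ?thesis using B by (simp add: field_simps)
 next
  case True
  have "C = 0"
  proof (rule ccontr)
   assume "C \<noteq> 0"
   then have "C > 0" using A by simp
   then have "A - 2 * ((A + 1) / C) * C = - A - 2" by (simp add: field_simps)
   then show False using q[of "(A + 1) / C"] True A by simp
  qed
  then show ?thesis using A by simp
 qed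
 then show ?thesis by (simp add: A_def B_def C_def)
qed

definition linear_fun :: "('v => complex) => bool" where
 "linear_fun l \<longleftrightarrow> (\<forall>f\<in>V. \<forall>g\<in>V. \<forall>c. l (lc f c g) = l f + c * l g)"

text \<open>Subtracting functionals that satisfy Bessel's inequality leaves a positive form.
  Cauchy-Schwarz for this defect drives both the contraction theorem and Bessel's inequality
  itself.\<close>

lemma semi_inner_defect:
 assumes "\<forall>p\<in>set L. linear_fun (fst p)"
  and "\<And>f. f \<in> V ==> (\<Sum>(l, y)\<leftarrow>L. (cmod (l f))\<^sup>2) \<le> Re (ip f f)"
 shows "semi_inner V lc (%f g. ip f g - (\<Sum>(l, y)\<leftarrow>L. l f * cnj (l g)))"
proof
 fix f g h c
 assume f: "f \<in> V" and g: "g \<in> V" and h: "h \<in> V"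
 show "lc f c g \<in> V" using f g by (rule lc)
 have "(\<Sum>(l, y)\<leftarrow>L. l (lc f c g) * cnj (l h)) =
  (\<Sum>(l, y)\<leftarrow>L. l f * cnj (l h)) + c * (\<Sum>(l, y)\<leftarrow>L. l g * cnj (l h))"
  using assms(1) f g by (induction L) (auto simp: linear_fun_def algebra_simps)
 then show "ip (lc f c g) h - (\<Sum>(l, y)\<leftarrow>L. l (lc f c g) * cnj (l h)) =
  ip f h - (\<Sum>(l, y)\<leftarrow>L. l f * cnj (l h)) + c * (ip g h - (\<Sum>(l, y)\<leftarrow>L. l g * cnj (l h)))"
  using ip_lc[OF f g h] by (simp add: algebra_simps)
next
 fix f g assume f: "f \<in> V" and g: "g \<in> V"
 have "(\<Sum>(l, y)\<leftarrow>L. l g * cnj (l f)) = cnj (\<Sum>(l, y)\<leftarrow>L. l f * cnj (l g))"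
  by (induction L) auto
 then show "ip g f - (\<Sum>(l, y)\<leftarrow>L. l g * cnj (l f)) = cnj (ip f g - (\<Sum>(l, y)\<leftarrow>L. l f * cnj (l g)))"
  using ip_cnj[OF f g] by simp
next
 fix f assume f: "f \<in> V"
 have "(\<Sum>(l, y)\<leftarrow>L. l f * cnj (l f)) = complex_of_real (\<Sum>(l, y)\<leftarrow>L. (cmod (l f))\<^sup>2)"
  by (induction L) (auto simp: complex_norm_square simp del: of_real_power)
 then show "0 \<le> Re (ip f f - (\<Sum>(l, y)\<leftarrow>L. l f * cnj (l f)))"
  using assms(2)[OF f] by simp
qed

text \<open>The Bessel condition says that \<open>(l e)\<close>, with \<open>e\<close> ranging over \<open>es\<close> and \<open>l\<close> over \<open>L\<close>, is a
 contraction matrix. If the row of the first \<open>e\<close> is not yet a unit vector, it is completed to one by an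
 additional functional; a unitary change of the Gaussians then moves it to the first coordinate.\<close>

theorem gauss_nn_contraction:
 fixes L :: "(('v => complex) \<times> 'a::complex_normed_vector) list"
 assumes "set es \<subseteq> V" "distinct es" "\<And>e e'. e \<in> set es ==> e' \<in> set es ==> ip e e' = (if e = e' then 1 else 0)"
  and "\<forall>p\<in>set L. linear_fun (fst p)"
  and "\<And>f. f \<in> V ==> (\<Sum>(l, y)\<leftarrow>L. (cmod (l f))\<^sup>2) \<le> Re (ip f f)"
 shows "gauss_nn (map (%e. \<Sum>(l, y)\<leftarrow>L. l e *\<^sub>C y) es) z \<le> gauss_nn (map snd L) z"
 using assms
proof (induction es arbitrary: L z)
 case Nil
 then show ?case using gauss_nn_Nil_le by simp
next
 case (Cons e es)
 have e: "e \<in> V" "ip e e = 1" using Cons.prems(1,3) by auto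
 define D where "D f g = ip f g - (\<Sum>(l, y)\<leftarrow>L. l f * cnj (l g))" for f g
 interpret D: semi_inner V lc D
  using semi_inner_defect[OF Cons.prems(4,5)] by (simp add: D_def[abs_def])
 have DR: "Re (D f f) = Re (ip f f) - (\<Sum>(l, y)\<leftarrow>L. (cmod (l f))\<^sup>2)" for f
 proof -
  have "(\<Sum>(l, y)\<leftarrow>L. l f * cnj (l f)) = complex_of_real (\<Sum>(l, y)\<leftarrow>L. (cmod (l f))\<^sup>2)"
   by (induction L) (auto simp: complex_norm_square simp del: of_real_power)
  then show ?thesis by (simp add: D_def)
 qed
 \<comment> \<open>The missing mass of the row of \<open>e\<close> is \<open>D e e\<close>.
   Cauchy-Schwarz for \<open>D\<close> shows that adding the functional \<open>D f e / r\<close>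
   keeps the Bessel condition; it is paired with the vector \<open>0\<close>, so no represented
   vector changes.\<close>
 define r where "r = sqrt (Re (D e e))"
 define l0 where "l0 f = (if r = 0 then 0 else D f e / of_real r)" for f
 define L1 where "L1 = (l0, 0::'a) # L"
 have r2: "r\<^sup>2 = Re (D e e)" using D.ip_pos[OF e(1)] by (simp add: r_def)
 have L1: "\<forall>p\<in>set L1. linear_fun (fst p)"
  using Cons.prems(4) e D.ip_lc by (auto simp: L1_def l0_def linear_fun_def add_divide_distrib)
 have l0: "(cmod (l0 f))\<^sup>2 \<le> Re (D f f)" if f: "f \<in> V" for f
 proof (cases "r = 0")
  case False
  then have "(cmod (l0 f))\<^sup>2 = (cmod (D f e))\<^sup>2 / r\<^sup>2"
   by (simp add: l0_def norm_divide power_divide)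
  also have "\<dots> \<le> Re (D f f)"
   using False D.Cauchy_Schwarz[OF f e(1)] by (simp add: r2[symmetric] field_simps)
  finally show ?thesis .
 qed (use D.ip_pos[OF f] in \<open>simp add: l0_def\<close>)
 have L1b: "(\<Sum>(l, y)\<leftarrow>L1. (cmod (l f))\<^sup>2) \<le> Re (ip f f)" if "f \<in> V" for f
  using l0[OF that] DR[of f] by (simp add: L1_def)
 have "(cmod (l0 e))\<^sup>2 = Re (D e e)"
 proof (cases "r = 0")
  case False
  have "cmod (D e e) = r\<^sup>2" unfolding r2 by (subst D.ip_self[OF e(1)]) (use D.ip_pos[OF e(1)] in simp)
  then show ?thesis using False by (simp add: l0_def r2[symmetric] norm_divide power_divide power2_eq_square)
 qed (use r2 in \<open>simp add: l0_def\<close>)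
 then have L1e: "(\<Sum>(l, y)\<leftarrow>L1. (cmod (l e))\<^sup>2) = 1"
  using DR[of e] e by (simp add: L1_def)
 obtain l1 y1 M where M: "\<And>z. gauss_nn (y1 # map snd M) z = gauss_nn (map snd L1) z"
  "\<And>f. (\<Sum>(l, y)\<leftarrow>(l1, y1) # M. l f *\<^sub>C y) = (\<Sum>(l, y)\<leftarrow>L1. l f *\<^sub>C y)"
  "\<And>f. (\<Sum>(l, y)\<leftarrow>(l1, y1) # M. (cmod (l f))\<^sup>2) = (\<Sum>(l, y)\<leftarrow>L1. (cmod (l f))\<^sup>2)"
  "\<forall>p\<in>set ((l1, y1) # M). linear_fun (fst p)" "\<forall>p\<in>set M. fst p e = 0"
 proof (rule gauss_nn_rotate_to_head[of L1 linear_fun e])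
  show "L1 \<noteq> []" by (simp add: L1_def)
  show "linear_fun (%f. c * l f + c' * l' f)" if "linear_fun l" "linear_fun l'" for l l' c c'
   using that by (simp add: linear_fun_def algebra_simps)
 qed (use L1 in auto)
 define D2 where "D2 f g = ip f g - (\<Sum>(l, y)\<leftarrow>(l1, y1) # M. l f * cnj (l g))" for f g
 interpret D2: semi_inner V lc D2
  unfolding D2_def[abs_def] by (rule semi_inner_defect) (use M(4) L1b in \<open>simp_all only: M(3)\<close>)
 have Me: "(\<Sum>(l, y)\<leftarrow>M. l f * cnj (l e)) = 0" "(\<Sum>(l, y)\<leftarrow>M. l e *\<^sub>C y) = 0" "(\<Sum>(l, y)\<leftarrow>M. (cmod (l e))\<^sup>2) = 0" for f
  using M(5) by (induction M) auto
 have l1e: "cmod (l1 e) = 1"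
  using M(3)[of e] L1e Me(3) by (simp add: power2_eq_1_iff) (use norm_ge_zero[of "l1 e"] in linarith)
 have D2e: "D2 f e = ip f e - l1 f * cnj (l1 e)" for f
  using Me(1)[of f] by (simp add: D2_def)
 \<comment> \<open>After the rotation the row of \<open>e\<close> is concentrated in its head, so
   the new defect form vanishes at \<open>e\<close> and, by Cauchy-Schwarz, against every
   \<open>f\<close>. Orthogonality of the other \<open>e'\<close> to \<open>e\<close> then forces
   \<open>l1 e' = 0\<close>, and the induction can continue with the tail \<open>M\<close>.\<close>
 have "D2 e e = 0" using l1e e complex_norm_square[of "l1 e"] by (simp add: D2e)
 then have D20: "D2 f e = 0" if "f \<in> V" for f
  using D2.Cauchy_Schwarz[OF that e(1)] by simp
 have l1z: "l1 e' = 0" if "e' \<in> set es" for e'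
 proof -
  have "e' \<in> V" "ip e' e = 0" using that Cons.prems(1,2,3) by auto
  then show ?thesis using D20[of e'] D2e[of e'] l1e by auto
 qed
 have "gauss_nn (map (%e. \<Sum>(l, y)\<leftarrow>L. l e *\<^sub>C y) (e # es)) z =
   gauss_nn (map (%e. \<Sum>(l, y)\<leftarrow>(l1, y1) # M. l e *\<^sub>C y) (e # es)) z"
  unfolding M(2) by (simp add: L1_def)
 also have "\<dots> = gauss_nn (l1 e *\<^sub>C y1 # map (%e. \<Sum>(l, y)\<leftarrow>M. l e *\<^sub>C y) es) z"
 proof -
  have "map (%e. \<Sum>(l, y)\<leftarrow>(l1, y1) # M. l e *\<^sub>C y) es = map (%e. \<Sum>(l, y)\<leftarrow>M. l e *\<^sub>C y) es"
   using l1z by (intro map_cong) auto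
  moreover have "(\<Sum>(l, y)\<leftarrow>(l1, y1) # M. l e *\<^sub>C y) = l1 e *\<^sub>C y1"
   using Me(2) by simp
  ultimately show ?thesis by (simp only: list.map)
 qed
 also have "\<dots> = gauss_nn (y1 # map (%e. \<Sum>(l, y)\<leftarrow>M. l e *\<^sub>C y) es) z"
  by (rule gauss_nn_phase[OF l1e])
 also have "\<dots> \<le> gauss_nn (y1 # map snd M) z"
  unfolding gauss_nn.simps
 proof (intro nn_integral_mono Cons.IH)
  show "(\<Sum>(l, y)\<leftarrow>M. (cmod (l f))\<^sup>2) \<le> Re (ip f f)" if "f \<in> V" for f
  proof -
   have "(\<Sum>(l, y)\<leftarrow>M. (cmod (l f))\<^sup>2) \<le> (\<Sum>(l, y)\<leftarrow>(l1, y1) # M. (cmod (l f))\<^sup>2)"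
    by simp
   then show ?thesis unfolding M(3) using L1b[OF that] by linarith
  qed
 qed (use Cons.prems M(4) in auto)
 also have "\<dots> = gauss_nn (map snd L) z"
  unfolding M(1) using gauss_nn_zero by (simp only: L1_def list.map snd_conv)
 finally show ?case .
qed

end

section \<open>Gaussian sums on the infinite product space\<close>

lemma gauss_eq_cplx: "gauss n w = cplx (w n)"
 by (simp add: gauss_def cplx_def)

lemma gauss_space_eq: "gauss_space = PiM UNIV (%_. gauss_pair)"
 by (simp add: gauss_space_def gauss_pair_def)

interpretation gauss_prod: product_prob_space "%_::nat. gauss_pair" UNIV
 by unfold_locales

interpretation gauss_space: prob_space gauss_space
 unfolding gauss_space_eq by (rule prob_space_PiM) (rule gauss_pair.prob_space_axioms)

lemma borel_measurable_gauss [measurable]: "gauss n \<in> borel_measurable gauss_space"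
 unfolding gauss_eq_cplx[abs_def] gauss_space_eq by measurable

text \<open>The induction splits off coordinate \<open>N\<close> as the outermost integral, hence
  the reversed list.\<close>

lemma nn_integral_gauss_finite:
 "(\<integral>\<^sup>+w. ennreal ((norm (z + (\<Sum>n<N. cplx (w n) *\<^sub>C y n)))\<^sup>2) \<partial>PiM {..<N} (%_. gauss_pair))
  = gauss_nn (rev (map y [0..<N])) z"
proof (induction N arbitrary: z)
 case 0
 then show ?case by (simp add: PiM_empty)
next
 case (Suc N)
 have I: "{..<Suc N} = insert N {..<N}" by auto
 have *: "(%w. z + (\<Sum>n<Suc N. cplx (w n) *\<^sub>C y n)) \<in> borel_measurable (PiM (insert N {..<N}) (%_. gauss_pair))"
  by (rule borel_measurable_add_sum_scaleC) (auto simp: less_Suc_eq intro!: measurable_compose[OF measurable_component_singleton])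
 have m: "(%w. ennreal ((norm (z + (\<Sum>n<Suc N. cplx (w n) *\<^sub>C y n)))\<^sup>2))
   \<in> borel_measurable (PiM (insert N {..<N}) (%_. gauss_pair))"
  using measurable_compose[OF * borel_measurable_gauss_nn[of "[]"]] by simp
 have "(\<integral>\<^sup>+w. ennreal ((norm (z + (\<Sum>n<Suc N. cplx (w n) *\<^sub>C y n)))\<^sup>2) \<partial>PiM {..<Suc N} (%_. gauss_pair))
  = (\<integral>\<^sup>+c. (\<integral>\<^sup>+w. ennreal ((norm (z + (\<Sum>n<Suc N. cplx ((w(N := c)) n) *\<^sub>C y n)))\<^sup>2)
    \<partial>PiM {..<N} (%_. gauss_pair)) \<partial>gauss_pair)"
  unfolding I by (rule gauss_prod.product_nn_integral_insert_rev[OF _ _ m[unfolded I]]) auto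
 also have "\<dots> = (\<integral>\<^sup>+c. (\<integral>\<^sup>+w. ennreal ((norm ((z + cplx c *\<^sub>C y N) + (\<Sum>n<N. cplx (w n) *\<^sub>C y n)))\<^sup>2)
    \<partial>PiM {..<N} (%_. gauss_pair)) \<partial>gauss_pair)"
 proof -
  have "z + (\<Sum>n<Suc N. cplx ((w(N := c)) n) *\<^sub>C y n) = (z + cplx c *\<^sub>C y N) + (\<Sum>n<N. cplx (w n) *\<^sub>C y n)" for w c
   by (simp add: algebra_simps)
  then show ?thesis by (simp only:)
 qed
 also have "\<dots> = gauss_nn (rev (map y [0..<Suc N])) z"
  by (simp add: Suc.IH)
 finally show ?case .
qed

lemma nn_integral_gauss_space:
 "(\<integral>\<^sup>+w. ennreal ((norm (z + (\<Sum>n<N. gauss n w *\<^sub>C y n)))\<^sup>2) \<partial>gauss_space)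
  = gauss_nn (rev (map y [0..<N])) z"
proof -
 have *: "(%w. z + (\<Sum>n<N. cplx (w n) *\<^sub>C y n)) \<in> borel_measurable (PiM {..<N} (%_. gauss_pair))"
  by (rule borel_measurable_add_sum_scaleC) (auto intro!: measurable_compose[OF measurable_component_singleton])
 have m: "(%w. ennreal ((norm (z + (\<Sum>n<N. cplx (w n) *\<^sub>C y n)))\<^sup>2)) \<in> borel_measurable (PiM {..<N} (%_. gauss_pair))"
  using measurable_compose[OF * borel_measurable_gauss_nn[of "[]"]] by simp
 have "gauss_nn (rev (map y [0..<N])) z =
  (\<integral>\<^sup>+w. ennreal ((norm (z + (\<Sum>n<N. cplx (w n) *\<^sub>C y n)))\<^sup>2) \<partial>distr (PiM UNIV (%_. gauss_pair)) (PiM {..<N} (%_. gauss_pair)) (%x. restrict x {..<N}))"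
  unfolding nn_integral_gauss_finite[symmetric] by (subst gauss_prod.distr_PiM_restrict_finite) auto
 also have "\<dots> = (\<integral>\<^sup>+w. ennreal ((norm (z + (\<Sum>n<N. cplx (w n) *\<^sub>C y n)))\<^sup>2) \<partial>PiM UNIV (%_. gauss_pair))"
  by (subst nn_integral_distr) (use m in \<open>auto intro!: measurable_restrict_subset\<close>)
 finally show ?thesis by (simp add: gauss_eq_cplx gauss_space_eq)
qed

definition gauss_E :: "nat => (nat => 'a::complex_normed_vector) => ennreal" where
 "gauss_E N y = (\<integral>\<^sup>+w. ennreal ((norm (\<Sum>n<N. gauss n w *\<^sub>C y n))\<^sup>2) \<partial>gauss_space)"

lemma gauss_E_eq_nn: "gauss_E N y = gauss_nn (rev (map y [0..<N])) 0"
 unfolding gauss_E_def nn_integral_gauss_space[of 0, symmetric] by simp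

lemma nn_integral_cplx_sq: "(\<integral>\<^sup>+c. ennreal ((cmod (cplx c))\<^sup>2) \<partial>gauss_pair) = 1"
proof -
 interpret N: prob_space std_normal_distribution
  using prob_space_normal_density[of 1 0] by simp
 have sq: "(\<integral>\<^sup>+x. ennreal (x\<^sup>2 / 2) \<partial>std_normal_distribution) = ennreal (1/2)"
 proof -
  have hb: "has_bochner_integral lborel (%x. std_normal_density x * x\<^sup>2) 1"
   using std_normal_moment_even[of 1] by (simp add: fact_numeral)
  have "(\<integral>\<^sup>+x. ennreal (x\<^sup>2 / 2) \<partial>std_normal_distribution) =
   (\<integral>\<^sup>+x. ennreal (std_normal_density x * x\<^sup>2 / 2) \<partial>lborel)"
   by (subst nn_integral_density) (auto simp: ennreal_mult[symmetric] normal_density_nonneg)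
  also have "\<dots> = ennreal (\<integral>x. std_normal_density x * x\<^sup>2 / 2 \<partial>lborel)"
   using hb by (intro nn_integral_eq_integral) (auto simp: has_bochner_integral_iff normal_density_nonneg)
  finally show ?thesis using hb by (simp add: has_bochner_integral_iff)
 qed
 have "(\<integral>\<^sup>+c. ennreal ((cmod (cplx c))\<^sup>2) \<partial>gauss_pair) = (\<integral>\<^sup>+c. ennreal ((fst c)\<^sup>2 / 2) + ennreal ((snd c)\<^sup>2 / 2) \<partial>gauss_pair)"
 proof (rule nn_integral_cong)
  fix c
  have "(cmod (cplx c))\<^sup>2 = (fst c)\<^sup>2 / 2 + (snd c)\<^sup>2 / 2"
   by (simp add: cplx_def cmod_power2 power_divide)
  then show "ennreal ((cmod (cplx c))\<^sup>2) = ennreal ((fst c)\<^sup>2 / 2) + ennreal ((snd c)\<^sup>2 / 2)"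
   by (simp add: ennreal_plus)
 qed
 also have "\<dots> = (\<integral>\<^sup>+x. \<integral>\<^sup>+y. ennreal (x\<^sup>2 / 2) + ennreal (y\<^sup>2 / 2) \<partial>std_normal_distribution \<partial>std_normal_distribution)"
  unfolding gauss_pair_def
  by (subst N.nn_integral_fst[symmetric]) simp_all
 also have "\<dots> = ennreal (1/2) + ennreal (1/2)"
  by (simp add: nn_integral_add sq N.emeasure_space_1[simplified])
 also have "\<dots> = ennreal (1/2 + 1/2)" by (rule ennreal_plus[symmetric]) simp_all
 also have "\<dots> = 1" by simp
 finally show ?thesis .
qed

text \<open>Quadratic growth in the shift survives integration over one further Gaussian, because
  its second moment is 1; this yields finiteness of \<open>gauss_E\<close>.\<close>

lemma gauss_nn_bound: "\<exists>K\<ge>0. \<forall>z. gauss_nn ys z \<le> ennreal (K * (1 + (norm z)\<^sup>2))"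
proof (induction ys)
 case Nil
 show ?case by (rule exI[of _ 1]) (auto intro!: ennreal_leI)
next
 case (Cons y ys)
 then obtain K where K: "K \<ge> 0" "\<And>z. gauss_nn ys z \<le> ennreal (K * (1 + (norm z)\<^sup>2))" by blast
 define K' where "K' = K * (2 + 2 * (norm y)\<^sup>2)"
 have "gauss_nn (y # ys) z \<le> ennreal (K' * (1 + (norm z)\<^sup>2))" for z
 proof -
  have "gauss_nn (y # ys) z \<le> (\<integral>\<^sup>+c. ennreal (K * (1 + 2 * (norm z)\<^sup>2)) + ennreal (2 * K * (norm y)\<^sup>2) * ennreal ((cmod (cplx c))\<^sup>2) \<partial>gauss_pair)"
   unfolding gauss_nn.simps
  proof (rule nn_integral_mono)
   fix c
   have "(norm (z + cplx c *\<^sub>C y))\<^sup>2 \<le> (norm z + cmod (cplx c) * norm y)\<^sup>2"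
    using norm_triangle_ineq[of z "cplx c *\<^sub>C y"] by (intro power_mono) (auto simp: norm_scaleC)
   also have "\<dots> \<le> 2 * (norm z)\<^sup>2 + 2 * ((cmod (cplx c))\<^sup>2 * (norm y)\<^sup>2)"
    using sum_squares_bound[of "norm z" "cmod (cplx c) * norm y"]
    by (simp add: power2_sum power_mult_distrib algebra_simps)
   finally have "K * (1 + (norm (z + cplx c *\<^sub>C y))\<^sup>2) \<le> K * (1 + 2 * (norm z)\<^sup>2 + 2 * ((cmod (cplx c))\<^sup>2 * (norm y)\<^sup>2))"
    using K(1) by (intro mult_left_mono) auto
   then have "gauss_nn ys (z + cplx c *\<^sub>C y) \<le> ennreal (K * (1 + 2 * (norm z)\<^sup>2 + 2 * ((cmod (cplx c))\<^sup>2 * (norm y)\<^sup>2)))"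
    using K(2)[of "z + cplx c *\<^sub>C y"] order_trans ennreal_leI by blast
   also have "\<dots> = ennreal (K * (1 + 2 * (norm z)\<^sup>2)) + ennreal (2 * K * (norm y)\<^sup>2) * ennreal ((cmod (cplx c))\<^sup>2)"
    using K(1) by (subst ennreal_mult[symmetric], simp, simp, subst ennreal_plus[symmetric], simp_all add: algebra_simps)
   finally show "gauss_nn ys (z + cplx c *\<^sub>C y) \<le> \<dots>" .
  qed
  also have "\<dots> = ennreal (K * (1 + 2 * (norm z)\<^sup>2)) + ennreal (2 * K * (norm y)\<^sup>2)"
   by (simp add: nn_integral_add nn_integral_cmult nn_integral_cplx_sq gauss_pair.emeasure_space_1[simplified])
  also have "\<dots> = ennreal (K * (1 + 2 * (norm z)\<^sup>2) + 2 * K * (norm y)\<^sup>2)"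
   using K(1) by simp
  also have "\<dots> \<le> ennreal (K' * (1 + (norm z)\<^sup>2))"
  proof (rule ennreal_leI)
   have "0 \<le> K * (1 + 2 * ((norm y)\<^sup>2 * (norm z)\<^sup>2))"
    using K(1) by simp
   then show "K * (1 + 2 * (norm z)\<^sup>2) + 2 * K * (norm y)\<^sup>2 \<le> K' * (1 + (norm z)\<^sup>2)"
    unfolding K'_def by (simp add: algebra_simps)
  qed
  finally show ?thesis .
 qed
 moreover have "K' \<ge> 0" using K(1) by (simp add: K'_def)
 ultimately show ?case by blast
qed

lemma gauss_E_finite: "gauss_E N y < \<infinity>"
 unfolding gauss_E_eq_nn using gauss_nn_bound[of "rev (map y [0..<N])"]
 by (metis ennreal_less_top infinity_ennreal_def order_le_less_trans)

lemma gauss_E_1: "gauss_E 1 y = ennreal ((norm (y 0))\<^sup>2)"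
proof -
 have "gauss_E 1 y = (\<integral>\<^sup>+c. ennreal ((norm (y 0))\<^sup>2) * ennreal ((cmod (cplx c))\<^sup>2) \<partial>gauss_pair)"
  unfolding gauss_E_eq_nn by (auto simp: norm_scaleC power_mult_distrib ennreal_mult mult.commute intro!: nn_integral_cong)
 also have "\<dots> = ennreal ((norm (y 0))\<^sup>2)"
  by (simp add: nn_integral_cmult nn_integral_cplx_sq)
 finally show ?thesis .
qed

lemma borel_measurable_gauss_sum:
 "(%w. \<Sum>n<N. gauss n w *\<^sub>C y n) \<in> borel_measurable gauss_space"
 using borel_measurable_add_sum_scaleC[of "%_. 0" gauss_space N gauss y] by simp

lemma gauss_E_eq_integral:
 "gauss_E N y = ennreal (\<integral>w. (norm (\<Sum>n<N. gauss n w *\<^sub>C y n))\<^sup>2 \<partial>gauss_space)"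
proof -
 have m: "(%w. (norm (\<Sum>n<N. gauss n w *\<^sub>C y n))\<^sup>2) \<in> borel_measurable gauss_space"
  by (rule measurable_compose[OF borel_measurable_gauss_sum borel_measurable_continuous_onI])
   (intro continuous_intros)
 have "integrable gauss_space (%w. (norm (\<Sum>n<N. gauss n w *\<^sub>C y n))\<^sup>2)"
  using gauss_E_finite[of N y] by (intro integrableI_bounded m) (simp add: gauss_E_def)
 then show ?thesis unfolding gauss_E_def by (intro nn_integral_eq_integral) auto
qed

text \<open>In terms of \<open>gauss_E\<close> the estimate carries no integrability conditions and
  also covers the empty sum; the constant is replaced by its absolute value.\<close>

lemma gamma_bounded_gauss_E:
 assumes "gamma_bounded \<T>"
 obtains C where "C \<ge> 0"
  "\<And>N T x. (\<And>n. n < N ==> T n \<in> \<T>) ==> gauss_E N (%n. T n (x n)) \<le> ennreal (C\<^sup>2) * gauss_E N x"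
  "\<And>T x. T \<in> \<T> ==> norm (T x) \<le> C * norm x"
proof -
 obtain C where C: "\<And>N T x. N \<ge> 1 ==> (\<And>n. n < N ==> T n \<in> \<T>) ==>
    (\<integral>w. (norm (\<Sum>n<N. gauss n w *\<^sub>C T n (x n)))\<^sup>2 \<partial>gauss_space)
     \<le> C\<^sup>2 * (\<integral>w. (norm (\<Sum>n<N. gauss n w *\<^sub>C x n))\<^sup>2 \<partial>gauss_space)"
  using assms unfolding gamma_bounded_def by blast
 have 1: "gauss_E N (%n. T n (x n)) \<le> ennreal (\<bar>C\<bar>\<^sup>2) * gauss_E N x" if "\<And>n. n < N ==> T n \<in> \<T>" for N T x
 proof (cases "N = 0")
  case False
  then show ?thesis using C[of N T x] that
   by (simp add: gauss_E_eq_integral ennreal_mult[symmetric] ennreal_leI)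
 qed (simp add: gauss_E_def)
 \<comment> \<open>The case of a single summand, by \<open>gauss_E_1\<close>.\<close>
 have 2: "norm (T x) \<le> \<bar>C\<bar> * norm x" if "T \<in> \<T>" for T x
 proof -
  have "ennreal ((norm (T x))\<^sup>2) \<le> ennreal (\<bar>C\<bar>\<^sup>2) * ennreal ((norm x)\<^sup>2)"
   using 1[of 1 "%_. T" "%_. x"] that by (simp only: gauss_E_1)
  then have "(norm (T x))\<^sup>2 \<le> (\<bar>C\<bar> * norm x)\<^sup>2"
   by (simp add: ennreal_mult[symmetric] power_mult_distrib)
  then show ?thesis by (rule power2_le_imp_le) simp
 qed
 show ?thesis by (rule that[of "\<bar>C\<bar>"]) (use 1 2 in auto)
qed

text \<open>Jensen's inequality inserts the new Gaussian at the innermost place. It is then moved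
  outwards by exchanging neighbours, which is a rotation combined with a change of sign.\<close>

lemma gauss_E_mono: "N \<le> M ==> gauss_E N y \<le> gauss_E M y"
proof (induction M rule: dec_induct)
 case (step M)
 have "gauss_nn ys z \<le> gauss_nn (u # ys) z" for ys z and u :: 'a
 proof (induction ys arbitrary: z)
  case Nil
  show ?case using gauss_nn_Nil_le[of z "[u]"] by simp
 next
  case (Cons y ys)
  have "gauss_nn (y # ys) z \<le> gauss_nn (y # u # ys) z"
   unfolding gauss_nn.simps(2)[of y] by (intro nn_integral_mono Cons.IH)
  also have "\<dots> = gauss_nn ((-1) *\<^sub>C y # u # ys) z" by (rule gauss_nn_phase[symmetric]) simp
  also have "\<dots> = gauss_nn (u # y # ys) z"
   using gauss_nn_rotate[of 0 1 u y ys z] by (simp add: scaleC_minus1)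
  finally show ?case .
 qed
 then have "gauss_E M y \<le> gauss_E (Suc M) y" by (simp add: gauss_E_eq_nn del: gauss_nn.simps)
 then show ?case using step by simp
qed simp

lemma borel_measurable_norm_diff_gauss_sum:
 assumes "S \<in> borel_measurable gauss_space"
 shows "(%w. (norm (S w - (\<Sum>n<N. gauss n w *\<^sub>C y n)))\<^sup>2) \<in> borel_measurable gauss_space"
proof -
 have "(%w. S w + (\<Sum>n<N. gauss n w *\<^sub>C (- y n))) \<in> borel_measurable gauss_space"
  by (rule borel_measurable_add_sum_scaleC[OF assms]) simp
 then have "(%w. S w - (\<Sum>n<N. gauss n w *\<^sub>C y n)) \<in> borel_measurable gauss_space"
  by (simp add: scaleC.minus_right sum_negf)
 then show ?thesis
  by (rule measurable_compose[OF _ borel_measurable_continuous_onI]) (intro continuous_intros)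
qed

lemma norm_sq_le_diff: "(norm (a::'a::real_normed_vector))\<^sup>2 \<le> 2 * (norm b)\<^sup>2 + 2 * (norm (a - b))\<^sup>2"
proof -
 have "(norm a)\<^sup>2 \<le> (norm b + norm (a - b))\<^sup>2"
  using norm_triangle_ineq[of b "a - b"] by (intro power_mono) auto
 also have "\<dots> \<le> 2 * (norm b)\<^sup>2 + 2 * (norm (a - b))\<^sup>2"
  using sum_squares_bound[of "norm b" "norm (a - b)"] by (simp add: power2_sum)
 finally show ?thesis .
qed

text \<open>\<open>norm_sq_le_diff\<close> takes the place of Minkowski's inequality, since only the
  order of magnitude matters. The factors 2 in the norm comparisons below originate here.\<close>

lemma gamma_sums_bounds:
 fixes T :: "(real => complex) => 'a::complex_normed_vector"
 assumes "gamma_sums h T S"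
 shows "ennreal (\<integral>w. (norm (S w))\<^sup>2 \<partial>gauss_space) = (\<integral>\<^sup>+w. ennreal ((norm (S w))\<^sup>2) \<partial>gauss_space)"
  and "gauss_E N (%n. T (h n)) \<le> 2 * (\<integral>\<^sup>+w. ennreal ((norm (S w))\<^sup>2) \<partial>gauss_space)"
  and "(\<And>N. gauss_E N (%n. T (h n)) \<le> M) ==> (\<integral>\<^sup>+w. ennreal ((norm (S w))\<^sup>2) \<partial>gauss_space) \<le> 2 * M"
proof -
 define D where "D N = (\<integral>\<^sup>+ w. ennreal ((norm (S w - (\<Sum>n<N. gauss n w *\<^sub>C T (h n))))\<^sup>2) \<partial>gauss_space)" for N
 define I where "I = (\<integral>\<^sup>+w. ennreal ((norm (S w))\<^sup>2) \<partial>gauss_space)"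
 have S: "S \<in> borel_measurable gauss_space" and D: "D \<longlonglongrightarrow> 0"
  using assms unfolding gamma_sums_def D_def by auto
 have mS: "(%w. (norm (S w))\<^sup>2) \<in> borel_measurable gauss_space"
  using borel_measurable_norm_diff_gauss_sum[OF S, where N = 0] by simp
 have mN: "(%w. (norm (\<Sum>n<N. gauss n w *\<^sub>C T (h n)))\<^sup>2) \<in> borel_measurable gauss_space" for N
  by (rule measurable_compose[OF borel_measurable_gauss_sum borel_measurable_continuous_onI])
   (intro continuous_intros)
 note mD = borel_measurable_norm_diff_gauss_sum[OF S]
 have 1: "I \<le> 2 * gauss_E N (%n. T (h n)) + 2 * D N" for N
 proof -
  have "I \<le> (\<integral>\<^sup>+w. 2 * ennreal ((norm (\<Sum>n<N. gauss n w *\<^sub>C T (h n)))\<^sup>2)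
    + 2 * ennreal ((norm (S w - (\<Sum>n<N. gauss n w *\<^sub>C T (h n))))\<^sup>2) \<partial>gauss_space)"
   unfolding I_def using norm_sq_le_diff
   by (intro nn_integral_mono) (simp add: ennreal_mult[symmetric] ennreal_plus[symmetric] ennreal_leI flip: ennreal_numeral del: ennreal_plus)
  also have "\<dots> = 2 * gauss_E N (%n. T (h n)) + 2 * D N"
   unfolding gauss_E_def D_def using mN mD by (simp add: nn_integral_add nn_integral_cmult)
  finally show ?thesis .
 qed
 have 2: "gauss_E N (%n. T (h n)) \<le> 2 * I + 2 * D N" for N
 proof -
  have "gauss_E N (%n. T (h n)) \<le> (\<integral>\<^sup>+w. 2 * ennreal ((norm (S w))\<^sup>2)
    + 2 * ennreal ((norm (S w - (\<Sum>n<N. gauss n w *\<^sub>C T (h n))))\<^sup>2) \<partial>gauss_space)"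
   unfolding gauss_E_def
  proof (intro nn_integral_mono)
   fix w
   show "ennreal ((norm (\<Sum>n<N. gauss n w *\<^sub>C T (h n)))\<^sup>2)
     \<le> 2 * ennreal ((norm (S w))\<^sup>2) + 2 * ennreal ((norm (S w - (\<Sum>n<N. gauss n w *\<^sub>C T (h n))))\<^sup>2)"
    using norm_sq_le_diff[of "\<Sum>n<N. gauss n w *\<^sub>C T (h n)" "S w"]
    by (simp add: ennreal_mult[symmetric] ennreal_plus[symmetric] ennreal_leI norm_minus_commute flip: ennreal_numeral del: ennreal_plus)
  qed
  also have "\<dots> = 2 * I + 2 * D N"
   unfolding I_def D_def using mS mD by (simp add: nn_integral_add nn_integral_cmult)
  finally show ?thesis .
 qed
 have lim: "(%N. c + 2 * D N) \<longlonglongrightarrow> c" for c :: ennreal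
 proof -
  have "(%N. c + 2 * D N) \<longlonglongrightarrow> c + 2 * 0"
   by (intro tendsto_add tendsto_const ennreal_tendsto_cmult D) simp
  then show ?thesis by simp
 qed
 have "I < \<infinity>"
 proof -
  have "eventually (%N. D N < 1) sequentially" using D by (rule order_tendstoD) simp
  then obtain N where "D N < 1" by (auto simp: eventually_sequentially)
  then have "2 * D N < \<infinity>" by (metis ennreal_mult_less_top ennreal_numeral_less_top infinity_ennreal_def order_less_trans ennreal_one_less_top)
  moreover have "2 * gauss_E N (%n. T (h n)) < \<infinity>"
   using gauss_E_finite[of N "%n. T (h n)"] by (simp add: ennreal_mult_less_top)
  ultimately show ?thesis using 1[of N] by (metis ennreal_add_eq_top infinity_ennreal_def less_top order_le_less_trans)
 qed
 then have "integrable gauss_space (%w. (norm (S w))\<^sup>2)"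
  unfolding I_def by (intro integrableI_bounded mS) simp
 then show "ennreal (\<integral>w. (norm (S w))\<^sup>2 \<partial>gauss_space) = (\<integral>\<^sup>+w. ennreal ((norm (S w))\<^sup>2) \<partial>gauss_space)"
  by (intro nn_integral_eq_integral[symmetric]) auto
 show "gauss_E N (%n. T (h n)) \<le> 2 * (\<integral>\<^sup>+w. ennreal ((norm (S w))\<^sup>2) \<partial>gauss_space)"
 proof (rule LIMSEQ_le_const[OF lim[of "2 * (\<integral>\<^sup>+w. ennreal ((norm (S w))\<^sup>2) \<partial>gauss_space)"]], intro exI allI impI)
  fix M assume "N \<le> M"
  then show "gauss_E N (%n. T (h n)) \<le> 2 * (\<integral>\<^sup>+w. ennreal ((norm (S w))\<^sup>2) \<partial>gauss_space) + 2 * D M"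
   using gauss_E_mono 2[of M] unfolding I_def by (meson order_trans)
 qed
 show "(\<integral>\<^sup>+w. ennreal ((norm (S w))\<^sup>2) \<partial>gauss_space) \<le> 2 * M" if M: "\<And>N. gauss_E N (%n. T (h n)) \<le> M"
 proof (rule LIMSEQ_le_const[OF lim[of "2 * M"]], intro exI allI impI)
  fix N
  show "(\<integral>\<^sup>+w. ennreal ((norm (S w))\<^sup>2) \<partial>gauss_space) \<le> 2 * M + 2 * D N"
   using 1[of N] M[of N] unfolding I_def
   by (meson add_right_mono mult_left_mono order_trans zero_le)
 qed
qed

section \<open>The Hilbert space of square integrable functions\<close>

lemma sets_haar [measurable_cong, simp]: "sets haar = sets borel"
 by (simp add: haar_def)

lemma space_haar [simp]: "space haar = UNIV"
 by (simp add: haar_def)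

definition H_ip :: "(real => complex) => (real => complex) => complex" where
 "H_ip f g = (\<integral>t. f t * cnj (g t) \<partial>haar)"

definition H_lc :: "(real => complex) => complex => (real => complex) => real => complex" where
 "H_lc f c g = (%t. f t + c * g t)"

lemma borel_measurable_H_space: "f \<in> H_space ==> f \<in> borel_measurable borel"
 by (simp add: H_space_def)

lemma integrable_H_space: "f \<in> H_space ==> integrable haar (%t. (cmod (f t))\<^sup>2)"
 by (simp add: H_space_def)

lemma integrable_H_mult:
 assumes f: "f \<in> H_space" and g: "g \<in> H_space"
 shows "integrable haar (%t. f t * cnj (g t))"
proof (rule Bochner_Integration.integrable_bound)
 show "integrable haar (%t. (cmod (f t))\<^sup>2 + (cmod (g t))\<^sup>2)"
  using f g by (intro Bochner_Integration.integrable_add integrable_H_space)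
 have "f \<in> borel_measurable borel" "g \<in> borel_measurable borel"
  using f g by (auto intro: borel_measurable_H_space)
 moreover from this(2) have "(%t. cnj (g t)) \<in> borel_measurable borel"
  by (rule measurable_compose[OF _ borel_measurable_continuous_onI]) (intro continuous_intros)
 ultimately show "(%t. f t * cnj (g t)) \<in> borel_measurable haar" by measurable
 show "AE t in haar. norm (f t * cnj (g t)) \<le> norm ((cmod (f t))\<^sup>2 + (cmod (g t))\<^sup>2)"
 proof (rule AE_I2)
  fix t
  have "cmod (f t) * cmod (g t) \<le> (cmod (f t))\<^sup>2 + (cmod (g t))\<^sup>2"
   using sum_squares_bound[of "cmod (f t)" "cmod (g t)"]
    zero_le_power2[of "cmod (f t)"] zero_le_power2[of "cmod (g t)"] by linarith
  then show "norm (f t * cnj (g t)) \<le> norm ((cmod (f t))\<^sup>2 + (cmod (g t))\<^sup>2)"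
   by (simp add: norm_mult)
 qed
qed

lemma H_lc_in:
 assumes f: "f \<in> H_space" and g: "g \<in> H_space"
 shows "H_lc f c g \<in> H_space"
proof -
 have m: "f \<in> borel_measurable borel" "g \<in> borel_measurable borel"
  using f g by (auto intro: borel_measurable_H_space)
 have "integrable haar (%t. (cmod (f t + c * g t))\<^sup>2)"
 proof (rule Bochner_Integration.integrable_bound)
  show "integrable haar (%t. 2 * (cmod (f t))\<^sup>2 + 2 * (cmod c)\<^sup>2 * (cmod (g t))\<^sup>2)"
   using f g by (intro Bochner_Integration.integrable_add integrable_mult_right integrable_H_space)
  show "(%t. (cmod (f t + c * g t))\<^sup>2) \<in> borel_measurable haar" using m by measurable
  show "AE t in haar. norm ((cmod (f t + c * g t))\<^sup>2) \<le> norm (2 * (cmod (f t))\<^sup>2 + 2 * (cmod c)\<^sup>2 * (cmod (g t))\<^sup>2)"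
   using norm_sq_le_diff[of "f t + c * g t" "f t" for t]
   by (intro AE_I2) (simp add: norm_mult power_mult_distrib mult.assoc)
 qed
 then show ?thesis using m by (simp add: H_space_def H_lc_def)
qed

interpretation H: semi_inner H_space H_lc H_ip
proof
 fix f g h c assume H: "f \<in> H_space" "g \<in> H_space" "h \<in> H_space"
 show "H_ip (H_lc f c g) h = H_ip f h + c * H_ip g h"
  using integrable_H_mult[OF H(1,3)] integrable_H_mult[OF H(2,3)]
  by (simp add: H_ip_def H_lc_def ring_distribs mult.assoc)
next
 fix f g assume H: "f \<in> H_space" "g \<in> H_space"
 show "H_ip g f = cnj (H_ip f g)"
  unfolding H_ip_def by (subst Bochner_Integration.integral_cnj[symmetric]) (simp add: mult.commute)
next
 fix f :: "real => complex" assume "f \<in> H_space"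
 have "H_ip f f = (\<integral>t. complex_of_real ((cmod (f t))\<^sup>2) \<partial>haar)"
  unfolding H_ip_def by (intro Bochner_Integration.integral_cong) (simp_all add: complex_norm_square[symmetric])
 then show "0 \<le> Re (H_ip f f)"
  by (simp add: integral_complex_of_real del: of_real_power)
qed (rule H_lc_in)

definition H_sq :: "(real => complex) => real" where
 "H_sq f = (\<integral>t. (cmod (f t))\<^sup>2 \<partial>haar)"

lemma Re_H_ip_self: "Re (H_ip f f) = H_sq f"
proof -
 have "H_ip f f = (\<integral>t. complex_of_real ((cmod (f t))\<^sup>2) \<partial>haar)"
  unfolding H_ip_def by (intro Bochner_Integration.integral_cong) (simp_all add: complex_norm_square[symmetric])
 then show ?thesis by (simp add: H_sq_def integral_complex_of_real del: of_real_power)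
qed

lemma H_norm_eq: "H_norm f = sqrt (H_sq f)"
 by (simp add: H_norm_def H_sq_def)

lemma H_sq_nonneg: "H_sq f \<ge> 0"
 by (simp add: H_sq_def)

lemma nn_integral_H_sq: "f \<in> H_space ==> (\<integral>\<^sup>+t. ennreal ((cmod (f t))\<^sup>2) \<partial>haar) = ennreal (H_sq f)"
 unfolding H_sq_def by (intro nn_integral_eq_integral integrable_H_space) auto

lemma H_zero: "(%_. 0) \<in> H_space"
 by (simp add: H_space_def)

lemma H_diff: "f \<in> H_space ==> g \<in> H_space ==> (%t. f t - g t) \<in> H_space"
 using H_lc_in[of f g "-1"] by (simp add: H_lc_def)

lemma H_add: "f \<in> H_space ==> g \<in> H_space ==> (%t. f t + g t) \<in> H_space"
 using H_lc_in[of f g 1] by (simp add: H_lc_def)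

lemma H_ip_diff: "f \<in> H_space ==> g \<in> H_space ==> h \<in> H_space ==> H_ip (%t. f t - g t) h = H_ip f h - H_ip g h"
 using H.ip_lc[of f g h "-1"] by (simp add: H_lc_def)

lemma H_sum: "(\<And>n. n \<in> I ==> h n \<in> H_space) ==> (%t. \<Sum>n\<in>I. c n * h n t) \<in> H_space"
proof (induction I rule: infinite_finite_induct)
 case (insert x F)
 then have "H_lc (%t. \<Sum>n\<in>F. c n * h n t) (c x) (h x) \<in> H_space" by (intro H_lc_in) auto
 then show ?case using insert by (simp add: H_lc_def add.commute)
qed (simp_all add: H_zero)

lemma H_ip_sum: "(\<And>n. n \<in> I ==> h n \<in> H_space) ==> g \<in> H_space ==>
  H_ip (%t. \<Sum>n\<in>I. c n * h n t) g = (\<Sum>n\<in>I. c n * H_ip (h n) g)"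
proof (induction I rule: infinite_finite_induct)
 case (insert x F)
 have "H_ip (H_lc (%t. \<Sum>n\<in>F. c n * h n t) (c x) (h x)) g = (\<Sum>n\<in>insert x F. c n * H_ip (h n) g)"
  using insert by (subst H.ip_lc) (auto intro: H_sum)
 then show ?case using insert by (simp add: H_lc_def add.commute)
qed (simp_all add: H_ip_def)

text \<open>Cauchy-Schwarz for the defect form of the first \<open>N\<close> vectors: by
  orthogonality, pairing with \<open>h N\<close> is the same in the defect form as in
  \<open>ip\<close>.\<close>

lemma (in semi_inner) Bessel:
 fixes N :: nat
 assumes "\<And>n. n < N ==> h n \<in> V" "\<And>m n. m < N ==> n < N ==> ip (h m) (h n) = (if m = n then 1 else 0)"
  and "f \<in> V"
 shows "(\<Sum>n<N. (cmod (ip f (h n)))\<^sup>2) \<le> Re (ip f f)"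
 using assms
proof (induction N arbitrary: f)
 case 0
 then show ?case using ip_pos by simp
next
 case (Suc N)
 define L where "L = map (%n. (%f. ip f (h n), ())) [0..<N]"
 define D where "D f g = ip f g - (\<Sum>(l, y)\<leftarrow>L. l f * cnj (l g))" for f g
 have L: "(\<Sum>(l, y)\<leftarrow>L. F l) = (\<Sum>n<N. F (%f. ip f (h n)))" for F :: "('v => complex) => 'c::comm_monoid_add"
  by (simp add: L_def comp_def interv_sum_list_conv_sum_set_nat lessThan_atLeast0)
 have "(\<Sum>(l, y)\<leftarrow>L. (cmod (l f))\<^sup>2) \<le> Re (ip f f)" if "f \<in> V" for f
  unfolding L using Suc.IH[of f] Suc.prems(1,2) that by simp
 then interpret D: semi_inner V lc D
  unfolding D_def[abs_def]
  by (intro semi_inner_defect) (use Suc.prems(1) in \<open>auto simp: L_def linear_fun_def ip_lc\<close>)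
 have DN: "D f (h N) = ip f (h N)" for f
  unfolding D_def L using Suc.prems(2) by (auto intro!: sum.neutral)
 have "(cmod (D f (h N)))\<^sup>2 \<le> Re (D f f) * Re (D (h N) (h N))"
  using Suc.prems by (intro D.Cauchy_Schwarz) auto
 then have "(cmod (ip f (h N)))\<^sup>2 \<le> Re (D f f)"
  using Suc.prems(2)[of N N] unfolding DN by simp
 also have "\<dots> = Re (ip f f) - (\<Sum>n<N. (cmod (ip f (h n)))\<^sup>2)"
  unfolding D_def L by (simp add: complex_norm_square[symmetric] del: of_real_power)
 finally show ?case by simp
qed

text \<open>Bessel's inequality for the system \<open>h\<close> is the contraction condition of
  \<open>gauss_nn_contraction\<close> for the coefficient functionals.\<close>

lemma (in semi_inner) gauss_E_contraction:
 fixes y :: "nat => 'a::complex_normed_vector"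
 assumes e: "\<And>j. j < n ==> e j \<in> V" "\<And>i j. i < n ==> j < n ==> ip (e i) (e j) = (if i = j then 1 else 0)"
  and h: "\<And>k. k < N ==> h k \<in> V" "\<And>k l. k < N ==> l < N ==> ip (h k) (h l) = (if k = l then 1 else 0)"
 shows "gauss_E n (%j. \<Sum>k<N. ip (e j) (h k) *\<^sub>C y k) \<le> gauss_E N y"
proof -
 define L where "L = rev (map (%n. (%f. ip f (h n), y n)) [0..<N])"
 have L: "(\<Sum>(l, y)\<leftarrow>L. F l y) = (\<Sum>n<N. F (%f. ip f (h n)) (y n))" for F :: "('v => complex) => 'a => 'c::comm_monoid_add"
  unfolding L_def rev_map[symmetric]
  by (simp add: comp_def interv_sum_list_conv_sum_set_nat lessThan_atLeast0)
 have "gauss_nn (map (%e. \<Sum>(l, y)\<leftarrow>L. l e *\<^sub>C y) (rev (map e [0..<n]))) 0 \<le> gauss_nn (map snd L) 0"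
 proof (rule gauss_nn_contraction)
  show "set (rev (map e [0..<n])) \<subseteq> V" using e(1) by auto
  have inj: "inj_on e {..<n}"
  proof (rule inj_onI)
   fix i j assume "i \<in> {..<n}" "j \<in> {..<n}" "e i = e j"
   then show "i = j" using e(2)[of i i] e(2)[of i j] by (auto split: if_splits)
  qed
  then show "distinct (rev (map e [0..<n]))" by (simp add: distinct_map lessThan_atLeast0)
  show "ip a b = (if a = b then 1 else 0)" if "a \<in> set (rev (map e [0..<n]))" "b \<in> set (rev (map e [0..<n]))" for a b
  proof -
   have "a \<in> e ` {..<n}" "b \<in> e ` {..<n}" using that by auto
   then obtain i j where "i < n" "a = e i" "j < n" "b = e j" by blast
   then show ?thesis using e(2)[of i j] inj by (auto simp: inj_on_def)
  qed
  show "\<forall>p\<in>set L. linear_fun (fst p)" using h(1) by (auto simp: L_def linear_fun_def ip_lc)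
  show "(\<Sum>(l, y)\<leftarrow>L. (cmod (l f))\<^sup>2) \<le> Re (ip f f)" if "f \<in> V" for f
   unfolding L using h that by (intro Bessel) auto
 qed
 then show ?thesis
  unfolding gauss_E_eq_nn L by (simp add: L_def rev_map comp_def)
qed

text \<open>The Riesz-Fischer argument for the seminorm: a rapidly converging subsequence converges
  almost everywhere, and Fatou's lemma controls the distance of the whole sequence from that
  limit.\<close>

lemma H_complete:
 assumes F: "\<And>n. F n \<in> H_space"
  and cauchy: "\<And>ep. ep > 0 ==> \<exists>N. \<forall>m\<ge>N. \<forall>n\<ge>N. H_sq (%t. F m t - F n t) < ep"
 obtains f where "f \<in> H_space" "(%n. H_sq (%t. f t - F n t)) \<longlonglongrightarrow> 0"
proof -
 have [measurable]: "F n \<in> borel_measurable borel" for n using F by (rule borel_measurable_H_space)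
 have "\<exists>N. \<forall>m\<ge>N. \<forall>n\<ge>N. H_sq (%t. F m t - F n t) < (1/4) ^ k" for k :: nat
  by (rule cauchy) simp
 then obtain N where N: "\<And>k m n. m \<ge> N k ==> n \<ge> N k ==> H_sq (%t. F m t - F n t) < (1/4) ^ k"
  by metis
 \<comment> \<open>Partial sums put both \<open>r k\<close> and \<open>r (Suc k)\<close> above
   \<open>N k\<close>, and the summand \<open>k\<close> makes the indices tend to infinity.\<close>
 define r where "r k = (\<Sum>i\<le>k. N i) + k" for k
 have rN: "r k \<ge> N k" "r (Suc k) \<ge> N k" for k
  using member_le_sum[of k "{..k}" N] unfolding r_def by simp_all
 have rk: "r k \<ge> k" for k by (simp add: r_def)
 define d where "d k t = F (r (Suc k)) t - F (r k) t" for k t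
 have [measurable]: "d k \<in> borel_measurable borel" for k unfolding d_def by measurable
 have dH: "d k \<in> H_space" for k unfolding d_def using F by (intro H_diff)
 have dsq: "H_sq (d k) \<le> (1/4) ^ k" for k
  unfolding d_def using N[OF rN(2) rN(1)] by (simp add: less_imp_le)
 have "(\<integral>\<^sup>+t. (\<Sum>k. ennreal (2 ^ k * (cmod (d k t))\<^sup>2)) \<partial>haar) = (\<Sum>k. (\<integral>\<^sup>+t. ennreal (2 ^ k * (cmod (d k t))\<^sup>2) \<partial>haar))"
  by (rule nn_integral_suminf) measurable
 also have "\<dots> = (\<Sum>k. ennreal (2 ^ k * H_sq (d k)))"
  by (simp add: ennreal_mult nn_integral_cmult nn_integral_H_sq[OF dH] H_sq_nonneg del: ennreal_power)
 also have "\<dots> \<le> (\<Sum>k. ennreal ((1/2) ^ k))"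
 proof (rule suminf_le)
  fix k
  have "2 ^ k * H_sq (d k) \<le> 2 ^ k * (1/4) ^ k" using dsq by (intro mult_left_mono) auto
  also have "\<dots> = (1/2::real) ^ k" by (simp flip: power_mult_distrib)
  finally show "ennreal (2 ^ k * H_sq (d k)) \<le> ennreal ((1/2) ^ k)" by (rule ennreal_leI)
 qed auto
 also have "\<dots> = ennreal (\<Sum>k. (1/2) ^ k)"
  by (rule suminf_ennreal2) (auto intro: summable_geometric)
 finally have "(\<integral>\<^sup>+t. (\<Sum>k. ennreal (2 ^ k * (cmod (d k t))\<^sup>2)) \<partial>haar) \<noteq> \<infinity>"
  using ennreal_less_top by (metis infinity_ennreal_def neq_top_trans ennreal_neq_top)
 then have "AE t in haar. (\<Sum>k. ennreal (2 ^ k * (cmod (d k t))\<^sup>2)) \<noteq> \<infinity>"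
  by (intro nn_integral_PInf_AE) auto
 then have conv: "AE t in haar. convergent (%k. F (r k) t)"
 proof eventually_elim
  fix t assume "(\<Sum>k. ennreal (2 ^ k * (cmod (d k t))\<^sup>2)) \<noteq> \<infinity>"
  then have s: "summable (%k. 2 ^ k * (cmod (d k t))\<^sup>2)"
   by (intro summable_suminf_not_top) auto
  have "summable (%k. d k t)"
  proof (rule summable_comparison_test')
   show "summable (%k. (1/2) ^ k + 2 ^ k * (cmod (d k t))\<^sup>2)"
    using s by (intro summable_add summable_geometric) auto
   fix k :: nat
   \<comment> \<open>The weight \<open>2 ^ k\<close> turns integrability of the squares into
     pointwise summability of the moduli: twice \<open>cmod (d k t)\<close> is at most
     \<open>(1/2) ^ k + 2 ^ k * (cmod (d k t))\<^sup>2\<close>.\<close>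
   define u where "u = sqrt (2 ^ k)"
   have u: "u > 0" "u\<^sup>2 = 2 ^ k" by (simp_all add: u_def)
   have "2 * (1 / u) * (u * cmod (d k t)) \<le> (1 / u)\<^sup>2 + (u * cmod (d k t))\<^sup>2"
    by (rule sum_squares_bound)
   then have "2 * cmod (d k t) \<le> (1/2) ^ k + 2 ^ k * (cmod (d k t))\<^sup>2"
    using u by (simp add: power_mult_distrib power_divide power_one_over)
   then show "norm (d k t) \<le> (1/2) ^ k + 2 ^ k * (cmod (d k t))\<^sup>2"
    using norm_ge_zero[of "d k t"] by linarith
  qed
  then have "convergent (%n. \<Sum>k<n. d k t)" by (simp add: summable_iff_convergent)
  moreover have "(\<Sum>k<n. d k t) = F (r n) t - F (r 0) t" for n
   unfolding d_def by (rule sum_lessThan_telescope)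
  ultimately have "convergent (%n. F (r n) t - F (r 0) t)" by simp
  then show "convergent (%n. F (r n) t)" by (simp add: convergent_diff_const_right_iff)
 qed
 define f where "f t = lim (%k. F (r k) t)" for t
 have [measurable]: "f \<in> borel_measurable borel" unfolding f_def by measurable
 have lim: "AE t in haar. (%k. F (r k) t) \<longlonglongrightarrow> f t"
  using conv by eventually_elim (simp add: f_def convergent_LIMSEQ_iff)
 have fat: "(\<integral>\<^sup>+t. ennreal ((cmod (f t - F n t))\<^sup>2) \<partial>haar) \<le> ennreal ((1/4) ^ k)" if n: "n \<ge> N k" for n k
 proof -
  have "(\<integral>\<^sup>+t. ennreal ((cmod (f t - F n t))\<^sup>2) \<partial>haar) = (\<integral>\<^sup>+t. liminf (%j. ennreal ((cmod (F (r j) t - F n t))\<^sup>2)) \<partial>haar)"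
  proof (rule nn_integral_cong_AE)
   show "AE t in haar. ennreal ((cmod (f t - F n t))\<^sup>2) = liminf (%j. ennreal ((cmod (F (r j) t - F n t))\<^sup>2))"
    using lim
   proof eventually_elim
    fix t assume "(%k. F (r k) t) \<longlonglongrightarrow> f t"
    then have "(%j. ennreal ((cmod (F (r j) t - F n t))\<^sup>2)) \<longlonglongrightarrow> ennreal ((cmod (f t - F n t))\<^sup>2)"
     by (intro tendsto_ennrealI tendsto_intros)
    then show "ennreal ((cmod (f t - F n t))\<^sup>2) = liminf (%j. ennreal ((cmod (F (r j) t - F n t))\<^sup>2))"
     by (rule lim_imp_Liminf[OF sequentially_bot, symmetric])
   qed
  qed
  also have "\<dots> \<le> liminf (%j. (\<integral>\<^sup>+t. ennreal ((cmod (F (r j) t - F n t))\<^sup>2) \<partial>haar))"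
   by (rule nn_integral_liminf) measurable
  also have "\<dots> = liminf (%j. ennreal (H_sq (%t. F (r j) t - F n t)))"
   using F by (simp add: nn_integral_H_sq H_diff)
  also have "\<dots> \<le> ennreal ((1/4) ^ k)"
  proof (rule Liminf_le)
   show "eventually (%j. ennreal (H_sq (%t. F (r j) t - F n t)) \<le> ennreal ((1/4) ^ k)) sequentially"
    unfolding eventually_sequentially
   proof (intro exI allI impI ennreal_leI)
    fix j assume "j \<ge> N k"
    then show "H_sq (%t. F (r j) t - F n t) \<le> (1/4) ^ k"
     using N[of k "r j" n] n rk[of j] by simp
   qed
  qed simp
  finally show ?thesis .
 qed
 have fFH: "(%t. f t - F n t) \<in> H_space" if "n \<ge> N k" for n k
  unfolding H_space_def
 proof (intro CollectI conjI)
  show "integrable haar (%t. (cmod (f t - F n t))\<^sup>2)"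
   using fat[OF that] by (intro integrableI_bounded) (auto simp: order_le_less_trans)
 qed measurable
 have fH: "f \<in> H_space" using H_add[OF fFH[of 0 "N 0"] F[of "N 0"]] by simp
 have "(%n. H_sq (%t. f t - F n t)) \<longlonglongrightarrow> 0"
 proof (rule LIMSEQ_I)
  fix ep :: real assume "ep > 0"
  then obtain k where k: "(1/4) ^ k < ep" using real_arch_pow_inv[of ep "1/4"] by auto
  show "\<exists>n0. \<forall>n\<ge>n0. norm (H_sq (%t. f t - F n t) - 0) < ep"
  proof (intro exI allI impI)
   fix n assume n: "n \<ge> N k"
   have "ennreal (H_sq (%t. f t - F n t)) \<le> ennreal ((1/4) ^ k)"
    using fat[OF n] nn_integral_H_sq[OF fFH[OF n]] by simp
   then have "H_sq (%t. f t - F n t) \<le> (1/4) ^ k" by (subst (asm) ennreal_le_iff) auto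
   then show "norm (H_sq (%t. f t - F n t) - 0) < ep" using k H_sq_nonneg by simp
  qed
 qed
 then show ?thesis using that fH by blast
qed

section \<open>Orthonormal bases of H\<close>

lemma H_sq_cong_AE:
 assumes "f \<in> H_space" "g \<in> H_space" "AE t in haar. f t = g t"
 shows "H_sq f = H_sq g"
 unfolding H_sq_def
 using assms by (intro integral_cong_AE) (auto dest: borel_measurable_H_space)

lemma H_sq_eq_0: "f \<in> H_space ==> H_sq f = 0 \<longleftrightarrow> (AE t in haar. f t = 0)"
 unfolding H_sq_def by (subst integral_nonneg_eq_0_iff_AE) (auto intro: integrable_H_space)

lemma H_CS: "f \<in> H_space ==> g \<in> H_space ==> (cmod (H_ip f g))\<^sup>2 \<le> H_sq f * H_sq g"
 using H.Cauchy_Schwarz by (simp add: Re_H_ip_self)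

text \<open>Bessel makes the partial sums Cauchy. Their limit has the same coefficients as
  \<open>g\<close>, so the totality clause of \<open>H_onb\<close> identifies the two almost
  everywhere.\<close>

lemma H_onb_expansion:
 assumes h: "H_onb h" and g: "g \<in> H_space"
 shows "(%N. H_sq (%t. g t - (\<Sum>n<N. H_ip g (h n) * h n t))) \<longlonglongrightarrow> 0"
proof -
 have hH: "h n \<in> H_space" and hip: "H_ip (h m) (h n) = (if m = n then 1 else 0)" for m n
  using h by (simp_all add: H_onb_def H_ip_def)
 define c where "c n = H_ip g (h n)" for n
 define F where "F N t = (\<Sum>n<N. c n * h n t)" for N t
 have FH: "F N \<in> H_space" for N unfolding F_def using hH by (intro H_sum)
 have ip: "H_ip (%t. \<Sum>k\<in>I. c k * h k t) (h n) = (if n \<in> I then c n else 0)" if "finite I" for I n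
  using hH that by (simp add: H_ip_sum hip if_distrib[of "%x. _ * x"] cong: if_cong)
 have sq: "H_sq (%t. \<Sum>k\<in>I. c k * h k t) = (\<Sum>k\<in>I. (cmod (c k))\<^sup>2)" if "finite I" for I
 proof -
  let ?s = "%t. \<Sum>k\<in>I. c k * h k t"
  have s: "?s \<in> H_space" using hH by (intro H_sum)
  have "H_ip ?s ?s = (\<Sum>k\<in>I. c k * cnj (H_ip ?s (h k)))"
   using hH s by (subst H_ip_sum) (auto simp: H.ip_cnj[OF s])
  also have "\<dots> = (\<Sum>k\<in>I. c k * cnj (c k))" using that by (simp add: ip)
  also have "\<dots> = complex_of_real (\<Sum>k\<in>I. (cmod (c k))\<^sup>2)"
   by (simp add: complex_norm_square del: of_real_power)
  finally show ?thesis by (simp add: Re_H_ip_self[symmetric])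
 qed
 have summ: "summable (%n. (cmod (c n))\<^sup>2)"
 proof (rule summableI_nonneg_bounded)
  show "(\<Sum>n<N. (cmod (c n))\<^sup>2) \<le> H_sq g" for N
   using H.Bessel[of N h g] hH hip g by (simp add: c_def Re_H_ip_self)
 qed simp
 have FF: "H_sq (%t. F m t - F n t) = (\<Sum>k\<in>{n..<m}. (cmod (c k))\<^sup>2)" if "n \<le> m" for m n
 proof -
  have "F m t - F n t = (\<Sum>k\<in>{n..<m}. c k * h k t)" for t
   using that unfolding F_def lessThan_atLeast0 by (simp add: sum_diff_nat_ivl)
  then show ?thesis using sq[of "{n..<m}"] by simp
 qed
 have comm: "H_sq (%t. F m t - F n t) = H_sq (%t. F n t - F m t)" for m n
  by (simp add: H_sq_def norm_minus_commute)
 obtain f where f: "f \<in> H_space" "(%n. H_sq (%t. f t - F n t)) \<longlonglongrightarrow> 0"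
 proof (rule H_complete[of F])
  fix ep :: real assume "ep > 0"
  then obtain N where N: "\<And>m n. m \<ge> N ==> norm (\<Sum>k\<in>{m..<n}. (cmod (c k))\<^sup>2) < ep"
   using summ unfolding summable_Cauchy by meson
  have "H_sq (%t. F m t - F n t) < ep" if "m \<ge> N" "n \<ge> N" for m n
   using N[of n m] N[of m n] that FF[of n m] FF[of m n] comm[of m n] by (cases "n \<le> m") auto
  then show "\<exists>N. \<forall>m\<ge>N. \<forall>n\<ge>N. H_sq (%t. F m t - F n t) < ep" by blast
 qed (use FH in auto)
 have fc: "H_ip f (h k) = c k" for k
 proof -
  have "(cmod (H_ip f (h k) - c k))\<^sup>2 \<le> 0"
  proof (rule LIMSEQ_le_const[OF f(2)], intro exI allI impI)
   fix n assume "Suc k \<le> n"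
   then have "H_ip (F n) (h k) = c k" unfolding F_def by (subst ip) auto
   then have "H_ip (%t. f t - F n t) (h k) = H_ip f (h k) - c k"
    using f(1) FH hH by (simp add: H_ip_diff)
   moreover have "H_sq (h k) = 1" using hip[of k k] by (simp add: Re_H_ip_self[symmetric])
   ultimately show "(cmod (H_ip f (h k) - c k))\<^sup>2 \<le> H_sq (%t. f t - F n t)"
    using H_CS[OF H_diff[OF f(1) FH[of n]] hH[of k]] by simp
  qed
  then show ?thesis by simp
 qed
 have "\<forall>n. H_ip (%t. g t - f t) (h n) = 0"
  using f(1) g hH by (simp add: H_ip_diff fc) (simp add: c_def)
 moreover have "\<forall>g\<in>H_space. (\<forall>n. H_ip g (h n) = 0) \<longrightarrow> (AE t in haar. g t = 0)"
  using h by (simp add: H_onb_def H_ip_def)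
 ultimately have "AE t in haar. g t - f t = 0"
  using H_diff[OF g f(1)] by blast
 then have "H_sq (%t. g t - F n t) = H_sq (%t. f t - F n t)" for n
  using FH f(1) g by (intro H_sq_cong_AE H_diff) auto
 then show ?thesis using f(2) by (simp add: F_def c_def)
qed

text \<open>A Householder reflection. The phase \<open>ta\<close> makes
  \<open>ta * H_ip e (h k)\<close> real and nonnegative, so the reflection \<open>R\<close> along h
  k - ta e exchanges \<open>h k\<close> and \<open>ta e\<close>. It fixes the earlier
  \<open>h j\<close>, which are orthogonal to both, and carries a basis to a basis; dropping the
  phase puts \<open>e\<close> in position \<open>k\<close>.\<close>

lemma H_onb_step:
 assumes h: "H_onb h" and e: "e \<in> H_space" "H_ip e e = 1" "\<And>j. j < k ==> H_ip (h j) e = 0"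
 shows "\<exists>h'. H_onb h' \<and> h' k = e \<and> (\<forall>j<k. h' j = h j)"
proof -
 have hH: "h n \<in> H_space" and hip: "H_ip (h m) (h n) = (if m = n then 1 else 0)" for m n
  using h by (simp_all add: H_onb_def H_ip_def)
 define a where "a = H_ip e (h k)"
 define ta where "ta = (if a = 0 then 1 else cnj a / of_real (cmod a))"
 have ta: "ta * a = of_real (cmod a)" "cmod ta = 1"
  by (auto simp: ta_def norm_divide mult.commute[of "cnj a"] complex_norm_square[symmetric] power2_eq_square)
 have ta': "ta * cnj ta = 1" using ta(2) complex_norm_square[of ta] by simp
 define e' where "e' = H_lc (%_. 0) ta e"
 have e'H: "e' \<in> H_space" unfolding e'_def using e H_zero by (intro H_lc_in)
 have e'ip: "H_ip e' g = ta * H_ip e g" if "g \<in> H_space" for g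
  unfolding e'_def using that e H_zero by (subst H.ip_lc) (auto simp: H_ip_def)
 have ipe': "H_ip g e' = cnj ta * H_ip g e" if "g \<in> H_space" for g
  using e'ip[OF that] H.ip_cnj[OF e'H that] H.ip_cnj[OF e(1) that] by simp
 define v where "v = (%t. h k t - e' t)"
 have vH: "v \<in> H_space" unfolding v_def using hH e'H by (intro H_diff)
 have ipv: "H_ip g v = H_ip g (h k) - cnj ta * H_ip g e" if "g \<in> H_space" for g
 proof -
  have "H_ip v g = H_ip (h k) g - H_ip e' g" unfolding v_def using hH e'H that by (intro H_ip_diff)
  then show ?thesis
   using H.ip_cnj[OF vH that] H.ip_cnj[OF hH that] H.ip_cnj[OF e'H that] ipe'[OF that] by simp
 qed
 define s where "s = 2 - 2 * cmod a"
 have hkv: "H_ip (h k) v = of_real (s / 2)"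
 proof -
  have "H_ip (h k) e = cnj a" using H.ip_cnj[OF e(1) hH] by (simp add: a_def)
  then have "H_ip (h k) v = 1 - cnj (ta * a)" using hH by (simp add: ipv hip)
  then show ?thesis by (simp add: ta s_def)
 qed
 have e'v: "H_ip e' v = - of_real (s / 2)"
 proof -
  have "s / 2 = 1 - cmod a" by (simp add: s_def)
  then have "complex_of_real (s / 2) = 1 - of_real (cmod a)" by simp
  moreover have "H_ip e' v = of_real (cmod a) - 1"
   using e'H hH e ta ta' by (simp add: ipv e'ip a_def[symmetric] mult.commute)
  ultimately show ?thesis by (metis minus_diff_eq)
 qed
 have vv: "H_ip v v = of_real s"
 proof -
  have "H_ip v v = H_ip (h k) v - H_ip e' v" unfolding v_def by (rule H_ip_diff) (use hH e'H vH in \<open>auto simp: v_def\<close>)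
  then show ?thesis by (simp add: hkv e'v)
 qed
 \<comment> \<open>\<open>s\<close> is the squared norm of \<open>v\<close>. If it is
   \<open>0\<close>, then \<open>h k\<close> and \<open>ta e\<close> already agree almost everywhere
   and no reflection is made.\<close>
 define R where "R f = (if s = 0 then f else H_lc f (- (2 / of_real s) * H_ip f v) v)" for f
 have RH: "R f \<in> H_space" if "f \<in> H_space" for f unfolding R_def using that vH by (auto intro: H_lc_in)
 have Rv: "H_ip (R f) v = - H_ip f v" if "f \<in> H_space" "s \<noteq> 0" for f
  using that vH by (simp add: R_def H.ip_lc vv)
 have RR: "R (R f) = f" if "f \<in> H_space" for f
 proof (cases "s = 0")
  case False
  then show ?thesis unfolding R_def[of "R f"] using Rv[OF that False] False by (simp add: R_def H_lc_def fun_eq_iff)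
 qed (simp add: R_def)
 have Rip: "H_ip (R f) g = H_ip f (R g)" if "f \<in> H_space" "g \<in> H_space" for f g
 proof (cases "s = 0")
  case False
  then show ?thesis
   using that vH by (simp add: R_def H.ip_lc H.ip_lc_right) (simp add: H.ip_cnj[of g v])
 qed (simp add: R_def)
 have Riso: "H_ip (R f) (R g) = H_ip f g" if "f \<in> H_space" "g \<in> H_space" for f g
  using that by (simp add: Rip RH RR)
 \<comment> \<open>Stated through inner products because in the degenerate case \<open>h k\<close>
   and \<open>e'\<close> agree only almost everywhere, not as functions.\<close>
 have Rhk: "H_ip g (R (h k)) = cnj ta * H_ip g e" if g: "g \<in> H_space" for g
 proof (cases "s = 0")
  case True
  then have "(cmod (H_ip g v))\<^sup>2 \<le> 0" using H_CS[OF g vH] vv by (simp add: Re_H_ip_self[symmetric])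
  then show ?thesis using True ipv[OF g] by (simp add: R_def)
 next
  case False
  then have "R (h k) = e'" unfolding R_def by (simp add: hkv H_lc_def fun_eq_iff) (simp add: v_def)
  then show ?thesis using ipe'[OF g] by simp
 qed
 have Rhj: "R (h j) = h j" if "j < k" for j
  using that hH e(3)[OF that] by (simp add: R_def ipv hip H_lc_def)
 define h' where "h' n = (if n = k then e else R (h n))" for n
 have h'H: "h' n \<in> H_space" for n using e hH by (simp add: h'_def RH)
 have ta0: "ta \<noteq> 0" using ta(2) by auto
 have ek: "H_ip (R (h m)) e = 0" if "m \<noteq> k" for m
  using Rhk[OF RH[OF hH[of m]]] Riso[OF hH hH, of m k] hip[of m k] that ta0 by simp
 have h'ip: "H_ip (h' m) (h' n) = (if m = n then 1 else 0)" for m n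
  using e ek[of m] ek[of n] Riso[OF hH hH, of m n] hip[of m n] H.ip_cnj[OF RH[OF hH[of n]] e(1)]
  by (auto simp: h'_def)
 have tot: "AE t in haar. g t = 0" if g: "g \<in> H_space" and z: "\<forall>n. H_ip g (h' n) = 0" for g
 proof -
  have "H_ip (R g) (h n) = 0" for n
   using z[rule_format, of n] Rhk[OF g] g hH by (cases "n = k") (simp_all add: Rip h'_def)
  then have "AE t in haar. R g t = 0" using h RH[OF g] by (simp add: H_onb_def H_ip_def)
  then have "H_sq (R g) = 0" using RH[OF g] H_sq_eq_0 by blast
  then have "H_sq g = 0" using Riso[OF g g] by (simp add: Re_H_ip_self[symmetric])
  then show ?thesis using g H_sq_eq_0 by blast
 qed
 have "H_onb h'" using h'H h'ip tot by (simp add: H_onb_def H_ip_def)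
 then show ?thesis using Rhj by (intro exI[of _ h']) (auto simp: h'_def)
qed

text \<open>In a basis that begins with the given system, the Gaussian series of a finite-rank
  operator built from this system becomes a finite sum.\<close>

lemma H_onb_extend:
 fixes e :: "nat => real => complex"
 assumes "H_onb h0" "\<And>j. j < n ==> e j \<in> H_space"
  "\<And>i j. i < n ==> j < n ==> H_ip (e i) (e j) = (if i = j then 1 else 0)"
 shows "\<exists>h. H_onb h \<and> (\<forall>j<n. h j = e j)"
 using assms(2,3)
proof (induction n)
 case (Suc n)
 then obtain h where h: "H_onb h" "\<forall>j<n. h j = e j" by auto
 then obtain h' where "H_onb h'" "h' n = e n" "\<forall>j<n. h' j = h j"
  using H_onb_step[of h "e n" n] Suc.prems by auto
 then show ?case using h by (intro exI[of _ h']) (auto simp: less_Suc_eq)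
qed (use assms(1) in auto)

section \<open>Gamma norms compared with finite Gaussian sums\<close>

lemma gauss_E_le_limit:
 fixes y :: "nat => 'a::complex_normed_vector"
 assumes "\<And>j. j < n ==> (%N. Y N j) \<longlonglongrightarrow> y j" "\<And>N. gauss_E n (Y N) \<le> M"
 shows "gauss_E n y \<le> M"
proof -
 have m: "(%w. (norm (\<Sum>j<n. gauss j w *\<^sub>C Y N j))\<^sup>2) \<in> borel_measurable gauss_space" for N
  by (rule measurable_compose[OF borel_measurable_gauss_sum borel_measurable_continuous_onI])
   (intro continuous_intros)
 \<comment> \<open>The integrands converge pointwise, and Fatou's lemma gives the one inequality
   that is asked for.\<close>
 have "gauss_E n y = (\<integral>\<^sup>+w. liminf (%N. ennreal ((norm (\<Sum>j<n. gauss j w *\<^sub>C Y N j))\<^sup>2)) \<partial>gauss_space)"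
  unfolding gauss_E_def
 proof (rule nn_integral_cong)
  fix w
  have "(%N. ennreal ((norm (\<Sum>j<n. gauss j w *\<^sub>C Y N j))\<^sup>2)) \<longlonglongrightarrow> ennreal ((norm (\<Sum>j<n. gauss j w *\<^sub>C y j))\<^sup>2)"
   by (intro tendsto_ennrealI tendsto_power tendsto_norm tendsto_sum scaleC.tendsto tendsto_const assms(1)) simp
  then show "ennreal ((norm (\<Sum>j<n. gauss j w *\<^sub>C y j))\<^sup>2) = liminf (%N. ennreal ((norm (\<Sum>j<n. gauss j w *\<^sub>C Y N j))\<^sup>2))"
   by (rule lim_imp_Liminf[OF sequentially_bot, symmetric])
 qed
 also have "\<dots> \<le> liminf (%N. gauss_E n (Y N))"
  unfolding gauss_E_def by (intro nn_integral_liminf measurable_compose[OF m measurable_ennreal])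
 also have "\<dots> \<le> M"
  by (rule Liminf_le) (use assms(2) in auto)
 finally show ?thesis .
qed

text \<open>\<open>gamma_norm\<close> is tied to one basis picked by \<open>SOME\<close>; the
  comparison lemmas below are proved for whichever basis that is.\<close>

lemma gamma_norm_choice:
 assumes "H_onb h" "gamma_sums h T S"
 obtains h' S' where "H_onb h'" "gamma_sums h' T S'" "gamma_norm T = sqrt (\<integral>w. (norm (S' w))\<^sup>2 \<partial>gauss_space)"
proof -
 have "\<exists>r h S. H_onb h \<and> gamma_sums h T S \<and> r = sqrt (\<integral>w. (norm (S w))\<^sup>2 \<partial>gauss_space)"
  using assms by blast
 from someI_ex[OF this] show ?thesis using that unfolding gamma_norm_def by blast
qed

lemma H_bounded_op_add:
 "H_bounded_op T ==> g \<in> H_space ==> h \<in> H_space ==> T (%t. g t + h t) = T g + T h"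
 by (simp add: H_bounded_op_def)

lemma H_bounded_op_scale:
 "H_bounded_op T ==> g \<in> H_space ==> T (%t. c * g t) = c *\<^sub>C T g"
 by (simp add: H_bounded_op_def)

lemma H_bounded_op_sum:
 fixes N :: nat
 assumes T: "H_bounded_op T" and h: "\<And>n. h n \<in> H_space"
 shows "T (%t. \<Sum>n<N. c n * h n t) = (\<Sum>n<N. c n *\<^sub>C T (h n))"
proof (induction N)
 case 0
 show ?case using H_bounded_op_scale[OF T H_zero, of 0] by simp
next
 case (Suc N)
 have 1: "(%t. \<Sum>n<N. c n * h n t) \<in> H_space" using h by (intro H_sum)
 have "(%t. c N * h N t) \<in> H_space" using H_lc_in[OF H_zero h[of N], of "c N"] by (simp add: H_lc_def)
 then have "T (%t. (\<Sum>n<N. c n * h n t) + c N * h N t) = T (%t. \<Sum>n<N. c n * h n t) + T (%t. c N * h N t)"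
  by (rule H_bounded_op_add[OF T 1])
 moreover have "T (%t. c N * h N t) = c N *\<^sub>C T (h N)" by (rule H_bounded_op_scale[OF T h])
 ultimately show ?case using Suc by simp
qed

text \<open>Expanding the \<open>e j\<close> in the chosen basis approximates the values
  \<open>T (e j)\<close> by contractions of the Gaussian sums of that basis; lower semicontinuity
  removes the truncation.\<close>

lemma gamma_norm_dominates:
 fixes T :: "(real => complex) => 'a::complex_normed_vector"
 assumes T: "gamma_radonifying T"
  and e: "\<And>j. j < n ==> e j \<in> H_space" "\<And>i j. i < n ==> j < n ==> H_ip (e i) (e j) = (if i = j then 1 else 0)"
 shows "gauss_E n (%j. T (e j)) \<le> ennreal (2 * (gamma_norm T)\<^sup>2)" "gamma_norm T \<ge> 0"
proof -
 have bT: "H_bounded_op T" using T by (simp add: gamma_radonifying_def)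
 obtain h0 S0 where h0: "H_onb h0" "gamma_sums h0 T S0"
  using T unfolding gamma_radonifying_def by blast
 obtain h S where hS: "H_onb h" "gamma_sums h T S" "gamma_norm T = sqrt (\<integral>w. (norm (S w))\<^sup>2 \<partial>gauss_space)"
  by (rule gamma_norm_choice[OF h0])
 show "gamma_norm T \<ge> 0" by (simp add: hS)
 have hH: "h n \<in> H_space" and hip: "H_ip (h m) (h n) = (if m = n then 1 else 0)" for m n
  using hS(1) by (simp_all add: H_onb_def H_ip_def)
 obtain K where K: "\<And>g. g \<in> H_space ==> norm (T g) \<le> K * H_norm g"
  using bT unfolding H_bounded_op_def by blast
 show "gauss_E n (%j. T (e j)) \<le> ennreal (2 * (gamma_norm T)\<^sup>2)"
 proof (rule gauss_E_le_limit)
  fix j assume j: "j < n"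
  let ?F = "%N t. \<Sum>k<N. H_ip (e j) (h k) * h k t"
  have FH: "?F N \<in> H_space" for N using hH by (intro H_sum)
  define b where "b N = K * H_norm (%t. e j t - ?F N t)" for N
  define a where "a N = T (e j) - (\<Sum>k<N. H_ip (e j) (h k) *\<^sub>C T (h k))" for N
  have "(%N. K * H_norm (%t. e j t - ?F N t)) \<longlonglongrightarrow> K * sqrt 0"
   unfolding H_norm_eq by (intro tendsto_mult tendsto_const tendsto_real_sqrt H_onb_expansion[OF hS(1) e(1)[OF j]])
  then have b: "b \<longlonglongrightarrow> 0" by (simp add: b_def[abs_def])
  have ab: "norm (T (e j) - (\<Sum>k<N. H_ip (e j) (h k) *\<^sub>C T (h k))) \<le> K * H_norm (%t. e j t - ?F N t)" for N
  proof -
   have d: "(%t. e j t - ?F N t) \<in> H_space" using e(1)[OF j] FH by (intro H_diff)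
   have "T (%t. (e j t - ?F N t) + ?F N t) = T (%t. e j t - ?F N t) + T (?F N)"
    by (rule H_bounded_op_add[OF bT d FH])
   then have "T (e j) - T (?F N) = T (%t. e j t - ?F N t)" by simp
   then show ?thesis using K[OF d] by (simp add: H_bounded_op_sum[OF bT hH])
  qed
  have "eventually (%N. norm (a N) \<le> b N) sequentially"
   using ab by (intro always_eventually allI) (simp only: a_def b_def)
  then have "a \<longlonglongrightarrow> 0" using b by (rule Lim_null_comparison)
  from tendsto_diff[OF tendsto_const[of "T (e j)"] this]
  show "(%N. \<Sum>k<N. H_ip (e j) (h k) *\<^sub>C T (h k)) \<longlonglongrightarrow> T (e j)" by (simp add: a_def)
 next
  fix N
  have "gauss_E n (%j. \<Sum>k<N. H_ip (e j) (h k) *\<^sub>C T (h k)) \<le> gauss_E N (%k. T (h k))"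
   using e hH hip by (intro H.gauss_E_contraction) auto
  also have "\<dots> \<le> 2 * ennreal (\<integral>w. (norm (S w))\<^sup>2 \<partial>gauss_space)"
   unfolding gamma_sums_bounds(1)[OF hS(2)] by (rule gamma_sums_bounds(2)[OF hS(2)])
  also have "\<dots> = ennreal (2 * (gamma_norm T)\<^sup>2)"
   by (simp add: hS(3) ennreal_mult)
  finally show "gauss_E n (%j. \<Sum>k<N. H_ip (e j) (h k) *\<^sub>C T (h k)) \<le> ennreal (2 * (gamma_norm T)\<^sup>2)" .
 qed
qed

text \<open>Provides elements of the unit ball over which \<open>dual_pairings\<close> takes its
  supremum. A basis extending \<open>e\<close> shows that the Gaussian series converges, and
  contraction bounds it in the chosen basis; the \<open>1/2\<close> compensates the factor 2 of
  \<open>gamma_sums_bounds\<close>. The pairing in \<open>finite_rank_op\<close> has no conjugate,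
  so it is the inner product only for real \<open>e j\<close>.\<close>

lemma gamma_norm_finite_rank_le:
 fixes x :: "nat => 'a::complex_normed_vector"
 assumes onb: "H_onb h0"
  and e: "\<And>j. j < n ==> e j \<in> H_space" "\<And>i j. i < n ==> j < n ==> H_ip (e i) (e j) = (if i = j then 1 else 0)"
  and re: "\<And>j t. j < n ==> cnj (e j t) = e j t"
  and x: "gauss_E n x \<le> ennreal (1/2)"
 shows "gamma_norm (finite_rank_op n e x) \<le> 1"
proof -
 have U: "finite_rank_op n e x g = (\<Sum>j<n. H_ip g (e j) *\<^sub>C x j)" for g
  unfolding finite_rank_op_def H_ip_def using re by simp
 obtain h where h: "H_onb h" "\<forall>j<n. h j = e j" using H_onb_extend[OF onb e] by blast
 have hip: "H_ip (h m) (h n) = (if m = n then 1 else 0)" for m n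
  using h by (simp_all add: H_onb_def H_ip_def)
 define S where "S w = (\<Sum>j<n. gauss j w *\<^sub>C finite_rank_op n e x (h j))" for w
 have z: "finite_rank_op n e x (h k) = 0" if "k \<ge> n" for k
  unfolding U
 proof (rule sum.neutral, rule ballI)
  fix j assume "j \<in> {..<n}"
  then have "H_ip (h k) (e j) = 0" using h(2) hip[of k j] that by auto
  then show "H_ip (h k) (e j) *\<^sub>C x j = 0" by simp
 qed
 have "gamma_sums h (finite_rank_op n e x) S"
  unfolding gamma_sums_def
 proof
  show "S \<in> borel_measurable gauss_space" unfolding S_def by (rule borel_measurable_gauss_sum)
  have "eventually (%N. (\<integral>\<^sup>+ w. ennreal ((norm (S w - (\<Sum>n'<N. gauss n' w *\<^sub>C finite_rank_op n e x (h n'))))\<^sup>2) \<partial>gauss_space) = 0) sequentially"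
   unfolding eventually_sequentially
  proof (intro exI allI impI)
   fix N assume "n \<le> N"
   then have "(\<Sum>n'<N. gauss n' w *\<^sub>C finite_rank_op n e x (h n')) = S w" for w
    unfolding S_def by (intro sum.mono_neutral_right) (auto simp: z)
   then show "(\<integral>\<^sup>+ w. ennreal ((norm (S w - (\<Sum>n'<N. gauss n' w *\<^sub>C finite_rank_op n e x (h n'))))\<^sup>2) \<partial>gauss_space) = 0"
    by simp
  qed
  then show "(%N. \<integral>\<^sup>+ w. ennreal ((norm (S w - (\<Sum>n'<N. gauss n' w *\<^sub>C finite_rank_op n e x (h n'))))\<^sup>2) \<partial>gauss_space) \<longlonglongrightarrow> 0"
   by (rule tendsto_eventually)
 qed
 from gamma_norm_choice[OF h(1) this] obtain h' S' where h': "H_onb h'" "gamma_sums h' (finite_rank_op n e x) S'"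
  "gamma_norm (finite_rank_op n e x) = sqrt (\<integral>w. (norm (S' w))\<^sup>2 \<partial>gauss_space)" by blast
 have "gauss_E N (%k. finite_rank_op n e x (h' k)) \<le> ennreal (1/2)" for N
 proof -
  have "gauss_E N (%k. finite_rank_op n e x (h' k)) \<le> gauss_E n x"
   unfolding U using h'(1) e by (intro H.gauss_E_contraction) (auto simp: H_onb_def H_ip_def)
  then show ?thesis using x by (rule order_trans)
 qed
 then have "ennreal (\<integral>w. (norm (S' w))\<^sup>2 \<partial>gauss_space) \<le> 2 * ennreal (1/2)"
  unfolding gamma_sums_bounds(1)[OF h'(2)] by (intro gamma_sums_bounds(3)[OF h'(2)])
 also have "\<dots> = ennreal (2 * (1/2))" by (subst ennreal_mult) simp_all
 finally have "ennreal (\<integral>w. (norm (S' w))\<^sup>2 \<partial>gauss_space) \<le> ennreal 1" by simp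
 then show ?thesis unfolding h'(3) by (simp add: ennreal_le_iff del: ennreal_1)
qed

lemma gamma_dual_norm_dominates:
 fixes y :: "nat => 'a::complex_normed_vector"
 assumes onb: "H_onb h0" and V: "in_gamma_dual V"
  and e: "\<And>j. j < n ==> e j \<in> H_space" "\<And>i j. i < n ==> j < n ==> H_ip (e i) (e j) = (if i = j then 1 else 0)"
  and re: "\<And>j t. j < n ==> cnj (e j t) = e j t"
  and y: "gauss_E n y \<le> ennreal (m\<^sup>2)" and m: "m > 0"
 shows "cmod (\<Sum>j<n. V (e j) (y j)) \<le> gamma_dual_norm V * (2 * m)"
proof -
 \<comment> \<open>This scaling brings \<open>gauss_E\<close> down to \<open>1/4\<close>, within the
   \<open>1/2\<close> demanded for the unit ball.\<close>
 define x where "x j = complex_of_real (1 / (2 * m)) *\<^sub>C y j" for j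
 have "gauss_E n x = ennreal ((1 / (2 * m))\<^sup>2) * gauss_E n y"
 proof -
  have mm: "(%w. (norm (\<Sum>j<n. gauss j w *\<^sub>C y j))\<^sup>2) \<in> borel_measurable gauss_space"
   by (rule measurable_compose[OF borel_measurable_gauss_sum borel_measurable_continuous_onI])
    (intro continuous_intros)
  have "(\<Sum>j<n. gauss j w *\<^sub>C x j) = complex_of_real (1 / (2 * m)) *\<^sub>C (\<Sum>j<n. gauss j w *\<^sub>C y j)" for w
   unfolding x_def scaleC.sum_right by (simp add: scaleC_scaleC mult.commute)
  then have "(norm (\<Sum>j<n. gauss j w *\<^sub>C x j))\<^sup>2 = (1 / (2 * m))\<^sup>2 * (norm (\<Sum>j<n. gauss j w *\<^sub>C y j))\<^sup>2" for w
   by (simp only: norm_scaleC norm_of_real power_mult_distrib power2_abs)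
  then have "gauss_E n x = (\<integral>\<^sup>+w. ennreal ((1 / (2 * m))\<^sup>2) * ennreal ((norm (\<Sum>j<n. gauss j w *\<^sub>C y j))\<^sup>2) \<partial>gauss_space)"
   unfolding gauss_E_def by (simp only: ennreal_mult zero_le_power2)
  also have "\<dots> = ennreal ((1 / (2 * m))\<^sup>2) * gauss_E n y"
   unfolding gauss_E_def by (rule nn_integral_cmult) (rule measurable_compose[OF mm measurable_ennreal])
  finally show ?thesis .
 qed
 also have "\<dots> \<le> ennreal ((1 / (2 * m))\<^sup>2) * ennreal (m\<^sup>2)"
  using y by (intro mult_left_mono) auto
 also have "\<dots> = ennreal (1/4)" using m by (simp add: ennreal_mult[symmetric] power_divide)
 also have "\<dots> \<le> ennreal (1/2)" by (rule ennreal_leI) simp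
 finally have "gamma_norm (finite_rank_op n e x) \<le> 1"
  by (intro gamma_norm_finite_rank_le[OF onb e re])
 then have "cmod (\<Sum>j<n. V (e j) (x j)) \<in> dual_pairings V"
  using e(1) unfolding dual_pairings_def by blast
 then have "cmod (\<Sum>j<n. V (e j) (x j)) \<le> gamma_dual_norm V"
  using V unfolding in_gamma_dual_def gamma_dual_norm_def by (intro cSup_upper) auto
 moreover have "(\<Sum>j<n. V (e j) (x j)) = (1 / (2 * m)) * (\<Sum>j<n. V (e j) (y j))"
 proof -
  have "V (e j) (x j) = complex_of_real (1 / (2 * m)) * V (e j) (y j)" if "j < n" for j
  proof -
   have "bounded_clinear (V (e j))"
    using V e(1)[OF that] by (simp add: in_gamma_dual_def H_bounded_dual_op_def)
   then have "V (e j) (complex_of_real (1 / (2 * m)) *\<^sub>C y j) = complex_of_real (1 / (2 * m)) *\<^sub>C V (e j) (y j)"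
    unfolding bounded_clinear_def by blast
   then show ?thesis by (simp only: x_def scaleC_complex_def)
  qed
  then show ?thesis by (simp add: sum_distrib_left)
 qed
 moreover have "cmod (complex_of_real (1 / (2 * m)) * (\<Sum>j<n. V (e j) (y j))) = cmod (\<Sum>j<n. V (e j) (y j)) / (2 * m)"
  using m by (simp only: norm_mult norm_of_real) simp
 ultimately have "cmod (\<Sum>j<n. V (e j) (y j)) / (2 * m) \<le> gamma_dual_norm V" by simp
 then show ?thesis using m by (simp add: pos_divide_le_eq)
qed

section \<open>Bounded functionals\<close>

text \<open>A norm-dominated linear functional on a subspace, encoded by its graph, so that
  extension is inclusion and a chain has its union as upper bound. Single-valuedness is a
  consequence of the domination at first component \<open>0\<close>.\<close>

definition dominated_graph :: "('a::real_normed_vector \<times> real) set => bool" where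
 "dominated_graph G \<longleftrightarrow> (0, 0) \<in> G \<and> (\<forall>p\<in>G. \<forall>q\<in>G. p + q \<in> G) \<and> (\<forall>c. \<forall>p\<in>G. c *\<^sub>R p \<in> G) \<and>
  (\<forall>p\<in>G. snd p \<le> norm (fst p))"

lemma dominated_graph_extend:
 fixes G :: "('a::real_normed_vector \<times> real) set"
 assumes G: "dominated_graph G"
 shows "\<exists>G'. dominated_graph G' \<and> G \<subseteq> G' \<and> x1 \<in> fst ` G'"
proof -
 have g: "(0, 0) \<in> G" "\<And>p q. p \<in> G ==> q \<in> G ==> p + q \<in> G" "\<And>c p. p \<in> G ==> c *\<^sub>R p \<in> G"
  "\<And>x a. (x, a) \<in> G ==> a \<le> norm x"
  using G by (auto simp: dominated_graph_def)
 define A where "A = (%(x, a). a - norm (x - x1)) ` G"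
 have le: "a - norm (x - x1) \<le> norm (y + x1) - b" if "(x, a) \<in> G" "(y, b) \<in> G" for x a y b
 proof -
  have "a + b \<le> norm (x + y)" using g(4)[of "x + y" "a + b"] g(2)[OF that] by simp
  also have "\<dots> \<le> norm (x - x1) + norm (y + x1)"
   using norm_triangle_ineq[of "x - x1" "y + x1"] by simp
  finally show ?thesis by simp
 qed
 \<comment> \<open>The value at \<open>x1\<close> has to lie above every
   \<open>a - norm (x - x1)\<close> and below every \<open>norm (y + x1) - b\<close>;
   \<open>le\<close> says that these requirements are compatible.\<close>
 define \<xi> where "\<xi> = Sup A"
 have "A \<noteq> {}" using g(1) by (auto simp: A_def)
 moreover have "bdd_above A"
  by (rule bdd_aboveI[of _ "norm x1"]) (use le[OF _ g(1)] in \<open>auto simp: A_def\<close>)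
 ultimately have A: "A \<noteq> {}" "bdd_above A" .
 have xi1: "a - norm (x - x1) \<le> \<xi>" if "(x, a) \<in> G" for x a
  unfolding \<xi>_def using that A by (intro cSup_upper) (auto simp: A_def)
 have xi2: "\<xi> \<le> norm (y + x1) - b" if "(y, b) \<in> G" for y b
  unfolding \<xi>_def using that A le by (intro cSup_least) (auto simp: A_def)
 define G' where "G' = {p + t *\<^sub>R (x1, \<xi>) |p t. p \<in> G}"
 have "dominated_graph G'"
  unfolding dominated_graph_def
 proof (intro conjI ballI allI)
  show "(0, 0) \<in> G'" unfolding G'_def
   by (rule CollectI, rule exI[of _ "(0,0)"], rule exI[of _ 0]) (use g(1) in simp)
 next
  fix p q assume "p \<in> G'" "q \<in> G'"
  then obtain p' t q' u where *: "p = p' + t *\<^sub>R (x1, \<xi>)" "q = q' + u *\<^sub>R (x1, \<xi>)" "p' \<in> G" "q' \<in> G"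
   unfolding G'_def by blast
  then have "p + q = (p' + q') + (t + u) *\<^sub>R (x1, \<xi>)" by (simp add: scaleR_add_left algebra_simps)
  then show "p + q \<in> G'" unfolding G'_def using g(2) * by blast
 next
  fix c p assume "p \<in> G'"
  then obtain p' t where *: "p = p' + t *\<^sub>R (x1, \<xi>)" "p' \<in> G" unfolding G'_def by blast
  then have "c *\<^sub>R p = c *\<^sub>R p' + (c * t) *\<^sub>R (x1, \<xi>)" by (simp add: scaleR_add_right)
  then show "c *\<^sub>R p \<in> G'" unfolding G'_def using g(3) * by blast
 next
  fix p assume "p \<in> G'"
  then obtain x a t where *: "p = (x, a) + t *\<^sub>R (x1, \<xi>)" "(x, a) \<in> G" unfolding G'_def by auto
  have "a + t * \<xi> \<le> norm (x + t *\<^sub>R x1)"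
  proof (cases t "0::real" rule: linorder_cases)
   case equal
   then show ?thesis using g(4)[OF *(2)] by simp
  next
   case greater
   have "((1/t) *\<^sub>R x, a / t) \<in> G" using g(3)[OF *(2), of "1/t"] by simp
   from xi2[OF this] have "a / t + \<xi> \<le> norm ((1/t) *\<^sub>R x + x1)" by simp
   then have "t * (a / t + \<xi>) \<le> norm (t *\<^sub>R ((1/t) *\<^sub>R x + x1))" using greater by simp
   then show ?thesis using greater by (simp add: algebra_simps)
  next
   case less
   define s where "s = - t"
   have s: "s > 0" "t = - s" using less by (simp_all add: s_def)
   have "((1/s) *\<^sub>R x, a / s) \<in> G" using g(3)[OF *(2), of "1/s"] by simp
   from xi1[OF this] have "a / s - \<xi> \<le> norm ((1/s) *\<^sub>R x - x1)" by simp
   then have "s * (a / s - \<xi>) \<le> norm (s *\<^sub>R ((1/s) *\<^sub>R x - x1))" using s by simp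
   then show ?thesis using s by (simp add: algebra_simps)
  qed
  then show "snd p \<le> norm (fst p)" using * by simp
 qed
 moreover have "G \<subseteq> G'"
 proof
  fix p assume "p \<in> G"
  then show "p \<in> G'" unfolding G'_def by (intro CollectI exI[of _ p] exI[of _ 0]) (simp add: zero_prod_def)
 qed
 moreover have "(x1, \<xi>) \<in> G'"
  unfolding G'_def by (intro CollectI exI[of _ "(0,0)"] exI[of _ 1]) (use g(1) in simp)
 then have "x1 \<in> fst ` G'" by force
 ultimately show ?thesis by blast
qed

lemma Hahn_Banach_real:
 fixes x0 :: "'a::real_normed_vector"
 obtains f :: "'a => real" where "linear f" "\<And>x. f x \<le> norm x" "f x0 = norm x0"
proof -
 define G0 where "G0 = {(t *\<^sub>R x0, t * norm x0) |t. True}"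
 have G0: "dominated_graph G0"
  unfolding dominated_graph_def
 proof (intro conjI ballI allI)
  show "(0, 0) \<in> G0" unfolding G0_def by (intro CollectI exI[of _ 0]) simp
 next
  fix p q assume "p \<in> G0" "q \<in> G0"
  then obtain t u where "p = (t *\<^sub>R x0, t * norm x0)" "q = (u *\<^sub>R x0, u * norm x0)" unfolding G0_def by blast
  then show "p + q \<in> G0" unfolding G0_def
   by (intro CollectI exI[of _ "t + u"]) (simp add: scaleR_add_left ring_distribs)
 next
  fix c p assume "p \<in> G0"
  then obtain t where "p = (t *\<^sub>R x0, t * norm x0)" unfolding G0_def by blast
  then show "c *\<^sub>R p \<in> G0" unfolding G0_def by (intro CollectI exI[of _ "c * t"]) simp
 next
  fix p assume "p \<in> G0"
  then show "snd p \<le> norm (fst p)" by (auto simp: G0_def intro!: mult_right_mono)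
 qed
 define \<A> where "\<A> = {G. dominated_graph G \<and> G0 \<subseteq> G}"
 have "\<exists>M\<in>\<A>. \<forall>X\<in>\<A>. M \<subseteq> X \<longrightarrow> X = M"
 proof (rule subset_Zorn_nonempty)
  show "\<A> \<noteq> {}" using G0 by (auto simp: \<A>_def)
  fix C assume ne: "C \<noteq> {}" and ch: "subset.chain \<A> C"
  have CA: "C \<subseteq> \<A>" and lin: "\<And>X Y. X \<in> C ==> Y \<in> C ==> X \<subseteq> Y \<or> Y \<subseteq> X"
   using ch by (auto simp: subset.chain_def)
  have d: "dominated_graph X" "G0 \<subseteq> X" if "X \<in> C" for X using CA that by (auto simp: \<A>_def)
  have "dominated_graph (\<Union>C)"
   unfolding dominated_graph_def
  proof (intro conjI ballI allI)
   show "(0, 0) \<in> \<Union>C" using ne d(1) by (force simp: dominated_graph_def)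
  next
   fix p q assume "p \<in> \<Union>C" "q \<in> \<Union>C"
   then obtain X where "X \<in> C" "p \<in> X" "q \<in> X" using lin by blast
   then show "p + q \<in> \<Union>C" using d(1)[of X] by (auto simp: dominated_graph_def)
  next
   fix c p assume "p \<in> \<Union>C"
   then obtain X where "X \<in> C" "p \<in> X" by blast
   then show "c *\<^sub>R p \<in> \<Union>C" using d(1)[of X] unfolding dominated_graph_def by blast
  next
   fix p assume "p \<in> \<Union>C"
   then obtain X where "X \<in> C" "p \<in> X" by blast
   then show "snd p \<le> norm (fst p)" using d(1)[of X] by (auto simp: dominated_graph_def)
  qed
  then show "\<Union>C \<in> \<A>" using ne d(2) by (auto simp: \<A>_def)
 qed
 then obtain M where M: "dominated_graph M" "G0 \<subseteq> M" "\<And>X. dominated_graph X ==> M \<subseteq> X ==> X = M"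
  unfolding \<A>_def by (metis (mono_tags, lifting) mem_Collect_eq subset_trans)
 have dom: "x \<in> fst ` M" for x
  using dominated_graph_extend[OF M(1), of x] M(3) by metis
 have m: "\<And>p q. p \<in> M ==> q \<in> M ==> p + q \<in> M" "\<And>c p. p \<in> M ==> c *\<^sub>R p \<in> M"
  "\<And>x a. (x, a) \<in> M ==> a \<le> norm x"
  using M(1) by (auto simp: dominated_graph_def)
 \<comment> \<open>Both \<open>(0, a - b)\<close> and \<open>(0, b - a)\<close> belong to
   \<open>M\<close>, and their second components are at most \<open>norm 0\<close>.\<close>
 have uniq: "a = b" if "(x, a) \<in> M" "(x, b) \<in> M" for x a b
 proof -
  have "(x, a) + (-1) *\<^sub>R (x, b) \<in> M" "(x, b) + (-1) *\<^sub>R (x, a) \<in> M"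
   using that m(1,2) by blast+
  then show ?thesis using m(3)[of 0 "a - b"] m(3)[of 0 "b - a"] by simp
 qed
 define f where "f x = (THE a. (x, a) \<in> M)" for x
 have fM: "(x, f x) \<in> M" for x
 proof -
  obtain a where "(x, a) \<in> M" using dom[of x] by force
  then have "f x = a" unfolding f_def using uniq by (intro the_equality) blast+
  then show ?thesis using \<open>(x, a) \<in> M\<close> by simp
 qed
 have "linear f"
 proof (rule linearI)
  show "f (x + y) = f x + f y" for x y
   using uniq[OF fM[of "x + y"]] m(1)[OF fM[of x] fM[of y]] by simp
  show "f (c *\<^sub>R x) = c *\<^sub>R f x" for c x
   using uniq[OF fM[of "c *\<^sub>R x"]] m(2)[OF fM[of x], of c] by simp
 qed
 moreover have "f x0 = norm x0"
 proof -
  have "(1 *\<^sub>R x0, 1 * norm x0) \<in> G0" unfolding G0_def by blast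
  then show ?thesis using uniq[OF fM[of x0]] M(2) by auto
 qed
 ultimately show ?thesis using that m(3)[OF fM] by blast
qed

lemma bounded_clinear_imp_bounded_linear: "bounded_clinear f ==> bounded_linear f"
 by (simp add: bounded_clinear_def)

lemma bounded_clinear_scaleC: "bounded_clinear f ==> f (c *\<^sub>C x) = c *\<^sub>C f x"
 by (simp add: bounded_clinear_def)

lemma functional_scaleC: "bounded_clinear f ==> f (c *\<^sub>C x) = c * (f x :: complex)"
 by (simp add: bounded_clinear_def scaleC_complex_def)

lemma bounded_clinearI:
 assumes "\<And>x y. f (x + y) = f x + f y" "\<And>c x. f (c *\<^sub>C x) = c *\<^sub>C f x" "\<And>x. norm (f x) \<le> K * norm x"
 shows "bounded_clinear f"
proof -
 have "bounded_linear f"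
 proof (rule bounded_linear_intro)
  show "f (r *\<^sub>R x) = r *\<^sub>R f x" for r x
   using assms(2)[of "complex_of_real r" x] by (simp add: scaleC_of_real)
  show "norm (f x) \<le> norm x * K" for x using assms(3)[of x] by (simp add: mult.commute)
 qed (rule assms(1))
 then show ?thesis using assms(2) by (simp add: bounded_clinear_def)
qed

lemma bounded_clinear_compose:
 "bounded_clinear f ==> bounded_clinear g ==> bounded_clinear (%x. f (g x))"
 by (simp add: bounded_clinear_def bounded_linear_compose)

lemma bounded_clinear_onorm: "bounded_clinear f ==> norm (f x) \<le> onorm f * norm x"
 by (simp add: bounded_clinear_def onorm)

text \<open>Complexification of the real functional by f x = g x - i g (i x). A phase turns
  \<open>f x\<close> into a real number, so the norm does not increase.\<close>

theorem Hahn_Banach: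
 fixes x0 :: "'a::complex_normed_vector"
 obtains f :: "'a => complex" where "bounded_clinear f" "\<And>x. cmod (f x) \<le> norm x" "cmod (f x0) = norm x0"
proof -
 obtain g :: "'a => real" where g: "linear g" "\<And>x. g x \<le> norm x" "g x0 = norm x0"
  by (rule Hahn_Banach_real[of x0]) blast
 define f where "f x = Complex (g x) (- g (\<i> *\<^sub>C x))" for x
 have add: "f (x + y) = f x + f y" for x y
  by (simp add: f_def scaleC_add_right linear_add[OF g(1)] complex_eq_iff)
 have sc: "f (c *\<^sub>C x) = c * f x" for c x
 proof -
  have c: "c *\<^sub>C y = Re c *\<^sub>R y + Im c *\<^sub>R (\<i> *\<^sub>C y)" for y :: 'a
  proof -
   have "c *\<^sub>C y = complex_of_real (Re c) *\<^sub>C y + (complex_of_real (Im c) * \<i>) *\<^sub>C y"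
    by (simp add: scaleC_add_left[symmetric]) (metis complex_eq mult.commute)
   then show ?thesis by (metis scaleC_of_real scaleC_scaleC)
  qed
  have 1: "g (c *\<^sub>C y) = Re c * g y + Im c * g (\<i> *\<^sub>C y)" for y
   by (subst c) (simp add: linear_add[OF g(1)] linear_scale[OF g(1)])
  have "g (\<i> *\<^sub>C \<i> *\<^sub>C x) = - g x"
   by (simp add: scaleC_scaleC scaleC_minus1 linear_neg[OF g(1)])
  moreover have "g (\<i> *\<^sub>C c *\<^sub>C x) = g (c *\<^sub>C \<i> *\<^sub>C x)"
   by (simp add: scaleC_scaleC mult.commute)
  ultimately show ?thesis by (simp add: f_def complex_eq_iff 1)
 qed
 have bd: "cmod (f x) \<le> norm x" for x
 proof (cases "f x = 0")
  case False
  define ta where "ta = cnj (f x) / of_real (cmod (f x))"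
  have "f (ta *\<^sub>C x) = of_real (cmod (f x))"
   using False by (simp add: sc ta_def mult.commute[of "cnj _"] complex_norm_square[symmetric] power2_eq_square)
  then have "cmod (f x) = g (ta *\<^sub>C x)" by (simp add: f_def complex_eq_iff)
  also have "\<dots> \<le> norm (ta *\<^sub>C x)" by (rule g(2))
  also have "\<dots> = norm x" using False by (simp add: norm_scaleC ta_def norm_divide)
  finally show ?thesis .
 qed simp
 have "norm x0 \<le> cmod (f x0)" using complex_Re_le_cmod[of "f x0"] g(3) by (simp add: f_def)
 then have "cmod (f x0) = norm x0" using bd[of x0] by simp
 moreover have "bounded_clinear f"
  by (rule bounded_clinearI[where K = 1]) (simp_all add: add sc scaleC_complex_def bd)
 ultimately show ?thesis using that bd by blast
qed

lemma functional_onorm_le: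
 fixes f :: "'a::real_normed_vector => complex"
 shows "(\<And>x. cmod (f x) \<le> norm x) ==> onorm f \<le> 1"
 by (rule onorm_bound) simp_all

text \<open>Every operator identity below is tested with functionals, which turns vector-valued
  contour integrals into scalar ones, where residues and Fubini apply.\<close>

lemma eq_functionalI:
 assumes "\<And>f. bounded_clinear f ==> f x = (f y :: complex)"
 shows "x = (y :: 'a::complex_normed_vector)"
proof -
 obtain f where f: "bounded_clinear f" "cmod (f (x - y)) = norm (x - y)"
  by (rule Hahn_Banach[of "x - y"]) blast
 have "f (x - y) = f x - f y" using f(1) by (simp add: bounded_clinear_def bounded_linear.linear linear_diff)
 then show ?thesis using assms[OF f(1)] f(2) by simp
qed

lemma norm_functional_leI:
 assumes "\<And>f. bounded_clinear f ==> (\<And>x. cmod (f x) \<le> norm x) ==> cmod (f x) \<le> K"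
 shows "norm (x :: 'a::complex_normed_vector) \<le> K"
proof -
 obtain f where f: "bounded_clinear f" "\<And>y. cmod (f y) \<le> norm y" "cmod (f x) = norm x"
  by (rule Hahn_Banach[of x]) blast
 then show ?thesis using assms[OF f(1,2)] by simp
qed

section \<open>Integrals along rays\<close>

lemma has_integral_powr_interval:
 assumes "0 < a" "a \<le> b" "e \<noteq> 0"
 shows "((%r::real. r powr (e - 1)) has_integral (b powr e / e - a powr e / e)) {a..b}"
proof (rule fundamental_theorem_of_calculus)
 fix x assume "x \<in> {a..b}"
 then have "((%r. r powr e / e) has_real_derivative x powr (e - 1)) (at x within {a..b})"
  using assms by (auto intro!: derivative_eq_intros)
 then show "((%r. r powr e / e) has_vector_derivative x powr (e - 1)) (at x within {a..b})"
  by (simp add: has_real_derivative_iff_has_vector_derivative)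
qed fact

lemma norm_integral_powr_le:
 fixes f :: "real => 'a::banach"
 assumes "continuous_on {a..b} f" "0 < a" "a \<le> b" "e \<noteq> 0"
  and "\<And>r. r \<in> {a..b} ==> norm (f r) \<le> C * r powr (e - 1)"
 shows "norm (integral {a..b} f) \<le> C * (b powr e / e - a powr e / e)"
proof -
 have hi: "((%r. C * r powr (e - 1)) has_integral (C * (b powr e / e - a powr e / e))) {a..b}"
  using assms by (intro has_integral_mult_right has_integral_powr_interval)
 have "norm (integral {a..b} f) \<le> integral {a..b} (%r. C * r powr (e - 1))"
 proof (rule integral_norm_bound_integral)
  show "f integrable_on {a..b}" using assms(1) by (rule integrable_continuous_interval)
  show "(%r. C * r powr (e - 1)) integrable_on {a..b}" using hi by blast
 qed (use assms(5) in simp)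
 then show ?thesis using integral_unique[OF hi] by (simp only:)
qed

text \<open>The integrand may be unbounded at 0. Its primitive inherits uniform continuity from the
  primitive of the majorant, hence extends to 0, and the fundamental theorem with interior
  derivatives applies to the extension.\<close>

lemma integrable_powr_at_0:
 fixes f :: "real => 'a::banach"
 assumes f: "continuous_on {0<..b} f" and e: "e > 0" and b: "b > 0" and C: "C \<ge> 0"
  and bd: "\<And>r. r \<in> {0<..b} ==> norm (f r) \<le> C * r powr (e - 1)"
 shows "f integrable_on {0..b}" "norm (integral {0..b} f) \<le> C * (b powr e / e)"
proof -
 define F where "F x = - integral {x..b} f" for x
 have fc: "continuous_on {x..y} f" if "0 < x" "y \<le> b" for x y
  using that by (intro continuous_on_subset[OF f]) auto
 have Fd: "F y - F x = integral {x..y} f" if "0 < x" "x \<le> y" "y \<le> b" for x y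
  using that Henstock_Kurzweil_Integration.integral_combine[of x y b f] fc[of x b]
  by (simp add: F_def integrable_continuous_interval algebra_simps)
 have Fb: "norm (F y - F x) \<le> C * (y powr e / e - x powr e / e)" if "0 < x" "x \<le> y" "y \<le> b" for x y
  unfolding Fd[OF that] using that fc e bd by (intro norm_integral_powr_le) auto
 have "uniformly_continuous_on {0<..b} F"
 proof -
  have "continuous_on {0..b} (%x. C * (x powr e / e))"
   using e by (intro continuous_on_mult continuous_on_divide continuous_on_powr' continuous_on_const continuous_on_id) auto
  then have uc: "uniformly_continuous_on {0..b} (%x. C * (x powr e / e))"
   by (rule compact_uniformly_continuous) simp
  show ?thesis
   unfolding uniformly_continuous_on_def
  proof (intro allI impI)
   fix ep :: real assume "ep > 0"
   then obtain d where d: "d > 0" "\<And>x y. x \<in> {0..b} ==> y \<in> {0..b} ==> dist y x < d ==>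
     dist (C * (y powr e / e)) (C * (x powr e / e)) < ep"
    using uc unfolding uniformly_continuous_on_def by metis
   have *: "dist (F y) (F x) < ep" if "x \<in> {0<..b}" "y \<in> {0<..b}" "dist y x < d" "x \<le> y" for x y
   proof -
    have "norm (F y - F x) \<le> C * (y powr e / e - x powr e / e)" using that by (intro Fb) auto
    also have "\<dots> \<le> dist (C * (y powr e / e)) (C * (x powr e / e))" by (simp add: dist_real_def algebra_simps)
    also have "\<dots> < ep" using that by (intro d(2)) auto
    finally show ?thesis by (simp add: dist_norm)
   qed
   show "\<exists>d>0. \<forall>x\<in>{0<..b}. \<forall>x'\<in>{0<..b}. dist x' x < d \<longrightarrow> dist (F x') (F x) < ep"
   proof (intro exI[of _ d] conjI ballI impI)
    fix x y assume "x \<in> {0<..b}" "y \<in> {0<..b}" "dist y x < d"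
    then show "dist (F y) (F x) < ep"
     using *[of x y] *[of y x] by (cases "x \<le> y") (auto simp: dist_commute)
   qed (rule d)
  qed
 qed
 then obtain g where g: "uniformly_continuous_on (closure {0<..b}) g" "\<And>x. x \<in> {0<..b} ==> F x = g x"
  by (rule uniformly_continuous_on_extension_on_closure) blast
 have gc: "continuous_on {0..b} g"
  using uniformly_continuous_imp_continuous[OF g(1)] b by simp
 have hi: "(f has_integral (g b - g 0)) {0..b}"
 proof (rule fundamental_theorem_of_calculus_interior)
  fix x assume x: "x \<in> {0<..<b}"
  have "((%u. integral {x/2..u} f) has_vector_derivative f x) (at x within {x/2..b})"
   using x by (intro integral_has_vector_derivative fc) auto
  then have "((%u. integral {x/2..u} f) has_vector_derivative f x) (at x within {x/2<..<b})"
   by (rule has_vector_derivative_within_subset) auto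
  then have "((%u. integral {x/2..u} f) has_vector_derivative f x) (at x)"
   using x by (subst (asm) has_vector_derivative_within_open) auto
  then have "((%u. integral {x/2..u} f + F (x/2)) has_vector_derivative f x) (at x)"
   by (auto intro!: derivative_eq_intros)
  then show "(g has_vector_derivative f x) (at x)"
  proof (rule has_vector_derivative_transform_within_open[of _ _ _ "{x/2<..<b}"])
   fix u assume "u \<in> {x/2<..<b}"
   then show "integral {x/2..u} f + F (x/2) = g u"
    using x Fd[of "x/2" u] g(2)[of u] by (simp add: algebra_simps)
  qed (use x in auto)
 qed (use b gc in auto)
 then show "f integrable_on {0..b}" by blast
 have "((%x. norm (g b - g x)) \<longlongrightarrow> norm (g b - g 0)) (at 0 within {0..b})"
  using gc b by (intro tendsto_intros) (auto simp: continuous_on_def)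
 then have lim: "((%x. norm (g b - g x)) \<longlongrightarrow> norm (g b - g 0)) (at_right 0)"
  using b at_within_Icc_at_right by metis
 have "norm (g b - g 0) \<le> C * (b powr e / e)"
 proof (rule tendsto_upperbound[OF lim])
  show "eventually (%x. norm (g b - g x) \<le> C * (b powr e / e)) (at_right 0)"
  proof -
   have "eventually (%x. x \<in> {0<..<b}) (at_right 0)" by (rule eventually_at_rightI[of 0 b]) (use b in auto)
   then show ?thesis
   proof eventually_elim
    fix x assume "x \<in> {0<..<b}"
    then have "norm (F b - F x) \<le> C * (b powr e / e - x powr e / e)" by (intro Fb) auto
    also have "\<dots> \<le> C * (b powr e / e)" using C e by (intro mult_left_mono) auto
    finally show "norm (g b - g x) \<le> C * (b powr e / e)"
     using g(2)[of b] g(2)[of x] b \<open>x \<in> _\<close> by simp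
   qed
  qed
 qed simp
 then show "norm (integral {0..b} f) \<le> C * (b powr e / e)" using hi by (simp add: integral_unique)
qed

text \<open>Decay of order \<open>ep\<close> at 0 and at infinity relative to \<open>dr / r\<close>,
  hence exponents shifted by \<open>- 1\<close>. Each of the two bounds holds for all
  \<open>r\<close>.\<close>

definition ray_decay :: "real => real => (real => 'a::real_normed_vector) => bool" where
 "ray_decay C ep f \<longleftrightarrow> (\<forall>r>0. norm (f r) \<le> C * r powr (ep - 1) \<and> norm (f r) \<le> C * r powr (- ep - 1))"

text \<open>The intervals (0,1] and [1,\<infinity>) contribute at most \<open>C / ep\<close> each.
  The limit is taken over [exp (- n), exp n] because these intervals become [- n, n] in the
  coordinate \<open>ln r\<close>.\<close>

theorem ray_integral:
 fixes f :: "real => 'a::banach"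
 assumes f: "continuous_on {0<..} f" and d: "ray_decay C ep f" and e: "ep > 0" and C: "C \<ge> 0"
 shows "f integrable_on {0<..}" "norm (integral {0<..} f) \<le> 2 * C / ep"
  "(%n. integral {exp (- real n)..exp (real n)} f) \<longlonglongrightarrow> integral {0<..} f"
proof -
 have fc: "continuous_on {x..y} f" if "0 < x" for x y
  using that by (intro continuous_on_subset[OF f]) auto
 have b1: "norm (f r) \<le> C * r powr (ep - 1)" and b2: "norm (f r) \<le> C * r powr (- ep - 1)" if "r > 0" for r
  using d that by (auto simp: ray_decay_def)
 have i0: "f integrable_on {0..b}" "norm (integral {0..b} f) \<le> C * (b powr ep / ep)" if "b > 0" for b
  by (rule integrable_powr_at_0[OF continuous_on_subset[OF f] e that C]; use b1 in auto)+
 have tail: "norm (integral {a..b} f) \<le> C * (a powr (- ep) / ep)" if "0 < a" "a \<le> b" for a b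
 proof -
  have "norm (integral {a..b} f) \<le> C * (b powr (- ep) / (- ep) - a powr (- ep) / (- ep))"
   using that e b2 by (intro norm_integral_powr_le fc) auto
  also have "\<dots> \<le> C * (a powr (- ep) / ep)"
   using e C by (intro mult_left_mono) (auto simp: field_simps)
  finally show ?thesis .
 qed
 define J where "J b = integral {0..b} f" for b
 have Jd: "J b - J a = integral {a..b} f" if "0 < a" "a \<le> b" for a b
  using that Henstock_Kurzweil_Integration.integral_combine[of 0 a b f] i0(1)[of b]
  by (simp add: J_def algebra_simps)
 have t0: "(%n. C * (real (Suc n) powr (- ep) / ep)) \<longlonglongrightarrow> 0"
 proof -
  have "(%n. real (Suc n) powr (- ep)) \<longlonglongrightarrow> 0"
   using e by (intro tendsto_neg_powr filterlim_compose[OF filterlim_real_sequentially filterlim_Suc]) auto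
  then have "(%n. C * (real (Suc n) powr (- ep) / ep)) \<longlonglongrightarrow> C * (0 / ep)"
   using e by (intro tendsto_intros) auto
  then show ?thesis by simp
 qed
 have "Cauchy (%n. J (real (Suc n)))"
 proof (rule metric_CauchyI)
  fix dl :: real assume "dl > 0"
  then obtain M where M: "\<And>n. n \<ge> M ==> C * (real (Suc n) powr (- ep) / ep) < dl"
   using order_tendstoD(2)[OF t0] by (auto simp: eventually_sequentially)
  have *: "dist (J (real (Suc n))) (J (real (Suc m))) < dl" if "M \<le> m" "m \<le> n" for m n
   using tail[of "real (Suc m)" "real (Suc n)"] M[OF that(1)] that Jd[of "real (Suc m)" "real (Suc n)"]
   by (simp add: dist_norm)
  show "\<exists>M. \<forall>m\<ge>M. \<forall>n\<ge>M. dist (J (real (Suc m))) (J (real (Suc n))) < dl"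
  proof (intro exI allI impI)
   fix m n assume "m \<ge> M" "n \<ge> M"
   then show "dist (J (real (Suc m))) (J (real (Suc n))) < dl"
    using *[of m n] *[of n m] by (cases "m \<le> n") (auto simp: dist_commute)
  qed
 qed
 then obtain I where I: "(%n. J (real (Suc n))) \<longlonglongrightarrow> I" by (auto simp: Cauchy_convergent_iff convergent_def)
 have JI: "norm (I - J b) \<le> C * (b powr (- ep) / ep)" if "b > 0" for b
 proof (rule LIMSEQ_le_const2[OF tendsto_norm[OF tendsto_diff[OF I tendsto_const]]])
  show "\<exists>N. \<forall>n\<ge>N. norm (J (real (Suc n)) - J b) \<le> C * (b powr (- ep) / ep)"
  proof (intro exI allI impI)
   fix n assume "nat \<lceil>b\<rceil> \<le> n"
   then have "b \<le> real (Suc n)" by linarith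
   then show "norm (J (real (Suc n)) - J b) \<le> C * (b powr (- ep) / ep)"
    using tail[OF that] Jd[OF that] by simp
  qed
 qed
 define h where "h x = (if x \<in> {0<..} then f x else 0)" for x
 have h0: "(h has_integral J b) {0..b}" if "b > 0" for b
 proof (rule has_integral_spike[of "{0}"])
  show "(f has_integral J b) {0..b}" using i0(1)[OF that] unfolding J_def by (simp add: integrable_integral)
 qed (auto simp: h_def)
 have hab: "(h has_integral J b) {a..b}" if "a \<le> 0" "b > 0" for a b
 proof -
  have "(h has_integral 0) {a..0}" by (rule has_integral_is_0) (auto simp: h_def)
  then have "(h has_integral (0 + J b)) {a..b}"
   using that h0[of b] by (intro has_integral_combine[of a 0 b]) auto
  then show ?thesis by simp
 qed
 have HI: "(f has_integral I) {0<..}"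
  unfolding has_integral_alt'[of f] h_def[symmetric]
 proof (intro conjI allI impI)
  fix a b :: real
  show "(%x. h x) integrable_on cbox a b"
  proof (rule integrable_on_subcbox)
   have "(h has_integral J (max b 1)) {min a 0..max b 1}" by (rule hab) auto
   then show "h integrable_on cbox (min a 0) (max b 1)" by (simp add: has_integral_integrable)
  qed auto
 next
  fix dl :: real assume "dl > 0"
  then obtain M where M: "\<And>n. n \<ge> M ==> C * (real (Suc n) powr (- ep) / ep) < dl"
   using order_tendstoD(2)[OF t0] by (auto simp: eventually_sequentially)
  show "\<exists>B>0. \<forall>a b. ball 0 B \<subseteq> cbox a b \<longrightarrow> norm (integral (cbox a b) (%x. h x) - I) < dl"
  proof (intro exI[of _ "real (Suc M)"] conjI allI impI)
   fix a b :: real assume "ball 0 (real (Suc M)) \<subseteq> cbox a b"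
   then have *: "{- real (Suc M)<..<real (Suc M)} \<subseteq> {a..b}" by (simp add: ball_eq_greaterThanLessThan)
   then have "b \<ge> real (Suc M)" "a \<le> 0"
    using * by (auto simp: greaterThanLessThan_subseteq_atLeastAtMost_iff)
   then have "integral (cbox a b) h = J b" using hab[of a b] by (simp add: integral_unique)
   moreover have "norm (I - J b) \<le> C * (real (Suc M) powr (- ep) / ep)"
   proof (rule order_trans[OF JI])
    show "C * (b powr (- ep) / ep) \<le> C * (real (Suc M) powr (- ep) / ep)"
     using \<open>b \<ge> _\<close> e C by (intro mult_left_mono divide_right_mono powr_mono2') auto
   qed (use \<open>b \<ge> _\<close> in auto)
   ultimately show "norm (integral (cbox a b) (%x. h x) - I) < dl"
    using M[of M] by (simp add: norm_minus_commute)
  qed auto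
 qed
 then show "f integrable_on {0<..}" by blast
 have II: "integral {0<..} f = I" using HI by (rule integral_unique)
 show "norm (integral {0<..} f) \<le> 2 * C / ep"
 proof -
  have "norm I \<le> norm (I - J 1) + norm (J 1)" using norm_triangle_ineq[of "I - J 1" "J 1"] by simp
  also have "\<dots> \<le> C / ep + C / ep" using JI[of 1] i0(2)[of 1] by (simp add: J_def)
  finally show ?thesis by (simp add: II)
 qed
 show "(%n. integral {exp (- real n)..exp (real n)} f) \<longlonglongrightarrow> integral {0<..} f"
  unfolding II
 proof (rule metric_LIMSEQ_I)
  fix dl :: real assume d: "dl > 0"
  have l: "(%n. C * (exp (- real n) powr ep / ep)) \<longlonglongrightarrow> 0"
  proof -
   have "(%n. C * (exp (- ep * real n) / ep)) \<longlonglongrightarrow> C * (0 / ep)"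
    using e by (intro tendsto_intros filterlim_compose[OF exp_at_bot] filterlim_tendsto_neg_mult_at_bot[OF tendsto_const] filterlim_real_sequentially) auto
   then show ?thesis by (simp add: powr_def)
  qed
  have "dl/2 > 0" using d by simp
  from order_tendstoD(2)[OF l this] obtain M where M: "\<And>n. n \<ge> M ==> C * (exp (- real n) powr ep / ep) < dl/2"
   by (auto simp: eventually_sequentially)
  show "\<exists>M. \<forall>n\<ge>M. dist (integral {exp (- real n)..exp (real n)} f) I < dl"
  proof (intro exI allI impI)
   fix n assume n: "n \<ge> M"
   define p q where "p = exp (- real n)" and "q = exp (real n)"
   have pq: "0 < p" "p \<le> q" "q powr (- ep) = p powr ep" by (auto simp: p_def q_def powr_def)
   have "norm (integral {p..q} f - I) = norm ((J q - I) - J p)" using Jd[OF pq(1,2)] by (simp add: algebra_simps)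
   also have "\<dots> \<le> norm (I - J q) + norm (J p)"
    using norm_triangle_ineq4[of "J q - I" "J p"] by (simp add: norm_minus_commute)
   also have "\<dots> \<le> C * (p powr ep / ep) + C * (p powr ep / ep)"
    using JI[of q] i0(2)[OF pq(1)] pq by (intro add_mono) (auto simp: J_def)
   also have "\<dots> < dl" using M[OF n, folded p_def] by linarith
   finally show "dist (integral {exp (- real n)..exp (real n)} f) I < dl" by (simp add: dist_norm p_def q_def)
  qed
 qed
qed

section \<open>Contour integrals in the coordinate log z\<close>

definition ray_int :: "real => (complex => complex) => complex" where
 "ray_int ta F = integral {0<..} (%r. F (rcis r ta) * cis ta)"

definition strip :: "real => real => complex set" where
 "strip a b = {w. a < Im w \<and> Im w < b}"

lemma open_strip: "open (strip a b)" and convex_strip: "convex (strip a b)"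
proof -
 have *: "strip a b = {w. Im w > a} \<inter> {w. Im w < b}" by (auto simp: strip_def)
 show "open (strip a b)" unfolding * by (intro open_Int open_halfspace_Im_gt open_halfspace_Im_lt)
 show "convex (strip a b)" unfolding * by (intro convex_Int convex_halfspace_Im_gt convex_halfspace_Im_lt)
qed

lemma exp_Complex: "exp (Complex u ta) = rcis (exp u) ta"
 by (subst exp_eq_polar) (simp add: rcis_def)

text \<open>The substitution \<open>r = exp u\<close> turns the ray into the horizontal line of
  height \<open>ta\<close>; the factor \<open>exp (Complex u ta)\<close> is dz/dw.\<close>

lemma ray_int_log_limit:
 assumes F: "continuous_on {0<..} (%r. F (rcis r ta))" and d: "ray_decay C ep (%r. F (rcis r ta))"
  and e: "ep > 0" and C: "C \<ge> 0"
 shows "(%n. integral {- real n..real n} (%u. F (exp (Complex u ta)) * exp (Complex u ta))) \<longlonglongrightarrow> ray_int ta F"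
proof -
 define f where "f r = F (rcis r ta) * cis ta" for r
 have fc: "continuous_on {0<..} f" unfolding f_def by (intro continuous_intros F)
 have "ray_decay C ep f" using d by (simp add: ray_decay_def f_def norm_mult)
 then have lim: "(%n. integral {exp (- real n)..exp (real n)} f) \<longlonglongrightarrow> ray_int ta F"
  unfolding ray_int_def f_def[symmetric] by (rule ray_integral(3)[OF fc _ e C])
 have "integral {exp (- real n)..exp (real n)} f =
   integral {- real n..real n} (%u. F (exp (Complex u ta)) * exp (Complex u ta))" for n
 proof -
  have "((%u. exp u *\<^sub>R f (exp u)) has_integral (integral {exp (- real n)..exp (real n)} f)) {- real n..real n}"
  proof (rule has_integral_substitution[where c = "exp (- real n)" and d = "exp (real n)"])
   show "continuous_on {exp (- real n)..exp (real n)} f"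
    by (rule continuous_on_subset[OF fc]) (auto intro: less_le_trans[OF exp_gt_zero])
   show "(exp has_field_derivative exp x) (at x within {- real n..real n})" for x :: real
    by (auto intro!: derivative_eq_intros)
  qed auto
  moreover have "exp u *\<^sub>R f (exp u) = F (exp (Complex u ta)) * exp (Complex u ta)" for u
   by (simp add: f_def exp_Complex rcis_def scaleR_conv_of_real algebra_simps)
  ultimately show ?thesis by (simp add: integral_unique)
 qed
 then show ?thesis using lim by simp
qed

lemma contour_integral_horizontal:
 fixes a b ta :: real
 assumes "a < b"
 shows "contour_integral (linepath (Complex a ta) (Complex b ta)) f = integral {a..b} (%u. f (Complex u ta))"
proof -
 have "(f has_contour_integral I) (linepath (Complex a ta) (Complex b ta)) \<longleftrightarrow>
   ((%z. f (z + Complex 0 ta)) has_contour_integral I) (linepath (of_real a) (of_real b))" for I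
 proof -
  have "linepath (Complex a ta) (Complex b ta) x = linepath (of_real a) (of_real b) x + Complex 0 ta" for x
   by (simp add: linepath_def complex_eq_iff algebra_simps)
  moreover have "Complex b ta - Complex a ta = of_real b - of_real a" by (simp add: complex_eq_iff)
  ultimately show ?thesis by (simp only: has_contour_integral_linepath)
 qed
 then have "contour_integral (linepath (Complex a ta) (Complex b ta)) f =
  contour_integral (linepath (of_real a) (of_real b)) (%z. f (z + Complex 0 ta))"
  by (simp add: contour_integral_def contour_integrable_on_def)
 also have "\<dots> = integral {a..b} (%u. f (Complex u ta))"
 proof -
  have "complex_of_real u + Complex 0 ta = Complex u ta" for u by (simp add: complex_eq_iff)
  then show ?thesis using assms by (subst contour_integral_linepath_Reals_eq) simp_all
 qed
 finally show ?thesis .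
qed

text \<open>The residue theorem on rectangles with vertical sides at real parts - n and n, whose
  contribution is O(exp (- ep n)). Decay is demanded only for large real parts, so that poles inside
  are allowed.\<close>

lemma strip_residues:
 fixes f :: "complex => complex"
 assumes f: "f holomorphic_on strip a' b' - P" and P: "finite P" "P \<subseteq> strip \<alpha> \<beta>"
  and ab: "a' < \<alpha>" "\<alpha> < \<beta>" "\<beta> < b'"
  and bd: "\<And>w. \<alpha> \<le> Im w ==> Im w \<le> \<beta> ==> \<bar>Re w\<bar> \<ge> R ==> cmod (f w) \<le> K * exp (- ep * \<bar>Re w\<bar>)"
  and e: "ep > 0" and K: "K \<ge> 0"
 shows "(%n. integral {- real n..real n} (%u. f (Complex u \<alpha>)) - integral {- real n..real n} (%u. f (Complex u \<beta>)))
  \<longlonglongrightarrow> 2 * pi * \<i> * (\<Sum>p\<in>P. residue f p)"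
proof -
 define I where "I ta n = integral {- real n..real n} (%u. f (Complex u ta))" for ta n
 define L where "L = 2 * pi * \<i> * (\<Sum>p\<in>P. residue f p)"
 obtain R1 where R1: "\<And>p. p \<in> P ==> \<bar>Re p\<bar> < R1"
 proof -
  have "\<bar>Re p\<bar> < Max (insert 0 ((%p. \<bar>Re p\<bar>) ` P)) + 1" if "p \<in> P" for p
  proof -
   have "\<bar>Re p\<bar> \<le> Max (insert 0 ((%p. \<bar>Re p\<bar>) ` P))" using that P(1) by (intro Max_ge) auto
   then show ?thesis by linarith
  qed
  then show ?thesis using that by blast
 qed
 define N where "N = nat \<lceil>max 1 (max R R1)\<rceil>"
 have main: "norm (I \<alpha> n - I \<beta> n - L) \<le> 2 * K * (\<beta> - \<alpha>) * exp (- ep * real n)" if n: "n \<ge> N" for n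
 proof -
  have n': "real n \<ge> 1" "real n \<ge> R" "real n \<ge> R1" using n unfolding N_def by linarith+
  define p1 p2 p3 p4 where "p1 = Complex (- real n) \<alpha>" and "p2 = Complex (real n) \<alpha>"
   and "p3 = Complex (real n) \<beta>" and "p4 = Complex (- real n) \<beta>"
  define \<gamma> where "\<gamma> = rectpath p1 p3"
  have \<gamma>: "\<gamma> = linepath p1 p2 +++ linepath p2 p3 +++ linepath p3 p4 +++ linepath p4 p1"
   by (simp add: \<gamma>_def rectpath_def Let_def p1_def p2_def p3_def p4_def)
  have img: "path_image \<gamma> \<subseteq> strip a' b' - P"
  proof
   fix z assume "z \<in> path_image \<gamma>"
   then have z: "Re z \<in> {- real n, real n} \<and> Im z \<in> {\<alpha>..\<beta>} \<or> Im z \<in> {\<alpha>, \<beta>} \<and> Re z \<in> {- real n..real n}"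
    unfolding \<gamma>_def using ab by (subst (asm) path_image_rectpath) (auto simp: p1_def p3_def)
   then have "z \<notin> P" using R1[of z] P(2) n' by (auto simp: strip_def)
   then show "z \<in> strip a' b' - P" using z ab by (auto simp: strip_def)
  qed
  have seg: "path_image (linepath p1 p2) \<subseteq> strip a' b' - P" "path_image (linepath p2 p3) \<subseteq> strip a' b' - P"
   "path_image (linepath p3 p4) \<subseteq> strip a' b' - P" "path_image (linepath p4 p1) \<subseteq> strip a' b' - P"
   using img unfolding \<gamma> by (simp_all add: path_image_join)
  have op: "open (strip a' b' - P)" using open_strip P(1) by (simp add: finite_imp_closed open_Diff)
  have int: "f contour_integrable_on linepath p q" if "path_image (linepath p q) \<subseteq> strip a' b' - P" for p q
   using f op that by (intro contour_integrable_holomorphic_simple) auto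
  have "contour_integral \<gamma> f = 2 * pi * \<i> * (\<Sum>p\<in>P. winding_number \<gamma> p * residue f p)"
  proof (rule Residue_theorem[OF open_strip _ P(1) f])
   show "connected (strip a' b')" using convex_strip by (rule convex_connected)
   show "\<forall>z. z \<notin> strip a' b' \<longrightarrow> winding_number \<gamma> z = 0"
    using img by (auto intro!: winding_number_zero_outside[OF _ convex_strip[of a' b']] simp: \<gamma>_def)
  qed (use img in \<open>auto simp: \<gamma>_def\<close>)
  also have "(\<Sum>p\<in>P. winding_number \<gamma> p * residue f p) = (\<Sum>p\<in>P. residue f p)"
  proof (rule sum.cong)
   fix p assume p: "p \<in> P"
   then have "p \<in> box p1 p3"
    using P(2) R1[OF p] n' by (auto simp: strip_def in_box_complex_iff p1_def p3_def)
   then show "winding_number \<gamma> p * residue f p = residue f p"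
    unfolding \<gamma>_def by (simp add: winding_number_rectpath)
  qed simp
  finally have c1: "contour_integral \<gamma> f = L" by (simp add: L_def)
  have c2: "contour_integral \<gamma> f = contour_integral (linepath p1 p2) f + (contour_integral (linepath p2 p3) f
    + (contour_integral (linepath p3 p4) f + contour_integral (linepath p4 p1) f))"
   unfolding \<gamma> using int[OF seg(1)] int[OF seg(2)] int[OF seg(3)] int[OF seg(4)]
   by (simp add: contour_integrable_joinI)
  have c3: "contour_integral (linepath p1 p2) f = I \<alpha> n"
   using n' by (simp add: p1_def p2_def contour_integral_horizontal I_def)
  have c4: "contour_integral (linepath p3 p4) f = - I \<beta> n"
  proof -
   have "contour_integral (linepath p3 p4) f = - contour_integral (linepath p4 p3) f"
    using seg(3) f op by (intro contour_integral_reverse_linepath continuous_on_subset[OF holomorphic_on_imp_continuous_on[OF f]]) (simp add: closed_segment_commute)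
   then show ?thesis using n' by (simp add: p3_def p4_def contour_integral_horizontal I_def)
  qed
  have vert: "norm (contour_integral (linepath p q) f) \<le> K * exp (- ep * real n) * (\<beta> - \<alpha>)"
   if "path_image (linepath p q) \<subseteq> strip a' b' - P" "closed_segment p q \<subseteq> {w. \<bar>Re w\<bar> = real n \<and> Im w \<in> {\<alpha>..\<beta>}}" "norm (q - p) = \<beta> - \<alpha>" for p q
  proof -
   have "norm (contour_integral (linepath p q) f) \<le> K * exp (- ep * real n) * norm (q - p)"
   proof (rule contour_integral_bound_linepath[OF int[OF that(1)]])
    fix w assume "w \<in> closed_segment p q"
    then have "\<bar>Re w\<bar> = real n" "Im w \<in> {\<alpha>..\<beta>}" using that(2) by auto
    then show "norm (f w) \<le> K * exp (- ep * real n)" using bd[of w] n' by simp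
   qed (use K in simp)
   then show ?thesis by (simp add: that(3))
  qed
  have v1: "norm (contour_integral (linepath p2 p3) f) \<le> K * exp (- ep * real n) * (\<beta> - \<alpha>)"
  proof (rule vert[OF seg(2)])
   show "norm (p3 - p2) = \<beta> - \<alpha>" using ab by (simp add: p2_def p3_def norm_complex_def cmod_def)
   show "closed_segment p2 p3 \<subseteq> {w. \<bar>Re w\<bar> = real n \<and> Im w \<in> {\<alpha>..\<beta>}}"
    using ab by (subst closed_segment_same_Re) (auto simp: p2_def p3_def closed_segment_eq_real_ivl)
  qed
  have v2: "norm (contour_integral (linepath p4 p1) f) \<le> K * exp (- ep * real n) * (\<beta> - \<alpha>)"
  proof (rule vert[OF seg(4)])
   show "norm (p1 - p4) = \<beta> - \<alpha>" using ab by (simp add: p1_def p4_def norm_complex_def cmod_def)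
   show "closed_segment p4 p1 \<subseteq> {w. \<bar>Re w\<bar> = real n \<and> Im w \<in> {\<alpha>..\<beta>}}"
    using ab by (subst closed_segment_same_Re) (auto simp: p1_def p4_def closed_segment_eq_real_ivl)
  qed
  have "norm (contour_integral (linepath p2 p3) f + contour_integral (linepath p4 p1) f) \<le> 2 * (K * exp (- ep * real n) * (\<beta> - \<alpha>))"
   using norm_triangle_ineq[of "contour_integral (linepath p2 p3) f" "contour_integral (linepath p4 p1) f"] v1 v2
   by linarith
  moreover have "I \<alpha> n - I \<beta> n - L = - (contour_integral (linepath p2 p3) f + contour_integral (linepath p4 p1) f)"
   using c1 c2 c3 c4 by (simp add: algebra_simps)
  ultimately have "norm (I \<alpha> n - I \<beta> n - L) \<le> 2 * (K * exp (- ep * real n) * (\<beta> - \<alpha>))"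
   by (simp only: norm_minus_cancel)
  then show ?thesis by (simp add: algebra_simps)
 qed
 have "(%n. I \<alpha> n - I \<beta> n - L) \<longlonglongrightarrow> 0"
 proof (rule Lim_null_comparison)
  show "eventually (%n. norm (I \<alpha> n - I \<beta> n - L) \<le> 2 * K * (\<beta> - \<alpha>) * exp (- ep * real n)) sequentially"
   using main unfolding eventually_sequentially by blast
  have "(%n. 2 * K * (\<beta> - \<alpha>) * exp (- ep * real n)) \<longlonglongrightarrow> 2 * K * (\<beta> - \<alpha>) * 0"
   using e by (intro tendsto_mult[OF tendsto_const] filterlim_compose[OF exp_at_bot] filterlim_tendsto_neg_mult_at_bot[OF tendsto_const] filterlim_real_sequentially) auto
  then show "(%n. 2 * K * (\<beta> - \<alpha>) * exp (- ep * real n)) \<longlonglongrightarrow> 0" by simp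
 qed
 then show ?thesis unfolding I_def L_def by (simp add: LIM_zero_iff)
qed

text \<open>The decay condition in the variable \<open>u = ln r\<close>; the factor
  \<open>exp u\<close> is the Jacobian.\<close>

definition log_decay :: "real => real => (complex => complex) => real => bool" where
 "log_decay C ep F ta \<longleftrightarrow> (\<forall>u. cmod (F (exp (Complex u ta))) * exp u \<le> C * exp (- ep * \<bar>u\<bar>))"

lemma log_decay_ray_decay:
 assumes "log_decay C ep F ta" "ep > 0" "C \<ge> 0"
 shows "ray_decay C ep (%r. F (rcis r ta))"
 unfolding ray_decay_def
proof (intro allI impI)
 fix r :: real assume r: "r > 0"
 define u where "u = ln r"
 have u: "exp u = r" using r by (simp add: u_def)
 have "cmod (F (rcis r ta)) * r \<le> C * exp (- ep * \<bar>u\<bar>)"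
  using assms(1)[unfolded log_decay_def, rule_format, of u] by (simp add: exp_Complex u)
 then have 1: "cmod (F (rcis r ta)) \<le> C * exp (- ep * \<bar>u\<bar>) / r" using r by (simp add: pos_le_divide_eq)
 have "C * exp (- ep * \<bar>u\<bar>) / r \<le> C * exp (ep * u) / r" "C * exp (- ep * \<bar>u\<bar>) / r \<le> C * exp (- ep * u) / r"
 proof -
  have "- \<bar>u\<bar> \<le> u" "- \<bar>u\<bar> \<le> - u" by auto
  then have "ep * (- \<bar>u\<bar>) \<le> ep * u" "ep * (- \<bar>u\<bar>) \<le> ep * (- u)" using assms(2) by (intro mult_left_mono; simp)+
  then show "C * exp (- ep * \<bar>u\<bar>) / r \<le> C * exp (ep * u) / r" "C * exp (- ep * \<bar>u\<bar>) / r \<le> C * exp (- ep * u) / r"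
   using r assms(3) by (auto intro!: divide_right_mono mult_left_mono)
 qed
 moreover have "exp (ep * u) / r = r powr (ep - 1)" "exp (- ep * u) / r = r powr (- ep - 1)"
  using r powr_diff[of r ep 1] powr_diff[of r "- ep" 1] by (simp_all add: powr_def[of r ep] powr_def[of r "- ep"] u_def)
 ultimately show "norm (F (rcis r ta)) \<le> C * r powr (ep - 1) \<and> norm (F (rcis r ta)) \<le> C * r powr (- ep - 1)"
  using 1 by (metis order_trans times_divide_eq_right)
qed

lemma continuous_on_ray:
 assumes "continuous_on S F" "\<And>r. r > 0 ==> rcis r ta \<in> S"
 shows "continuous_on {0<..} (%r. F (rcis r ta))"
 using assms(2) by (intro continuous_on_compose2[OF assms(1)]) (auto simp: rcis_def intro!: continuous_intros)


text \<open>The case of \<open>strip_residues\<close> without poles. Since angles are heights in a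
  strip, the rotation may also pass across the negative real axis.\<close>

theorem ray_int_rotate:
 assumes h: "(%w. F (exp w)) holomorphic_on strip a' b'" and ab: "a' < \<alpha>" "\<alpha> < \<beta>" "\<beta> < b'"
  and F: "continuous_on {0<..} (%r. F (rcis r \<alpha>))" "continuous_on {0<..} (%r. F (rcis r \<beta>))"
  and d: "\<And>ta. \<alpha> \<le> ta ==> ta \<le> \<beta> ==> log_decay C ep F ta" and e: "ep > 0" and C: "C \<ge> 0"
 shows "ray_int \<alpha> F = ray_int \<beta> F"
proof -
 define f where "f w = F (exp w) * exp w" for w
 have "(%n. integral {- real n..real n} (%u. f (Complex u \<alpha>)) - integral {- real n..real n} (%u. f (Complex u \<beta>)))
  \<longlonglongrightarrow> 2 * pi * \<i> * (\<Sum>p\<in>{}. residue f p)"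
 proof (rule strip_residues[OF _ _ _ ab])
  show "f holomorphic_on strip a' b' - {}" unfolding f_def using h by (auto intro!: holomorphic_intros)
  fix w assume "\<alpha> \<le> Im w" "Im w \<le> \<beta>"
  then show "cmod (f w) \<le> C * exp (- ep * \<bar>Re w\<bar>)"
   using d[of "Im w", unfolded log_decay_def, rule_format, of "Re w"] by (simp add: f_def norm_mult)
 qed (use e C in auto)
 moreover have "(%n. integral {- real n..real n} (%u. f (Complex u \<alpha>)) - integral {- real n..real n} (%u. f (Complex u \<beta>)))
  \<longlonglongrightarrow> ray_int \<alpha> F - ray_int \<beta> F"
  unfolding f_def using ab by (intro tendsto_diff ray_int_log_limit[OF _ _ e C] F log_decay_ray_decay[OF d e C]) auto
 ultimately have "ray_int \<alpha> F - ray_int \<beta> F = 2 * pi * \<i> * (\<Sum>p\<in>{}. residue f p)"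
  using LIMSEQ_unique by blast
 then show ?thesis by simp
qed

text \<open>Since the strip has width at most \<open>2 * pi\<close>, the point \<open>p\<close> has
  a single logarithm there, and the residue of h(e^w) e^w / (e^w - p) at it is \<open>h p\<close>.
  The bound on \<open>h\<close> may lose the factor \<open>1 + exp (Re w)\<close>, because division
  by \<open>z - p\<close> regains it.\<close>

theorem ray_int_Cauchy:
 assumes h: "(%w. h (exp w)) holomorphic_on strip a' b'" and ab: "a' < \<alpha>" "\<alpha> < \<beta>" "\<beta> < b'" "b' - a' \<le> 2 * pi"
  and p: "p = exp (Complex v tu)" "\<alpha> < tu" "tu < \<beta>"
  and F: "continuous_on {0<..} (%r. h (rcis r \<alpha>))" "continuous_on {0<..} (%r. h (rcis r \<beta>))"
  and d: "log_decay C ep (%z. h z / (z - p)) \<alpha>" "log_decay C ep (%z. h z / (z - p)) \<beta>"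
  and bd: "\<And>w. \<alpha> \<le> Im w ==> Im w \<le> \<beta> ==> cmod (h (exp w)) * exp (Re w) \<le> K * (1 + exp (Re w)) * exp (- ep * \<bar>Re w\<bar>)"
  and e: "ep > 0" and C: "C \<ge> 0" and K: "K \<ge> 0"
 shows "ray_int \<alpha> (%z. h z / (z - p)) - ray_int \<beta> (%z. h z / (z - p)) = 2 * pi * \<i> * h p"
proof -
 define w0 where "w0 = Complex v tu"
 define F where "F z = h z / (z - p)" for z
 define f where "f w = F (exp w) * exp w" for w
 have w0: "w0 \<in> strip \<alpha> \<beta>" "exp w0 = p" using p by (auto simp: w0_def strip_def)
 have inj: "w = w0" if w: "w \<in> strip a' b'" "exp w = p" for w
 proof -
  obtain k :: int where k: "w = w0 + (of_int (2 * k) * pi) * \<i>"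
   using w(2) w0(2) exp_eq[of w w0] by auto
  have "\<bar>Im w - Im w0\<bar> < 2 * pi" using w(1) w0(1) ab by (auto simp: strip_def)
  then have "\<bar>of_int (2 * k) * pi\<bar> < 2 * pi" using k by simp
  then have "\<bar>real_of_int k\<bar> < 1" by (simp add: abs_mult)
  then have "k = 0" by linarith
  then show ?thesis using k by simp
 qed
 define q0 where "q0 = 2 * (1 + exp (- v))"
 have "(%n. integral {- real n..real n} (%u. f (Complex u \<alpha>)) - integral {- real n..real n} (%u. f (Complex u \<beta>)))
  \<longlonglongrightarrow> 2 * pi * \<i> * (\<Sum>p\<in>{w0}. residue f p)"
 proof (rule strip_residues[OF _ _ _ ab(1-3)])
  show "f holomorphic_on strip a' b' - {w0}"
   unfolding f_def F_def using inj
   by (intro holomorphic_intros holomorphic_on_subset[OF h]) auto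
  \<comment> \<open>Beyond this real part, \<open>exp (Re w)\<close> and \<open>exp v\<close> differ
    at least by the factor \<open>exp 2 \<ge> 3\<close>, so \<open>cmod (exp w - p)\<close> is
    comparable with \<open>1 + exp (Re w)\<close>.\<close>
  define B where "B = \<bar>v\<bar> + 2"
  fix w assume w: "\<alpha> \<le> Im w" "Im w \<le> \<beta>" "\<bar>Re w\<bar> \<ge> B"
  have np: "cmod p = exp v" using p by simp
  have low: "(1 + exp (Re w)) * (1 / (2 * (1 + exp (- v)))) \<le> cmod (exp w - p)"
  proof (cases "Re w \<ge> 0")
   case True
   then have "Re w \<ge> v + 2" "Re w \<ge> 2" using w(3) by (auto simp: B_def)
   then have 1: "exp (Re w) \<ge> exp (v + 2)" "exp (Re w) \<ge> exp 2" by auto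
   have e2: "exp (2::real) \<ge> 3" using exp_ge_add_one_self[of 2] by simp
   then have "3 * exp v \<le> exp (v + 2)" by (simp add: exp_add)
   then have 2: "exp (Re w) - exp v \<ge> 2/3 * exp (Re w)" using 1 by linarith
   have "cmod (exp w - p) \<ge> exp (Re w) - exp v" using norm_triangle_ineq2[of "exp w" p] np by simp
   moreover have "(1 + exp (Re w)) * (1 / (2 * (1 + exp (- v)))) \<le> (1 + exp (Re w)) * (1/2)"
    using frac_le[of 1 1 2 "2 * (1 + exp (- v))"] by (intro mult_left_mono) auto
   moreover have "(1 + exp (Re w)) * (1/2) \<le> 2/3 * exp (Re w)" using order_trans[OF e2 1(2)] by (simp add: field_simps)
   ultimately show ?thesis using 2 by linarith
  next
   case False
   then have "Re w \<le> v - 2" "Re w \<le> - 2" using w(3) by (auto simp: B_def)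
   then have 1: "exp (Re w) \<le> exp (v - 2)" "exp (Re w) \<le> exp (- 2)" by auto
   have e2: "exp (2::real) \<ge> 3" using exp_ge_add_one_self[of 2] by simp
   then have i2: "exp (- 2::real) \<le> 1/3" by (simp add: exp_minus field_simps)
   then have "exp (v - 2) \<le> exp v / 3" using mult_left_mono[of "exp (-2)" "1/3" "exp v"] by (simp add: exp_diff exp_minus field_simps)
   then have 2: "exp v - exp (Re w) \<ge> 2/3 * exp v" using 1 by linarith
   have "cmod (exp w - p) \<ge> exp v - exp (Re w)" using norm_triangle_ineq2[of p "exp w"] np by (simp add: norm_minus_commute)
   moreover have "(1 + exp (Re w)) * (1 / (2 * (1 + exp (- v)))) \<le> (4/3) * (1 / (2 * (1 + exp (- v))))"
    using order_trans[OF 1(2) i2] by (intro mult_right_mono) (auto simp: add_nonneg_nonneg)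
   moreover have "(4/3) * (1 / (2 * (1 + exp (- v)))) \<le> 2/3 * exp v"
   proof -
    have "1 \<le> exp v * (1 + exp (- v))" by (simp add: algebra_simps exp_minus)
    then show ?thesis by (simp add: field_simps exp_minus add_pos_pos)
   qed
   ultimately show ?thesis using 2 by linarith
  qed
  define q where "q = 2 * (1 + exp (- v))"
  have q: "q > 0" by (simp add: q_def add_pos_pos)
  have low': "(1 + exp (Re w)) / q \<le> cmod (exp w - p)" using low by (simp add: q_def)
  have "0 < (1 + exp (Re w)) / q" using q by (simp add: add_pos_pos)
  then have pos: "cmod (exp w - p) > 0" using low' by linarith
  have "1 + exp (Re w) \<le> q * cmod (exp w - p)" using low' q by (simp add: field_simps)
  then have "K * (1 + exp (Re w)) * exp (- ep * \<bar>Re w\<bar>) \<le> K * (q * cmod (exp w - p)) * exp (- ep * \<bar>Re w\<bar>)"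
   using K by (intro mult_right_mono mult_left_mono) auto
  then have "cmod (h (exp w)) * exp (Re w) \<le> (K * q * exp (- ep * \<bar>Re w\<bar>)) * cmod (exp w - p)"
   using bd[OF w(1,2)] by (simp add: mult_ac)
  then have "cmod (h (exp w)) * exp (Re w) / cmod (exp w - p) \<le> K * q * exp (- ep * \<bar>Re w\<bar>)"
   using pos by (simp add: pos_divide_le_eq)
  then show "cmod (f w) \<le> (K * q0) * exp (- ep * \<bar>Re w\<bar>)"
   by (simp add: f_def F_def norm_mult norm_divide q_def q0_def)
 qed (use e K w0 in \<open>auto simp: q0_def add_nonneg_nonneg\<close>)
 moreover have "residue f w0 = h p"
 proof -
  have "((%w. (exp w - exp w0) / (w - w0)) \<longlongrightarrow> exp w0) (at w0)"
   using DERIV_exp[of w0] by (simp add: has_field_derivative_iff)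
  then have "((%w. h (exp w) * exp w / ((exp w - p) / (w - w0))) \<longlongrightarrow> h p * p / p) (at w0)"
  proof (intro tendsto_divide tendsto_mult)
   have "w0 \<in> strip a' b'" using w0(1) ab by (auto simp: strip_def)
   then have "isCont (%w. h (exp w)) w0"
    using holomorphic_on_imp_continuous_on[OF h] open_strip by (simp add: continuous_on_eq_continuous_at)
   then show "((%w. h (exp w)) \<longlongrightarrow> h p) (at w0)" by (simp add: isCont_def w0(2))
   show "(exp \<longlongrightarrow> p) (at w0)" using isCont_exp[of w0] by (simp add: isCont_def w0(2))
  qed (use w0 in auto)
  then have "((%w. f w * (w - w0)) \<longlongrightarrow> h p) (at w0)"
   using w0(2) by (auto simp: f_def F_def)
  moreover have "w0 \<in> strip a' b'" using w0(1) ab by (auto simp: strip_def)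
  moreover have "f holomorphic_on strip a' b' - {w0}"
   unfolding f_def F_def using inj
   by (intro holomorphic_intros holomorphic_on_subset[OF h]) auto
  ultimately show ?thesis using residue_simple'[OF open_strip] by blast
 qed
 moreover have "(%n. integral {- real n..real n} (%u. f (Complex u \<alpha>)) - integral {- real n..real n} (%u. f (Complex u \<beta>)))
  \<longlonglongrightarrow> ray_int \<alpha> F - ray_int \<beta> F"
 proof -
  have c: "continuous_on {0<..} (%r. F (rcis r ta))" if "ta = \<alpha> \<or> ta = \<beta>" for ta
  proof -
   have "rcis r ta \<noteq> p" if "r > 0" for r
   proof
    assume "rcis r ta = p"
    then have "exp (Complex (ln r) ta) = p" using that by (simp add: exp_Complex)
    then have "Complex (ln r) ta = w0" using \<open>ta = \<alpha> \<or> ta = \<beta>\<close> ab by (intro inj) (auto simp: strip_def)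
    then show False using w0(1) \<open>ta = \<alpha> \<or> ta = \<beta>\<close> by (auto simp: strip_def)
   qed
   then show ?thesis unfolding F_def using F that
    by (auto simp: rcis_def intro!: continuous_intros)
  qed
  show ?thesis unfolding f_def
   by (intro tendsto_diff ray_int_log_limit[OF _ _ e C] c log_decay_ray_decay[OF _ e C])
    (use d in \<open>auto simp: F_def[abs_def]\<close>)
 qed
 ultimately have "ray_int \<alpha> F - ray_int \<beta> F = 2 * pi * \<i> * (\<Sum>p\<in>{w0}. h (exp p))"
  using LIMSEQ_unique w0 by fastforce
 then show ?thesis by (simp add: F_def[abs_def] w0)
qed

section \<open>The functional calculus of a sectorial resolvent\<close>

lemma cos_le_cos_range:
 assumes "0 \<le> dl" "dl \<le> x" "x \<le> 2 * pi - dl"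
 shows "cos x \<le> cos dl"
proof (cases "x \<le> pi")
 case True
 then show ?thesis using assms by (intro cos_monotone_0_pi_le) auto
next
 case False
 have "cos x = cos (2 * pi - x)" by simp
 also have "\<dots> \<le> cos dl" using False assms by (intro cos_monotone_0_pi_le) auto
 finally show ?thesis .
qed

lemma cos_less_cos_range:
 assumes "0 \<le> dl" "dl < x" "x < 2 * pi - dl"
 shows "cos x < cos dl"
proof (cases "x \<le> pi")
 case True
 then show ?thesis using assms by (intro cos_monotone_0_pi) auto
next
 case False
 have "cos x = cos (2 * pi - x)" by simp
 also have "\<dots> < cos dl" using False assms by (intro cos_monotone_0_pi) auto
 finally show ?thesis .
qed

text \<open>A lower bound for \<open>cmod (z - w) / max (cmod z) (cmod w)\<close> when the arguments
  of \<open>z\<close> and \<open>w\<close> are at least \<open>dl\<close> apart modulo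
  \<open>2 * pi\<close>. The cutoff at \<open>0\<close> handles obtuse angles; the constant is not
  meant to be sharp.\<close>

definition gap :: "real => real" where
 "gap dl = sqrt (1 - max 0 (cos dl))"

lemma gap_pos: "0 < dl ==> dl \<le> pi ==> gap dl > 0"
 using cos_monotone_0_pi[of 0 dl] by (simp add: gap_def)

lemma exp_Complex_eq: "exp (Complex u ta) = of_real (exp u) * cis ta"
 by (simp add: exp_Complex rcis_def)

lemma gap_dist:
 assumes "0 < dl" "dl \<le> \<bar>ta - tu\<bar>" "\<bar>ta - tu\<bar> \<le> 2 * pi - dl"
 shows "gap dl * exp u \<le> cmod (exp (Complex u ta) - exp (Complex v tu))"
  and "gap dl * exp v \<le> cmod (exp (Complex u ta) - exp (Complex v tu))"
proof -
 define c where "c = max 0 (cos dl)"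
 define r q where "r = exp u" and "q = exp v"
 have r: "r > 0" "q > 0" by (auto simp: r_def q_def)
 have c: "0 \<le> c" "c \<le> 1" by (auto simp: c_def)
 have "cos (ta - tu) = cos \<bar>ta - tu\<bar>" by (simp add: abs_if cos_minus[of "ta - tu", symmetric])
 also have "\<dots> \<le> cos dl" using assms by (intro cos_le_cos_range) auto
 finally have cc: "cos (ta - tu) \<le> c" by (simp add: c_def)
 have "(cmod (exp (Complex u ta) - exp (Complex v tu)))\<^sup>2 = (r * cos ta - q * cos tu)\<^sup>2 + (r * sin ta - q * sin tu)\<^sup>2"
  by (simp add: exp_Complex_eq cmod_power2 r_def q_def)
 also have "\<dots> = r\<^sup>2 * ((cos ta)\<^sup>2 + (sin ta)\<^sup>2) + q\<^sup>2 * ((cos tu)\<^sup>2 + (sin tu)\<^sup>2) - 2 * r * q * cos (ta - tu)"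
 proof -
  have "(r * a - q * c)\<^sup>2 + (r * b - q * d)\<^sup>2 = r\<^sup>2 * (a\<^sup>2 + b\<^sup>2) + q\<^sup>2 * (c\<^sup>2 + d\<^sup>2) - 2 * r * q * (a * c + b * d)"
   for a b c d :: real by (simp add: power2_eq_square algebra_simps)
  then show ?thesis unfolding cos_diff .
 qed
 also have "\<dots> = r\<^sup>2 + q\<^sup>2 - 2 * r * q * cos (ta - tu)" by simp
 also have "\<dots> \<ge> r\<^sup>2 + q\<^sup>2 - 2 * r * q * c"
  using cc r by (simp add: mult_left_mono)
 finally have 1: "r\<^sup>2 + q\<^sup>2 - 2 * r * q * c \<le> (cmod (exp (Complex u ta) - exp (Complex v tu)))\<^sup>2" .
 \<comment> \<open>The law of cosines rewritten so that all three terms are nonnegative for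
   \<open>c\<close> between 0 and 1; either of the first two gives one of the claims.\<close>
 have 2: "r\<^sup>2 + q\<^sup>2 - 2 * r * q * c = (1 - c) * r\<^sup>2 + (1 - c) * q\<^sup>2 + c * (r - q)\<^sup>2"
  by (simp add: power2_eq_square algebra_simps)
 have g: "gap dl = sqrt (1 - c)" by (simp add: gap_def c_def)
 have n: "0 \<le> (1 - c) * q\<^sup>2" "0 \<le> (1 - c) * r\<^sup>2" "0 \<le> c * (r - q)\<^sup>2" using c by auto
 have "(gap dl * exp u)\<^sup>2 = (1 - c) * r\<^sup>2" "(gap dl * exp v)\<^sup>2 = (1 - c) * q\<^sup>2"
  using c by (simp_all add: g r_def q_def power_mult_distrib)
 then have sq: "(gap dl * exp u)\<^sup>2 \<le> (cmod (exp (Complex u ta) - exp (Complex v tu)))\<^sup>2"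
  "(gap dl * exp v)\<^sup>2 \<le> (cmod (exp (Complex u ta) - exp (Complex v tu)))\<^sup>2"
  using 1 2 n by linarith+
 show "gap dl * exp u \<le> cmod (exp (Complex u ta) - exp (Complex v tu))"
  by (rule power2_le_imp_le[OF sq(1)]) simp
 show "gap dl * exp v \<le> cmod (exp (Complex u ta) - exp (Complex v tu))"
  by (rule power2_le_imp_le[OF sq(2)]) simp
qed

text \<open>For s between 0 and \<pi>, the complement of the closed sector of half-angle
  \<open>s\<close>. Described by the cosine instead of \<open>Arg\<close>, it is evidently open and
  accommodates angles beyond \<pi>.\<close>

definition cosector :: "real => complex set" where
 "cosector s = {z. Re z < cmod z * cos s}"

lemma exp_in_cosector:
 assumes "0 \<le> s" "s < \<bar>ta\<bar>" "\<bar>ta\<bar> < 2 * pi - s"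
 shows "exp (Complex u ta) \<in> cosector s"
proof -
 have "cos ta = cos \<bar>ta\<bar>" by simp
 also have "\<dots> < cos s" using assms by (intro cos_less_cos_range) auto
 finally show ?thesis by (simp add: cosector_def exp_Complex_eq norm_mult)
qed

lemma rcis_in_cosector:
 assumes "0 \<le> s" "s < \<bar>ta\<bar>" "\<bar>ta\<bar> < 2 * pi - s" "r > 0"
 shows "rcis r ta \<in> cosector s"
 using exp_in_cosector[OF assms(1-3), of "ln r"] assms(4) by (simp add: exp_Complex)

lemma open_cosector: "open (cosector s)"
 unfolding cosector_def by (intro open_Collect_less continuous_intros)

lemma zero_notin_cosector: "0 \<notin> cosector s"
 by (simp add: cosector_def)

text \<open>The class \<open>H0inf\<close> in the coordinate \<open>w = log z\<close>.\<close>

definition h0 :: "real => real => real => (complex => complex) => bool" where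
 "h0 C ep b f \<longleftrightarrow> (%w. f (exp w)) holomorphic_on strip (- b) b \<and> ep > 0 \<and> C \<ge> 0 \<and>
  (\<forall>w\<in>strip (- b) b. cmod (f (exp w)) \<le> C * exp (- ep * \<bar>Re w\<bar>))"

text \<open>What the contour integral itself asks of a symbol: continuity and decay on its two rays.
  The averaged symbols \<open>sq_symbol\<close> are treated at this level, without
  holomorphy.\<close>

definition h0_ray :: "real => real => real => (complex => complex) => bool" where
 "h0_ray C ep nu f \<longleftrightarrow> ep > 0 \<and> C \<ge> 0 \<and> (\<forall>ta\<in>{nu, - nu}. continuous_on {0<..} (%r. f (rcis r ta)) \<and>
  (\<forall>u. cmod (f (exp (Complex u ta))) \<le> C * exp (- ep * \<bar>u\<bar>)))"

lemma continuous_on_rcis_exp: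
 assumes "continuous_on S (%w. f (exp w))" "\<And>u. Complex u ta \<in> S"
 shows "continuous_on {0<..} (%r. f (rcis r ta))"
proof -
 have "continuous_on {0<..} (%r. f (exp (Complex (ln r) ta)))"
  using assms(2) by (intro continuous_on_compose2[OF assms(1)])
   (auto simp: Complex_eq intro!: continuous_intros)
 then show ?thesis by (rule continuous_on_eq) (simp add: exp_Complex)
qed

lemma h0_bound: "h0 C ep b f ==> \<bar>ta\<bar> < b ==> cmod (f (exp (Complex u ta))) \<le> C * exp (- ep * \<bar>u\<bar>)"
 unfolding h0_def by (auto simp: strip_def dest!: spec[of _ "Complex u ta"])

lemma h0_imp_h0_ray: "h0 C ep b f ==> \<bar>nu\<bar> < b ==> h0_ray C ep nu f"
 using h0_bound[of C ep b f nu] h0_bound[of C ep b f "- nu"] unfolding h0_def h0_ray_def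
 by (auto intro!: continuous_on_rcis_exp[OF holomorphic_on_imp_continuous_on] simp: strip_def)

lemma h0_mult:
 assumes "h0 C ep b f" "h0 C' ep' b g"
 shows "h0 (C * C') (ep + ep') b (%z. f z * g z)"
 unfolding h0_def
proof (intro conjI ballI)
 show "(%w. f (exp w) * g (exp w)) holomorphic_on strip (- b) b"
  using assms unfolding h0_def by (intro holomorphic_intros) auto
 fix w assume "w \<in> strip (- b) b"
 then have "cmod (f (exp w)) * cmod (g (exp w)) \<le> (C * exp (- ep * \<bar>Re w\<bar>)) * (C' * exp (- ep' * \<bar>Re w\<bar>))"
  using assms unfolding h0_def by (intro mult_mono) auto
 then show "cmod (f (exp w) * g (exp w)) \<le> C * C' * exp (- (ep + ep') * \<bar>Re w\<bar>)"
  by (simp add: norm_mult algebra_simps exp_add[symmetric] flip: exp_add)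
qed (use assms in \<open>auto simp: h0_def\<close>)

lemma h0_subset: "h0 C ep b f ==> b' \<le> b ==> h0 C ep b' f"
 unfolding h0_def by (auto intro: holomorphic_on_subset simp: strip_def)

text \<open>The calculus is built on a family with the resolvent identity and the sectorial bound,
  without mentioning the operator; the locale serves for both \<open>A\<close> and
  \<open>B\<close>.\<close>

locale sect_resolvent =
 fixes R :: "complex => 'a::complex_banach => 'a" and s M :: real
 assumes s: "0 < s" "s < pi" and M: "M \<ge> 0"
  and R_clinear: "z \<in> cosector s ==> bounded_clinear (R z)"
  and R_bound: "z \<in> cosector s ==> norm (R z x) * cmod z \<le> M * norm x"
  and R_identity: "z \<in> cosector s ==> w \<in> cosector s ==> R z x - R w x = (w - z) *\<^sub>C R z (R w x)"
begin

lemma R_commute: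
 assumes "z \<in> cosector s" "w \<in> cosector s"
 shows "R z (R w x) = R w (R z x)"
proof (cases "z = w")
 case False
 have "(w - z) *\<^sub>C R z (R w x) = (w - z) *\<^sub>C R w (R z x)"
  using R_identity[OF assms, of x] R_identity[OF assms(2,1), of x]
  by (metis minus_diff_eq scaleC.minus_left)
 then have "(1 / (w - z)) *\<^sub>C (w - z) *\<^sub>C R z (R w x) = (1 / (w - z)) *\<^sub>C (w - z) *\<^sub>C R w (R z x)" by simp
 then show ?thesis using False by (simp add: scaleC_scaleC)
qed simp

lemma R_bound': "z \<in> cosector s ==> norm (R z x) \<le> M * norm x / cmod z"
 using R_bound[of z x] zero_notin_cosector[of s] by (metis pos_le_divide_eq zero_less_norm_iff)

lemma continuous_on_R: "continuous_on (cosector s) (%z. R z x)"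
 unfolding continuous_on_def
proof
 fix z assume z: "z \<in> cosector s"
 have z0: "cmod z > 0" using z zero_notin_cosector by (metis zero_less_norm_iff)
 have lim: "((%w. cmod (z - w) * (M * (M * norm x / cmod z) / cmod w)) \<longlongrightarrow> cmod (z - z) * (M * (M * norm x / cmod z) / cmod z)) (at z within cosector s)"
  using z0 by (intro tendsto_intros) auto
 have "((%w. R w x - R z x) \<longlongrightarrow> 0) (at z within cosector s)"
 proof (rule Lim_null_comparison)
  show "eventually (%w. norm (R w x - R z x) \<le> cmod (z - w) * (M * (M * norm x / cmod z) / cmod w)) (at z within cosector s)"
   unfolding eventually_at_filter
  proof (intro always_eventually allI impI)
   fix w assume w: "w \<in> cosector s"
   have "norm (R w x - R z x) = cmod (z - w) * norm (R w (R z x))"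
    by (simp add: R_identity[OF w z] norm_scaleC)
   also have "norm (R w (R z x)) \<le> M * norm (R z x) / cmod w" by (rule R_bound'[OF w])
   also have "\<dots> \<le> M * (M * norm x / cmod z) / cmod w"
    using R_bound'[OF z] M by (intro divide_right_mono mult_left_mono) auto
   finally show "norm (R w x - R z x) \<le> cmod (z - w) * (M * (M * norm x / cmod z) / cmod w)"
    by (simp add: mult_left_mono)
  qed
  show "((%w. cmod (z - w) * (M * (M * norm x / cmod z) / cmod w)) \<longlongrightarrow> 0) (at z within cosector s)"
   using lim by simp
 qed
 then show "((%z. R z x) \<longlongrightarrow> R z x) (at z within cosector s)" by (simp add: LIM_zero_iff)
qed

lemma holomorphic_on_R:
 assumes l: "bounded_clinear l"
 shows "(%z. l (R z x)) holomorphic_on cosector s"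
 unfolding holomorphic_on_open[OF open_cosector]
proof
 fix z assume z: "z \<in> cosector s"
 have bl: "bounded_linear l" using l by (rule bounded_clinear_imp_bounded_linear)
 have "((%w. l (R w x)) has_field_derivative - l (R z (R z x))) (at z within cosector s)"
  unfolding has_field_derivative_iff
 proof (rule Lim_transform_eventually)
  have "((%w. R w (R z x)) \<longlongrightarrow> R z (R z x)) (at z within cosector s)"
   using continuous_on_R z by (simp add: continuous_on_def)
  then show "((%w. - l (R w (R z x))) \<longlongrightarrow> - l (R z (R z x))) (at z within cosector s)"
   by (intro tendsto_minus bounded_linear.tendsto[OF bl])
  show "eventually (%w. - l (R w (R z x)) = (l (R w x) - l (R z x)) / (w - z)) (at z within cosector s)"
   unfolding eventually_at_filter
  proof (intro always_eventually allI impI)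
   fix w assume w: "w \<noteq> z" "w \<in> cosector s"
   have "l (R w x) - l (R z x) = l (R w x - R z x)" using bl by (simp add: bounded_linear.linear linear_diff)
   also have "\<dots> = (z - w) * l (R w (R z x))" by (simp add: R_identity[OF w(2) z] functional_scaleC[OF l])
   finally show "- l (R w (R z x)) = (l (R w x) - l (R z x)) / (w - z)" using w(1) by (simp add: field_simps)
  qed
 qed
 then show "\<exists>f'. ((%w. l (R w x)) has_field_derivative f') (at z)"
  using z open_cosector by (metis at_within_open)
qed

lemma functional_R_bound:
 assumes "bounded_clinear l" "z \<in> cosector s"
 shows "cmod (l (R z x)) * cmod z \<le> onorm l * M * norm x"
proof -
 have "cmod (l (R z x)) * cmod z \<le> (onorm l * norm (R z x)) * cmod z"
  using bounded_clinear_onorm[OF assms(1)] by (intro mult_right_mono) auto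
 also have "\<dots> = onorm l * (norm (R z x) * cmod z)" by simp
 also have "\<dots> \<le> onorm l * (M * norm x)"
  using assms R_bound by (intro mult_left_mono) (auto simp: onorm_pos_le bounded_clinear_imp_bounded_linear)
 finally show ?thesis by (simp add: mult.assoc)
qed

definition Phi_ray :: "real => (complex => complex) => 'a => real => 'a" where
 "Phi_ray ta f x r = (f (rcis r ta) * cis ta) *\<^sub>C R (rcis r ta) x"

definition Phi :: "real => (complex => complex) => 'a => 'a" where
 "Phi nu f x = (1 / (2 * complex_of_real pi * \<i>)) *\<^sub>C integral {0<..} (%r. Phi_ray (- nu) f x r - Phi_ray nu f x r)"

lemma angle_cosector: "s < nu ==> nu < pi ==> ta \<in> {nu, - nu} ==> exp (Complex u ta) \<in> cosector s"
 using s by (intro exp_in_cosector) auto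

lemma angle_cosector': "s < nu ==> nu < pi ==> ta \<in> {nu, - nu} ==> r > 0 ==> rcis r ta \<in> cosector s"
 using angle_cosector[of nu ta "ln r"] by (simp add: exp_Complex)

lemma ray_decay_of_log:
 assumes "\<And>u. norm (F (exp u)) * exp u \<le> C * exp (- ep * \<bar>u\<bar>)" "ep > 0" "C \<ge> 0"
 shows "ray_decay C ep (F :: real => 'b::real_normed_vector)"
proof -
 have "log_decay C ep (%z. of_real (norm (F (cmod z)))) 0"
  unfolding log_decay_def using assms(1) by (simp add: exp_Complex_eq norm_mult)
 from log_decay_ray_decay[OF this assms(2,3)] show ?thesis by (simp add: ray_decay_def)
qed

lemma Phi_ray_integral:
 assumes f: "h0_ray C ep nu f" and nu: "s < nu" "nu < pi" and ta: "ta \<in> {nu, - nu}"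
 shows "continuous_on {0<..} (Phi_ray ta f x)" "ray_decay (C * M * norm x) ep (Phi_ray ta f x)"
  "Phi_ray ta f x integrable_on {0<..}"
  "norm (integral {0<..} (Phi_ray ta f x)) \<le> 2 * (C * M * norm x) / ep"
proof -
 have e: "ep > 0" and C: "C \<ge> 0" and fc: "continuous_on {0<..} (%r. f (rcis r ta))"
  and fb: "\<And>u. cmod (f (exp (Complex u ta))) \<le> C * exp (- ep * \<bar>u\<bar>)"
  using f ta by (auto simp: h0_ray_def)
 have "continuous_on {0<..} (%r. R (rcis r ta) x)"
  by (rule continuous_on_ray[OF continuous_on_R]) (use angle_cosector'[OF nu ta] in auto)
 then show c: "continuous_on {0<..} (Phi_ray ta f x)"
  unfolding Phi_ray_def by (intro scaleC.continuous_on continuous_intros fc)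
 show d: "ray_decay (C * M * norm x) ep (Phi_ray ta f x)"
 proof (rule ray_decay_of_log)
  fix u
  let ?z = "exp (Complex u ta)"
  have z: "?z \<in> cosector s" by (rule angle_cosector[OF nu ta])
  have "norm (Phi_ray ta f x (exp u)) * exp u = cmod (f ?z) * (norm (R ?z x) * cmod ?z)"
   by (simp add: Phi_ray_def exp_Complex[symmetric] norm_scaleC norm_mult)
  also have "\<dots> \<le> (C * exp (- ep * \<bar>u\<bar>)) * (M * norm x)"
   using C by (intro mult_mono[OF fb R_bound[OF z]]) auto
  finally show "norm (Phi_ray ta f x (exp u)) * exp u \<le> C * M * norm x * exp (- ep * \<bar>u\<bar>)"
   by (simp add: mult_ac)
 qed (use e C M in auto)
 have "C * M * norm x \<ge> 0" using C M by simp
 from ray_integral[OF c d e this] show "Phi_ray ta f x integrable_on {0<..}"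
  "norm (integral {0<..} (Phi_ray ta f x)) \<le> 2 * (C * M * norm x) / ep" by auto
qed

lemma Phi_eq:
 assumes "h0_ray C ep nu f" "s < nu" "nu < pi"
 shows "Phi nu f x = (1 / (2 * complex_of_real pi * \<i>)) *\<^sub>C (integral {0<..} (Phi_ray (- nu) f x) - integral {0<..} (Phi_ray nu f x))"
 unfolding Phi_def using Phi_ray_integral(3)[OF assms] by (simp add: Henstock_Kurzweil_Integration.integral_diff)

lemma norm_Phi_le:
 assumes "h0_ray C ep nu f" "s < nu" "nu < pi"
 shows "norm (Phi nu f x) \<le> (2 * C * M / ep) * norm x"
proof -
 have e: "ep > 0" "C \<ge> 0" using assms(1) by (auto simp: h0_ray_def)
 have "norm (integral {0<..} (Phi_ray (- nu) f x) - integral {0<..} (Phi_ray nu f x)) \<le> 2 * (2 * (C * M * norm x) / ep)"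
  using Phi_ray_integral(4)[OF assms, of "- nu" x] Phi_ray_integral(4)[OF assms, of nu x]
   norm_triangle_ineq4[of "integral {0<..} (Phi_ray (- nu) f x)" "integral {0<..} (Phi_ray nu f x)"] by simp
 then have "norm (Phi nu f x) \<le> (1 / (2 * pi)) * (2 * (2 * (C * M * norm x) / ep))"
  unfolding Phi_eq[OF assms] norm_scaleC by (intro mult_mono) (auto simp: norm_divide norm_mult)
 also have "\<dots> \<le> 1 * (2 * (C * M * norm x) / ep)"
 proof -
  have "(1 / (2 * pi)) * (2 * (2 * (C * M * norm x) / ep)) = (1 / pi) * (2 * (C * M * norm x) / ep)" by simp
  also have "\<dots> \<le> 1 * (2 * (C * M * norm x) / ep)"
   using e M pi_gt3 by (intro mult_right_mono) (auto simp: field_simps)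
  finally show ?thesis .
 qed
 finally show ?thesis by (simp add: mult_ac)
qed

text \<open>The bridge from the X-valued calculus to \<open>ray_int\<close>, to which rotation,
  Cauchy's formula and Fubini apply.\<close>

lemma functional_Phi:
 assumes "h0_ray C ep nu f" "s < nu" "nu < pi" and l: "bounded_clinear l"
 shows "l (Phi nu f x) = (1 / (2 * complex_of_real pi * \<i>)) *
  (ray_int (- nu) (%z. f z * l (R z x)) - ray_int nu (%z. f z * l (R z x)))"
proof -
 have bl: "bounded_linear l" using l by (rule bounded_clinear_imp_bounded_linear)
 have *: "l (integral {0<..} (Phi_ray ta f x)) = ray_int ta (%z. f z * l (R z x))" if "ta \<in> {nu, - nu}" for ta
 proof -
  have "l (integral {0<..} (Phi_ray ta f x)) = integral {0<..} (l \<circ> Phi_ray ta f x)"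
   by (rule integral_linear[OF Phi_ray_integral(3)[OF assms(1-3) that] bl, symmetric])
  also have "l \<circ> Phi_ray ta f x = (%r. (f (rcis r ta) * l (R (rcis r ta) x)) * cis ta)"
   by (simp add: fun_eq_iff Phi_ray_def functional_scaleC[OF l] mult_ac)
  finally show ?thesis by (simp add: ray_int_def)
 qed
 show ?thesis
  unfolding Phi_eq[OF assms(1-3)] functional_scaleC[OF l]
  using bl by (simp add: bounded_linear.linear linear_diff *)
qed

lemma Phi_commute:
 assumes "h0_ray C ep nu f" "s < nu" "nu < pi" and T: "bounded_clinear T"
  and TR: "\<And>z x. z \<in> cosector s ==> T (R z x) = R z (T x)"
 shows "T (Phi nu f x) = Phi nu f (T x)"
proof (rule eq_functionalI)
 fix l :: "'a => complex" assume l: "bounded_clinear l"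
 have lT: "bounded_clinear (%x. l (T x))" using l T by (rule bounded_clinear_compose)
 have *: "ray_int ta (%z. f z * l (T (R z x))) = ray_int ta (%z. f z * l (R z (T x)))" if "ta \<in> {nu, - nu}" for ta
  unfolding ray_int_def by (rule Henstock_Kurzweil_Integration.integral_cong) (simp add: TR angle_cosector'[OF assms(2,3) that])
 show "l (T (Phi nu f x)) = l (Phi nu f (T x))"
  unfolding functional_Phi[OF assms(1-3) lT] functional_Phi[OF assms(1-3) l] by (simp add: *)
qed

lemma Phi_clinear:
 assumes "h0_ray C ep nu f" "s < nu" "nu < pi"
 shows "bounded_clinear (Phi nu f)"
proof (rule bounded_clinearI)
 fix x y c
 have RL: "R z (x + y) = R z x + R z y" "R z (c *\<^sub>C x) = c *\<^sub>C R z x" if "z \<in> cosector s" for z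
  using R_clinear[OF that] by (auto simp: bounded_clinear_def bounded_linear.linear linear_add)
 have add: "integral {0<..} (Phi_ray ta f (x + y)) = integral {0<..} (Phi_ray ta f x) + integral {0<..} (Phi_ray ta f y)"
  if ta: "ta \<in> {nu, - nu}" for ta
 proof -
  have "integral {0<..} (Phi_ray ta f (x + y)) = integral {0<..} (%r. Phi_ray ta f x r + Phi_ray ta f y r)"
   by (rule Henstock_Kurzweil_Integration.integral_cong)
    (simp add: Phi_ray_def RL[OF angle_cosector'[OF assms(2,3) ta]] scaleC_add_right)
  then show ?thesis using Phi_ray_integral(3)[OF assms ta] by (simp add: Henstock_Kurzweil_Integration.integral_add)
 qed
 show "Phi nu f (x + y) = Phi nu f x + Phi nu f y"
  unfolding Phi_eq[OF assms] by (simp add: add scaleC_add_right scaleC.diff_right algebra_simps)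
 have sc: "integral {0<..} (Phi_ray ta f (c *\<^sub>C x)) = c *\<^sub>C integral {0<..} (Phi_ray ta f x)"
  if ta: "ta \<in> {nu, - nu}" for ta
 proof -
  have "integral {0<..} (Phi_ray ta f (c *\<^sub>C x)) = integral {0<..} ((%y. c *\<^sub>C y) \<circ> Phi_ray ta f x)"
   by (rule Henstock_Kurzweil_Integration.integral_cong)
    (simp add: Phi_ray_def RL[OF angle_cosector'[OF assms(2,3) ta]] scaleC_scaleC mult_ac)
  then show ?thesis
   using integral_linear[OF Phi_ray_integral(3)[OF assms ta] scaleC.bounded_linear_right] by simp
 qed
 show "Phi nu f (c *\<^sub>C x) = c *\<^sub>C Phi nu f x"
  unfolding Phi_eq[OF assms] by (simp add: sc scaleC.diff_right[symmetric] scaleC_scaleC mult.commute)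
 show "norm (Phi nu f x) \<le> (2 * C * M / ep) * norm x" by (rule norm_Phi_le[OF assms])
qed

lemma Phi_lincomb:
 assumes "h0_ray C ep nu f" "h0_ray C' ep' nu g" and nu: "s < nu" "nu < pi"
 shows "Phi nu (%z. f z + c * g z) x = Phi nu f x + c *\<^sub>C Phi nu g x"
proof -
 have *: "integral {0<..} (Phi_ray ta (%z. f z + c * g z) x) = integral {0<..} (Phi_ray ta f x) + c *\<^sub>C integral {0<..} (Phi_ray ta g x)"
  "Phi_ray ta (%z. f z + c * g z) x integrable_on {0<..}"
  if ta: "ta \<in> {nu, - nu}" for ta
 proof -
  have eq: "Phi_ray ta (%z. f z + c * g z) x = (%r. Phi_ray ta f x r + ((%y. c *\<^sub>C y) \<circ> Phi_ray ta g x) r)"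
   by (simp add: Phi_ray_def fun_eq_iff scaleC_scaleC scaleC_add_left ring_distribs mult.assoc)
  have i: "((%y. c *\<^sub>C y) \<circ> Phi_ray ta g x) integrable_on {0<..}"
   by (rule integrable_linear[OF Phi_ray_integral(3)[OF assms(2) nu ta] scaleC.bounded_linear_right])
  show "integral {0<..} (Phi_ray ta (%z. f z + c * g z) x) = integral {0<..} (Phi_ray ta f x) + c *\<^sub>C integral {0<..} (Phi_ray ta g x)"
   unfolding eq using Phi_ray_integral(3)[OF assms(1) nu ta] i
    integral_linear[OF Phi_ray_integral(3)[OF assms(2) nu ta] scaleC.bounded_linear_right[of c]]
   by (simp only: Henstock_Kurzweil_Integration.integral_add)
  show "Phi_ray ta (%z. f z + c * g z) x integrable_on {0<..}"
   unfolding eq using Phi_ray_integral(3)[OF assms(1) nu ta] i by (intro integrable_add)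
 qed
 have "Phi nu (%z. f z + c * g z) x = (1 / (2 * complex_of_real pi * \<i>)) *\<^sub>C
  (integral {0<..} (Phi_ray (- nu) (%z. f z + c * g z) x) - integral {0<..} (Phi_ray nu (%z. f z + c * g z) x))"
  unfolding Phi_def using *(2) by (simp add: Henstock_Kurzweil_Integration.integral_diff)
 then show ?thesis
  unfolding Phi_eq[OF assms(1) nu] Phi_eq[OF assms(2) nu]
  by (simp add: * scaleC_add_right scaleC.diff_right scaleC_scaleC mult.commute algebra_simps)
qed

lemma Phi_cong:
 assumes "\<And>r ta. r > 0 ==> ta \<in> {nu, - nu} ==> f (rcis r ta) = g (rcis r ta)"
 shows "Phi nu f x = Phi nu g x"
 unfolding Phi_def
 by (rule arg_cong[where f = "%y. _ *\<^sub>C y"], rule Henstock_Kurzweil_Integration.integral_cong) (simp add: Phi_ray_def assms)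

text \<open>The two rays are rotated separately, each within a strip on which both the symbol and
  the resolvent are holomorphic, with heights between \<open>s\<close> and \<open>b\<close> or
  between \<open>- b\<close> and \<open>- s\<close>.\<close>

theorem Phi_angle_indep:
 assumes f: "h0 C ep b f" and b: "b \<le> pi" and nu: "s < nu1" "nu1 < b" "s < nu2" "nu2 < b"
 shows "Phi nu1 f x = Phi nu2 f x"
proof -
 have main: "Phi nu1 f x = Phi nu2 f x" if n: "s < nu1" "nu1 < nu2" "nu2 < b" for nu1 nu2
 proof (rule eq_functionalI)
  fix l :: "'a => complex" assume l: "bounded_clinear l"
  define F where "F z = f z * l (R z x)" for z
  have e: "ep > 0" "C \<ge> 0" using f by (auto simp: h0_def)
  define K where "K = C * (onorm l * M * norm x)"
  have K: "K \<ge> 0" using e M l by (auto simp: K_def onorm_pos_le bounded_clinear_imp_bounded_linear)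
  have dec: "log_decay K ep F ta" if "s < \<bar>ta\<bar>" "\<bar>ta\<bar> < b" for ta
   unfolding log_decay_def
  proof
   fix u
   let ?z = "exp (Complex u ta)"
   have z: "?z \<in> cosector s" using that b s by (intro exp_in_cosector) auto
   have "cmod (f ?z) \<le> C * exp (- ep * \<bar>u\<bar>)" using f that by (intro h0_bound)
   then have "cmod (f ?z) * (cmod (l (R ?z x)) * cmod ?z) \<le> (C * exp (- ep * \<bar>u\<bar>)) * (onorm l * M * norm x)"
    using e by (intro mult_mono[OF _ functional_R_bound[OF l z]]) auto
   then show "cmod (F ?z) * exp u \<le> K * exp (- ep * \<bar>u\<bar>)"
    by (simp add: F_def norm_mult K_def mult_ac)
  qed
  have holf: "(%w. f (exp w)) holomorphic_on strip (- b) b" using f by (simp add: h0_def)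
  have hol: "(%w. F (exp w)) holomorphic_on strip p q" if "s \<le> p \<and> q \<le> b \<or> - b \<le> p \<and> q \<le> - s" for p q
  proof -
   have "strip p q \<subseteq> strip (- b) b" using that s b nu by (auto simp: strip_def)
   moreover have "exp w \<in> cosector s" if "w \<in> strip p q" for w
    using exp_in_cosector[of s "Im w" "Re w"] that \<open>s \<le> p \<and> q \<le> b \<or> - b \<le> p \<and> q \<le> - s\<close> s b
    by (auto simp: strip_def)
   ultimately show ?thesis
    unfolding F_def using holf
    by (intro holomorphic_on_mult holomorphic_on_subset[OF holf]
      holomorphic_on_compose_gen[OF holomorphic_on_exp holomorphic_on_R[OF l], unfolded comp_def]) auto
  qed
  have cont: "continuous_on {0<..} (%r. F (rcis r ta))" if "s < \<bar>ta\<bar>" "\<bar>ta\<bar> < b" for ta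
  proof (cases "ta > 0")
   case True
   show ?thesis by (rule continuous_on_rcis_exp[OF holomorphic_on_imp_continuous_on[OF hol[of s b]]]) (use that True in \<open>auto simp: strip_def\<close>)
  next
   case False
   show ?thesis by (rule continuous_on_rcis_exp[OF holomorphic_on_imp_continuous_on[OF hol[of "- b" "- s"]]]) (use that False in \<open>auto simp: strip_def\<close>)
  qed
  have "ray_int nu1 F = ray_int nu2 F"
   by (rule ray_int_rotate[OF hol[of s b], of nu1 nu2 K ep]) (use n s e K in \<open>auto intro!: cont dec\<close>)
  moreover have "ray_int (- nu2) F = ray_int (- nu1) F"
   by (rule ray_int_rotate[OF hol[of "- b" "- s"], of "- nu2" "- nu1" K ep]) (use n s e K in \<open>auto intro!: cont dec\<close>)
  moreover have "h0_ray C ep nu1 f" "h0_ray C ep nu2 f" using f n s by (auto intro!: h0_imp_h0_ray)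
  ultimately show "l (Phi nu1 f x) = l (Phi nu2 f x)"
   using n s b l by (simp add: functional_Phi F_def[abs_def])
 qed
 consider "nu1 < nu2" | "nu1 = nu2" | "nu2 < nu1" by linarith
 then show ?thesis
 proof cases
  case 1 then show ?thesis using nu by (intro main)
 next
  case 2 then show ?thesis by simp
 next
  case 3 then show ?thesis using nu by (intro main[symmetric])
 qed
qed

end

section \<open>Fubini on pairs of rays and multiplicativity of the calculus\<close>

definition ray_weight :: "real => real => real" where
 "ray_weight ep r = (if r > 0 then min (r powr (ep - 1)) (r powr (- ep - 1)) else 0)"

lemma ray_weight_nonneg: "ray_weight ep r \<ge> 0"
 by (simp add: ray_weight_def)

lemma borel_measurable_ray_weight [measurable]: "ray_weight ep \<in> borel_measurable borel"
 unfolding ray_weight_def[abs_def] by measurable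

lemma ray_decay_iff: "C \<ge> 0 ==> ray_decay C ep f \<longleftrightarrow> (\<forall>r>0. norm (f r) \<le> C * ray_weight ep r)"
 by (auto simp: ray_decay_def ray_weight_def min_mult_distrib_left)

lemma nn_integral_ray_weight: "ep > 0 ==> (\<integral>\<^sup>+r. ennreal (ray_weight ep r) \<partial>lborel) < \<infinity>"
proof -
 assume e: "ep > 0"
 have c: "continuous_on {0<..} (ray_weight ep)"
 proof (rule continuous_on_eq)
  show "continuous_on {0<..} (%r. min (r powr (ep - 1)) (r powr (- ep - 1)))"
   by (intro continuous_intros) auto
 qed (simp add: ray_weight_def)
 have "ray_decay 1 ep (ray_weight ep)" by (subst ray_decay_iff) (auto simp: ray_weight_nonneg)
 from ray_integral(1)[OF c this e] obtain I where "(ray_weight ep has_integral I) {0<..}" by auto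
 then have "((%r. if r \<in> {0<..} then ray_weight ep r else 0) has_integral I) UNIV"
  by (simp only: has_integral_restrict_UNIV)
 moreover have "(%r. if r \<in> {0<..} then ray_weight ep r else 0) = ray_weight ep"
  by (auto simp: ray_weight_def)
 ultimately have "(ray_weight ep has_integral I) UNIV" by simp
 from nn_integral_has_integral_lborel[OF _ _ this] have "(\<integral>\<^sup>+r. ennreal (ray_weight ep r) \<partial>lborel) = ennreal I"
  by (simp add: ray_weight_nonneg)
 then show ?thesis by simp
qed

lemma set_integrable_ray:
 fixes f :: "real => complex"
 assumes f: "continuous_on {0<..} f" and d: "ray_decay C ep f" and e: "ep > 0" and C: "C \<ge> 0"
 shows "set_integrable lborel {0<..} f" "(LINT r:{0<..}|lborel. f r) = integral {0<..} f"
proof -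
 have m: "(%r. indicator {0<..} r *\<^sub>R f r) \<in> borel_measurable borel"
  by (rule borel_measurable_continuous_on_indicator[OF _ f]) simp
 have "(\<integral>\<^sup>+r. ennreal (norm (indicator {0<..} r *\<^sub>R f r)) \<partial>lborel) \<le> (\<integral>\<^sup>+r. ennreal C * ennreal (ray_weight ep r) \<partial>lborel)"
  using d C by (intro nn_integral_mono) (auto simp: ray_decay_iff indicator_def ennreal_mult[symmetric] ray_weight_nonneg intro!: ennreal_leI)
 also have "\<dots> < \<infinity>" using nn_integral_ray_weight[OF e] by (simp add: nn_integral_cmult ennreal_mult_less_top)
 finally show i: "set_integrable lborel {0<..} f"
  unfolding set_integrable_def using m by (intro integrableI_bounded) auto
 show "(LINT r:{0<..}|lborel. f r) = integral {0<..} f"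
  using set_borel_integral_eq_integral(2)[OF i] .
qed

text \<open>A product of two integrable weights majorises the integrand, which makes Lebesgue's
  Fubini theorem applicable; on each ray the gauge integral agrees with the Lebesgue
  integral.\<close>

theorem ray_Fubini:
 fixes T :: "real => real => complex"
 assumes T: "continuous_on ({0<..} \<times> {0<..}) (%(r, t). T r t)" and e: "ep > 0" "ep' > 0" and C: "C \<ge> 0"
  and bd: "\<And>r t. r > 0 ==> t > 0 ==> cmod (T r t) \<le> C * ray_weight ep r * ray_weight ep' t"
 shows "integral {0<..} (%r. integral {0<..} (T r)) = integral {0<..} (%t. integral {0<..} (%r. T r t))"
proof -
 define F where "F r t = indicator ({0<..} \<times> {0<..}) (r, t) *\<^sub>R T r t" for r t
 have "(%p. indicator ({0<..} \<times> {0<..}) p *\<^sub>R (case p of (r, t) => T r t)) \<in> borel_measurable borel"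
  by (rule borel_measurable_continuous_on_indicator[OF _ T]) (simp add: borel_prod[symmetric])
 moreover have "(%(r, t). F r t) = (%p. indicator ({0<..} \<times> {0<..}) p *\<^sub>R (case p of (r, t) => T r t))"
  by (auto simp: F_def)
 ultimately have Fm: "(%(r, t). F r t) \<in> borel_measurable (borel \<Otimes>\<^sub>M borel)"
  by (simp only: borel_prod)
 then have Fm': "(%(r, t). F r t) \<in> borel_measurable (lborel \<Otimes>\<^sub>M lborel)" by simp
 have Fi: "integrable (lborel \<Otimes>\<^sub>M lborel) (%(r, t). F r t)"
 proof (rule integrableI_bounded[OF Fm'])
  have "(\<integral>\<^sup>+p. ennreal (norm (case p of (r, t) => F r t)) \<partial>(lborel \<Otimes>\<^sub>M lborel))
   \<le> (\<integral>\<^sup>+p. ennreal C * ennreal (ray_weight ep (fst p)) * ennreal (ray_weight ep' (snd p)) \<partial>(lborel \<Otimes>\<^sub>M lborel))"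
  proof (rule nn_integral_mono)
   fix p :: "real \<times> real"
   have "norm (case p of (r, t) => F r t) \<le> C * ray_weight ep (fst p) * ray_weight ep' (snd p)"
    using bd[of "fst p" "snd p"] C
    by (auto simp: F_def indicator_def case_prod_beta ray_weight_nonneg split: if_splits)
   then show "ennreal (norm (case p of (r, t) => F r t)) \<le> ennreal C * ennreal (ray_weight ep (fst p)) * ennreal (ray_weight ep' (snd p))"
    using C by (simp add: ennreal_mult[symmetric] ray_weight_nonneg ennreal_leI)
  qed
  also have "\<dots> = (\<integral>\<^sup>+r. \<integral>\<^sup>+t. ennreal C * ennreal (ray_weight ep r) * ennreal (ray_weight ep' t) \<partial>lborel \<partial>lborel)"
   by (subst lborel.nn_integral_fst[symmetric]) simp_all
  also have "\<dots> = ennreal C * ((\<integral>\<^sup>+r. ennreal (ray_weight ep r) \<partial>lborel) * (\<integral>\<^sup>+t. ennreal (ray_weight ep' t) \<partial>lborel))"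
   by (simp add: nn_integral_cmult nn_integral_multc mult.assoc)
  also have "\<dots> < \<infinity>" using nn_integral_ray_weight e by (simp add: ennreal_mult_less_top)
  finally show "(\<integral>\<^sup>+p. ennreal (norm (case p of (r, t) => F r t)) \<partial>(lborel \<Otimes>\<^sub>M lborel)) < \<infinity>" .
 qed
 have in1: "(LINT t|lborel. F r t) = indicator {0<..} r *\<^sub>R integral {0<..} (T r)" for r
 proof (cases "r > 0")
  case True
  have c: "continuous_on {0<..} (T r)"
   using True by (intro continuous_on_compose2[OF T, of "{0<..}" "%t. (r, t)", simplified]) (auto intro!: continuous_intros)
  have d: "ray_decay (C * ray_weight ep r) ep' (T r)" using bd True C by (subst ray_decay_iff) (auto simp: ray_weight_nonneg)
  have "(LINT t:{0<..}|lborel. T r t) = integral {0<..} (T r)"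
   by (rule set_integrable_ray(2)[OF c d e(2)]) (use C in \<open>simp add: ray_weight_nonneg\<close>)
  then show ?thesis using True by (simp add: F_def set_lebesgue_integral_def indicator_times)
 qed (simp add: F_def indicator_times)
 have in2: "(LINT r|lborel. F r t) = indicator {0<..} t *\<^sub>R integral {0<..} (%r. T r t)" for t
 proof (cases "t > 0")
  case True
  have c: "continuous_on {0<..} (%r. T r t)"
   using True by (intro continuous_on_compose2[OF T, of "{0<..}" "%r. (r, t)", simplified]) (auto intro!: continuous_intros)
  have d: "ray_decay (C * ray_weight ep' t) ep (%r. T r t)" using bd True C by (subst ray_decay_iff) (auto simp: ray_weight_nonneg mult_ac)
  have "(LINT r:{0<..}|lborel. T r t) = integral {0<..} (%r. T r t)"
   by (rule set_integrable_ray(2)[OF c d e(1)]) (use C in \<open>simp add: ray_weight_nonneg\<close>)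
  then show ?thesis using True by (simp add: F_def set_lebesgue_integral_def indicator_times)
 qed (simp add: F_def indicator_times)
 have "integrable lborel (%r. LINT t|lborel. F r t)" "integrable lborel (%t. LINT r|lborel. F r t)"
  using lborel_pair.integrable_fst'[OF Fi] lborel_pair.integrable_snd[OF Fi] by simp_all
 then have s1: "set_integrable lborel {0<..} (%r. integral {0<..} (T r))" and s2: "set_integrable lborel {0<..} (%t. integral {0<..} (%r. T r t))"
  by (simp_all add: set_integrable_def in1 in2)
 have "(LINT t|lborel. (LINT r|lborel. F r t)) = (LINT r|lborel. (LINT t|lborel. F r t))"
  by (rule lborel_pair.Fubini_integral[OF Fi])
 then have "(LINT t:{0<..}|lborel. integral {0<..} (%r. T r t)) = (LINT r:{0<..}|lborel. integral {0<..} (T r))"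
  by (simp add: set_lebesgue_integral_def in1 in2)
 then show ?thesis
  using set_borel_integral_eq_integral(2)[OF s1] set_borel_integral_eq_integral(2)[OF s2] by simp
qed

lemma ray_int_lincomb:
 assumes F: "continuous_on {0<..} (%r. F (rcis r ta))" "ray_decay C ep (%r. F (rcis r ta))" "ep > 0" "C \<ge> 0"
  and G: "continuous_on {0<..} (%r. G (rcis r ta))" "ray_decay C' ep' (%r. G (rcis r ta))" "ep' > 0" "C' \<ge> 0"
 shows "ray_int ta (%z. F z + c * G z) = ray_int ta F + c * ray_int ta G"
proof -
 have F': "(%r. F (rcis r ta) * cis ta) integrable_on {0<..}"
  using F by (intro integrable_on_mult_left ray_integral(1)[of _ C ep])
 have G': "(%r. c * (G (rcis r ta) * cis ta)) integrable_on {0<..}"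
  using G by (intro integrable_on_mult_right integrable_on_mult_left ray_integral(1)[of _ C' ep'])
 show ?thesis
  unfolding ray_int_def
  using Henstock_Kurzweil_Integration.integral_add[OF F' G'] by (simp add: ring_distribs mult.assoc)
qed

lemma log_decay_exp: "log_decay C ep F ta \<longleftrightarrow> (\<forall>u. cmod (F (exp (Complex u ta))) \<le> C * exp (- ep * \<bar>u\<bar>) / exp u)"
 by (simp add: log_decay_def pos_le_divide_eq)

text \<open>The denominator is bounded below in two ways. The bound by \<open>exp v\<close> keeps
  the full decay of \<open>f\<close>, with a constant depending on \<open>v\<close>; the bound by
  \<open>exp u\<close> yields \<open>log_decay\<close> with a constant uniform in
  \<open>v\<close>.\<close>

lemma h0_div:
 assumes f: "h0 C ep b f" and b: "b' \<le> b" and d: "dl > 0" "dl \<le> \<bar>tu\<bar> - b'" "\<bar>tu\<bar> + b' \<le> 2 * pi - dl" and b0: "b' > 0"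
 shows "h0 (C / (gap dl * exp v)) ep b' (%z. f z / (exp (Complex v tu) - z))"
  and "\<bar>ta\<bar> < b' ==> log_decay (C / gap dl) ep (%z. f z / (exp (Complex v tu) - z)) ta"
  and "\<bar>ta\<bar> < b' ==> gap dl * exp u \<le> cmod (exp (Complex v tu) - exp (Complex u ta))"
  and "gap dl > 0"
proof -
 show g: "gap dl > 0" using d b0 by (intro gap_pos) auto
 have e: "ep > 0" "C \<ge> 0" using f by (auto simp: h0_def)
 have gd: "gap dl * exp u \<le> cmod (exp (Complex v tu) - exp (Complex u ta))"
  "gap dl * exp v \<le> cmod (exp (Complex v tu) - exp (Complex u ta))" if "\<bar>ta\<bar> < b'" for u ta
 proof -
  have *: "dl \<le> \<bar>ta - tu\<bar>" "\<bar>ta - tu\<bar> \<le> 2 * pi - dl" using d that by linarith+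
  show "gap dl * exp u \<le> cmod (exp (Complex v tu) - exp (Complex u ta))"
   "gap dl * exp v \<le> cmod (exp (Complex v tu) - exp (Complex u ta))"
   by (subst norm_minus_commute, rule gap_dist[OF d(1) *])+
 qed
 then show "\<bar>ta\<bar> < b' ==> gap dl * exp u \<le> cmod (exp (Complex v tu) - exp (Complex u ta))" by blast
 have ne: "exp (Complex v tu) \<noteq> exp w" if "w \<in> strip (- b') b'" for w
 proof -
  have "0 < gap dl * exp v" using g by simp
  also have "\<dots> \<le> cmod (exp (Complex v tu) - exp (Complex (Re w) (Im w)))" using that by (intro gd) (auto simp: strip_def)
  finally show ?thesis by auto
 qed
 have fb: "cmod (f (exp (Complex u ta))) \<le> C * exp (- ep * \<bar>u\<bar>)" if "\<bar>ta\<bar> < b'" for u ta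
  using h0_bound[OF f] that b by simp
 show "h0 (C / (gap dl * exp v)) ep b' (%z. f z / (exp (Complex v tu) - z))"
  unfolding h0_def
 proof (intro conjI ballI)
  show "(%w. f (exp w) / (exp (Complex v tu) - exp w)) holomorphic_on strip (- b') b'"
   using f b ne unfolding h0_def by (intro holomorphic_intros) (auto intro: holomorphic_on_subset simp: strip_def)
  fix w assume w: "w \<in> strip (- b') b'"
  then have "\<bar>Im w\<bar> < b'" by (auto simp: strip_def)
  then have "cmod (f (exp (Complex (Re w) (Im w)))) / cmod (exp (Complex v tu) - exp (Complex (Re w) (Im w)))
   \<le> C * exp (- ep * \<bar>Re w\<bar>) / (gap dl * exp v)"
   using g e by (intro frac_le fb gd) auto
  then show "cmod (f (exp w) / (exp (Complex v tu) - exp w)) \<le> C / (gap dl * exp v) * exp (- ep * \<bar>Re w\<bar>)"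
   by (simp add: norm_divide)
 qed (use e g in auto)
 show "log_decay (C / gap dl) ep (%z. f z / (exp (Complex v tu) - z)) ta" if "\<bar>ta\<bar> < b'"
  unfolding log_decay_exp
 proof
  fix u
  have "cmod (f (exp (Complex u ta))) / cmod (exp (Complex v tu) - exp (Complex u ta)) \<le> C * exp (- ep * \<bar>u\<bar>) / (gap dl * exp u)"
   using g e that by (intro frac_le fb gd) auto
  then show "cmod (f (exp (Complex u ta)) / (exp (Complex v tu) - exp (Complex u ta))) \<le> C / gap dl * exp (- ep * \<bar>u\<bar>) / exp u"
   by (simp add: norm_divide)
 qed
qed

context sect_resolvent
begin

lemma functional_ray_decay:
 assumes f: "h0_ray C ep nu f" and nu: "s < nu" "nu < pi" and ta: "ta \<in> {nu, - nu}" and l: "bounded_clinear l"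
 shows "continuous_on {0<..} (%r. f (rcis r ta) * l (R (rcis r ta) x))"
  "ray_decay (C * (onorm l * M * norm x)) ep (%r. f (rcis r ta) * l (R (rcis r ta) x))"
  "C * (onorm l * M * norm x) \<ge> 0"
proof -
 have c: "continuous_on {0<..} (%r. R (rcis r ta) x)"
  by (rule continuous_on_ray[OF continuous_on_R]) (use angle_cosector'[OF nu ta] in auto)
 then have "continuous_on {0<..} (%r. l (R (rcis r ta) x))"
  by (rule bounded_linear.continuous_on[OF bounded_clinear_imp_bounded_linear[OF l]])
 then show "continuous_on {0<..} (%r. f (rcis r ta) * l (R (rcis r ta) x))"
  using f ta by (intro continuous_on_mult) (auto simp: h0_ray_def)
 have e: "ep > 0" "C \<ge> 0" using f by (auto simp: h0_ray_def)
 show K: "C * (onorm l * M * norm x) \<ge> 0"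
  using e M l by (auto simp: onorm_pos_le bounded_clinear_imp_bounded_linear)
 show "ray_decay (C * (onorm l * M * norm x)) ep (%r. f (rcis r ta) * l (R (rcis r ta) x))"
 proof (rule log_decay_ray_decay[OF _ e(1) K])
  show "log_decay (C * (onorm l * M * norm x)) ep (%z. f z * l (R z x)) ta"
   unfolding log_decay_def
  proof
   fix u
   let ?z = "exp (Complex u ta)"
   have "cmod (f ?z) * (cmod (l (R ?z x)) * cmod ?z) \<le> (C * exp (- ep * \<bar>u\<bar>)) * (onorm l * M * norm x)"
    using f ta e by (intro mult_mono functional_R_bound[OF l angle_cosector[OF nu ta]]) (auto simp: h0_ray_def)
   then show "cmod (f ?z * l (R ?z x)) * exp u \<le> C * (onorm l * M * norm x) * exp (- ep * \<bar>u\<bar>)"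
    by (simp add: norm_mult mult_ac)
  qed
 qed
qed

text \<open>The resolvent identity splits the integrand into (f(z) / (p - z)) R(z) and a scalar
  multiple of f(z) / (p - z). The latter has no pole between the two rays, so its contour integral
  vanishes by rotation.\<close>

theorem R_Phi:
 assumes f: "h0 C ep b f" and b: "b \<le> pi" and nu: "s < nu" "nu < b" and tu: "nu < \<bar>tu\<bar>" "\<bar>tu\<bar> < 2 * pi - nu"
  and p: "p = exp (Complex v tu)"
 shows "R p (Phi nu f x) = Phi nu (%z. f z / (p - z)) x"
proof (rule eq_functionalI)
 fix l :: "'a => complex" assume l: "bounded_clinear l"
 \<comment> \<open>An angle above \<open>nu\<close> that is separated from the argument of
   \<open>p\<close> both ways round, with margin \<open>dl\<close>.\<close>
 define b' where "b' = min b (min ((nu + \<bar>tu\<bar>) / 2) ((nu + (2 * pi - \<bar>tu\<bar>)) / 2))"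
 define dl where "dl = min (\<bar>tu\<bar> - b') (2 * pi - \<bar>tu\<bar> - b')"
 have b': "nu < b'" "b' \<le> b" using nu tu by (auto simp: b'_def)
 have d: "dl > 0" "dl \<le> \<bar>tu\<bar> - b'" "\<bar>tu\<bar> + b' \<le> 2 * pi - dl"
  using tu by (auto simp: dl_def b'_def min_def)
 have b0: "b' > 0" using b' nu s by simp
 note hd = h0_div[OF f b'(2) d b0]
 have nupi: "nu < pi" using nu b by simp
 have e: "ep > 0" "C \<ge> 0" using f by (auto simp: h0_def)
 have pc: "p \<in> cosector s" unfolding p using nu tu s by (intro exp_in_cosector) auto
 have fr: "h0_ray C ep nu f" using f nu s by (intro h0_imp_h0_ray) auto
 define F where "F = (%z. f z / (p - z))"
 have Fh: "h0 (C / (gap dl * exp v)) ep b' F" using hd(1)[of v] by (simp add: F_def p)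
 have Fr: "h0_ray (C / (gap dl * exp v)) ep nu F" using Fh b' nu s by (intro h0_imp_h0_ray) auto
 have dec: "log_decay (C / gap dl) ep F ta" if "\<bar>ta\<bar> < b'" for ta using hd(2)[OF that, of v] by (simp add: F_def p)
 have Fc: "continuous_on {0<..} (%r. F (rcis r ta))" if "ta \<in> {nu, - nu}" for ta using Fr that by (auto simp: h0_ray_def)
 have K: "C / gap dl \<ge> 0" using e hd(4) by simp
 have zero: "ray_int (- nu) F = ray_int nu F"
  by (rule ray_int_rotate[of F "- b'" b' "- nu" nu "C / gap dl" ep])
   (use Fh b' nu s e K in \<open>auto simp: h0_def intro!: Fc dec\<close>)
 have lR: "bounded_clinear (%y. l (R p y))" by (rule bounded_clinear_compose[OF l R_clinear[OF pc]])
 have "ray_int ta (%z. f z * l (R p (R z x))) = ray_int ta (%z. F z * l (R z x)) + (- l (R p x)) * ray_int ta F" if ta: "ta \<in> {nu, - nu}" for ta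
 proof -
  have eq: "f z * l (R p (R z x)) = F z * l (R z x) + (- l (R p x)) * F z" if z: "z = rcis r ta" "r > 0" for z r
  proof -
   have zc: "z \<in> cosector s" using angle_cosector'[OF nu(1) nupi ta z(2)] z(1) by simp
   have "gap dl * exp (ln r) \<le> cmod (p - exp (Complex (ln r) ta))"
    unfolding p by (rule hd(3)) (use ta b' nu s in auto)
   then have "gap dl * r \<le> cmod (p - z)" using z by (simp add: exp_Complex)
   moreover have "gap dl * r > 0" using hd(4) z by simp
   ultimately have pz: "p - z \<noteq> 0" by auto
   have "l (R z x) - l (R p x) = l (R z x - R p x)" using l by (simp add: bounded_clinear_def bounded_linear.linear linear_diff)
   also have "\<dots> = (p - z) * l (R p (R z x))"
    by (simp add: R_identity[OF zc pc] functional_scaleC[OF l] R_commute[OF zc pc])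
   finally have "l (R p (R z x)) = (l (R z x) - l (R p x)) / (p - z)" using pz by (simp add: field_simps)
   show ?thesis unfolding \<open>l (R p (R z x)) = _\<close> by (simp add: F_def diff_divide_distrib algebra_simps)
  qed
  have "ray_int ta (%z. f z * l (R p (R z x))) = ray_int ta (%z. F z * l (R z x) + (- l (R p x)) * F z)"
   unfolding ray_int_def by (rule Henstock_Kurzweil_Integration.integral_cong) (subst eq[OF refl], auto)
  also have "\<dots> = ray_int ta (%z. F z * l (R z x)) + (- l (R p x)) * ray_int ta F"
  proof (rule ray_int_lincomb[OF functional_ray_decay(1,2)[OF Fr nu(1) nupi ta l] e(1) functional_ray_decay(3)[OF Fr nu(1) nupi ta l]])
   show "ray_decay (C / gap dl) ep (%r. F (rcis r ta))"
    using ta b' nu s e K by (intro log_decay_ray_decay dec) auto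
  qed (use Fc ta e K in auto)
  finally show ?thesis .
 qed
 then show "l (R p (Phi nu f x)) = l (Phi nu (%z. f z / (p - z)) x)"
  unfolding functional_Phi[OF fr nu(1) nupi lR] F_def[symmetric] functional_Phi[OF Fr nu(1) nupi l]
  by (simp add: zero)
qed

end

lemma ray_decay_mult_bounded:
 fixes F G :: "real => complex"
 assumes "ray_decay C ep F" "\<And>r. r > 0 ==> cmod (G r) \<le> B" "C \<ge> 0"
 shows "ray_decay (C * B) ep (%r. F r * G r)"
proof -
 have B: "B \<ge> 0" using order_trans[OF norm_ge_zero assms(2)[of 1]] by simp
 have "cmod (F r * G r) \<le> C * B * ray_weight ep r" if "r > 0" for r
 proof -
  have "cmod (F r) * cmod (G r) \<le> (C * ray_weight ep r) * B"
   using assms that by (intro mult_mono) (auto simp: ray_decay_iff ray_weight_nonneg)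
  then show ?thesis by (simp add: norm_mult mult_ac)
 qed
 then show ?thesis using assms B by (subst ray_decay_iff) auto
qed

lemma h0_uminus: "h0 C ep b f ==> h0 C ep b (%z. - f z)"
 unfolding h0_def by (auto intro!: holomorphic_intros)

context sect_resolvent
begin

text \<open>The resolvent identity for \<open>z\<close> on the inner and \<open>w\<close> on the
  outer contour. Cauchy's formula in \<open>w\<close> produces \<open>g z\<close>; the remaining
  double integral vanishes when \<open>z\<close> is integrated first, since the pole
  \<open>w\<close> lies outside the inner contour.\<close>

lemma Phi_mult_aux:
 assumes f: "h0 C ep b f" and g: "h0 C' ep' b g" and b: "b \<le> pi" and nu: "s < nu1" "nu1 < nu2" "nu2 < b"
 shows "Phi nu1 f (Phi nu2 g x) = Phi nu1 (%z. f z * g z) x"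
proof (rule eq_functionalI)
 fix l :: "'a => complex" assume l: "bounded_clinear l"
 define c where "c = 1 / (2 * complex_of_real pi * \<i>)"
 define y where "y = Phi nu2 g x"
 define q where "q w = l (R w x)" for w
 have e: "ep > 0" "C \<ge> 0" "ep' > 0" "C' \<ge> 0" using f g by (auto simp: h0_def)
 have nu1: "s < nu1" "nu1 < pi" and nu2: "s < nu2" "nu2 < pi" using nu b by auto
 define dl where "dl = min (nu2 - nu1) (2 * pi - nu1 - nu2)"
 have dl: "dl > 0" "dl \<le> nu2 - nu1" "nu1 + nu2 \<le> 2 * pi - dl" using nu b by (auto simp: dl_def)
 have \<kappa>: "gap dl > 0" using dl nu s b by (intro gap_pos) auto
 have gd: "gap dl * r \<le> cmod (rcis r ta1 - rcis t ta2)" "gap dl * t \<le> cmod (rcis r ta1 - rcis t ta2)" "rcis r ta1 \<noteq> rcis t ta2"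
  if "ta1 \<in> {nu1, - nu1}" "ta2 \<in> {nu2, - nu2}" "r > 0" "t > 0" for r t ta1 ta2
 proof -
  have *: "dl \<le> \<bar>ta1 - ta2\<bar>" "\<bar>ta1 - ta2\<bar> \<le> 2 * pi - dl" using that dl nu s by auto
  show 1: "gap dl * r \<le> cmod (rcis r ta1 - rcis t ta2)" "gap dl * t \<le> cmod (rcis r ta1 - rcis t ta2)"
   using gap_dist(1)[OF dl(1) *, where u = "ln r" and v = "ln t"] gap_dist(2)[OF dl(1) *, where u = "ln r" and v = "ln t"] that
   by (simp_all add: exp_Complex)
  have "gap dl * r > 0" using \<kappa> that by simp
  then show "rcis r ta1 \<noteq> rcis t ta2" using 1 by auto
 qed
 have fr: "h0_ray C ep nu1 f" and gr1: "h0_ray C' ep' nu1 g" and gr2: "h0_ray C' ep' nu2 g"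
  by (rule h0_imp_h0_ray[OF f] h0_imp_h0_ray[OF g]; use nu s in simp)+
 have fg: "h0 (C * C') (ep + ep') b (%z. f z * g z)" by (rule h0_mult[OF f g])
 have fgr: "h0_ray (C * C') (ep + ep') nu1 (%z. f z * g z)" by (rule h0_imp_h0_ray[OF fg]) (use nu s in simp)
 define K where "K = C' * (onorm l * M * norm x)"
 have gq: "continuous_on {0<..} (%t. g (rcis t ta) * q (rcis t ta))" "ray_decay K ep' (%t. g (rcis t ta) * q (rcis t ta))" "K \<ge> 0"
  if "ta \<in> {nu2, - nu2}" for ta
  using functional_ray_decay[OF gr2 nu2 that l, of x] by (simp_all add: q_def K_def)
 have K: "K \<ge> 0" using gq(3)[of nu2] by simp
 have gc: "continuous_on {0<..} (%t. g (rcis t ta))" if "ta \<in> {nu2, - nu2}" for ta using gr2 that by (auto simp: h0_ray_def)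
 have fc: "continuous_on {0<..} (%t. f (rcis t ta))" if "ta \<in> {nu1, - nu1}" for ta using fr that by (auto simp: h0_ray_def)
 define J where "J z = ray_int (- nu2) (%w. g w * q w / (z - w)) - ray_int nu2 (%w. g w * q w / (z - w))" for z
 have Adec: "continuous_on {0<..} (%t. g (rcis t ta2) * q (rcis t ta2) / (rcis r ta1 - rcis t ta2))"
  "ray_decay (K * (1 / (gap dl * r))) ep' (%t. g (rcis t ta2) * q (rcis t ta2) / (rcis r ta1 - rcis t ta2))"
  if th: "ta1 \<in> {nu1, - nu1}" "ta2 \<in> {nu2, - nu2}" "r > 0" for r ta1 ta2
 proof -
  show "continuous_on {0<..} (%t. g (rcis t ta2) * q (rcis t ta2) / (rcis r ta1 - rcis t ta2))"
   using gd(3)[OF th] by (intro continuous_on_divide gq(1)[OF th(2)]) (auto simp: rcis_def intro!: continuous_intros)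
  have "ray_decay (K * (1 / (gap dl * r))) ep' (%t. (g (rcis t ta2) * q (rcis t ta2)) * (1 / (rcis r ta1 - rcis t ta2)))"
  proof (rule ray_decay_mult_bounded[OF gq(2)[OF th(2)] _ K])
   fix t :: real assume "t > 0"
   then show "cmod (1 / (rcis r ta1 - rcis t ta2)) \<le> 1 / (gap dl * r)"
    using gd(1)[OF th] \<kappa> th(3) by (auto simp: norm_divide intro!: frac_le)
  qed
  then show "ray_decay (K * (1 / (gap dl * r))) ep' (%t. g (rcis t ta2) * q (rcis t ta2) / (rcis r ta1 - rcis t ta2))"
   by simp
 qed
 \<comment> \<open>For fixed \<open>z\<close> on the inner contour, the scalar part of the resolvent
   identity is a Cauchy integral enclosing \<open>z\<close>; what is left over is
   \<open>J z\<close>.\<close>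
 have stepA: "l (R z y) = g z * q z + c * J z" if th: "ta1 \<in> {nu1, - nu1}" and r: "r > 0" and z: "z = rcis r ta1" for z r ta1
 proof -
  have zc: "z \<in> cosector s" unfolding z by (rule angle_cosector'[OF nu1 th r])
  have lz: "bounded_clinear (%u. l (R z u))" by (rule bounded_clinear_compose[OF l R_clinear[OF zc]])
  have z': "z = exp (Complex (ln r) ta1)" using r by (simp add: z exp_Complex)
  have Bdec: "log_decay (C' / gap dl) ep' (%w. g w / (w - z)) ta2" if th2: "ta2 \<in> {nu2, - nu2}" for ta2
   unfolding log_decay_exp
  proof
   fix u
   have "gap dl * exp u \<le> cmod (exp (Complex u ta2) - z)"
    using gd(2)[OF th th2 r, of "exp u"] by (simp add: z exp_Complex norm_minus_commute)
   then have "cmod (g (exp (Complex u ta2))) / cmod (exp (Complex u ta2) - z) \<le> C' * exp (- ep' * \<bar>u\<bar>) / (gap dl * exp u)"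
    using gr2 th2 \<kappa> e by (intro frac_le) (auto simp: h0_ray_def)
   then show "cmod (g (exp (Complex u ta2)) / (exp (Complex u ta2) - z)) \<le> C' / gap dl * exp (- ep' * \<bar>u\<bar>) / exp u"
    by (simp add: norm_divide)
  qed
  have C\<kappa>: "C' / gap dl \<ge> 0" using e \<kappa> by simp
  have Bc: "continuous_on {0<..} (%t. g (rcis t ta2) / (rcis t ta2 - z))" if th2: "ta2 \<in> {nu2, - nu2}" for ta2
   using gd(3)[OF th th2 r, THEN not_sym] by (intro continuous_on_divide gc[OF th2]) (auto simp: rcis_def z intro!: continuous_intros)
  have split: "ray_int ta2 (%w. g w * l (R z (R w x))) = ray_int ta2 (%w. g w * q w / (z - w)) + q z * ray_int ta2 (%w. g w / (w - z))"
   if th2: "ta2 \<in> {nu2, - nu2}" for ta2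
  proof -
   have eq: "g w * l (R z (R w x)) = g w * q w / (z - w) + q z * (g w / (w - z))" if w: "w = rcis t ta2" "t > 0" for w t
   proof -
    have wc: "w \<in> cosector s" unfolding w by (rule angle_cosector'[OF nu2 th2 w(2)])
    have zw: "z - w \<noteq> 0" using gd(3)[OF th th2 r w(2)] by (simp add: z w)
    have "q w - q z = l (R w x - R z x)" using l by (simp add: q_def bounded_clinear_def bounded_linear.linear linear_diff)
    also have "\<dots> = (z - w) * l (R z (R w x))"
     by (simp add: R_identity[OF wc zc] functional_scaleC[OF l] R_commute[OF wc zc])
    finally have 1: "l (R z (R w x)) = (q w - q z) / (z - w)" using zw by (simp add: field_simps)
    have 2: "g w / (w - z) = - (g w / (z - w))" using minus_divide_right[of "g w" "z - w"] by simp
    show ?thesis unfolding 1 2 by (simp add: diff_divide_distrib algebra_simps)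
   qed
   have "ray_int ta2 (%w. g w * l (R z (R w x))) = ray_int ta2 (%w. g w * q w / (z - w) + q z * (g w / (w - z)))"
    unfolding ray_int_def by (rule Henstock_Kurzweil_Integration.integral_cong) (subst eq[OF refl], auto)
   also have "\<dots> = ray_int ta2 (%w. g w * q w / (z - w)) + q z * ray_int ta2 (%w. g w / (w - z))"
   proof (rule ray_int_lincomb)
    show "continuous_on {0<..} (%t. g (rcis t ta2) * q (rcis t ta2) / (z - rcis t ta2))"
     "ray_decay (K * (1 / (gap dl * r))) ep' (%t. g (rcis t ta2) * q (rcis t ta2) / (z - rcis t ta2))"
     using Adec[OF th th2 r] by (simp_all add: z)
    show "ray_decay (C' / gap dl) ep' (%t. g (rcis t ta2) / (rcis t ta2 - z))"
     using log_decay_ray_decay[OF Bdec[OF th2] e(3) C\<kappa>] .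
   qed (use Bc[OF th2] e K \<kappa> r C\<kappa> in auto)
   finally show ?thesis .
  qed
  have "ray_int (- nu2) (%w. g w / (w - z)) - ray_int nu2 (%w. g w / (w - z)) = 2 * pi * \<i> * g z"
  proof (rule ray_int_Cauchy[OF _ _ _ _ _ z'])
   show "(%w. g (exp w)) holomorphic_on strip (- b) b" using g by (simp add: h0_def)
   show "log_decay (C' / gap dl) ep' (%w. g w / (w - z)) (- nu2)" "log_decay (C' / gap dl) ep' (%w. g w / (w - z)) nu2"
    by (rule Bdec; simp)+
   fix w assume "- nu2 \<le> Im w" "Im w \<le> nu2"
   then have "cmod (g (exp (Complex (Re w) (Im w)))) \<le> C' * exp (- ep' * \<bar>Re w\<bar>)"
    using nu by (intro h0_bound[OF g]) auto
   then have "cmod (g (exp w)) * exp (Re w) \<le> (C' * exp (- ep' * \<bar>Re w\<bar>)) * (1 + exp (Re w))"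
    using e by (intro mult_mono) auto
   then show "cmod (g (exp w)) * exp (Re w) \<le> C' * (1 + exp (Re w)) * exp (- ep' * \<bar>Re w\<bar>)" by (simp add: mult_ac)
  qed (use nu s b th e C\<kappa> gc in auto)
  moreover have "l (R z y) = c * (ray_int (- nu2) (%w. g w * l (R z (R w x))) - ray_int nu2 (%w. g w * l (R z (R w x))))"
   unfolding y_def c_def by (rule functional_Phi[OF gr2 nu2 lz])
  ultimately have "l (R z y) = c * J z + c * (q z * (2 * pi * \<i> * g z))"
   by (simp add: split J_def algebra_simps)
  moreover have "c * (q z * (2 * pi * \<i> * g z)) = (c * (2 * pi * \<i>)) * (g z * q z)" by (simp only: mult_ac)
  moreover have "c * (2 * pi * \<i>) = 1" by (simp add: c_def)
  ultimately show ?thesis by (simp only: add.commute mult_1_left)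
 qed
 \<comment> \<open>\<open>D\<close> is the difference of the two integrands to be compared. On the
   rays it equals \<open>c * f z * J z\<close>, so its contour integral is a double integral, with
   integrand \<open>T\<close> up to a constant.\<close>
 define D where "D z = f z * l (R z y) + (-1) * (f z * g z * q z)" for z
 have Dray: "D (rcis r ta) = c * (f (rcis r ta) * J (rcis r ta))" if "ta \<in> {nu1, - nu1}" "r > 0" for r ta
  using stepA[OF that refl] by (simp add: D_def algebra_simps)
 note fd = functional_ray_decay[OF fr nu1 _ l]
 note fgd = functional_ray_decay[OF fgr nu1 _ l]
 have Dint: "ray_int ta D = ray_int ta (%z. f z * l (R z y)) + (-1) * ray_int ta (%z. f z * g z * q z)"
  "(%r. D (rcis r ta) * cis ta) integrable_on {0<..}" if th: "ta \<in> {nu1, - nu1}" for ta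
 proof -
  show "ray_int ta D = ray_int ta (%z. f z * l (R z y)) + (-1) * ray_int ta (%z. f z * g z * q z)"
   unfolding D_def q_def
   by (rule ray_int_lincomb[OF fd(1,2)[OF th] e(1) fd(3)[OF th] fgd(1,2)[OF th] _ fgd(3)[OF th]]) (use e in simp)
  have 1: "(%r. f (rcis r ta) * l (R (rcis r ta) y) * cis ta) integrable_on {0<..}"
   by (rule integrable_on_mult_left[OF ray_integral(1)[OF fd(1,2)[OF th] e(1) fd(3)[OF th]]])
  have 2: "(%r. (-1) * (f (rcis r ta) * g (rcis r ta) * l (R (rcis r ta) x) * cis ta)) integrable_on {0<..}"
   by (intro integrable_on_mult_right integrable_on_mult_left ray_integral(1)[OF fgd(1,2)[OF th] _ fgd(3)[OF th]]) (use e in simp)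
  show "(%r. D (rcis r ta) * cis ta) integrable_on {0<..}"
   using integrable_add[OF 1 2] by (simp add: D_def q_def ring_distribs)
 qed
 define k where "k ta1 ta2 r t = f (rcis r ta1) * cis ta1 * (g (rcis t ta2) * q (rcis t ta2) / (rcis r ta1 - rcis t ta2) * cis ta2)" for ta1 ta2 r t
 define T where "T r t = (k (- nu1) (- nu2) r t - k (- nu1) nu2 r t) - (k nu1 (- nu2) r t - k nu1 nu2 r t)" for r t
 have kt: "(k ta1 ta2 r) integrable_on {0<..}" "integral {0<..} (k ta1 ta2 r) = f (rcis r ta1) * cis ta1 * ray_int ta2 (%w. g w * q w / (rcis r ta1 - w))"
  if "ta1 \<in> {nu1, - nu1}" "ta2 \<in> {nu2, - nu2}" "r > 0" for ta1 ta2 r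
 proof -
  have i: "(%t. g (rcis t ta2) * q (rcis t ta2) / (rcis r ta1 - rcis t ta2) * cis ta2) integrable_on {0<..}"
   by (rule integrable_on_mult_left[OF ray_integral(1)[OF Adec[OF that] e(3)]]) (use K \<kappa> that in simp)
  show "(k ta1 ta2 r) integrable_on {0<..}" unfolding k_def by (rule integrable_on_mult_right[OF i])
  show "integral {0<..} (k ta1 ta2 r) = f (rcis r ta1) * cis ta1 * ray_int ta2 (%w. g w * q w / (rcis r ta1 - w))"
   unfolding k_def ray_int_def by (simp only: integral_mult_right)
 qed
 have stepB: "integral {0<..} (T r) = (1 / c) * (D (rcis r (- nu1)) * cis (- nu1) - D (rcis r nu1) * cis nu1)" if r: "r > 0" for r
 proof -
  have "integral {0<..} (T r) = (integral {0<..} (k (- nu1) (- nu2) r) - integral {0<..} (k (- nu1) nu2 r))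
    - (integral {0<..} (k nu1 (- nu2) r) - integral {0<..} (k nu1 nu2 r))"
   unfolding T_def using kt(1)[OF _ _ r]
   by (simp add: Henstock_Kurzweil_Integration.integral_diff integrable_diff)
  also have "\<dots> = f (rcis r (- nu1)) * cis (- nu1) * J (rcis r (- nu1)) - f (rcis r nu1) * cis nu1 * J (rcis r nu1)"
   using kt(2)[OF _ _ r] by (simp add: J_def algebra_simps)
  also have "\<dots> = (1 / c) * (D (rcis r (- nu1)) * cis (- nu1) - D (rcis r nu1) * cis nu1)"
   using Dray[OF _ r] by (simp add: c_def algebra_simps)
  finally show ?thesis .
 qed
 \<comment> \<open>An angle between the contours: \<open>f z / (z - w)\<close> is holomorphic in the
   strip of half-width \<open>b'\<close> for every \<open>w\<close> on the outer contour.\<close>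
 define b' where "b' = (nu1 + nu2) / 2"
 define dl' where "dl' = min (nu2 - b') (2 * pi - nu2 - b')"
 have b': "nu1 < b'" "b' < nu2" "b' \<le> b" "b' > 0" using nu s by (auto simp: b'_def)
 have hd: "h0 (C / (gap dl' * t)) ep b' (%z. f z / (z - rcis t ta2))"
  "\<bar>ta\<bar> < b' ==> log_decay (C / gap dl') ep (%z. f z / (z - rcis t ta2)) ta" "gap dl' > 0"
  if "ta2 \<in> {nu2, - nu2}" "t > 0" for ta ta2 t
 proof -
  have d: "dl' > 0" "dl' \<le> \<bar>ta2\<bar> - b'" "\<bar>ta2\<bar> + b' \<le> 2 * pi - dl'"
   using that b' nu b s by (auto simp: dl'_def)
  have m: "- f z / (exp (Complex (ln t) ta2) - z) = f z / (z - rcis t ta2)" for z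
   using that minus_divide_divide[of "f z" "z - rcis t ta2"] by (simp add: exp_Complex)
  note h = h0_div[OF h0_uminus[OF f] b'(3) d b'(4)]
  show "h0 (C / (gap dl' * t)) ep b' (%z. f z / (z - rcis t ta2))" using h(1)[where v = "ln t", unfolded m] that by simp
  show "\<bar>ta\<bar> < b' ==> log_decay (C / gap dl') ep (%z. f z / (z - rcis t ta2)) ta" by (rule h(2)[where v = "ln t", unfolded m])
  show "gap dl' > 0" by (rule h(4))
 qed
 have \<kappa>': "gap dl' > 0" using hd(3)[of nu2 1] by simp
 have C\<kappa>': "C / gap dl' \<ge> 0" using e \<kappa>' by simp
 have fdc: "continuous_on {0<..} (%r. f (rcis r ta1) / (rcis r ta1 - rcis t ta2))" "ray_decay (C / gap dl') ep (%r. f (rcis r ta1) / (rcis r ta1 - rcis t ta2))"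
  if "ta1 \<in> {nu1, - nu1}" "ta2 \<in> {nu2, - nu2}" "t > 0" for ta1 ta2 t
 proof -
  show "continuous_on {0<..} (%r. f (rcis r ta1) / (rcis r ta1 - rcis t ta2))"
   using gd(3)[OF that(1,2) _ that(3)] by (intro continuous_on_divide fc[OF that(1)]) (auto simp: rcis_def intro!: continuous_intros)
  have "\<bar>ta1\<bar> < b'" using that b' nu s by auto
  then show "ray_decay (C / gap dl') ep (%r. f (rcis r ta1) / (rcis r ta1 - rcis t ta2))"
   using log_decay_ray_decay[OF hd(2)[OF that(2,3)] e(1) C\<kappa>'] by blast
 qed
 have kr: "(%r. k ta1 ta2 r t) integrable_on {0<..}" "integral {0<..} (%r. k ta1 ta2 r t) = g (rcis t ta2) * q (rcis t ta2) * cis ta2 * ray_int ta1 (%z. f z / (z - rcis t ta2))"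
  if "ta1 \<in> {nu1, - nu1}" "ta2 \<in> {nu2, - nu2}" "t > 0" for ta1 ta2 t
 proof -
  have k: "(%r. k ta1 ta2 r t) = (%r. g (rcis t ta2) * q (rcis t ta2) * cis ta2 * (f (rcis r ta1) / (rcis r ta1 - rcis t ta2) * cis ta1))"
   by (simp add: k_def fun_eq_iff)
  have i: "(%r. f (rcis r ta1) / (rcis r ta1 - rcis t ta2) * cis ta1) integrable_on {0<..}"
   by (rule integrable_on_mult_left[OF ray_integral(1)[OF fdc[OF that] e(1) C\<kappa>']])
  show "(%r. k ta1 ta2 r t) integrable_on {0<..}" unfolding k by (rule integrable_on_mult_right[OF i])
  show "integral {0<..} (%r. k ta1 ta2 r t) = g (rcis t ta2) * q (rcis t ta2) * cis ta2 * ray_int ta1 (%z. f z / (z - rcis t ta2))"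
   unfolding k ray_int_def by (simp only: integral_mult_right)
 qed
 have rot: "ray_int (- nu1) (%z. f z / (z - rcis t ta2)) = ray_int nu1 (%z. f z / (z - rcis t ta2))"
  if "ta2 \<in> {nu2, - nu2}" "t > 0" for ta2 t
  by (rule ray_int_rotate[of "%z. f z / (z - rcis t ta2)" "- b'" b' "- nu1" nu1 "C / gap dl'" ep])
   (use hd(1)[OF that] b' nu s e C\<kappa>' fdc(1)[OF _ that] in \<open>auto simp: h0_def intro!: hd(2)[OF that]\<close>)
 \<comment> \<open>In the other order of integration, the inner integral is the difference of two
   ray integrals that agree by rotation.\<close>
 have stepC: "integral {0<..} (%r. T r t) = 0" if t: "t > 0" for t
 proof -
  have "integral {0<..} (%r. T r t) = (integral {0<..} (%r. k (- nu1) (- nu2) r t) - integral {0<..} (%r. k (- nu1) nu2 r t))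
    - (integral {0<..} (%r. k nu1 (- nu2) r t) - integral {0<..} (%r. k nu1 nu2 r t))"
   unfolding T_def using kr(1)[OF _ _ t]
   by (simp add: Henstock_Kurzweil_Integration.integral_diff integrable_diff)
  also have "\<dots> = 0" using kr(2)[OF _ _ t] rot[OF _ t] by simp
  finally show ?thesis .
 qed
 have kb: "cmod (k ta1 ta2 r t) \<le> C / gap dl' * K * ray_weight ep r * ray_weight ep' t"
  if "ta1 \<in> {nu1, - nu1}" "ta2 \<in> {nu2, - nu2}" "r > 0" "t > 0" for ta1 ta2 r t
 proof -
  have "cmod (k ta1 ta2 r t) = cmod (f (rcis r ta1) / (rcis r ta1 - rcis t ta2)) * cmod (g (rcis t ta2) * q (rcis t ta2))"
   by (simp add: k_def norm_mult norm_divide)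
  also have "\<dots> \<le> (C / gap dl' * ray_weight ep r) * (K * ray_weight ep' t)"
  proof (rule mult_mono[OF _ _ mult_nonneg_nonneg[OF C\<kappa>' ray_weight_nonneg] norm_ge_zero])
   show "cmod (f (rcis r ta1) / (rcis r ta1 - rcis t ta2)) \<le> C / gap dl' * ray_weight ep r"
    using fdc(2)[OF that(1,2,4), unfolded ray_decay_iff[OF C\<kappa>']] that(3) by blast
   show "cmod (g (rcis t ta2) * q (rcis t ta2)) \<le> K * ray_weight ep' t"
    using gq(2)[OF that(2), unfolded ray_decay_iff[OF K]] that(4) by blast
  qed
  finally show ?thesis by (simp only: mult_ac)
 qed
 have kc: "continuous_on ({0<..} \<times> {0<..}) (%p. k ta1 ta2 (fst p) (snd p))"
  if "ta1 \<in> {nu1, - nu1}" "ta2 \<in> {nu2, - nu2}" for ta1 ta2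
  unfolding k_def
 proof (intro continuous_on_mult continuous_on_divide continuous_on_diff continuous_on_const)
  show "continuous_on ({0<..} \<times> {0<..}) (%p. f (rcis (fst p) ta1))"
   by (rule continuous_on_compose2[OF fc[OF that(1)]]) (auto intro!: continuous_intros)
  show "continuous_on ({0<..} \<times> {0<..}) (%p. g (rcis (snd p) ta2))"
   by (rule continuous_on_compose2[OF gc[OF that(2)]]) (auto intro!: continuous_intros)
  have "continuous_on {0<..} (%t. l (R (rcis t ta2) x))"
   by (intro bounded_linear.continuous_on[OF bounded_clinear_imp_bounded_linear[OF l]] continuous_on_ray[OF continuous_on_R])
    (use angle_cosector'[OF nu2 that(2)] in auto)
  then show "continuous_on ({0<..} \<times> {0<..}) (%p. q (rcis (snd p) ta2))"
   unfolding q_def by (rule continuous_on_compose2) (auto intro!: continuous_intros)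
 qed (use gd(3)[OF that] in \<open>auto simp: rcis_def intro!: continuous_intros\<close>)
 have "integral {0<..} (%r. integral {0<..} (T r)) = integral {0<..} (%t. integral {0<..} (%r. T r t))"
 proof (rule ray_Fubini[OF _ e(1,3)])
  show "continuous_on ({0<..} \<times> {0<..}) (%(r, t). T r t)"
   unfolding T_def case_prod_beta by (intro continuous_on_diff kc) auto
  show "4 * (C / gap dl' * K) \<ge> 0"
   by (rule mult_nonneg_nonneg[OF _ mult_nonneg_nonneg[OF C\<kappa>' K]]) simp
  fix r t :: real assume rt: "r > 0" "t > 0"
  let ?B = "C / gap dl' * K * ray_weight ep r * ray_weight ep' t"
  have "cmod (T r t) \<le> (cmod (k (- nu1) (- nu2) r t) + cmod (k (- nu1) nu2 r t)) + (cmod (k nu1 (- nu2) r t) + cmod (k nu1 nu2 r t))"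
   unfolding T_def by (rule order_trans[OF norm_triangle_ineq4 add_mono[OF norm_triangle_ineq4 norm_triangle_ineq4]])
  also have "\<dots> \<le> (?B + ?B) + (?B + ?B)" by (intro add_mono kb rt) auto
  finally show "cmod (T r t) \<le> 4 * (C / gap dl' * K) * ray_weight ep r * ray_weight ep' t" by simp
 qed
 also have "\<dots> = integral {0<..} (%t::real. 0)"
  by (rule Henstock_Kurzweil_Integration.integral_cong) (simp add: stepC)
 finally have F0: "integral {0<..} (%r. integral {0<..} (T r)) = 0" by simp
 have "integral {0<..} (%r. integral {0<..} (T r)) =
   integral {0<..} (%r. (1 / c) * (D (rcis r (- nu1)) * cis (- nu1) - D (rcis r nu1) * cis nu1))"
  by (rule Henstock_Kurzweil_Integration.integral_cong) (simp add: stepB)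
 also have "\<dots> = (1 / c) * (ray_int (- nu1) D - ray_int nu1 D)"
  unfolding ray_int_def using Dint(2)[of nu1] Dint(2)[of "- nu1"]
  by (simp only: integral_mult_right) (simp add: Henstock_Kurzweil_Integration.integral_diff)
 finally have "ray_int (- nu1) D = ray_int nu1 D" using F0 by (simp add: c_def)
 then have "ray_int (- nu1) (%z. f z * l (R z y)) - ray_int nu1 (%z. f z * l (R z y)) =
   ray_int (- nu1) (%z. f z * g z * q z) - ray_int nu1 (%z. f z * g z * q z)"
  using Dint(1)[of nu1] Dint(1)[of "- nu1"] by (simp add: algebra_simps)
 then show "l (Phi nu1 f (Phi nu2 g x)) = l (Phi nu1 (%z. f z * g z) x)"
  unfolding functional_Phi[OF fr nu1 l] functional_Phi[OF fgr nu1 l] y_def[symmetric] q_def by simp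
qed

text \<open>Angle independence moves the second contour outwards, as the proof for nested contours
  requires.\<close>

theorem Phi_mult:
 assumes f: "h0 C ep b f" and g: "h0 C' ep' b g" and b: "b \<le> pi" and nu: "s < nu" "nu < b"
 shows "Phi nu f (Phi nu g x) = Phi nu (%z. f z * g z) x"
proof -
 define nu2 where "nu2 = (nu + b) / 2"
 have n: "nu < nu2" "nu2 < b" using nu by (auto simp: nu2_def)
 have "Phi nu g x = Phi nu2 g x" using n nu by (intro Phi_angle_indep[OF g b]) auto
 then show ?thesis using Phi_mult_aux[OF f g b nu(1) n] by simp
qed

end

section \<open>The explicit symbols and the value of the regulariser\<close>

definition mx :: "real => real" where "mx u = max 1 (exp u)"

lemma mx: "mx u \<ge> 1" "mx u \<ge> exp u" "mx u > 0" "exp u / (mx u)\<^sup>2 = exp (- \<bar>u\<bar>)" "exp u = mx u * (mx u * exp (- \<bar>u\<bar>))"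
proof -
 show p: "mx u \<ge> 1" "mx u \<ge> exp u" "mx u > 0" by (auto simp: mx_def)
 show "exp u / (mx u)\<^sup>2 = exp (- \<bar>u\<bar>)"
  by (cases "u \<ge> 0") (auto simp: mx_def max_def power2_eq_square exp_minus field_simps)
 then show "exp u = mx u * (mx u * exp (- \<bar>u\<bar>))" using p by (simp add: power2_eq_square field_simps)
qed

lemma exp_minus1: "exp (Complex 0 pi) = -1" "exp (Complex 0 0) = 1"
 by (simp_all add: exp_Complex_eq)

lemma norm_1_plus_exp:
 assumes "\<bar>ta\<bar> < b" "b < pi"
 shows "gap (pi - b) * mx u \<le> cmod (1 + exp (Complex u ta))" "gap (pi - b) > 0"
proof -
 show g: "gap (pi - b) > 0" using assms by (intro gap_pos) auto
 have "gap (pi - b) * exp u \<le> cmod (exp (Complex u ta) - exp (Complex 0 pi))"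
  "gap (pi - b) * exp 0 \<le> cmod (exp (Complex u ta) - exp (Complex 0 pi))"
  by (rule gap_dist; use assms in auto)+
 then show "gap (pi - b) * mx u \<le> cmod (1 + exp (Complex u ta))"
  by (simp add: exp_minus1 mx_def max_def add.commute)
qed

lemma h0I:
 assumes "(%w. f (exp w)) holomorphic_on strip (- b) b" "ep > 0" "C \<ge> 0"
  "\<And>u ta. \<bar>ta\<bar> < b ==> cmod (f (exp (Complex u ta))) \<le> C * exp (- ep * \<bar>u\<bar>)"
 shows "h0 C ep b f"
 unfolding h0_def
proof (intro conjI ballI)
 fix w assume "w \<in> strip (- b) b"
 then show "cmod (f (exp w)) \<le> C * exp (- ep * \<bar>Re w\<bar>)"
  using assms(4)[of "Im w" "Re w"] by (auto simp: strip_def)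
qed (use assms in auto)

lemma one_plus_exp_nonzero: "w \<in> strip (- b) b ==> b < pi ==> 1 + exp w \<noteq> 0"
proof -
 assume w: "w \<in> strip (- b) b" and b: "b < pi"
 have "\<bar>Im w\<bar> < b" using w by (auto simp: strip_def)
 note n = norm_1_plus_exp(1)[OF this b, of "Re w"] norm_1_plus_exp(2)[OF this b]
 have "0 < gap (pi - b) * mx (Re w)" using n(2) mx(3) by simp
 also note n(1)
 finally show ?thesis by auto
qed

lemma h0_regulariser:
 assumes b: "0 < b" "b < pi"
 shows "h0 (1 / (gap (pi - b))\<^sup>2) 1 b regulariser"
proof (rule h0I)
 show "(%w. regulariser (exp w)) holomorphic_on strip (- b) b"
  unfolding regulariser_def using one_plus_exp_nonzero[OF _ b(2)] by (intro holomorphic_intros) auto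
 fix u ta :: real assume ta: "\<bar>ta\<bar> < b"
 note n = norm_1_plus_exp(1)[OF ta b(2), of u] norm_1_plus_exp(2)[OF ta b(2)]
 have pos: "0 < gap (pi - b) * mx u" using n(2) mx(3) by simp
 have pos1: "0 < cmod (1 + exp (Complex u ta))" using pos n(1) by linarith
 have "cmod (regulariser (exp (Complex u ta))) = exp u / (cmod (1 + exp (Complex u ta)))\<^sup>2"
  by (simp add: regulariser_def norm_divide norm_power)
 also have "\<dots> \<le> exp u / (gap (pi - b) * mx u)\<^sup>2"
  by (intro divide_left_mono power_mono mult_pos_pos zero_less_power n(1) pos pos1) (use pos in auto)
 also have "\<dots> = 1 / (gap (pi - b))\<^sup>2 * (exp u / (mx u)\<^sup>2)" by (simp add: power_mult_distrib)
 finally show "cmod (regulariser (exp (Complex u ta))) \<le> 1 / (gap (pi - b))\<^sup>2 * exp (- 1 * \<bar>u\<bar>)"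
  by (simp add: mx(4))
qed auto

abbreviation rt :: "complex => complex" where "rt z \<equiv> z powr (1 / 2)"

lemma rt_exp: "\<bar>Im w\<bar> < pi ==> rt (exp w) = exp (w / 2)"
 by (simp add: powr_def)

lemma rt_square: "rt z * rt z = z"
 by (simp add: powr_add[symmetric] flip: powr_add)

text \<open>Where the contour integral has the factor \<open>rt z\<close> and a difference of two
  terms with an extra factor \<open>1 + z\<close>, division by this factor leaves
  \<open>chi\<close>. It satisfies chi z * ups z = z / (1 + z) * (regulariser z)^2.\<close>

definition chi :: "complex => complex" where "chi z = rt z / (1 + z)"

lemma h0_chi:
 assumes b: "0 < b" "b < pi"
 shows "h0 (1 / gap (pi - b)) (1 / 2) b chi"
proof (rule h0I)
 have "(%w. exp (w / 2) / (1 + exp w)) holomorphic_on strip (- b) b"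
  using one_plus_exp_nonzero[OF _ b(2)] by (intro holomorphic_intros) auto
 then show "(%w. chi (exp w)) holomorphic_on strip (- b) b"
  by (rule holomorphic_transform) (use b in \<open>auto simp: chi_def rt_exp strip_def\<close>)
 fix u ta :: real assume ta: "\<bar>ta\<bar> < b"
 note n = norm_1_plus_exp(1)[OF ta b(2), of u] norm_1_plus_exp(2)[OF ta b(2)]
 have pos: "0 < gap (pi - b) * mx u" using n(2) mx(3) by simp
 have pos1: "0 < cmod (1 + exp (Complex u ta))" using pos n(1) by linarith
 have r: "rt (exp (Complex u ta)) = exp (Complex u ta / 2)" using ta b by (intro rt_exp) auto
 have "cmod (chi (exp (Complex u ta))) = exp (u / 2) / cmod (1 + exp (Complex u ta))"
  unfolding chi_def r by (simp add: norm_divide)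
 also have "\<dots> \<le> exp (u / 2) / (gap (pi - b) * mx u)"
  by (intro divide_left_mono mult_pos_pos[OF pos1 pos] n(1)) auto
 also have "\<dots> = 1 / gap (pi - b) * exp (- (1 / 2) * \<bar>u\<bar>)"
  using n(2) by (cases "u \<ge> 0") (auto simp: mx_def max_def exp_minus field_simps simp flip: exp_add)
 finally show "cmod (chi (exp (Complex u ta))) \<le> 1 / gap (pi - b) * exp (- (1 / 2) * \<bar>u\<bar>)" .
qed (use b in \<open>auto intro!: less_imp_le gap_pos\<close>)

text \<open>The numerator of the product of two regularised square functions: the square of
  \<open>phi_fun\<close> supplies the root and a factor \<open>1 / (z - l)\<close>, and each of the
  two functions carries one \<open>regulariser\<close>.\<close>

definition ups :: "complex => complex" where "ups z = rt z * (regulariser z * regulariser z)"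

lemma h0_ups:
 assumes b: "0 < b" "b < pi"
 shows "h0 (1 / (gap (pi - b)) ^ 4) (3 / 2) b ups"
proof (rule h0I)
 note reg = h0_regulariser[OF b]
 have "(%w. exp (w / 2) * (regulariser (exp w) * regulariser (exp w))) holomorphic_on strip (- b) b"
  using reg by (intro holomorphic_intros) (auto simp: h0_def)
 then show "(%w. ups (exp w)) holomorphic_on strip (- b) b"
  by (rule holomorphic_transform) (use b in \<open>auto simp: ups_def rt_exp strip_def\<close>)
 fix u ta :: real assume ta: "\<bar>ta\<bar> < b"
 have r: "rt (exp (Complex u ta)) = exp (Complex u ta / 2)" using ta b by (intro rt_exp) auto
 define k where "k = 1 / (gap (pi - b))\<^sup>2 * exp (- 1 * \<bar>u\<bar>)"
 have k: "cmod (regulariser (exp (Complex u ta))) \<le> k" "k \<ge> 0" using h0_bound[OF reg ta, of u] by (simp_all add: k_def)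
 have "cmod (ups (exp (Complex u ta))) = exp (u / 2) * (cmod (regulariser (exp (Complex u ta))) * cmod (regulariser (exp (Complex u ta))))"
  unfolding ups_def r by (simp add: norm_mult)
 also have "\<dots> \<le> exp (\<bar>u\<bar> / 2) * (k * k)"
  using k by (intro mult_mono) auto
 also have "\<dots> = 1 / (gap (pi - b)) ^ 4 * exp (- (3 / 2) * \<bar>u\<bar>)"
 proof -
  have "exp (\<bar>u\<bar> / 2) * (exp (- \<bar>u\<bar>) * exp (- \<bar>u\<bar>)) = exp (- (3 / 2) * \<bar>u\<bar>)" by (simp flip: exp_add)
  then show ?thesis by (simp add: k_def power4_eq_xxxx power2_eq_square)
 qed
 finally show "cmod (ups (exp (Complex u ta))) \<le> 1 / (gap (pi - b)) ^ 4 * exp (- (3 / 2) * \<bar>u\<bar>)" .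
qed auto

text \<open>For \<open>h\<close> of order 1 / (1 + |z|), the quotient \<open>h z / (z - 1)\<close>
  decays like |z|^(-2). Such rational terms are split off when the contour integral of the
  regulariser is evaluated.\<close>

lemma ray_int_Cauchy_one:
 assumes h: "(%w. h (exp w)) holomorphic_on strip (- b) b" and nu: "0 < nu" "nu < b" "b < pi" and H: "H \<ge> 0"
  and bd': "\<forall>u ta. \<bar>ta\<bar> < b \<longrightarrow> cmod (h (exp (Complex u ta))) \<le> H / mx u"
 shows "ray_int (- nu) (%z. h z / (z - 1)) - ray_int nu (%z. h z / (z - 1)) = 2 * pi * \<i> * h 1"
  and "ta \<in> {nu, - nu} ==> continuous_on {0<..} (%r. h (rcis r ta) / (rcis r ta - 1))"
  and "ta \<in> {nu, - nu} ==> ray_decay (H / gap nu) 1 (%r. h (rcis r ta) / (rcis r ta - 1))"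
  and "H / gap nu \<ge> 0"
proof -
 note bd = bd'[rule_format]
 have g: "gap nu > 0" using nu by (intro gap_pos) auto
 then show H': "H / gap nu \<ge> 0" using H by simp
 have d: "gap nu * mx u \<le> cmod (exp (Complex u ta) - 1)" if "ta \<in> {nu, - nu}" for u ta
 proof -
  have "gap nu * exp u \<le> cmod (exp (Complex u ta) - exp (Complex 0 0))"
   "gap nu * exp 0 \<le> cmod (exp (Complex u ta) - exp (Complex 0 0))"
   by (rule gap_dist; use nu that in auto)+
  then show ?thesis by (simp add: exp_minus1 mx_def max_def)
 qed
 have ld: "log_decay (H / gap nu) 1 (%z. h z / (z - 1)) ta" if ta: "ta \<in> {nu, - nu}" for ta
  unfolding log_decay_def
 proof
  fix u
  have "cmod (h (exp (Complex u ta)) / (exp (Complex u ta) - 1)) * exp u \<le> (H / mx u) / (gap nu * mx u) * exp u"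
   unfolding norm_divide using g mx(3)[of u] H ta nu
   by (intro mult_right_mono frac_le bd d) auto
  also have "\<dots> = H / gap nu * (exp u / (mx u)\<^sup>2)" by (simp add: power2_eq_square)
  finally show "cmod (h (exp (Complex u ta)) / (exp (Complex u ta) - 1)) * exp u \<le> H / gap nu * exp (- 1 * \<bar>u\<bar>)"
   by (simp add: mx(4))
 qed
 show "ray_decay (H / gap nu) 1 (%r. h (rcis r ta) / (rcis r ta - 1))" if "ta \<in> {nu, - nu}"
  using log_decay_ray_decay[OF ld[OF that] _ H'] by simp
 have hc: "continuous_on {0<..} (%r. h (rcis r ta))" if "ta \<in> {nu, - nu}" for ta
  using nu that by (intro continuous_on_rcis_exp[OF holomorphic_on_imp_continuous_on[OF h]]) (auto simp: strip_def)
 show "continuous_on {0<..} (%r. h (rcis r ta) / (rcis r ta - 1))" if ta: "ta \<in> {nu, - nu}"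
 proof -
  have "rcis r ta \<noteq> 1" if "r > 0" for r
  proof -
   have "0 < gap nu * mx (ln r)" using g mx(3) by simp
   also have "\<dots> \<le> cmod (rcis r ta - 1)" using d[OF ta, of "ln r"] that by (simp add: exp_Complex)
   finally show ?thesis by auto
  qed
  then show ?thesis by (intro continuous_on_divide hc ta) (auto simp: rcis_def intro!: continuous_intros)
 qed
 show "ray_int (- nu) (%z. h z / (z - 1)) - ray_int nu (%z. h z / (z - 1)) = 2 * pi * \<i> * h 1"
 proof (rule ray_int_Cauchy[OF h _ _ _ _ exp_minus1(2)[symmetric]])
  show "log_decay (H / gap nu) 1 (%z. h z / (z - 1)) (- nu)" "log_decay (H / gap nu) 1 (%z. h z / (z - 1)) nu"
   by (rule ld; simp)+
  fix w assume w: "- nu \<le> Im w" "Im w \<le> nu"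
  define u where "u = Re w"
  have "cmod (h (exp w)) \<le> H / mx u" using bd[of "Im w" u] w nu by (simp add: u_def)
  then have "cmod (h (exp w)) * exp u \<le> H / mx u * (mx u * (mx u * exp (- \<bar>u\<bar>)))"
   by (subst mx(5)[symmetric]) (rule mult_right_mono, auto)
  also have "\<dots> = H * (mx u * exp (- \<bar>u\<bar>))" using mx(3)[of u] by simp
  also have "\<dots> \<le> H * ((1 + exp u) * exp (- \<bar>u\<bar>))"
   using H by (intro mult_left_mono mult_right_mono) (auto simp: mx_def)
  finally show "cmod (h (exp w)) * exp (Re w) \<le> H * (1 + exp (Re w)) * exp (- 1 * \<bar>Re w\<bar>)" by (simp add: u_def)
 qed (use nu H H' hc in auto)
qed

context sect_resolvent
begin

lemma minus1_cosector: "-1 \<in> cosector s"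
 using exp_in_cosector[of s pi 0] s by (simp add: exp_minus1)

text \<open>Partial fractions give z / (1 + z)^2 = 1 / (1 + z) - 1 / (1 + z)^2, and
  \<open>R (-1)\<close> stands for the inverse of -(1 + A). Neither summand belongs to the decay
  class of the calculus, so the value is found by deforming the contour around the negative
  axis.\<close>

theorem Phi_regulariser:
 assumes nu: "s < nu" "nu < pi"
 shows "Phi nu regulariser x = - R (-1) x - R (-1) (R (-1) x)"
proof (rule eq_functionalI)
 fix l :: "'a => complex" assume l: "bounded_clinear l"
 define m :: complex where "m = -1"
 have mc: "m \<in> cosector s" using minus1_cosector by (simp add: m_def)
 define r1 where "r1 = l (R m x)"
 define r2 where "r2 = l (R m (R m x))"
 define q where "q z = l (R z x)" for z
 \<comment> \<open>\<open>T\<close> is holomorphic off the sector, also at -1. The pole is placed at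
   1, inside the sector, and its coefficient cancels the leading term at infinity, so
   \<open>T\<close> decays like |z|^(-2) and remains bounded at 0.\<close>
 define T where "T z = - (l (R z (R m x)) + l (R z (R m (R m x)))) + (r1 + r2) / (z - 1)" for z
 define b where "b = (nu + pi) / 2"
 have b: "nu < b" "b < pi" "0 < b" using nu s by (auto simp: b_def)
 define \<kappa> where "\<kappa> = gap (pi - b)"
 have \<kappa>: "\<kappa> > 0" using b by (auto simp: \<kappa>_def intro!: gap_pos)
 have g: "gap nu > 0" using nu s by (intro gap_pos) auto
 have c1: "z \<noteq> 1" if "z \<in> cosector s" for z
 proof
  assume "z = 1"
  then have "1 < cos s" using that by (simp add: cosector_def)
  then show False using cos_le_one[of s] by linarith
 qed
 have bl: "bounded_linear l" using l by (rule bounded_clinear_imp_bounded_linear)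
 have RR: "l (R z (R m v)) = (l (R m v) - l (R z v)) / (1 + z)" if "z \<in> cosector s" "z \<noteq> -1" for z v
 proof -
  have "l (R m v) - l (R z v) = l (R m v - R z v)" using bl by (simp add: bounded_linear.linear linear_diff)
  also have "\<dots> = (z - m) * l (R z (R m v))"
   by (simp add: R_identity[OF mc that(1)] functional_scaleC[OF l] R_commute[OF mc that(1)])
  finally show ?thesis using that(2) by (simp add: m_def field_simps add_eq_0_iff)
 qed
 have Teq: "T z = regulariser z * q z + r1 * ((1 + 3 * z) / ((z - 1) * (1 + z)\<^sup>2)) + r2 * (2 / ((z - 1) * (1 + z)))"
  if z: "z \<in> cosector s" "z \<noteq> -1" for z
 proof -
  have z1: "z - 1 \<noteq> 0" "1 + z \<noteq> 0" using c1[OF z(1)] z(2) by (auto simp: add_eq_0_iff)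
  have "T z = - ((r1 - q z) / (1 + z) + (r2 - (r1 - q z) / (1 + z)) / (1 + z)) + (r1 + r2) / (z - 1)"
   unfolding T_def RR[OF z] by (simp add: r1_def r2_def q_def)
  also have "\<dots> = regulariser z * q z + r1 * ((1 + 3 * z) / ((z - 1) * (1 + z)\<^sup>2)) + r2 * (2 / ((z - 1) * (1 + z)))"
   unfolding regulariser_def using z1 by (simp add: divide_simps power2_eq_square) (simp add: algebra_simps)
  finally show ?thesis .
 qed
 have fb: "cmod (l (R (exp (Complex u ta)) v)) * exp u \<le> onorm l * M * norm v"
  if "s < \<bar>ta\<bar>" "\<bar>ta\<bar> < 2 * pi - s" for u ta v
  using functional_R_bound[OF l exp_in_cosector[OF _ that, of u], of v] s by simp
 define K0 where "K0 = onorm l * M * norm (R m x) + onorm l * M * norm (R m (R m x)) + (cmod r1 + cmod r2) / gap nu"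
 define K1 where "K1 = onorm l * M * norm x * 4 + cmod r1 * (16 / gap nu) + cmod r2 * (4 / gap nu)"
 have ol: "onorm l \<ge> 0" using bl by (rule onorm_pos_le)
 have K01: "K0 \<ge> 0" "K1 \<ge> 0" using ol M g by (simp_all add: K0_def K1_def)
 define K where "K = K0 * exp 1 + K1"
 have K: "K \<ge> 0" using K01 by (simp add: K_def)
 have Td: "log_decay K 1 T ta" if ta: "nu \<le> ta" "ta \<le> 2 * pi - nu" for ta
  unfolding log_decay_def
 proof
  fix u
  define z where "z = exp (Complex u ta)"
  have th: "s < \<bar>ta\<bar>" "\<bar>ta\<bar> < 2 * pi - s" using ta nu s by auto
  have zc: "z \<in> cosector s" unfolding z_def using s by (intro exp_in_cosector th) auto
  have nz: "cmod z = exp u" by (simp add: z_def)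
  have d: "gap nu * mx u \<le> cmod (z - 1)"
  proof -
   have "gap nu * exp u \<le> cmod (exp (Complex u ta) - exp (Complex 0 0))"
    "gap nu * exp 0 \<le> cmod (exp (Complex u ta) - exp (Complex 0 0))"
    by (rule gap_dist; use nu s ta in auto)+
   then show ?thesis by (simp add: exp_minus1 mx_def max_def z_def)
  qed
  have zm: "cmod (z - 1) > 0" using c1[OF zc] by simp
  \<comment> \<open>For \<open>cmod z\<close> near 1 the factor \<open>1 + z\<close> may vanish and
    the definition of \<open>T\<close> is estimated directly; elsewhere the formula
    \<open>Teq\<close> exhibits the decay.\<close>
  have "cmod (T z) * exp u \<le> K * exp (- \<bar>u\<bar>)"
  proof (cases "\<bar>u\<bar> \<le> 1")
   case True
   have "cmod (T z) \<le> cmod (l (R z (R m x))) + cmod (l (R z (R m (R m x)))) + cmod ((r1 + r2) / (z - 1))"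
    unfolding T_def
    using norm_triangle_ineq[of "- (l (R z (R m x)) + l (R z (R m (R m x))))" "(r1 + r2) / (z - 1)"]
     norm_triangle_ineq[of "l (R z (R m x))" "l (R z (R m (R m x)))"] by (simp only: norm_minus_cancel)
   then have "cmod (T z) * exp u \<le> (cmod (l (R z (R m x))) + cmod (l (R z (R m (R m x)))) + cmod ((r1 + r2) / (z - 1))) * exp u"
    by (rule mult_right_mono) simp
   also have "\<dots> = cmod (l (R z (R m x))) * exp u + cmod (l (R z (R m (R m x)))) * exp u + cmod (r1 + r2) * (exp u / cmod (z - 1))"
    by (simp add: ring_distribs norm_divide)
   also have "\<dots> \<le> onorm l * M * norm (R m x) + onorm l * M * norm (R m (R m x)) + (cmod r1 + cmod r2) * (1 / gap nu)"
   proof (rule add_mono[OF add_mono mult_mono])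
    show "cmod (l (R z (R m x))) * exp u \<le> onorm l * M * norm (R m x)" "cmod (l (R z (R m (R m x)))) * exp u \<le> onorm l * M * norm (R m (R m x))"
     unfolding z_def using fb[OF th] by blast+
    have "gap nu * exp u \<le> cmod (z - 1)"
     by (rule order_trans[OF mult_left_mono[OF mx(2)] d]) (use g in simp)
    then show "exp u / cmod (z - 1) \<le> 1 / gap nu" using zm g by (simp add: field_simps)
   qed (auto simp: norm_triangle_ineq)
   also have "\<dots> = K0" by (simp add: K0_def)
   also have "\<dots> \<le> K0 * (exp 1 * exp (- \<bar>u\<bar>))"
   proof -
    have "1 \<le> exp 1 * exp (- \<bar>u\<bar>)" using True by (simp flip: exp_add)
    then show ?thesis using K01 by (simp add: mult_left_le[of _ K0] mult_le_cancel_left1)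
   qed
   also have "\<dots> \<le> K * exp (- \<bar>u\<bar>)" using K01 by (simp add: K_def algebra_simps)
   finally show ?thesis .
  next
   case False
   have e2: "exp (1::real) \<ge> 2" using exp_ge_add_one_self[of 1] by simp
   have p: "mx u / 2 \<le> cmod (1 + z)"
   proof (cases "u \<ge> 0")
    case True
    then have "exp u \<ge> exp 1" using False by simp
    then have "exp u \<ge> 2" using e2 by linarith
    moreover have "cmod (1 + z) \<ge> exp u - 1" using norm_diff_ineq[of z 1] nz by (simp add: add.commute)
    ultimately show ?thesis by (simp add: mx_def max_def)
   next
    case u: False
    then have "exp u \<le> exp (- 1)" using False by simp
    moreover have "exp (- 1::real) \<le> 1 / 2" using e2 by (simp add: exp_minus field_simps)
    ultimately have "exp u \<le> 1 / 2" by (rule order_trans)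
    moreover have "cmod (1 + z) \<ge> 1 - exp u" using norm_diff_ineq[of 1 z] nz by simp
    ultimately show ?thesis by (simp add: mx_def max_def)
   qed
   then have zm1: "z \<noteq> -1" using mx(3)[of u] by auto
   have q0: "cmod (q z) * exp u \<le> onorm l * M * norm x" unfolding q_def z_def by (rule fb[OF th])
   have mp: "mx u > 0" by (rule mx)
   have psi: "cmod (regulariser z) \<le> 4 * exp (- \<bar>u\<bar>)"
   proof -
    have "cmod (regulariser z) = exp u / (cmod (1 + z))\<^sup>2" by (simp add: regulariser_def norm_divide norm_power nz)
    also have "\<dots> \<le> exp u / (mx u / 2)\<^sup>2" using p mp zm1 by (intro divide_left_mono power_mono mult_pos_pos zero_less_power) (auto simp: add_eq_0_iff)
    also have "\<dots> = 4 * (exp u / (mx u)\<^sup>2)" by (simp add: power_divide)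
    finally show ?thesis by (simp only: mx(4))
   qed
   have t1: "cmod ((1 + 3 * z) / ((z - 1) * (1 + z)\<^sup>2)) * exp u \<le> 16 / gap nu * exp (- \<bar>u\<bar>)"
   proof -
    have "cmod (1 + 3 * z) \<le> 1 + 3 * exp u" using norm_triangle_ineq[of 1 "3 * z"] nz by (simp add: norm_mult)
    also have "\<dots> \<le> 4 * mx u" using mx(1,2)[of u] by linarith
    finally have "cmod ((1 + 3 * z) / ((z - 1) * (1 + z)\<^sup>2)) \<le> (4 * mx u) / ((gap nu * mx u) * (mx u / 2)\<^sup>2)"
     unfolding norm_divide norm_mult norm_power using p d mp g by (intro frac_le mult_mono power_mono) auto
    then have "cmod ((1 + 3 * z) / ((z - 1) * (1 + z)\<^sup>2)) * exp u \<le> (4 * mx u) / ((gap nu * mx u) * (mx u / 2)\<^sup>2) * exp u"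
     by (rule mult_right_mono) simp
    also have "\<dots> = 16 / gap nu * (exp u / (mx u)\<^sup>2)" using mp g by (simp add: power_divide)
    finally show ?thesis by (simp only: mx(4))
   qed
   have t2: "cmod (2 / ((z - 1) * (1 + z))) * exp u \<le> 4 / gap nu * exp (- \<bar>u\<bar>)"
   proof -
    have "cmod (2 / ((z - 1) * (1 + z))) \<le> 2 / ((gap nu * mx u) * (mx u / 2))"
     unfolding norm_divide norm_mult using p d mp g by (intro frac_le mult_mono) auto
    then have "cmod (2 / ((z - 1) * (1 + z))) * exp u \<le> 2 / ((gap nu * mx u) * (mx u / 2)) * exp u"
     by (rule mult_right_mono) simp
    also have "\<dots> = 4 / gap nu * (exp u / (mx u)\<^sup>2)" by (simp add: power2_eq_square)
    finally show ?thesis by (simp only: mx(4))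
   qed
   have "cmod (T z) \<le> cmod (regulariser z) * cmod (q z) + cmod r1 * cmod ((1 + 3 * z) / ((z - 1) * (1 + z)\<^sup>2)) + cmod r2 * cmod (2 / ((z - 1) * (1 + z)))"
    unfolding Teq[OF zc zm1] by (rule order_trans[OF norm_triangle_ineq add_mono[OF order_trans[OF norm_triangle_ineq]]]) (simp_all only: norm_mult order_refl)
   then have "cmod (T z) * exp u \<le> (cmod (regulariser z) * cmod (q z) + cmod r1 * cmod ((1 + 3 * z) / ((z - 1) * (1 + z)\<^sup>2)) + cmod r2 * cmod (2 / ((z - 1) * (1 + z)))) * exp u"
    by (rule mult_right_mono) simp
   also have "\<dots> = cmod (regulariser z) * (cmod (q z) * exp u) + cmod r1 * (cmod ((1 + 3 * z) / ((z - 1) * (1 + z)\<^sup>2)) * exp u) + cmod r2 * (cmod (2 / ((z - 1) * (1 + z))) * exp u)"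
    by (simp only: ring_distribs mult.assoc)
   also have "\<dots> \<le> (4 * exp (- \<bar>u\<bar>)) * (onorm l * M * norm x) + cmod r1 * (16 / gap nu * exp (- \<bar>u\<bar>)) + cmod r2 * (4 / gap nu * exp (- \<bar>u\<bar>))"
    by (rule add_mono[OF add_mono[OF mult_mono[OF psi q0] mult_left_mono[OF t1]] mult_left_mono[OF t2]]) simp_all
   also have "\<dots> = K1 * exp (- \<bar>u\<bar>)" by (simp add: K1_def algebra_simps)
   also have "\<dots> \<le> K * exp (- \<bar>u\<bar>)" using K01 by (intro mult_right_mono) (auto simp: K_def)
   finally show ?thesis .
  qed
  then show "cmod (T (exp (Complex u ta))) * exp u \<le> K * exp (- 1 * \<bar>u\<bar>)" by (simp add: z_def)
 qed
 have Thol: "(%w. T (exp w)) holomorphic_on strip s (2 * pi - s)"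
 proof -
  have ec: "exp w \<in> cosector s" if "w \<in> strip s (2 * pi - s)" for w
   using exp_in_cosector[of s "Im w" "Re w"] that s by (auto simp: strip_def)
  have "(%w. l (R (exp w) v)) holomorphic_on strip s (2 * pi - s)" for v
   by (rule holomorphic_on_compose_gen[OF holomorphic_on_exp holomorphic_on_R[OF l], unfolded comp_def]) (use ec in auto)
  then show ?thesis unfolding T_def using c1[OF ec] by (intro holomorphic_intros) auto
 qed
 have Tc: "continuous_on {0<..} (%r. T (rcis r ta))" if "nu \<le> ta" "ta \<le> 2 * pi - nu" for ta
  using nu that by (intro continuous_on_rcis_exp[OF holomorphic_on_imp_continuous_on[OF Thol]]) (auto simp: strip_def)
 have "ray_int nu T = ray_int (2 * pi - nu) T"
  by (rule ray_int_rotate[OF Thol, of nu "2 * pi - nu" K 1]) (use nu K in \<open>auto intro!: Tc Td\<close>)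
 \<comment> \<open>Rotating from \<open>nu\<close> through the negative axis to
   \<open>2 * pi - nu\<close> ends on the ray of angle \<open>- nu\<close>; so the contour integral
   of \<open>T\<close> is zero.\<close>
 have per: "cis (2 * pi - nu) = cis (- nu)" "rcis r (2 * pi - nu) = rcis r (- nu)" for r
  by (simp_all add: rcis_def cis.ctr)
 have Tper: "ray_int nu T = ray_int (- nu) T"
  using \<open>ray_int nu T = _\<close> by (simp only: ray_int_def per)
 have Tray: "continuous_on {0<..} (%r. T (rcis r ta))" "ray_decay K 1 (%r. T (rcis r ta))" if "ta \<in> {nu, - nu}" for ta
 proof -
  have 1: "continuous_on {0<..} (%r. T (rcis r nu))" "ray_decay K 1 (%r. T (rcis r nu))"
   using nu K by (auto intro!: Tc log_decay_ray_decay Td)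
  have "continuous_on {0<..} (%r. T (rcis r (2 * pi - nu)))" "ray_decay K 1 (%r. T (rcis r (2 * pi - nu)))"
   using nu K by (auto intro!: Tc log_decay_ray_decay Td)
  then show "continuous_on {0<..} (%r. T (rcis r ta))" "ray_decay K 1 (%r. T (rcis r ta))"
   using 1 that by (auto simp only: per insert_iff empty_iff)
 qed
 \<comment> \<open>The rational terms of \<open>Teq\<close> are \<open>- r1 * h1 z / (z - 1)\<close>
   and \<open>- r2 * h2 z / (z - 1)\<close>; both \<open>h1\<close> and \<open>h2\<close> have the
   value -1 at 1.\<close>
 define h1 h2 :: "complex => complex" where "h1 z = - ((1 + 3 * z) / (1 + z)\<^sup>2)" and "h2 z = - 2 / (1 + z)" for z
 have hol: "(%w. h1 (exp w)) holomorphic_on strip (- b) b" "(%w. h2 (exp w)) holomorphic_on strip (- b) b"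
  unfolding h1_def h2_def using one_plus_exp_nonzero[OF _ b(2)] by (intro holomorphic_intros; auto)+
 have hb: "cmod (h1 (exp (Complex u ta))) \<le> (4 / \<kappa>\<^sup>2) / mx u" "cmod (h2 (exp (Complex u ta))) \<le> (2 / \<kappa>) / mx u" if ta: "\<bar>ta\<bar> < b" for u ta
 proof -
  note n = norm_1_plus_exp(1)[OF ta b(2), of u, folded \<kappa>_def] norm_1_plus_exp(2)[OF ta b(2), folded \<kappa>_def]
  have mp: "mx u > 0" by (rule mx)
  have "cmod (1 + 3 * exp (Complex u ta)) \<le> 1 + 3 * exp u" using norm_triangle_ineq[of 1 "3 * exp (Complex u ta)"] by (simp add: norm_mult)
  also have "\<dots> \<le> 4 * mx u" using mx(1,2)[of u] by linarith
  finally have "cmod (1 + 3 * exp (Complex u ta)) / (cmod (1 + exp (Complex u ta)))\<^sup>2 \<le> 4 * mx u / (\<kappa> * mx u)\<^sup>2"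
   using n mp \<kappa> by (intro frac_le power_mono) auto
  also have "\<dots> = (4 / \<kappa>\<^sup>2) / mx u" using mp \<kappa> by (simp add: power2_eq_square)
  finally show "cmod (h1 (exp (Complex u ta))) \<le> (4 / \<kappa>\<^sup>2) / mx u" by (simp add: h1_def norm_divide norm_power norm_minus_commute del: minus_add_distrib)
  have "cmod (h2 (exp (Complex u ta))) \<le> 2 / (\<kappa> * mx u)"
   unfolding h2_def norm_divide using n mp \<kappa> by (intro frac_le) auto
  then show "cmod (h2 (exp (Complex u ta))) \<le> (2 / \<kappa>) / mx u" by simp
 qed
 have "0 < nu" using nu s by simp
 have H1: "4 / \<kappa>\<^sup>2 \<ge> 0" and H2: "2 / \<kappa> \<ge> 0" using \<kappa> by simp_all
 have hb': "\<forall>u ta. \<bar>ta\<bar> < b \<longrightarrow> cmod (h1 (exp (Complex u ta))) \<le> (4 / \<kappa>\<^sup>2) / mx u"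
  "\<forall>u ta. \<bar>ta\<bar> < b \<longrightarrow> cmod (h2 (exp (Complex u ta))) \<le> (2 / \<kappa>) / mx u" using hb by blast+
 note C1 = ray_int_Cauchy_one[OF hol(1) \<open>0 < nu\<close> b(1,2) H1 hb'(1)]
 note C2 = ray_int_Cauchy_one[OF hol(2) \<open>0 < nu\<close> b(1,2) H2 hb'(2)]
 have split: "ray_int ta (%z. regulariser z * q z) = ray_int ta T + r1 * ray_int ta (%z. h1 z / (z - 1)) + r2 * ray_int ta (%z. h2 z / (z - 1))"
  if ta: "ta \<in> {nu, - nu}" for ta
 proof -
  have reg: "h0_ray (1 / \<kappa>\<^sup>2) 1 nu regulariser"
   unfolding \<kappa>_def by (rule h0_imp_h0_ray[OF h0_regulariser[OF b(3,2)]]) (use b \<open>0 < nu\<close> in simp)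
  note fd = functional_ray_decay[OF reg nu ta l, of x, folded q_def]
  have eq: "T z = (regulariser z * q z + (- r1) * (h1 z / (z - 1))) + (- r2) * (h2 z / (z - 1))" if z: "z = rcis r ta" "r > 0" for z r
  proof -
   have zc: "z \<in> cosector s" unfolding z by (rule angle_cosector'[OF nu ta z(2)])
   have "z \<noteq> -1"
   proof
    assume "z = -1"
    then have "1 + exp (Complex (ln r) ta) = 0" using z by (simp add: exp_Complex)
    then show False using one_plus_exp_nonzero[of "Complex (ln r) ta" b] b ta \<open>0 < nu\<close> by (auto simp: strip_def)
   qed
   then show ?thesis
    unfolding Teq[OF zc \<open>z \<noteq> -1\<close>] h1_def h2_def by (simp add: mult_ac)
  qed
  have "ray_int ta T = ray_int ta (%z. (regulariser z * q z + (- r1) * (h1 z / (z - 1))) + (- r2) * (h2 z / (z - 1)))"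
   unfolding ray_int_def by (rule Henstock_Kurzweil_Integration.integral_cong) (subst eq[OF refl], auto)
  also have "\<dots> = ray_int ta (%z. regulariser z * q z + (- r1) * (h1 z / (z - 1))) + (- r2) * ray_int ta (%z. h2 z / (z - 1))"
  proof (rule ray_int_lincomb[OF _ _ _ _ C2(2,3)[OF ta] _ C2(4)])
   show "continuous_on {0<..} (%r. regulariser (rcis r ta) * q (rcis r ta) + - r1 * (h1 (rcis r ta) / (rcis r ta - 1)))"
    by (intro continuous_on_add continuous_on_mult continuous_on_const fd(1) C1(2)[OF ta])
   show "ray_decay (1 / \<kappa>\<^sup>2 * (onorm l * M * norm x) + cmod r1 * (4 / \<kappa>\<^sup>2 / gap nu)) 1 (%r. regulariser (rcis r ta) * q (rcis r ta) + - r1 * (h1 (rcis r ta) / (rcis r ta - 1)))"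
   proof -
    have n: "1 / \<kappa>\<^sup>2 * (onorm l * M * norm x) + cmod r1 * (4 / \<kappa>\<^sup>2 / gap nu) \<ge> 0"
     by (intro add_nonneg_nonneg fd(3) mult_nonneg_nonneg[OF norm_ge_zero C1(4)])
    show ?thesis
    proof (subst ray_decay_iff[OF n], intro allI impI)
     fix r :: real assume r: "r > 0"
     have "cmod (regulariser (rcis r ta) * q (rcis r ta) + - r1 * (h1 (rcis r ta) / (rcis r ta - 1)))
      \<le> cmod (regulariser (rcis r ta) * q (rcis r ta)) + cmod r1 * cmod (h1 (rcis r ta) / (rcis r ta - 1))"
      by (rule order_trans[OF norm_triangle_ineq]) (simp only: norm_mult norm_minus_cancel order_refl)
     also have "\<dots> \<le> 1 / \<kappa>\<^sup>2 * (onorm l * M * norm x) * ray_weight 1 r + cmod r1 * (4 / \<kappa>\<^sup>2 / gap nu * ray_weight 1 r)"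
      using fd(2)[unfolded ray_decay_iff[OF fd(3)]] C1(3)[OF ta, unfolded ray_decay_iff[OF C1(4)]] r
      by (intro add_mono mult_left_mono) auto
     finally show "cmod (regulariser (rcis r ta) * q (rcis r ta) + - r1 * (h1 (rcis r ta) / (rcis r ta - 1)))
      \<le> (1 / \<kappa>\<^sup>2 * (onorm l * M * norm x) + cmod r1 * (4 / \<kappa>\<^sup>2 / gap nu)) * ray_weight 1 r"
      by (simp only: ring_distribs mult.assoc)
    qed
   qed
   show "1 / \<kappa>\<^sup>2 * (onorm l * M * norm x) + cmod r1 * (4 / \<kappa>\<^sup>2 / gap nu) \<ge> 0"
    by (intro add_nonneg_nonneg fd(3) mult_nonneg_nonneg[OF norm_ge_zero C1(4)])
  qed auto
  also have "ray_int ta (%z. regulariser z * q z + (- r1) * (h1 z / (z - 1))) = ray_int ta (%z. regulariser z * q z) + (- r1) * ray_int ta (%z. h1 z / (z - 1))"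
   by (rule ray_int_lincomb[OF fd(1,2) _ fd(3) C1(2,3)[OF ta] _ C1(4)]) auto
  finally show ?thesis by (simp add: algebra_simps)
 qed
 have reg: "h0_ray (1 / \<kappa>\<^sup>2) 1 nu regulariser"
  unfolding \<kappa>_def by (rule h0_imp_h0_ray[OF h0_regulariser[OF b(3,2)]]) (use b \<open>0 < nu\<close> in simp)
 have "ray_int (- nu) (%z. regulariser z * q z) - ray_int nu (%z. regulariser z * q z) =
   r1 * (ray_int (- nu) (%z. h1 z / (z - 1)) - ray_int nu (%z. h1 z / (z - 1))) + r2 * (ray_int (- nu) (%z. h2 z / (z - 1)) - ray_int nu (%z. h2 z / (z - 1)))"
  using split[of nu] split[of "- nu"] Tper by (simp add: algebra_simps)
 also have "\<dots> = - (2 * pi * \<i>) * (r1 + r2)"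
  unfolding C1(1) C2(1) by (simp add: h1_def h2_def algebra_simps)
 finally have "l (Phi nu regulariser x) = - (r1 + r2)"
  unfolding functional_Phi[OF reg nu l] q_def[symmetric] by simp
 also have "\<dots> = l (- R (-1) x - R (-1) (R (-1) x))"
  using bl by (simp add: r1_def r2_def m_def bounded_linear.linear linear_diff linear_neg)
 finally show "l (Phi nu regulariser x) = l (- R (-1) x - R (-1) (R (-1) x))" .
qed

end

section \<open>Sectorial operators and their resolvents\<close>

lemma resolvent_props:
 assumes "l \<in> resolvent_set D A"
 shows "resolvent D A l x \<in> D" "l *\<^sub>C resolvent D A l x - A (resolvent D A l x) = x"
  "y \<in> D ==> resolvent D A l (l *\<^sub>C y - A y) = y" "bounded_clinear (resolvent D A l)"
proof -
 have b: "bij_betw (%x. l *\<^sub>C x - A x) D UNIV" and c: "bounded_clinear (resolvent D A l)"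
  using assms by (auto simp: resolvent_set_def)
 have x: "x \<in> (%x. l *\<^sub>C x - A x) ` D" using b by (simp add: bij_betw_def)
 show "resolvent D A l x \<in> D" "l *\<^sub>C resolvent D A l x - A (resolvent D A l x) = x"
  unfolding resolvent_def using inv_into_into[OF x] f_inv_into_f[OF x] by simp_all
 show "resolvent D A l (l *\<^sub>C y - A y) = y" if "y \<in> D"
  unfolding resolvent_def using inv_into_f_f[of "%x. l *\<^sub>C x - A x" D y] b that by (simp add: bij_betw_def)
 show "bounded_clinear (resolvent D A l)" by (rule c)
qed

lemma bounded_clinear_add: "bounded_clinear f ==> f (x + y) = f x + f y"
 and bounded_clinear_diff: "bounded_clinear f ==> f (x - y) = f x - f y"
 and bounded_clinear_minus: "bounded_clinear f ==> f (- x) = - f x"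
 by (simp_all add: bounded_clinear_def bounded_linear.linear linear_add linear_diff linear_neg)

lemma resolvent_identity:
 assumes "l \<in> resolvent_set D A" "m \<in> resolvent_set D A"
 shows "resolvent D A l x - resolvent D A m x = (m - l) *\<^sub>C resolvent D A l (resolvent D A m x)"
proof -
 define y where "y = resolvent D A m x"
 note l = resolvent_props[OF assms(1)] and m = resolvent_props[OF assms(2)]
 have x: "x = (l *\<^sub>C y - A y) + (m - l) *\<^sub>C y"
 proof -
  have "(l *\<^sub>C y - A y) + (m - l) *\<^sub>C y = m *\<^sub>C y - A y" by (simp add: scaleC.diff_left)
  then show ?thesis using m(2)[of x, folded y_def] by (rule trans[symmetric])
 qed
 then have "resolvent D A l x = resolvent D A l ((l *\<^sub>C y - A y) + (m - l) *\<^sub>C y)" by (rule arg_cong)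
 also have "\<dots> = y + (m - l) *\<^sub>C resolvent D A l y"
  unfolding bounded_clinear_add[OF l(4)] bounded_clinear_scaleC[OF l(4)]
  using l(3)[of y] m(1) by (simp add: y_def)
 finally show ?thesis by (simp add: y_def)
qed

lemma sector_Re: "0 < s ==> s < pi ==> z \<in> sector s ==> cmod z * cos s < Re z"
proof -
 assume s: "0 < s" "s < pi" and z: "z \<in> sector s"
 then have z: "z \<noteq> 0" "\<bar>Arg z\<bar> < s" by (auto simp: sector_def)
 have "cos s < cos \<bar>Arg z\<bar>" using z s by (intro cos_monotone_0_pi) auto
 then have c: "cos s < cos (Arg z)" by simp
 have "Re z = Re (rcis (cmod z) (Arg z))" by (simp only: rcis_cmod_Arg)
 also have "\<dots> = cmod z * cos (Arg z)" by (rule Re_rcis)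
 finally have Re: "Re z = cmod z * cos (Arg z)" .
 show "cmod z * cos s < Re z" unfolding Re by (rule mult_strict_left_mono[OF c]) (use z in simp)
qed

lemma sector_mono:
 assumes "0 \<le> \<omega>" "\<omega> < s"
 shows "sector \<omega> \<subseteq> sector s"
proof
 fix z assume z: "z \<in> sector \<omega>"
 show "z \<in> sector s"
 proof (cases "\<omega> = 0")
  case True
  then obtain r where "z = of_real r" "r > 0" using z by (auto simp: sector_def)
  then show ?thesis using assms by (simp add: sector_def)
 next
  case False
  then show ?thesis using z assms by (simp add: sector_def)
 qed
qed

lemma cosector_closure_sector: "0 < s ==> s < pi ==> cosector s \<inter> closure (sector s) = {}"
proof -
 assume s: "0 < s" "s < pi"
 have "closure (sector s) \<subseteq> {z. cmod z * cos s \<le> Re z}"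
 proof (rule closure_minimal)
  show "sector s \<subseteq> {z. cmod z * cos s \<le> Re z}" using sector_Re[OF s] less_imp_le by blast
  show "closed {z. cmod z * cos s \<le> Re z}" by (intro closed_Collect_le continuous_intros)
 qed
 moreover have "cosector s \<inter> {z. cmod z * cos s \<le> Re z} = {}" by (auto simp: cosector_def)
 ultimately show ?thesis by blast
qed

locale sect_op = sect_resolvent "resolvent D A" s M for D :: "'a::complex_banach set" and A s M +
 assumes lin: "linear_op D A" and res: "cosector s \<subseteq> resolvent_set D A"

lemma sect_opI:
 assumes s: "0 < s" "s < pi" and lin: "linear_op D A" and res: "cosector s \<subseteq> resolvent_set D A" and M: "M \<ge> 0"
  and bd: "\<And>l x. l \<in> cosector s ==> norm (l *\<^sub>C resolvent D A l x) \<le> M * norm x"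
 shows "sect_op D A s M"
proof
 fix z w :: complex and x :: 'a
 assume z: "z \<in> cosector s"
 then have z': "z \<in> resolvent_set D A" using res by auto
 show "bounded_clinear (resolvent D A z)" by (rule resolvent_props(4)[OF z'])
 show "norm (resolvent D A z x) * cmod z \<le> M * norm x" using bd[OF z, of x] by (simp add: norm_scaleC mult.commute)
 assume "w \<in> cosector s"
 then have "w \<in> resolvent_set D A" using res by auto
 then show "resolvent D A z x - resolvent D A w x = (w - z) *\<^sub>C resolvent D A z (resolvent D A w x)"
  by (rule resolvent_identity[OF z'])
qed (fact s lin res M)+

lemma sectorial_sect_op:
 assumes A: "sectorial D A \<omega>" and s: "\<omega> < s" "s < pi"
 obtains M where "sect_op D A s M"
proof -
 have \<omega>: "0 \<le> \<omega>" and lin: "linear_op D A" and sp: "op_spectrum D A \<subseteq> closure (sector \<omega>)"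
  and bd: "bdd_above ((%l. onorm (%x. l *\<^sub>C resolvent D A l x)) ` (- closure (sector s)))"
  using A s by (auto simp: sectorial_def closed_op_def)
 have s0: "0 < s" using \<omega> s by simp
 have cs: "z \<notin> closure (sector s)" "z \<in> resolvent_set D A" if "z \<in> cosector s" for z
 proof -
  show n: "z \<notin> closure (sector s)" using cosector_closure_sector[OF s0 s(2)] that by auto
  then have "z \<notin> closure (sector \<omega>)" using closure_mono[OF sector_mono[OF \<omega> s(1)]] by auto
  then show "z \<in> resolvent_set D A" using sp by (auto simp: op_spectrum_def)
 qed
 obtain K where K: "\<And>l. l \<in> - closure (sector s) ==> onorm (%x. l *\<^sub>C resolvent D A l x) \<le> K"
  using bd by (auto simp: bdd_above_def)
 have "sect_op D A s (max K 0)"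
 proof (rule sect_opI[OF s0 s(2) lin])
  fix l x assume l: "l \<in> cosector s"
  have bl: "bounded_linear (%x. l *\<^sub>C resolvent D A l x)"
   using bounded_linear_compose[OF scaleC.bounded_linear_right bounded_clinear_imp_bounded_linear[OF resolvent_props(4)[OF cs(2)[OF l]]]] .
  have "norm (l *\<^sub>C resolvent D A l x) \<le> onorm (%x. l *\<^sub>C resolvent D A l x) * norm x" by (rule onorm[OF bl])
  also have "\<dots> \<le> max K 0 * norm x" using K[of l] cs(1)[OF l] by (intro mult_right_mono) auto
  finally show "norm (l *\<^sub>C resolvent D A l x) \<le> max K 0 * norm x" .
 qed (use cs in auto)
 then show ?thesis by (rule that)
qed

text \<open>Above the \<gamma>-angle a single constant serves twice: for the Gaussian estimate and,
  with one summand, for the resolvent bound of the locale.\<close>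

lemma gamma_sectorial_sect_op:
 assumes B: "gamma_sectorial D B \<omega>" and s: "\<omega> < s" "s < pi" and lin: "linear_op D B"
 obtains C where "C \<ge> 0" "sect_op D B s C"
  "\<And>N l x. (\<And>n. n < N ==> l n \<in> cosector s) ==>
   gauss_E N (%n. l n *\<^sub>C resolvent D B (l n) (x n)) \<le> ennreal (C\<^sup>2) * gauss_E N x"
proof -
 define ep where "ep = s - \<omega>"
 have s0: "0 < s" and e: "ep > 0" "\<omega> + ep = s" using B s by (auto simp: gamma_sectorial_def ep_def)
 define S where "S = {l. l \<notin> sector s \<and> l \<noteq> 0}"
 have SR: "S \<subseteq> resolvent_set D B" and gb: "gamma_bounded {(%x. l *\<^sub>C resolvent D B l x) |l. l \<notin> sector s \<and> l \<noteq> 0}"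
 proof -
  have "\<forall>ep>0. {l. l \<notin> sector (\<omega> + ep) \<and> l \<noteq> 0} \<subseteq> resolvent_set D B \<and>
    gamma_bounded {(%x. l *\<^sub>C resolvent D B l x) |l. l \<notin> sector (\<omega> + ep) \<and> l \<noteq> 0}"
   using B unfolding gamma_sectorial_def by (elim conjE)
  note g = this[rule_format, OF e(1), unfolded e(2)]
  show "S \<subseteq> resolvent_set D B" using g unfolding S_def by (rule conjunct1)
  show "gamma_bounded {(%x. l *\<^sub>C resolvent D B l x) |l. l \<notin> sector s \<and> l \<noteq> 0}" using g by (rule conjunct2)
 qed
 have cS: "cosector s \<subseteq> S"
  using cosector_closure_sector[OF s0 s(2)] closure_subset[of "sector s"] zero_notin_cosector[of s] by (auto simp: S_def)
 let ?T = "{(%x. l *\<^sub>C resolvent D B l x) |l. l \<notin> sector s \<and> l \<noteq> 0}"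
 have mem: "(%x. l *\<^sub>C resolvent D B l x) \<in> ?T" if "l \<in> cosector s" for l
  using cS that by (auto simp: S_def)
 show ?thesis
 proof (rule gamma_bounded_gauss_E[OF gb])
  fix C :: real
  assume C0: "C \<ge> 0"
   and C: "\<And>N T x. (\<And>n. n < N ==> T n \<in> ?T) ==> gauss_E N (%n. T n (x n)) \<le> ennreal (C\<^sup>2) * gauss_E N x"
    "\<And>T x. T \<in> ?T ==> norm (T x) \<le> C * norm x"
  show ?thesis
  proof (rule that[OF C0])
   show "sect_op D B s C"
    by (rule sect_opI[OF s0 s(2) lin subset_trans[OF cS SR] C0 C(2)[OF mem]])
   show "gauss_E N (%n. l n *\<^sub>C resolvent D B (l n) (x n)) \<le> ennreal (C\<^sup>2) * gauss_E N x"
    if "\<And>n. n < N ==> l n \<in> cosector s" for N l and x :: "nat => 'a"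
    by (rule C(1)[of N "%n x. l n *\<^sub>C resolvent D B (l n) x" x]) (rule mem[OF that])
  qed
 qed
qed

lemma dense_range_compose:
 assumes f: "bounded_linear f" "closure (range f) = UNIV" and g: "closure (range g) = UNIV"
 shows "closure (range (%x. f (g x))) = UNIV"
proof -
 have "f ` closure (range g) \<subseteq> closure (f ` range g)" by (rule closure_bounded_linear_image_subset[OF f(1)])
 then have "range f \<subseteq> closure (range (%x. f (g x)))" using g by (simp add: image_image)
 then have "closure (range f) \<subseteq> closure (range (%x. f (g x)))" by (rule closure_minimal) simp
 then show ?thesis using f(2) by auto
qed

text \<open>Domination of \<open>L\<close> by \<open>Q\<close> makes the assignment of
  \<open>L w\<close> to \<open>Q w\<close> well defined and Lipschitz on a dense subspace, so it
  extends by limits.\<close>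

lemma dense_extension:
 fixes Q L :: "'a::complex_banach => 'a"
 assumes Q: "bounded_clinear Q" "closure (range Q) = UNIV" and L: "bounded_clinear L"
  and bd: "\<And>w. norm (L w) \<le> K * norm (Q w)"
 shows "\<exists>S. bounded_clinear S \<and> (\<forall>w. S (Q w) = L w)"
proof -
 have "\<exists>w. \<forall>n::nat. norm (Q (w n) - x) < inverse (Suc n)" for x
 proof -
  have "\<exists>w. norm (Q w - x) < inverse (Suc n)" for n :: nat
   using Q(2) closure_approachable[of x "range Q"] by (fastforce simp: dist_norm)
  then show ?thesis by metis
 qed
 then obtain w where w: "\<And>x n. norm (Q (w x n) - x) < inverse (Suc n)" by metis
 have wl: "(%n. Q (w x n)) \<longlonglongrightarrow> x" for x
  by (rule LIM_zero_cancel, rule Lim_null_comparison[OF _ LIMSEQ_inverse_real_of_nat])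
   (use w in \<open>auto intro!: always_eventually less_imp_le simp del: of_nat_Suc\<close>)
 have K0: "norm (L a - L b) \<le> K * norm (Q a - Q b)" for a b
  using bd[of "a - b"] by (simp only: bounded_clinear_diff[OF L] bounded_clinear_diff[OF Q(1)])
 define K' where "K' = max K 0"
 have K': "K' \<ge> 0" "norm (L a - L b) \<le> K' * norm (Q a - Q b)" "norm (L a) \<le> K' * norm (Q a)" for a b
  using K0[of a b] bd[of a] mult_right_mono[of K K' "norm (Q a - Q b)"] mult_right_mono[of K K' "norm (Q a)"]
  by (auto simp: K'_def)
 have conv: "convergent (%n. L (w x n))" for x
 proof (rule Cauchy_convergent, rule metric_CauchyI)
  fix e :: real assume e: "e > 0"
  have "Cauchy (%n. Q (w x n))" using wl[of x] by (rule LIMSEQ_imp_Cauchy)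
  then obtain N where N: "\<And>m n. m \<ge> N ==> n \<ge> N ==> norm (Q (w x m) - Q (w x n)) < e / (K' + 1)"
   using e K'(1) by (force simp: Cauchy_def dist_norm dest!: spec[of _ "e / (K' + 1)"])
  show "\<exists>N. \<forall>m\<ge>N. \<forall>n\<ge>N. dist (L (w x m)) (L (w x n)) < e"
  proof (intro exI allI impI)
   fix m n assume "m \<ge> N" "n \<ge> N"
   have "norm (L (w x m) - L (w x n)) \<le> (K' + 1) * norm (Q (w x m) - Q (w x n))"
    using K'(2)[of "w x m" "w x n"] by (simp add: ring_distribs add_increasing2)
   also have "\<dots> < (K' + 1) * (e / (K' + 1))" using N[OF \<open>m \<ge> N\<close> \<open>n \<ge> N\<close>] K'(1) by (intro mult_strict_left_mono) auto
   finally show "dist (L (w x m)) (L (w x n)) < e" using K'(1) by (simp add: dist_norm)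
  qed
 qed
 define S where "S x = lim (%n. L (w x n))" for x
 have Sl: "(%n. L (w x n)) \<longlonglongrightarrow> S x" for x unfolding S_def using conv[of x] by (simp add: convergent_LIMSEQ_iff)
 have uniq: "y = S x" if v: "(%n. Q (v n)) \<longlonglongrightarrow> x" "(%n. L (v n)) \<longlonglongrightarrow> y" for v x y
 proof -
  have "(%n. Q (v n) - Q (w x n)) \<longlonglongrightarrow> 0" using tendsto_diff[OF v(1) wl[of x]] by simp
  then have "(%n. K' * norm (Q (v n) - Q (w x n))) \<longlonglongrightarrow> 0" by (intro tendsto_mult_right_zero tendsto_norm_zero)
  then have "(%n. L (v n) - L (w x n)) \<longlonglongrightarrow> 0"
   by (rule Lim_null_comparison[rotated]) (intro always_eventually allI K')
  then show ?thesis using tendsto_diff[OF v(2) Sl[of x]] by (metis LIMSEQ_unique right_minus_eq)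
 qed
 have "bounded_clinear S"
 proof (rule bounded_clinearI)
  show "S (x + y) = S x + S y" for x y
   using uniq[of "%n. w x n + w y n" "x + y" "S x + S y"] tendsto_add[OF wl wl] tendsto_add[OF Sl Sl]
   by (simp add: bounded_clinear_add[OF L] bounded_clinear_add[OF Q(1)])
  show "S (c *\<^sub>C x) = c *\<^sub>C S x" for c x
   using uniq[of "%n. c *\<^sub>C w x n" "c *\<^sub>C x" "c *\<^sub>C S x"] scaleC.tendsto[OF tendsto_const wl] scaleC.tendsto[OF tendsto_const Sl]
   by (simp add: bounded_clinear_scaleC[OF L] bounded_clinear_scaleC[OF Q(1)])
  show "norm (S x) \<le> K' * norm x" for x
   by (rule LIMSEQ_le[OF tendsto_norm[OF Sl] tendsto_mult_left[OF tendsto_norm[OF wl]]]) (use K'(3) in auto)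
 qed
 moreover have "S (Q v) = L v" for v
  using uniq[of "%_. v" "Q v" "L v"] by simp
 ultimately show ?thesis by blast
qed

context sect_resolvent
begin

text \<open>The operator A (1 + A)^(-2) for \<open>R\<close> the resolvent of \<open>A\<close>,
  written with resolvents only, so that no contour angle enters; \<open>Phi_eq_Psi\<close>
  identifies it with the value of the regulariser.\<close>

definition Psi :: "'a => 'a" where "Psi x = - R (-1) x - R (-1) (R (-1) x)"

lemma Phi_eq_Psi: "s < nu ==> nu < pi ==> Phi nu regulariser = Psi"
 by (rule ext) (simp add: Psi_def Phi_regulariser)

lemma Psi_clinear: "bounded_clinear Psi"
proof -
 define nu where "nu = (s + pi) / 2"
 have nu: "s < nu" "nu < pi" using s by (auto simp: nu_def)
 have "h0_ray (1 / (gap (pi - (nu + pi) / 2))\<^sup>2) 1 nu regulariser"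
  by (rule h0_imp_h0_ray[OF h0_regulariser[of "(nu + pi) / 2"]]) (use nu s in auto)
 from Phi_clinear[OF this nu] show ?thesis using Phi_eq_Psi[OF nu] by simp
qed

lemma Psi_commute:
 assumes T: "bounded_clinear T" and TR: "\<And>z x. z \<in> cosector s ==> T (R z x) = R z (T x)"
 shows "T (Psi x) = Psi (T x)"
 by (simp add: Psi_def bounded_clinear_diff[OF T] bounded_clinear_minus[OF T] TR[OF minus1_cosector])

lemma Phi_R: "h0_ray C ep nu f ==> s < nu ==> nu < pi ==> z \<in> cosector s ==> Phi nu f (R z x) = R z (Phi nu f x)"
 by (rule Phi_commute[symmetric]) (auto intro!: R_clinear R_commute)

lemma Phi_Psi: "h0_ray C ep nu f ==> s < nu ==> nu < pi ==> Phi nu f (Psi x) = Psi (Phi nu f x)"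
 by (rule Psi_commute) (auto intro!: Phi_clinear Phi_R)

end

context sect_op
begin

abbreviation "Res \<equiv> resolvent D A"

lemma resolvent_apply:
 assumes z: "z \<in> cosector s" and y: "y \<in> D"
 shows "Res z (A y) = z *\<^sub>C Res z y - y"
proof -
 have "z \<in> resolvent_set D A" using z res by auto
 from resolvent_props(3,4)[OF this] show ?thesis
  using y by (simp add: bounded_clinear_diff bounded_clinear_scaleC algebra_simps)
qed

text \<open>An ergodic argument: a vector of the kernel equals z R(z) x for all admissible z,
  whereas z R(z) A w = z (z R(z) w - w) tends to 0 as z = - t tends to 0. Approximating x by some A
  w gives x = 0.\<close>

lemma injective:
 assumes d: "closure (A ` D) = UNIV" and x: "x \<in> D" "A x = 0"
 shows "x = 0"
proof -
 have "norm x \<le> 0 + e" if e: "e > 0" for e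
 proof -
  define ep where "ep = e / (M + 1)"
  have ep: "ep > 0" using e M by (simp add: ep_def)
  obtain w where w: "w \<in> D" "norm (x - A w) < ep"
   using d closure_approachable[of x "A ` D"] ep by (auto simp: dist_norm norm_minus_commute)
  \<comment> \<open>Chosen after \<open>w\<close>, so that the term with \<open>w\<close>
    contributes at most \<open>ep\<close>; together with \<open>M * ep\<close> from the
    approximation the total is \<open>e\<close>.\<close>
  define t where "t = ep / ((M + 1) * (norm w + 1))"
  have n1: "norm w + 1 > 0" by (simp add: add_nonneg_pos)
  have t: "t > 0" using ep M n1 by (simp add: t_def)
  define z where "z = - complex_of_real t"
  have "cos pi < cos s" using s by (intro cos_monotone_0_pi) auto
  then have "t * (-1) < t * cos s" using t by (intro mult_strict_left_mono) simp_all
  moreover have nz: "cmod z = t" using t by (simp add: z_def)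
  ultimately have z: "z \<in> cosector s" unfolding cosector_def mem_Collect_eq nz by (simp add: z_def)
  have bd: "norm (z *\<^sub>C Res z y) \<le> M * norm y" for y
   using R_bound[OF z, of y] by (simp add: norm_scaleC mult.commute)
  have "x = z *\<^sub>C Res z x"
   using resolvent_apply[OF z x(1)] bounded_clinear_diff[OF R_clinear[OF z], of 0 0] by (simp add: x(2))
  also have "\<dots> = z *\<^sub>C Res z (x - A w) + z *\<^sub>C (z *\<^sub>C Res z w - w)"
   by (simp add: bounded_clinear_diff[OF R_clinear[OF z]] resolvent_apply[OF z w(1)] scaleC.diff_right)
  also have "norm \<dots> \<le> M * norm (x - A w) + t * (M * norm w + norm w)"
  proof (rule order_trans[OF norm_triangle_ineq add_mono[OF bd]])
   have "norm (z *\<^sub>C Res z w - w) \<le> M * norm w + norm w"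
    using norm_triangle_ineq4[of "z *\<^sub>C Res z w" w] bd[of w] by linarith
   then show "norm (z *\<^sub>C (z *\<^sub>C Res z w - w)) \<le> t * (M * norm w + norm w)"
    using t by (simp add: norm_scaleC nz)
  qed
  also have "\<dots> \<le> M * ep + t * ((M + 1) * (norm w + 1))"
   using w(2) M t by (intro add_mono mult_left_mono) (auto simp: algebra_simps)
  also have "t * ((M + 1) * (norm w + 1)) = ep" using M n1 by (simp add: t_def)
  also have "M * ep + ep = (M + 1) * ep" by (simp add: ring_distribs)
  also have "\<dots> = e" using M by (simp add: ep_def)
  finally show ?thesis by simp
 qed
 then have "norm x \<le> 0" by (rule field_le_epsilon)
 then show ?thesis by simp
qed

lemma minus1_resolvent: "-1 \<in> resolvent_set D A" using minus1_cosector res by auto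

text \<open>Injectivity and dense range of \<open>Psi\<close> are read off from this factorisation
  through the corresponding properties of \<open>A\<close>.\<close>

lemma Psi_factor: "Psi x = Res (-1) (A (Res (-1) x))"
 using resolvent_apply[OF minus1_cosector, of "Res (-1) x"] resolvent_props(1)[OF minus1_resolvent, of x]
 by (simp add: Psi_def scaleC_minus1)

lemma inj_Psi:
 assumes d: "closure (A ` D) = UNIV" and x: "Psi x = 0"
 shows "x = 0"
proof -
 note m = resolvent_props[OF minus1_resolvent] bounded_clinear_imp_bounded_linear[OF resolvent_props(4)[OF minus1_resolvent]]
 have "0 \<in> D" "\<forall>x\<in>D. \<forall>y\<in>D. x + y \<in> D \<and> A (x + y) = A x + A y" using lin unfolding linear_op_def by blast+
 then have "A (0 + 0) = A 0 + A 0" by blast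
 then have A0: "A 0 = 0" by simp
 have i: "v = 0" if "Res (-1) v = 0" for v using m(2)[of v] A0 that by simp
 have "A (Res (-1) x) = 0" using x i by (simp add: Psi_factor)
 then have "Res (-1) x = 0" by (rule injective[OF d m(1)])
 then show ?thesis by (rule i)
qed

lemma inj_Psi_eq: "closure (A ` D) = UNIV ==> Psi x = Psi y ==> x = y"
 using inj_Psi[of "x - y"] bounded_clinear_diff[OF Psi_clinear, of x y] by simp

lemma dense_Psi:
 assumes "closure D = UNIV" "closure (A ` D) = UNIV"
 shows "closure (range Psi) = UNIV"
proof -
 note m = resolvent_props[OF minus1_resolvent]
 have r: "range (Res (-1)) = D"
 proof
  show "D \<subseteq> range (Res (-1))"
  proof
   fix y assume "y \<in> D"
   from m(3)[OF this, symmetric] show "y \<in> range (Res (-1))" by (rule range_eqI)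
  qed
 qed (use m(1) in auto)
 have "range (%x. A (Res (-1) x)) = A ` range (Res (-1))" by (simp add: image_image)
 then have "closure (range (%x. A (Res (-1) x))) = UNIV" using assms r by simp
 with r assms(1) have "closure (range (%x. Res (-1) (A (Res (-1) x)))) = UNIV"
  by (intro dense_range_compose[of "Res (-1)" "%x. A (Res (-1) x)"] bounded_clinear_imp_bounded_linear[OF m(4)]) simp_all
 moreover have "Psi = (%x. Res (-1) (A (Res (-1) x)))" by (rule ext) (rule Psi_factor)
 ultimately show ?thesis by simp
qed

lemma H0_calc_eq: "H0_calc D A sg f = Phi (calc_angle D A sg) f"
 by (rule ext) (simp add: H0_calc_def contour_calc_def Phi_def Phi_ray_def)

text \<open>On the range of \<open>Psi\<close>, the quotient that defines \<open>calc\<close>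
  cancels, since \<open>Psi\<close> is injective and commutes with the contour integral. The
  regularised symbol is needed on the two rays only.\<close>

lemma calc_Psi:
 assumes d: "closure (A ` D) = UNIV" and nu: "s < calc_angle D A sg" "calc_angle D A sg < pi"
  and f: "h0_ray C ep (calc_angle D A sg) (%z. f z * regulariser z)"
 shows "calc D A sg f (Psi w) = Phi (calc_angle D A sg) (%z. f z * regulariser z) w"
  and "Psi w \<in> calc_dom D A sg f"
proof -
 have r: "calc_rel D A sg f (Psi w) y \<longleftrightarrow> Psi y = Psi (Phi (calc_angle D A sg) (%z. f z * regulariser z) w)" for y
  by (simp add: calc_rel_def H0_calc_eq Phi_eq_Psi[OF nu] Phi_Psi[OF f nu])
 show "calc D A sg f (Psi w) = Phi (calc_angle D A sg) (%z. f z * regulariser z) w"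
  unfolding calc_def r by (rule the_equality) (auto dest: inj_Psi_eq[OF d])
 show "Psi w \<in> calc_dom D A sg f" unfolding calc_dom_def using r by auto
qed

text \<open>The range of \<open>Psi\<close> is dense and contained in the domain of the calculus, so
  the adjoint value is unique there and can be evaluated by \<open>calc_Psi\<close>.\<close>

lemma adjoint_calc_Psi:
 assumes d: "closure D = UNIV" "closure (A ` D) = UNIV" and nu: "s < calc_angle D A sg" "calc_angle D A sg < pi"
  and f: "h0_ray C ep (calc_angle D A sg) (%z. f z * regulariser z)"
  and x': "x' \<in> adjoint_dom (calc_dom D A sg f) (calc D A sg f)"
 shows "adjoint_op (calc_dom D A sg f) (calc D A sg f) x' (Psi w) = x' (Phi (calc_angle D A sg) (%z. f z * regulariser z) w)"
proof -
 obtain v where v: "adjoint_rel (calc_dom D A sg f) (calc D A sg f) x' v" using x' unfolding adjoint_dom_def mem_Collect_eq by (rule exE)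
 have vP: "u (Psi w) = x' (Phi (calc_angle D A sg) (%z. f z * regulariser z) w)"
  if "adjoint_rel (calc_dom D A sg f) (calc D A sg f) x' u" for u w
 proof -
  have "\<forall>x\<in>calc_dom D A sg f. u x = x' (calc D A sg f x)" using that unfolding adjoint_rel_def by (elim conjE)
  from bspec[OF this calc_Psi(2)[OF d(2) nu f]] show ?thesis by (simp only: calc_Psi(1)[OF d(2) nu f])
 qed
 have "u = v" if u: "adjoint_rel (calc_dom D A sg f) (calc D A sg f) x' u" for u
 proof
  fix x
  have c: "continuous_on UNIV u" "continuous_on UNIV v"
  proof -
   have 1: "bounded_clinear u" using u unfolding adjoint_rel_def by (elim conjE)
   have 2: "bounded_clinear v" using v unfolding adjoint_rel_def by (elim conjE)
   show "continuous_on UNIV u" by (rule linear_continuous_on[OF bounded_clinear_imp_bounded_linear[OF 1]])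
   show "continuous_on UNIV v" by (rule linear_continuous_on[OF bounded_clinear_imp_bounded_linear[OF 2]])
  qed
  have "closed {x. u x = v x}" by (rule closed_Collect_eq[OF c])
  moreover have "range Psi \<subseteq> {x. u x = v x}" using vP[OF u] vP[OF v] by auto
  ultimately have "closure (range Psi) \<subseteq> {x. u x = v x}" by (rule closure_minimal[rotated])
  then show "u x = v x" using dense_Psi[OF d] by auto
 qed
 then have "adjoint_op (calc_dom D A sg f) (calc D A sg f) x' = v"
  unfolding adjoint_op_def by (intro the_equality v)
 then show ?thesis using vP[OF v, of w] by (simp only:)
qed

end

section \<open>Riemann sums and averaged symbols\<close>

lemma Riemann_sum_error:
 fixes g :: "real => complex"
 assumes g: "continuous_on UNIV g" and d: "dl \<ge> 0" and e: "\<eta> \<ge> 0"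
  and osc: "\<And>u v. a \<le> u ==> u \<le> v ==> v \<le> u + dl ==> v \<le> a + real n * dl ==> cmod (g v - g u) \<le> \<eta>"
 shows "cmod (integral {a..a + real n * dl} g - dl *\<^sub>R (\<Sum>k<n. g (a + real k * dl))) \<le> real n * dl * \<eta>"
 using osc
proof (induction n)
 case 0
 then show ?case by simp
next
 case (Suc n)
 define c where "c = a + real n * dl"
 have c: "a \<le> c" "a + real (Suc n) * dl = c + dl" using d by (simp_all add: c_def ring_distribs)
 have gi: "g integrable_on {x..y}" for x y by (rule integrable_continuous_interval[OF continuous_on_subset[OF g]]) simp
 have IH: "cmod (integral {a..c} g - dl *\<^sub>R (\<Sum>k<n. g (a + real k * dl))) \<le> real n * dl * \<eta>"
  unfolding c_def
 proof (rule Suc.IH)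
  fix u v assume uv: "a \<le> u" "u \<le> v" "v \<le> u + dl" "v \<le> a + real n * dl"
  show "cmod (g v - g u) \<le> \<eta>" using uv d c(2) by (intro Suc.prems) (simp_all add: c_def)
 qed
 have "integral {c..c + dl} (%u. g u - g c) = integral {c..c + dl} g - dl *\<^sub>R g c"
  using d by (subst Henstock_Kurzweil_Integration.integral_diff[OF gi integrable_const_ivl]) simp_all
 moreover have "cmod (integral {c..c + dl} (%u. g u - g c)) \<le> \<eta> * (c + dl - c)"
 proof (rule integral_bound)
  show "continuous_on {c..c + dl} (%u. g u - g c)"
   by (intro continuous_intros continuous_on_subset[OF g]) simp
  show "cmod (g t - g c) \<le> \<eta>" if "t \<in> {c..c + dl}" for t
   using that c by (intro Suc.prems) simp_all
 qed (use d in simp)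
 ultimately have st: "cmod (integral {c..c + dl} g - dl *\<^sub>R g c) \<le> dl * \<eta>" by (simp add: mult.commute)
 have "integral {a..a + real (Suc n) * dl} g = integral {a..c} g + integral {c..c + dl} g"
  unfolding c(2) using c(1) d by (intro Henstock_Kurzweil_Integration.integral_combine[symmetric] gi) simp_all
 then have "integral {a..a + real (Suc n) * dl} g - dl *\<^sub>R (\<Sum>k<Suc n. g (a + real k * dl))
   = (integral {a..c} g - dl *\<^sub>R (\<Sum>k<n. g (a + real k * dl))) + (integral {c..c + dl} g - dl *\<^sub>R g c)"
  by (simp add: c_def scaleR_add_right)
 then have "cmod (integral {a..a + real (Suc n) * dl} g - dl *\<^sub>R (\<Sum>k<Suc n. g (a + real k * dl)))
   \<le> real n * dl * \<eta> + dl * \<eta>"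
  using norm_triangle_mono[OF IH st] by (simp only:)
 also have "\<dots> = real (Suc n) * dl * \<eta>" by (simp add: ring_distribs)
 finally show ?case .
qed

text \<open>\<open>q\<close> stands for the Gaussian pairings, bounded by \<open>K\<close> for every
  mesh. An error of order \<open>dl * dl\<close> per cell is enough, because with
  \<open>n * dl = L\<close> the total is at most \<open>L * dl * C\<close>.\<close>

lemma integral_bound_via_sums:
 fixes g :: "real => complex"
 assumes g: "continuous_on UNIV g" and L: "L > 0" and C: "C \<ge> 0"
  and q: "\<And>n dl. dl > 0 ==> cmod (q n dl) \<le> K"
  and err: "\<And>n dl. dl > 0 ==> dl \<le> L ==> cmod (q n dl - dl *\<^sub>R (\<Sum>k<n. g (a + real k * dl))) \<le> real n * (dl * dl * C)"
 shows "cmod (integral {a..a + L} g) \<le> K"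
proof (rule field_le_epsilon)
 fix e :: real assume e: "e > 0"
 define \<eta> where "\<eta> = e / (2 * L)"
 have \<eta>: "\<eta> > 0" using e L by (simp add: \<eta>_def)
 have uc: "uniformly_continuous_on {a..a + L} g"
  by (intro compact_uniformly_continuous continuous_on_subset[OF g]) simp_all
 from uc[unfolded uniformly_continuous_on_def, THEN spec[of _ \<eta>], THEN mp, OF \<eta>]
 obtain d where d': "d > 0 \<and> (\<forall>u\<in>{a..a + L}. \<forall>v\<in>{a..a + L}. dist v u < d \<longrightarrow> dist (g v) (g u) < \<eta>)"
  by (rule exE)
 note d = conjunct1[OF d'] conjunct2[OF d', rule_format]
 \<comment> \<open>A mesh below \<open>b\<close> makes the oscillation error of the Riemann sum and
   the accumulated cell error at most \<open>e / 2\<close> each.\<close>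
 define b where "b = min (d / 2) (e / (2 * L * (C + 1)))"
 have b: "b > 0" using d e L C by (simp add: b_def)
 obtain n :: nat where n: "real n > L / b" "n > 0"
 proof -
  obtain n0 :: nat where "real n0 > L / b" using reals_Archimedean2 by blast
  then show ?thesis by (intro that[of "Suc n0"]) simp_all
 qed
 define dl where "dl = L / real n"
 have dl: "dl > 0" "real n * dl = L" using n L by (simp_all add: dl_def)
 have db: "dl < b" using n b by (simp add: dl_def field_simps)
 have "1 \<le> real n" using n(2) by simp
 then have "dl \<le> L" using L by (simp add: dl_def field_simps)
 note er = err[OF dl(1) this, of n]
 have 1: "cmod (integral {a..a + L} g - dl *\<^sub>R (\<Sum>k<n. g (a + real k * dl))) \<le> e / 2"
 proof -
  have "cmod (integral {a..a + real n * dl} g - dl *\<^sub>R (\<Sum>k<n. g (a + real k * dl))) \<le> real n * dl * \<eta>"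
  proof (rule Riemann_sum_error[OF g])
   fix u v assume uv: "a \<le> u" "u \<le> v" "v \<le> u + dl" "v \<le> a + real n * dl"
   have "dl < d" using db d(1) by (simp add: b_def)
   then have "dist (g v) (g u) < \<eta>" using uv dl(2) by (intro d(2)) (auto simp: dist_real_def)
   then show "cmod (g v - g u) \<le> \<eta>" by (simp add: dist_norm)
  qed (use dl \<eta> in simp_all)
  then show ?thesis unfolding dl(2) using L by (simp add: \<eta>_def)
 qed
 have 2: "real n * (dl * dl * C) \<le> e / 2"
 proof -
  have "real n * (dl * dl * C) = L * (dl * C)" unfolding dl(2)[symmetric] by (simp add: mult_ac)
  also have "\<dots> \<le> L * (e / (2 * L * (C + 1)) * (C + 1))"
   using db L C dl(1) by (intro mult_left_mono mult_mono) (simp_all add: b_def)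
  also have "\<dots> = e / 2" using L C by simp
  finally show ?thesis .
 qed
 have "integral {a..a + L} g = (integral {a..a + L} g - dl *\<^sub>R (\<Sum>k<n. g (a + real k * dl)))
   - (q n dl - dl *\<^sub>R (\<Sum>k<n. g (a + real k * dl))) + q n dl" by simp
 also have "cmod \<dots> \<le> (e / 2 + e / 2) + K"
  by (rule order_trans[OF norm_triangle_ineq add_mono[OF order_trans[OF norm_triangle_ineq4 add_mono[OF 1 order_trans[OF er 2]]] q[OF dl(1)]]])
 finally show "cmod (integral {a..a + L} g) \<le> K + e" by simp
qed

text \<open>The normalised indicator, as an element of \<open>H\<close>, of the interval from
  \<open>a\<close> to \<open>b\<close> in the variable \<open>ln t\<close>. Half-open intervals keep
  adjacent cells disjoint.\<close>

definition cell :: "real => real => real => complex" where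
 "cell a b t = indicator {exp a..<exp b} t *\<^sub>R complex_of_real (1 / sqrt (b - a))"

lemma emeasure_haar_interval:
 assumes "a \<le> b"
 shows "emeasure haar {exp a..<exp b} = ennreal (b - a)"
proof -
 have "emeasure haar {exp a..<exp b} = (\<integral>\<^sup>+t. ennreal (indicator {0<..} t / t) * indicator {exp a..<exp b} t \<partial>lborel)"
  unfolding haar_def by (rule emeasure_density) simp_all
 also have "\<dots> = (\<integral>\<^sup>+t. ennreal (indicator {0<..} t / t) * indicator {exp a..exp b} t \<partial>lborel)"
 proof (rule nn_integral_cong_AE)
  show "AE t in lborel. ennreal (indicator {0<..} t / t) * indicator {exp a..<exp b} t = ennreal (indicator {0<..} t / t) * indicator {exp a..exp b} t"
   using AE_lborel_singleton[of "exp b"] by eventually_elim (auto simp: indicator_def)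
 qed
 also have "\<dots> = ennreal (ln (exp b) - ln (exp a))"
 proof (rule nn_integral_FTC_Icc)
  fix x assume "x \<in> {exp a..exp b}"
  then have "0 < x" using exp_gt_zero[of a] by (simp del: exp_gt_zero)
  then show "(ln has_real_derivative indicator {0<..} x / x) (at x)" "0 \<le> indicator {0<..} x / x"
   using DERIV_ln_divide[of x] by simp_all
 qed (use assms in simp_all)
 finally show ?thesis by simp
qed

lemma cell_integral:
 fixes G :: "real => complex"
 assumes ab: "a < b" and G: "continuous_on {0<..} G" and K: "\<And>t. t \<in> {exp a..<exp b} ==> cmod (G t) \<le> K"
 shows "integrable haar (%t. cell a b t * G t)" "cmod (\<integral>t. cell a b t * G t \<partial>haar) \<le> sqrt (b - a) * K"
proof -
 let ?I = "{exp a..<exp b}"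
 have pos: "0 < t" if "t \<in> ?I" for t using that exp_gt_zero[of a] by (simp del: exp_gt_zero)
 have fin: "emeasure haar ?I < \<infinity>" using ab by (simp add: emeasure_haar_interval)
 have me: "measure haar ?I = b - a" using ab by (simp add: measure_def emeasure_haar_interval)
 have eq: "cell a b t * G t = cell a b t * (indicator {0<..} t *\<^sub>R G t)" for t
  using pos by (auto simp: cell_def indicator_def)
 have gm: "(%t. indicator {0<..} t *\<^sub>R G t) \<in> borel_measurable borel"
  by (rule borel_measurable_continuous_on_indicator[OF _ G]) simp
 have cm: "cell a b \<in> borel_measurable borel" unfolding cell_def[abs_def] by measurable
 have m: "(%t. cell a b t * G t) \<in> borel_measurable haar"
  unfolding eq measurable_cong_sets[OF sets_haar refl] by (intro borel_measurable_times gm cm)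
 have i: "integrable haar (%t. indicator ?I t *\<^sub>R (K / sqrt (b - a)))"
  using fin by (intro integrable_scaleR_left integrable_real_indicator) simp_all
 have b: "cmod (cell a b t * G t) \<le> indicator ?I t *\<^sub>R (K / sqrt (b - a))" for t
  using K[of t] ab by (cases "t \<in> ?I") (simp_all add: cell_def norm_mult norm_divide divide_right_mono)
 show "integrable haar (%t. cell a b t * G t)"
  by (rule Bochner_Integration.integrable_bound[OF i m]) (rule AE_I2, rule order_trans[OF b], simp only: real_norm_def abs_ge_self)
 then have "cmod (\<integral>t. cell a b t * G t \<partial>haar) \<le> (\<integral>t. indicator ?I t *\<^sub>R (K / sqrt (b - a)) \<partial>haar)"
  by (rule Bochner_Integration.integral_norm_bound_integral[OF _ i]) (rule b)
 also have "\<dots> = (b - a) * (K / sqrt (b - a))" using fin by (subst integral_scaleR_left) (simp_all add: me integrable_real_indicator)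
 also have "\<dots> = sqrt (b - a) * K" using ab real_sqrt_mult_self[of "b - a"] by (simp add: field_simps)
 finally show "cmod (\<integral>t. cell a b t * G t \<partial>haar) \<le> sqrt (b - a) * K" .
qed

lemma cell_const: "a < b ==> (\<integral>t. cell a b t * c \<partial>haar) = complex_of_real (sqrt (b - a)) * c"
proof -
 assume ab: "a < b"
 have "(\<integral>t. cell a b t \<partial>haar) = measure haar {exp a..<exp b} *\<^sub>R complex_of_real (1 / sqrt (b - a))"
  unfolding cell_def[abs_def] using ab by (subst integral_scaleR_left) (simp_all add: emeasure_haar_interval integrable_real_indicator)
 also have "\<dots> = complex_of_real ((b - a) / sqrt (b - a))"
  using ab by (simp add: measure_def emeasure_haar_interval scaleR_conv_of_real)
 also have "(b - a) / sqrt (b - a) = sqrt (b - a)" by (rule real_div_sqrt) (use ab in simp)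
 finally show ?thesis by (simp only: integral_mult_left_zero)
qed

lemma cell_H_space: "a < b ==> cell a b \<in> H_space"
proof -
 assume ab: "a < b"
 have cm: "cell a b \<in> borel_measurable borel" unfolding cell_def[abs_def] by measurable
 have "(cmod (cell a b t))\<^sup>2 = indicator {exp a..<exp b} t *\<^sub>R (1 / (b - a))" for t
  using ab by (cases "t \<in> {exp a..<exp b}") (simp_all add: cell_def norm_divide power_divide)
 moreover have "integrable haar (%t. indicator {exp a..<exp b} t *\<^sub>R (1 / (b - a)))"
  using ab by (intro integrable_scaleR_left integrable_real_indicator) (simp_all add: emeasure_haar_interval)
 ultimately show ?thesis unfolding H_space_def using cm by simp
qed

lemma cell_cnj: "cnj (cell a b t) = cell a b t"
 by (simp add: cell_def scaleR_conv_of_real)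

lemma cell_orthonormal:
 fixes a dl :: real
 assumes d: "dl > 0"
 defines "e \<equiv> %k::nat. cell (a + real k * dl) (a + real k * dl + dl)"
 shows "H_ip (e i) (e j) = (if i = j then 1 else 0)"
proof (cases "i = j")
 case True
 have "H_ip (e i) (e i) = (\<integral>t. cell (a + real i * dl) (a + real i * dl + dl) t * complex_of_real (1 / sqrt dl) \<partial>haar)"
  unfolding H_ip_def
  by (rule Bochner_Integration.integral_cong) (auto simp: e_def cell_cnj cell_def indicator_def)
 also have "\<dots> = 1" using d by (subst cell_const) simp_all
 finally show ?thesis using True by simp
next
 case False
 have 0: "e k t * cnj (e l t) = 0" if "k < l" for k l t
 proof (cases "t < exp (a + real l * dl)")
  case True
  then show ?thesis by (simp add: e_def cell_def)
 next
  case F: False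
  have "real k + 1 \<le> real l" using that by simp
  from mult_right_mono[OF this less_imp_le[OF d]] have "a + real k * dl + dl \<le> a + real l * dl"
   by (simp add: ring_distribs)
  then have "exp (a + real k * dl + dl) \<le> exp (a + real l * dl)" by simp
  with F have "exp (a + real k * dl + dl) \<le> t" by linarith
  then show ?thesis by (simp add: e_def cell_def)
 qed
 have z: "e i t * cnj (e j t) = 0" for t
 proof (cases "i < j")
  case True
  then show ?thesis by (rule 0)
 next
  case F: False
  with False have "j < i" by simp
  from 0[OF this, of t] show ?thesis by auto
 qed
 have "H_ip (e i) (e j) = (\<integral>t. 0 \<partial>haar)" unfolding H_ip_def by (simp only: z)
 then show ?thesis using False by simp
qed

lemma exp_in_sector: "0 < sg ==> sg < pi ==> w \<in> strip (- sg) sg ==> exp w \<in> sector sg"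
 using Arg_exp[of w] by (simp add: sector_def strip_def abs_if)

text \<open>In logarithmic coordinates \<open>\<phi>\<close> is bounded and, by Cauchy's estimate, Lipschitz on horizontal lines.\<close>

lemma H0inf_log:
 assumes \<phi>: "\<phi> \<in> H0inf sg" and nu: "0 < nu" "nu < sg" "sg < pi"
 obtains K where "K \<ge> 0" "(%w. \<phi> (exp w)) holomorphic_on strip (- sg) sg"
  "\<And>w. w \<in> strip (- sg) sg ==> cmod (\<phi> (exp w)) \<le> K"
  "\<And>u v ta. ta \<in> {nu, - nu} ==> cmod (\<phi> (exp (Complex u ta)) - \<phi> (exp (Complex v ta))) \<le> K * \<bar>u - v\<bar>"
proof -
 obtain C ep where hol: "\<phi> holomorphic_on sector sg" and C: "C > 0" "ep > 0"
  "\<And>z. z \<in> sector sg ==> cmod (\<phi> z) \<le> C * min (cmod z powr ep) (cmod z powr (- ep))"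
  using \<phi> unfolding H0inf_def by blast
 have es: "exp w \<in> sector sg" if "w \<in> strip (- sg) sg" for w using exp_in_sector[OF _ _ that] nu by simp
 have h: "(%w. \<phi> (exp w)) holomorphic_on strip (- sg) sg"
  by (rule holomorphic_on_compose_gen[OF holomorphic_on_exp hol, unfolded comp_def]) (use es in blast)
 have bd: "cmod (\<phi> (exp w)) \<le> C" if "w \<in> strip (- sg) sg" for w
 proof -
  have "min (cmod (exp w) powr ep) (cmod (exp w) powr (- ep)) \<le> 1"
   using C(2) by (cases "Re w \<ge> 0") (simp_all add: powr_def min_le_iff_disj mult_nonneg_nonpos zero_le_mult_iff)
  then have "C * min (cmod (exp w) powr ep) (cmod (exp w) powr (- ep)) \<le> C * 1" using C(1) by (intro mult_left_mono) simp_all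
  then show ?thesis using C(3)[OF es[OF that]] by linarith
 qed
 \<comment> \<open>The derivative is bounded on a strip containing both lines of height
   \<open>nu\<close> and \<open>- nu\<close>; discs of radius \<open>r\<close> about its points stay
   in the strip where the symbol is bounded.\<close>
 define nu' where "nu' = (nu + sg) / 2"
 define r where "r = (sg - nu') / 2"
 have r: "r > 0" "nu < nu'" "nu' + r < sg" using nu by (simp_all add: r_def nu'_def field_simps)
 define g where "g w = \<phi> (exp w)" for w
 have d: "cmod (deriv g w) \<le> C / r" "(g has_field_derivative deriv g w) (at w within strip (- nu') nu')"
  if w: "w \<in> strip (- nu') nu'" for w
 proof -
  have sub: "cball w r \<subseteq> strip (- sg) sg"
  proof
   fix x assume "x \<in> cball w r"
   then have "\<bar>Im w - Im x\<bar> \<le> r" using abs_Im_le_cmod[of "w - x"] by (simp add: dist_norm)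
   then show "x \<in> strip (- sg) sg" using w r by (simp add: strip_def abs_le_iff)
  qed
  have hw: "g holomorphic_on strip (- sg) sg" using h by (simp add: g_def[abs_def])
  have "cmod ((deriv ^^ 1) g w) \<le> fact 1 * C / r ^ 1"
  proof (rule Cauchy_inequality[OF _ _ r(1)])
   show "g holomorphic_on ball w r" by (rule holomorphic_on_subset[OF hw subset_trans[OF ball_subset_cball sub]])
   show "continuous_on (cball w r) g" by (rule holomorphic_on_imp_continuous_on[OF holomorphic_on_subset[OF hw sub]])
   fix x assume "cmod (w - x) = r"
   then have "x \<in> cball w r" by (simp add: dist_norm)
   then show "cmod (g x) \<le> C" unfolding g_def using sub by (intro bd) blast
  qed
  then show "cmod (deriv g w) \<le> C / r" by simp
  have "w \<in> strip (- sg) sg" using sub r(1) by (meson centre_in_cball less_imp_le subsetD)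
  from holomorphic_derivI[OF hw open_strip this]
  show "(g has_field_derivative deriv g w) (at w within strip (- nu') nu')"
   by (rule has_field_derivative_at_within)
 qed
 have lip: "cmod (g (Complex u ta) - g (Complex v ta)) \<le> C / r * \<bar>u - v\<bar>" if "ta \<in> {nu, - nu}" for u v ta
 proof -
  have "Complex x ta \<in> strip (- nu') nu'" for x using that r nu by (auto simp: strip_def)
  note m = this[of u] this[of v]
  have "cmod (g (Complex u ta) - g (Complex v ta)) \<le> C / r * cmod (Complex u ta - Complex v ta)"
   by (rule field_differentiable_bound[OF convex_strip d(2,1) m])
  moreover have "Complex u ta - Complex v ta = complex_of_real (u - v)" by (simp add: complex_eq_iff)
  then have "cmod (Complex u ta - Complex v ta) = \<bar>u - v\<bar>" by (simp only: norm_of_real)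
  ultimately show ?thesis by simp
 qed
 define K where "K = max C (C / r)"
 show ?thesis
 proof (rule that[OF _ h])
  show "K \<ge> 0" using C(1) by (simp add: K_def)
  show "cmod (\<phi> (exp w)) \<le> K" if "w \<in> strip (- sg) sg" for w
   by (rule order_trans[OF bd[OF that]]) (simp add: K_def)
  show "cmod (\<phi> (exp (Complex u ta)) - \<phi> (exp (Complex v ta))) \<le> K * \<bar>u - v\<bar>" if "ta \<in> {nu, - nu}" for u v ta
   by (rule order_trans[OF lip[OF that, unfolded g_def]], rule mult_right_mono) (simp_all add: K_def)
 qed
qed

lemma of_real_mult_exp: "t > 0 ==> complex_of_real t * exp (Complex u ta) = exp (Complex (u + ln t) ta)"
 by (simp add: exp_Complex_eq exp_add)

text \<open>The output of \<open>H0inf_log\<close> as a context: \<open>sg\<close> is the sector of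
  the symbol and \<open>nu\<close> a contour angle below it. It is instantiated once for each of the
  four estimates in the theorem.\<close>

locale log_symbol =
 fixes \<phi> :: "complex => complex" and sg nu K :: real
 assumes sg: "0 < nu" "nu < sg" "sg < pi" and K: "K \<ge> 0"
  and hol: "(%w. \<phi> (exp w)) holomorphic_on strip (- sg) sg"
  and bd: "\<And>w. w \<in> strip (- sg) sg ==> cmod (\<phi> (exp w)) \<le> K"
  and lip: "\<And>u v ta. ta \<in> {nu, - nu} ==> cmod (\<phi> (exp (Complex u ta)) - \<phi> (exp (Complex v ta))) \<le> K * \<bar>u - v\<bar>"
begin

lemma ray_strip: "ta \<in> {nu, - nu} ==> Complex u ta \<in> strip (- sg) sg"
 using sg by (auto simp: strip_def)

lemma continuous_symbol: "ta \<in> {nu, - nu} ==> continuous_on {0<..} (%t. \<phi> (complex_of_real t * exp (Complex u ta)))"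
proof -
 assume ta: "ta \<in> {nu, - nu}"
 have "continuous_on {0<..} (%t. \<phi> (exp (Complex (u + ln t) ta)))"
  unfolding Complex_eq
 proof (rule continuous_on_compose2[OF holomorphic_on_imp_continuous_on[OF hol]])
  show "continuous_on {0<..} (%t. complex_of_real (u + ln t) + \<i> * complex_of_real ta)"
   by (intro continuous_intros) auto
 qed (use ray_strip[OF ta] in \<open>auto simp: Complex_eq simp del: of_real_add\<close>)
 then show ?thesis by (rule continuous_on_eq) (simp add: of_real_mult_exp)
qed

text \<open>Multiplying the argument by \<open>t\<close> is a translation by \<open>ln t\<close> in
  the logarithmic coordinate, so the Lipschitz bound controls the variation over a cell. The factor
  \<open>sqrt (b - a)\<close> is the integral of the normalised cell.\<close>

lemma sq_symbol_cell:
 assumes ab: "a < b" and ta: "ta \<in> {nu, - nu}"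
 shows "cmod (sq_symbol \<phi> (cell a b) (exp (Complex u ta))) \<le> sqrt (b - a) * K"
  and "cmod (sq_symbol \<phi> (cell a b) (exp (Complex u ta)) - complex_of_real (sqrt (b - a)) * \<phi> (complex_of_real (exp a) * exp (Complex u ta)))
   \<le> sqrt (b - a) * (K * (b - a))"
  and "cmod (sq_symbol \<phi> (cell a b) (exp (Complex u ta)) - sq_symbol \<phi> (cell a b) (exp (Complex v ta))) \<le> sqrt (b - a) * (K * \<bar>u - v\<bar>)"
proof -
 have t0: "0 < t" if "t \<in> {exp a..<exp b}" for t using that exp_gt_zero[of a] by (simp del: exp_gt_zero)
 have bd': "cmod (\<phi> (complex_of_real t * exp (Complex u ta))) \<le> K" if "t \<in> {exp a..<exp b}" for t u
  unfolding of_real_mult_exp[OF t0[OF that]] by (rule bd[OF ray_strip[OF ta]])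
 have I: "integrable haar (%t. cell a b t * \<phi> (complex_of_real t * exp (Complex u ta)))" for u
  by (rule cell_integral(1)[OF ab continuous_symbol[OF ta]]) (rule bd')
 show "cmod (sq_symbol \<phi> (cell a b) (exp (Complex u ta))) \<le> sqrt (b - a) * K"
  unfolding sq_symbol_def by (rule cell_integral(2)[OF ab continuous_symbol[OF ta]]) (rule bd')
 define c where "c = \<phi> (complex_of_real (exp a) * exp (Complex u ta))"
 have ic: "integrable haar (%t. cell a b t * c)" by (rule cell_integral(1)[OF ab, of _ "cmod c"]) simp_all
 have "sq_symbol \<phi> (cell a b) (exp (Complex u ta)) - complex_of_real (sqrt (b - a)) * c
   = (\<integral>t. cell a b t * (\<phi> (complex_of_real t * exp (Complex u ta)) - c) \<partial>haar)"
  unfolding sq_symbol_def right_diff_distrib cell_const[OF ab, symmetric] by (rule Bochner_Integration.integral_diff[OF I ic, symmetric])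
 also have "cmod \<dots> \<le> sqrt (b - a) * (K * (b - a))"
 proof (rule cell_integral(2)[OF ab])
  show "continuous_on {0<..} (%t. \<phi> (complex_of_real t * exp (Complex u ta)) - c)"
   by (intro continuous_intros continuous_symbol ta)
  fix t assume t: "t \<in> {exp a..<exp b}"
  have "cmod (\<phi> (complex_of_real t * exp (Complex u ta)) - c) \<le> K * \<bar>(u + ln t) - (u + ln (exp a))\<bar>"
   unfolding c_def of_real_mult_exp[OF t0[OF t]] of_real_mult_exp[OF exp_gt_zero] by (rule lip[OF ta])
  also have "\<dots> \<le> K * (b - a)"
  proof (rule mult_left_mono[OF _ K])
   have e: "exp (ln t) = t" using t0[OF t] by (rule exp_ln)
   have "exp a \<le> exp (ln t)" "exp (ln t) < exp b" using t unfolding e by simp_all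
   then have "a \<le> ln t" "ln t < b" by (simp_all only: exp_le_cancel_iff exp_less_cancel_iff)
   then show "\<bar>(u + ln t) - (u + ln (exp a))\<bar> \<le> b - a" by simp
  qed
  finally show "cmod (\<phi> (complex_of_real t * exp (Complex u ta)) - c) \<le> K * (b - a)" .
 qed
 finally show "cmod (sq_symbol \<phi> (cell a b) (exp (Complex u ta)) - complex_of_real (sqrt (b - a)) * \<phi> (complex_of_real (exp a) * exp (Complex u ta)))
   \<le> sqrt (b - a) * (K * (b - a))" unfolding c_def .
 have "sq_symbol \<phi> (cell a b) (exp (Complex u ta)) - sq_symbol \<phi> (cell a b) (exp (Complex v ta))
   = (\<integral>t. cell a b t * (\<phi> (complex_of_real t * exp (Complex u ta)) - \<phi> (complex_of_real t * exp (Complex v ta))) \<partial>haar)"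
  unfolding sq_symbol_def right_diff_distrib by (rule Bochner_Integration.integral_diff[OF I I, symmetric])
 also have "cmod \<dots> \<le> sqrt (b - a) * (K * \<bar>u - v\<bar>)"
 proof (rule cell_integral(2)[OF ab])
  show "continuous_on {0<..} (%t. \<phi> (complex_of_real t * exp (Complex u ta)) - \<phi> (complex_of_real t * exp (Complex v ta)))"
   by (intro continuous_intros continuous_symbol ta)
  fix t assume t: "t \<in> {exp a..<exp b}"
  show "cmod (\<phi> (complex_of_real t * exp (Complex u ta)) - \<phi> (complex_of_real t * exp (Complex v ta))) \<le> K * \<bar>u - v\<bar>"
   unfolding of_real_mult_exp[OF t0[OF t]] using lip[OF ta, of "u + ln t" "v + ln t"] by simp
 qed
 finally show "cmod (sq_symbol \<phi> (cell a b) (exp (Complex u ta)) - sq_symbol \<phi> (cell a b) (exp (Complex v ta))) \<le> sqrt (b - a) * (K * \<bar>u - v\<bar>)" .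
qed

definition reg_bound :: real where "reg_bound = 1 / (gap (pi - sg))\<^sup>2"

lemma reg: "h0 reg_bound 1 sg regulariser" "reg_bound \<ge> 0" "h0_ray reg_bound 1 nu regulariser"
proof -
 show h: "h0 reg_bound 1 sg regulariser" unfolding reg_bound_def by (rule h0_regulariser) (use sg in simp_all)
 show "reg_bound \<ge> 0" by (simp add: reg_bound_def)
 show "h0_ray reg_bound 1 nu regulariser" by (rule h0_imp_h0_ray[OF h]) (use sg in simp)
qed

lemma h0_symbol: "h0 (K * reg_bound) 1 sg (%z. \<phi> (complex_of_real (exp a) * z) * regulariser z)"
proof (rule h0I)
 have e: "complex_of_real (exp a) * exp w = exp (w + complex_of_real a)" for w
  by (simp add: exp_add exp_of_real mult.commute)
 have s: "w + complex_of_real a \<in> strip (- sg) sg" if "w \<in> strip (- sg) sg" for w using that by (simp add: strip_def)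
 have "(%w. \<phi> (exp (w + complex_of_real a))) holomorphic_on strip (- sg) sg"
  by (rule holomorphic_on_compose_gen[OF _ hol, unfolded comp_def]) (use s in \<open>auto intro!: holomorphic_intros\<close>)
 then show "(%w. \<phi> (complex_of_real (exp a) * exp w) * regulariser (exp w)) holomorphic_on strip (- sg) sg"
  unfolding e using reg(1) by (intro holomorphic_on_mult) (simp_all add: h0_def)
 fix u ta :: real assume ta: "\<bar>ta\<bar> < sg"
 have "Complex u ta \<in> strip (- sg) sg" using ta by (auto simp: strip_def)
 from bd[OF s[OF this]] have "cmod (\<phi> (complex_of_real (exp a) * exp (Complex u ta))) \<le> K" unfolding e .
 from mult_mono[OF this h0_bound[OF reg(1) ta, of u] K norm_ge_zero]
 show "cmod (\<phi> (complex_of_real (exp a) * exp (Complex u ta)) * regulariser (exp (Complex u ta))) \<le> K * reg_bound * exp (- 1 * \<bar>u\<bar>)"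
  by (simp add: norm_mult mult.assoc)
qed (use K reg in simp_all)

text \<open>For cells of length dl the averaged symbol has size dl^(1/2), and its distance from the
  value at the left end has size dl^(3/2). These two orders produce the quadratic error in
  \<open>cell_error\<close>.\<close>

lemma h0_ray_cell:
 assumes ab: "a < b"
 defines "f \<equiv> sq_symbol \<phi> (cell a b)"
 shows "h0_ray (sqrt (b - a) * K * reg_bound) 1 nu (%z. f z * regulariser z)"
  and "h0_ray (sqrt (b - a) * (K * (b - a)) * reg_bound) 1 nu
   (%z. f z * regulariser z + (- complex_of_real (sqrt (b - a))) * (\<phi> (complex_of_real (exp a) * z) * regulariser z))"
proof -
 note sq = sq_symbol_cell[OF ab, folded f_def]
 have rb: "cmod (regulariser (exp (Complex u ta))) \<le> reg_bound * exp (- 1 * \<bar>u\<bar>)" if "ta \<in> {nu, - nu}" for u ta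
  using reg(3) that by (auto simp: h0_ray_def)
 have rc: "continuous_on {0<..} (%r. regulariser (rcis r ta))" if "ta \<in> {nu, - nu}" for ta
  using reg(3) that by (auto simp: h0_ray_def)
 have nn: "sqrt (b - a) * K \<ge> 0" "sqrt (b - a) * (K * (b - a)) \<ge> 0" using ab K by simp_all
 have fc: "continuous_on {0<..} (%r. f (rcis r ta))" if ta: "ta \<in> {nu, - nu}" for ta
 proof -
  have "(sqrt (b - a) * K)-lipschitz_on UNIV (%u. f (exp (Complex u ta)))"
   using sq(3)[OF ta] nn by (intro lipschitz_onI) (simp_all add: dist_norm mult.assoc)
  from lipschitz_on_continuous_on[OF this]
  have "continuous_on {0<..} (%r. f (exp (Complex (ln r) ta)))"
   by (rule continuous_on_compose2) (auto intro!: continuous_intros)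
  then show ?thesis by (rule continuous_on_eq) (simp add: exp_Complex)
 qed
 show "h0_ray (sqrt (b - a) * K * reg_bound) 1 nu (%z. f z * regulariser z)"
  unfolding h0_ray_def
 proof (intro conjI ballI allI)
  fix ta u assume ta: "ta \<in> {nu, - nu}"
  show "continuous_on {0<..} (%r. f (rcis r ta) * regulariser (rcis r ta))" by (intro continuous_on_mult fc rc ta)
  show "cmod (f (exp (Complex u ta)) * regulariser (exp (Complex u ta))) \<le> sqrt (b - a) * K * reg_bound * exp (- 1 * \<bar>u\<bar>)"
   using mult_mono[OF sq(1)[OF ta, of u] rb[OF ta, of u] nn(1) norm_ge_zero] by (simp add: norm_mult mult_ac)
 qed (use nn reg in simp_all)
 show "h0_ray (sqrt (b - a) * (K * (b - a)) * reg_bound) 1 nu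
   (%z. f z * regulariser z + (- complex_of_real (sqrt (b - a))) * (\<phi> (complex_of_real (exp a) * z) * regulariser z))"
  unfolding h0_ray_def
 proof (intro conjI ballI allI)
  fix ta u assume ta: "ta \<in> {nu, - nu}"
  have "h0_ray (K * reg_bound) 1 nu (%z. \<phi> (complex_of_real (exp a) * z) * regulariser z)"
   by (rule h0_imp_h0_ray[OF h0_symbol]) (use sg in simp)
  then have c: "continuous_on {0<..} (%r. \<phi> (complex_of_real (exp a) * rcis r ta) * regulariser (rcis r ta))"
   using ta unfolding h0_ray_def by blast
  show "continuous_on {0<..} (%r. f (rcis r ta) * regulariser (rcis r ta) + - complex_of_real (sqrt (b - a)) * (\<phi> (complex_of_real (exp a) * rcis r ta) * regulariser (rcis r ta)))"
   by (intro continuous_on_add continuous_on_mult[OF continuous_on_const] continuous_on_mult[OF fc rc] c ta)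
  have "f (exp (Complex u ta)) * regulariser (exp (Complex u ta)) + - complex_of_real (sqrt (b - a)) * (\<phi> (complex_of_real (exp a) * exp (Complex u ta)) * regulariser (exp (Complex u ta)))
   = (f (exp (Complex u ta)) - complex_of_real (sqrt (b - a)) * \<phi> (complex_of_real (exp a) * exp (Complex u ta))) * regulariser (exp (Complex u ta))"
   by (simp only: left_diff_distrib mult.assoc) simp
  then show "cmod (f (exp (Complex u ta)) * regulariser (exp (Complex u ta)) + - complex_of_real (sqrt (b - a)) * (\<phi> (complex_of_real (exp a) * exp (Complex u ta)) * regulariser (exp (Complex u ta))))
   \<le> sqrt (b - a) * (K * (b - a)) * reg_bound * exp (- 1 * \<bar>u\<bar>)"
   using mult_mono[OF sq(2)[OF ta, of u] rb[OF ta, of u] nn(2) norm_ge_zero] by (simp only: norm_mult mult_ac)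
 qed (use nn reg in simp_all)
qed

end

section \<open>Two operators with commuting resolvents\<close>

context sect_resolvent
begin

lemma Phi_scale:
 assumes g: "h0_ray C ep nu g" and nu: "s < nu" "nu < pi"
 shows "Phi nu (%z. c * g z) x = c *\<^sub>C Phi nu g x"
proof -
 have "(%z. c * g z) = (%z. g z + (c - 1) * g z)" by (rule ext) (simp add: left_diff_distrib)
 then show ?thesis
  by (simp only: Phi_lincomb[OF g g nu] scaleC.diff_left scaleC_one) simp
qed

text \<open>The constant has to be uniform in \<open>u\<close>. Bounding the denominator below by a
  multiple of |z| costs one order of the decay 3/2 of \<open>ups\<close> and leaves 1/2.\<close>

lemma ups_resolvent:
 assumes nu: "s < nu" "nu < sg" and ta: "sg \<le> \<bar>ta\<bar>" "\<bar>ta\<bar> < pi"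
 obtains D where "D \<ge> 0"
  "\<And>u. h0_ray D (1 / 2) nu (%z. ups z / (exp (Complex u ta) - z))"
  "\<And>u x. R (exp (Complex u ta)) (Phi nu ups x) = Phi nu (%z. ups z / (exp (Complex u ta) - z)) x"
proof -
 define b' where "b' = (nu + sg) / 2"
 define dl where "dl = \<bar>ta\<bar> - b'"
 define C where "C = 1 / gap (pi - sg) ^ 4"
 have b': "nu < b'" "b' \<le> sg" "b' > 0" "\<bar>nu\<bar> < b'" "\<bar>- nu\<bar> < b'" using nu s by (simp_all add: b'_def)
 have d: "dl > 0" "dl \<le> \<bar>ta\<bar> - b'" "\<bar>ta\<bar> + b' \<le> 2 * pi - dl" using nu ta by (simp_all add: dl_def b'_def)
 have u0: "h0 C (3 / 2) sg ups" unfolding C_def by (rule h0_ups) (use nu ta s in simp_all)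
 have C: "C \<ge> 0" using u0 by (simp add: h0_def)
 note dv = h0_div[OF u0 b'(2) d b'(3)]
 have ray: "h0_ray (C / gap dl) (1 / 2) nu (%z. ups z / (exp (Complex u ta) - z))" for u
  unfolding h0_ray_def
 proof (intro conjI ballI allI)
  show "C / gap dl \<ge> 0" using C dv(4) by simp
  fix tu v assume tu: "tu \<in> {nu, - nu}"
  have t: "\<bar>tu\<bar> < b'" "\<bar>tu\<bar> < sg" using tu b' by auto
  have "h0_ray (C / (gap dl * exp u)) (3 / 2) nu (%z. ups z / (exp (Complex u ta) - z))"
   by (rule h0_imp_h0_ray[OF dv(1) b'(4)])
  then show "continuous_on {0<..} (%r. ups (rcis r tu) / (exp (Complex u ta) - rcis r tu))"
   using tu unfolding h0_ray_def by blast
  have "cmod (ups (exp (Complex v tu)) / (exp (Complex u ta) - exp (Complex v tu))) \<le> C * exp (- (3 / 2) * \<bar>v\<bar>) / (gap dl * exp v)"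
   unfolding norm_divide using dv(3)[OF t(1), of v u] dv(4) C h0_bound[OF u0 t(2), of v] by (intro frac_le) simp_all
  also have "\<dots> = C / gap dl * exp (- (3 / 2) * \<bar>v\<bar> - v)" by (simp add: exp_diff)
  also have "\<dots> \<le> C / gap dl * exp (- (1 / 2) * \<bar>v\<bar>)"
   using C dv(4) by (intro mult_left_mono) simp_all
  finally show "cmod (ups (exp (Complex v tu)) / (exp (Complex u ta) - exp (Complex v tu))) \<le> C / gap dl * exp (- (1 / 2) * \<bar>v\<bar>)" .
 qed simp
 show ?thesis
 proof (rule that[OF _ ray])
  show "C / gap dl \<ge> 0" using C dv(4) by simp
  show "R (exp (Complex u ta)) (Phi nu ups x) = Phi nu (%z. ups z / (exp (Complex u ta) - z)) x" for u x
   by (rule R_Phi[OF u0 _ nu _ _ refl]) (use nu ta in simp_all)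
 qed
qed

end

locale two_ops = sect_op DA A s M + B: sect_op DB B sB MB
 for DA :: "'a::complex_banach set" and A s M and DB :: "'a set" and B sB MB +
 assumes commute: "commuting_resolvents DA A DB B"
begin

definition P :: "complex => 'a => 'a" where "P l x = - resolvent DB B (- l) x"

lemma neg_cosector: "\<bar>ta\<bar> < pi - sB ==> - exp (Complex u ta) \<in> cosector sB"
proof -
 assume "\<bar>ta\<bar> < pi - sB"
 then have "cos (pi - sB) < cos \<bar>ta\<bar>" using B.s by (intro cos_monotone_0_pi) simp_all
 then have "- cos sB < cos ta" by simp
 then have "exp u * (- cos sB) < exp u * cos ta" by (intro mult_strict_left_mono) simp_all
 then show ?thesis by (simp add: cosector_def exp_Complex_eq norm_mult)
qed

lemma P_bound: "- l \<in> cosector sB ==> norm (P l x) * cmod l \<le> MB * norm x"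
 using B.R_bound[of "- l" x] by (simp add: P_def)

lemma P_clinear: "- l \<in> cosector sB ==> bounded_clinear (P l)"
proof -
 assume l: "- l \<in> cosector sB"
 then have l0: "l \<noteq> 0" using zero_notin_cosector[of sB] by auto
 note c = B.R_clinear[OF l]
 show ?thesis
 proof (rule bounded_clinearI)
  show "norm (P l x) \<le> (MB / cmod l) * norm x" for x
   using P_bound[OF l, of x] l0 by (simp add: field_simps)
 qed (simp_all add: P_def bounded_clinear_add[OF c] bounded_clinear_scaleC[OF c] scaleC.minus_right)
qed

lemma P_R: "- l \<in> cosector sB ==> z \<in> cosector s ==> P l (Res z x) = Res z (P l x)"
proof -
 assume l: "- l \<in> cosector sB" and z: "z \<in> cosector s"
 have "Res z (resolvent DB B (- l) x) = resolvent DB B (- l) (Res z x)"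
  using commute l z res B.res unfolding commuting_resolvents_def by blast
 then show ?thesis by (simp add: P_def bounded_clinear_minus[OF R_clinear[OF z]])
qed

lemma P_Phi: "- l \<in> cosector sB ==> h0_ray C ep nu f ==> s < nu ==> nu < pi ==> P l (Phi nu f x) = Phi nu f (P l x)"
 by (rule Phi_commute) (auto intro!: P_clinear P_R)

lemma P_Psi: "- l \<in> cosector sB ==> P l (Psi x) = Psi (P l x)"
 by (rule Psi_commute) (auto intro!: P_clinear P_R)

lemma continuous_on_PR:
 assumes S: "\<And>z. z \<in> S ==> z \<in> cosector s \<and> - z \<in> cosector sB"
 shows "continuous_on S (%z. P z (Res z x))"
 unfolding continuous_on_def
proof
 fix z0 assume z0: "z0 \<in> S"
 define y where "y = Res z0 x"
 have ev: "eventually (%z. z \<in> S) (at z0 within S)" by (simp add: eventually_at_filter)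
 have nz: "z \<noteq> 0" if "z \<in> S" for z using S[OF that] zero_notin_cosector[of s] by blast
 have c1: "continuous_on S (%z. Res z x)" by (rule continuous_on_subset[OF continuous_on_R]) (use S in blast)
 have c2: "continuous_on S (%z. P z y)"
  unfolding P_def by (intro continuous_on_minus continuous_on_compose2[OF B.continuous_on_R]) (use S in \<open>auto intro!: continuous_intros\<close>)
 have t1: "((%z. Res z x - y) \<longlongrightarrow> 0) (at z0 within S)"
  using c1 z0 unfolding continuous_on_def y_def by (intro LIM_zero) blast
 have "((%z. MB / cmod z * norm (Res z x - y)) \<longlongrightarrow> MB / cmod z0 * 0) (at z0 within S)"
  by (intro tendsto_intros tendsto_norm_zero t1) (use nz[OF z0] in simp)
 then have "((%z. MB / cmod z * norm (Res z x - y)) \<longlongrightarrow> 0) (at z0 within S)" by simp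
 then have t2: "((%z. P z (Res z x - y)) \<longlongrightarrow> 0) (at z0 within S)"
 proof (rule Lim_null_comparison[rotated])
  show "\<forall>\<^sub>F z in at z0 within S. norm (P z (Res z x - y)) \<le> MB / cmod z * norm (Res z x - y)"
   using ev
  proof (rule eventually_mono)
   fix z assume z: "z \<in> S"
   from P_bound[of z "Res z x - y"] show "norm (P z (Res z x - y)) \<le> MB / cmod z * norm (Res z x - y)"
    using S[OF z] nz[OF z] by (simp add: field_simps)
  qed
 qed
 have t3: "((%z. P z y) \<longlongrightarrow> P z0 y) (at z0 within S)" using c2 z0 unfolding continuous_on_def by blast
 have "((%z. P z (Res z x - y) + P z y) \<longlongrightarrow> P z0 y) (at z0 within S)"
  using tendsto_add[OF t2 t3] by simp
 then show "((%z. P z (Res z x)) \<longlongrightarrow> P z0 (Res z0 x)) (at z0 within S)"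
  unfolding y_def[symmetric]
 proof (rule Lim_transform_eventually)
  show "\<forall>\<^sub>F z in at z0 within S. P z (Res z x - y) + P z y = P z (Res z x)"
   using ev
  proof (rule eventually_mono)
   fix z assume z: "z \<in> S"
   have c: "bounded_clinear (P z)" by (rule P_clinear) (use S[OF z] in blast)
   show "P z (Res z x - y) + P z y = P z (Res z x)" by (simp add: bounded_clinear_diff[OF c])
  qed
 qed
qed

text \<open>The squares \<open>\<phi>(tA)\<^sup>2\<close> turn the bilinear expression into a resolvent of \<open>A\<close>.\<close>

lemma square_formula:
 fixes a :: real
 assumes S1: "log_symbol \<phi> sg1 nu1 K1" and S2: "log_symbol \<phi> sg2 nu2 K2"
  and nu1: "s < nu1" and nu2: "s < nu2" and nu: "nu = min nu1 nu2"
  and ta: "sg1 \<le> \<bar>ta\<bar>" "sg2 \<le> \<bar>ta\<bar>" "\<bar>ta\<bar> < pi - sB"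
  and sqr: "\<And>a r tu. r > 0 ==> tu \<in> {nu, - nu} ==> \<phi> (complex_of_real (exp a) * rcis r tu) * \<phi> (complex_of_real (exp a) * rcis r tu)
    = complex_of_real (exp (- a / 2)) * (rt (rcis r tu) / (rcis r tu - exp (Complex (- a) ta)))"
 defines "l \<equiv> exp (Complex (- a) ta)"
 defines "w \<equiv> %z. \<phi> (complex_of_real (exp a) * z) * regulariser z"
 shows "Phi nu2 w (l *\<^sub>C P l (Phi nu1 w v)) = (- complex_of_real (exp (- a / 2)) * l) *\<^sub>C P l (Res l (Phi nu ups v))"
proof -
 define sg where "sg = min sg1 sg2"
 have L: "0 < nu1" "nu1 < sg1" "sg1 < pi" "0 < nu2" "nu2 < sg2" "sg2 < pi"
  using log_symbol.sg[OF S1] log_symbol.sg[OF S2] by blast+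
 have n: "s < nu" "nu < sg1" "nu < sg2" "nu < sg" "sg \<le> pi" "nu < pi" "sg \<le> \<bar>ta\<bar>" "\<bar>ta\<bar> < pi"
  using L nu1 nu2 ta B.s by (simp_all add: nu sg_def min_def)
 have w1: "h0 (K1 * log_symbol.reg_bound sg1) 1 sg1 w" unfolding w_def by (rule log_symbol.h0_symbol[OF S1])
 have w2: "h0 (K2 * log_symbol.reg_bound sg2) 1 sg2 w" unfolding w_def by (rule log_symbol.h0_symbol[OF S2])
 \<comment> \<open>The square function and its dual may use different contour angles; both are moved
   to \<open>nu\<close>, where \<open>Phi_mult\<close> multiplies the symbols.\<close>
 have e1: "Phi nu1 w x = Phi nu w x" for x by (rule Phi_angle_indep[OF w1]) (use L n nu1 in simp_all)
 have e2: "Phi nu2 w x = Phi nu w x" for x by (rule Phi_angle_indep[OF w2]) (use L n nu2 in simp_all)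
 have wr: "h0_ray (K1 * log_symbol.reg_bound sg1) 1 nu w" by (rule h0_imp_h0_ray[OF w1]) (use n s in simp)
 have wsg: "h0 (K1 * log_symbol.reg_bound sg1) 1 sg w" by (rule h0_subset[OF w1]) (simp add: sg_def)
 have lB: "- l \<in> cosector sB" unfolding l_def by (rule neg_cosector[OF ta(3)])
 obtain D where D: "h0_ray D (1 / 2) nu (%z. ups z / (exp (Complex u ta) - z))"
  "Res (exp (Complex u ta)) (Phi nu ups x) = Phi nu (%z. ups z / (exp (Complex u ta) - z)) x" for u x
  by (rule ups_resolvent[OF n(1,4,7,8)]) blast
 have "Phi nu (%z. w z * w z) v = Phi nu (%z. (- complex_of_real (exp (- a / 2))) * (ups z / (l - z))) v"
 proof (rule Phi_cong)
  fix r tu :: real assume r: "0 < r" and tu: "tu \<in> {nu, - nu}"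
  define z where "z = rcis r tu"
  have "w z * w z = (\<phi> (complex_of_real (exp a) * z) * \<phi> (complex_of_real (exp a) * z)) * (regulariser z * regulariser z)"
   by (simp add: w_def mult_ac)
  also have "\<dots> = complex_of_real (exp (- a / 2)) * (rt z / (z - l)) * (regulariser z * regulariser z)"
   unfolding z_def l_def by (simp only: sqr[OF r tu])
  also have "\<dots> = complex_of_real (exp (- a / 2)) * (ups z / (z - l))" by (simp add: ups_def)
  also have "ups z / (z - l) = - (ups z / (l - z))" by (simp add: minus_divide_right)
  finally show "w (rcis r tu) * w (rcis r tu) = - complex_of_real (exp (- a / 2)) * (ups (rcis r tu) / (l - rcis r tu))"
   by (simp add: z_def)
 qed
 also have "\<dots> = (- complex_of_real (exp (- a / 2))) *\<^sub>C Res l (Phi nu ups v)"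
  unfolding l_def D(2) by (rule Phi_scale[OF D(1) n(1,6)])
 finally have ww: "Phi nu w (Phi nu w v) = (- complex_of_real (exp (- a / 2))) *\<^sub>C Res l (Phi nu ups v)"
  unfolding Phi_mult[OF wsg wsg n(5,1,4)] .
 have "Phi nu2 w (l *\<^sub>C P l (Phi nu1 w v)) = l *\<^sub>C P l (Phi nu w (Phi nu w v))"
  unfolding e1 e2 bounded_clinear_scaleC[OF Phi_clinear[OF wr n(1,6)]] P_Phi[OF lB wr n(1,6)] ..
 also have "\<dots> = (- complex_of_real (exp (- a / 2)) * l) *\<^sub>C P l (Res l (Phi nu ups v))"
  unfolding ww bounded_clinear_scaleC[OF P_clinear[OF lB]] by (simp only: scaleC_scaleC mult.commute)
 finally show ?thesis .
qed

text \<open>Both factors are replaced one after the other. Each replacement costs dl^(3/2) while the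
  other factor has size dl^(1/2), so each of the two errors is of order dl^2.\<close>

lemma cell_error:
 fixes a :: real
 assumes S1: "log_symbol \<phi> sg1 nu1 K1" and S2: "log_symbol \<phi> sg2 nu2 K2"
  and nu1: "s < nu1" and nu2: "s < nu2" and d: "dl > 0" and l: "- l \<in> cosector sB"
 defines "w \<equiv> %z. \<phi> (complex_of_real (exp a) * z) * regulariser z"
  and "f \<equiv> %z. sq_symbol \<phi> (cell a (a + dl)) z * regulariser z"
  and "c1 \<equiv> 2 * (K1 * log_symbol.reg_bound sg1) * M" and "c2 \<equiv> 2 * (K2 * log_symbol.reg_bound sg2) * M"
 shows "norm (Phi nu2 f (l *\<^sub>C P l (Phi nu1 f v)) - dl *\<^sub>R Phi nu2 w (l *\<^sub>C P l (Phi nu1 w v))) \<le> dl * dl * (2 * c1 * c2 * MB * norm v)"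
  and "c1 \<ge> 0" "c2 \<ge> 0"
proof -
 have L: "0 < nu1" "nu1 < sg1" "sg1 < pi" "0 < nu2" "nu2 < sg2" "sg2 < pi"
  using log_symbol.sg[OF S1] log_symbol.sg[OF S2] by blast+
 have pi12: "nu1 < pi" "nu2 < pi" using L by simp_all
 define q where "q = complex_of_real (sqrt dl)"
 have ab: "a < a + dl" using d by simp
 note g1 = log_symbol.h0_ray_cell[OF S1 ab, unfolded add_diff_cancel_left', folded q_def]
 have h1: "h0_ray (sqrt dl * K1 * log_symbol.reg_bound sg1) 1 nu1 f"
  "h0_ray (sqrt dl * (K1 * dl) * log_symbol.reg_bound sg1) 1 nu1 (%z. f z + (- q) * w z)"
  unfolding f_def w_def by (fact g1)+
 note g2 = log_symbol.h0_ray_cell[OF S2 ab, unfolded add_diff_cancel_left', folded q_def]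
 have h2: "h0_ray (sqrt dl * K2 * log_symbol.reg_bound sg2) 1 nu2 f"
  "h0_ray (sqrt dl * (K2 * dl) * log_symbol.reg_bound sg2) 1 nu2 (%z. f z + (- q) * w z)"
  unfolding f_def w_def by (fact g2)+
 have w1: "h0_ray (K1 * log_symbol.reg_bound sg1) 1 nu1 w"
  unfolding w_def by (rule h0_imp_h0_ray[OF log_symbol.h0_symbol[OF S1]]) (use L in simp)
 have w2: "h0_ray (K2 * log_symbol.reg_bound sg2) 1 nu2 w"
  unfolding w_def by (rule h0_imp_h0_ray[OF log_symbol.h0_symbol[OF S2]]) (use L in simp)
 show c: "c1 \<ge> 0" "c2 \<ge> 0" using w1 w2 M by (simp_all add: c1_def c2_def h0_ray_def)
 define N where "N y = l *\<^sub>C P l y" for y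
 have Nb: "norm (N y) \<le> MB * norm y" for y using P_bound[OF l, of y] by (simp add: N_def norm_scaleC mult.commute)
 have Nd: "N (x - y) = N x - N y" and Ns: "N (k *\<^sub>C x) = k *\<^sub>C N x" for x y k
  by (simp_all add: N_def bounded_clinear_diff[OF P_clinear[OF l]] bounded_clinear_scaleC[OF P_clinear[OF l]] scaleC.diff_right scaleC_scaleC mult.commute)
 define F1 F2 W1 W2 where "F1 = Phi nu1 f" and "F2 = Phi nu2 f" and "W1 = Phi nu1 w" and "W2 = Phi nu2 w"
 have F2c: "bounded_clinear F2" unfolding F2_def by (rule Phi_clinear[OF h2(1) nu2 pi12(2)])
 have W2c: "bounded_clinear W2" unfolding W2_def by (rule Phi_clinear[OF w2 nu2 pi12(2)])
 have E1: "norm (F1 x - q *\<^sub>C W1 x) \<le> sqrt dl * dl * c1 * norm x" for x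
 proof -
  have "F1 x - q *\<^sub>C W1 x = Phi nu1 (%z. f z + (- q) * w z) x"
   unfolding Phi_lincomb[OF h1(1) w1 nu1 pi12(1)] F1_def W1_def by (simp add: scaleC.minus_left)
  also have "norm \<dots> \<le> 2 * (sqrt dl * (K1 * dl) * log_symbol.reg_bound sg1) * M / 1 * norm x"
   by (rule norm_Phi_le[OF h1(2) nu1 pi12(1)])
  also have "\<dots> = sqrt dl * dl * c1 * norm x" by (simp add: c1_def mult_ac)
  finally show ?thesis .
 qed
 have E2: "norm (F2 x - q *\<^sub>C W2 x) \<le> sqrt dl * dl * c2 * norm x" for x
 proof -
  have "F2 x - q *\<^sub>C W2 x = Phi nu2 (%z. f z + (- q) * w z) x"
   unfolding Phi_lincomb[OF h2(1) w2 nu2 pi12(2)] F2_def W2_def by (simp add: scaleC.minus_left)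
  also have "norm \<dots> \<le> 2 * (sqrt dl * (K2 * dl) * log_symbol.reg_bound sg2) * M / 1 * norm x"
   by (rule norm_Phi_le[OF h2(2) nu2 pi12(2)])
  also have "\<dots> = sqrt dl * dl * c2 * norm x" by (simp add: c2_def mult_ac)
  finally show ?thesis .
 qed
 have F2b: "norm (F2 x) \<le> sqrt dl * c2 * norm x" for x
  using norm_Phi_le[OF h2(1) nu2 pi12(2), of x] unfolding F2_def c2_def by (simp add: mult_ac)
 have W1b: "norm (W1 x) \<le> c1 * norm x" for x
  using norm_Phi_le[OF w1 nu1 pi12(1), of x] unfolding W1_def c1_def by (simp add: mult_ac)
 have qq: "q * q = complex_of_real dl" unfolding q_def of_real_mult[symmetric] using d by simp
 have nq: "cmod q = sqrt dl" using d by (simp add: q_def)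
 have sd: "sqrt dl * sqrt dl = dl" "sqrt dl \<ge> 0" using d by simp_all
 have "F2 (N (F1 v)) - dl *\<^sub>R W2 (N (W1 v)) = F2 (N (F1 v - q *\<^sub>C W1 v)) + (F2 (N (q *\<^sub>C W1 v)) - q *\<^sub>C W2 (N (q *\<^sub>C W1 v)))"
  by (simp add: Nd Ns bounded_clinear_diff[OF F2c] bounded_clinear_scaleC[OF F2c] bounded_clinear_scaleC[OF W2c] scaleC_scaleC qq scaleC_of_real)
 also have "norm \<dots> \<le> sqrt dl * c2 * (MB * (sqrt dl * dl * c1 * norm v)) + sqrt dl * dl * c2 * (MB * (sqrt dl * (c1 * norm v)))"
 proof (rule norm_triangle_mono)
  show "norm (F2 (N (F1 v - q *\<^sub>C W1 v))) \<le> sqrt dl * c2 * (MB * (sqrt dl * dl * c1 * norm v))"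
   by (rule order_trans[OF F2b mult_left_mono[OF order_trans[OF Nb mult_left_mono[OF E1 B.M]]]]) (use c sd in simp)
  have "norm (q *\<^sub>C W1 v) \<le> sqrt dl * (c1 * norm v)" unfolding norm_scaleC nq by (rule mult_left_mono[OF W1b sd(2)])
  from order_trans[OF Nb mult_left_mono[OF this B.M]]
  have "norm (N (q *\<^sub>C W1 v)) \<le> MB * (sqrt dl * (c1 * norm v))" .
  from order_trans[OF E2 mult_left_mono[OF this]]
  show "norm (F2 (N (q *\<^sub>C W1 v)) - q *\<^sub>C W2 (N (q *\<^sub>C W1 v))) \<le> sqrt dl * dl * c2 * (MB * (sqrt dl * (c1 * norm v)))"
   using c sd d by simp
 qed
 also have "\<dots> = (sqrt dl * sqrt dl) * dl * (2 * c1 * c2 * MB * norm v)" by (simp add: algebra_simps)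
 also have "\<dots> = dl * dl * (2 * c1 * c2 * MB * norm v)" unfolding sd ..
 finally show "norm (Phi nu2 f (l *\<^sub>C P l (Phi nu1 f v)) - dl *\<^sub>R Phi nu2 w (l *\<^sub>C P l (Phi nu1 w v))) \<le> dl * dl * (2 * c1 * c2 * MB * norm v)"
  by (simp only: F1_def F2_def W1_def W2_def N_def)
qed

text \<open>The integrand in the variable \<open>u = ln t\<close>, at the point of the ray with
  modulus \<open>1 / t\<close>; the scalar factor is the one in
  \<open>square_formula\<close>.\<close>

definition kernel :: "real => real => ('a => complex) => 'a => real => complex" where
 "kernel nu ta x' v u = (- complex_of_real (exp (- u / 2)) * exp (Complex (- u) ta)) *
  x' (P (exp (Complex (- u) ta)) (Res (exp (Complex (- u) ta)) (Phi nu ups v)))"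

text \<open>By \<open>square_formula\<close> and \<open>cell_error\<close> the sums in
  \<open>Q\<close> are Riemann sums of the kernel up to O(dl), so a bound uniform in the mesh passes
  to the integral.\<close>

theorem kernel_estimate:
 assumes S1: "log_symbol \<phi> sg1 nu1 K1" and S2: "log_symbol \<phi> sg2 nu2 K2"
  and nu1: "s < nu1" and nu2: "s < nu2" and nu: "nu = min nu1 nu2"
  and ta: "sg1 \<le> \<bar>ta\<bar>" "sg2 \<le> \<bar>ta\<bar>" "\<bar>ta\<bar> < pi - sB"
  and sqr: "\<And>a r tu. r > 0 ==> tu \<in> {nu, - nu} ==> \<phi> (complex_of_real (exp a) * rcis r tu) * \<phi> (complex_of_real (exp a) * rcis r tu)
    = complex_of_real (exp (- a / 2)) * (rt (rcis r tu) / (rcis r tu - exp (Complex (- a) ta)))"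
  and x': "bounded_clinear x'" and m: "m > 0"
  and Q: "\<And>n a dl. dl > 0 ==> cmod (\<Sum>k<n. x' (Phi nu2 (%z. sq_symbol \<phi> (cell (a + real k * dl) (a + real k * dl + dl)) z * regulariser z)
    (exp (Complex (- (a + real k * dl)) ta) *\<^sub>C P (exp (Complex (- (a + real k * dl)) ta))
     (Phi nu1 (%z. sq_symbol \<phi> (cell (a + real k * dl) (a + real k * dl + dl)) z * regulariser z) v)))) \<le> K"
 shows "cmod (integral {- m..m} (kernel nu ta x' v)) \<le> K"
proof -
 define c where "c = 2 * (2 * (K1 * log_symbol.reg_bound sg1) * M) * (2 * (K2 * log_symbol.reg_bound sg2) * M) * MB * norm v"
 have xl: "bounded_linear x'" by (rule bounded_clinear_imp_bounded_linear[OF x'])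
 have n: "s < nu" "nu < \<bar>ta\<bar>" "\<bar>ta\<bar> < pi"
  using log_symbol.sg[OF S1] log_symbol.sg[OF S2] nu1 nu2 ta B.s by (simp_all add: nu min_def)
 have cont: "continuous_on UNIV (kernel nu ta x' v)"
 proof -
  have e: "continuous_on UNIV (%u. exp (Complex (- u) ta))" unfolding Complex_eq by (intro continuous_intros)
  have "continuous_on (range (%u. exp (Complex (- u) ta))) (%z. P z (Res z (Phi nu ups v)))"
  proof (rule continuous_on_PR)
   fix z assume "z \<in> range (%u. exp (Complex (- u) ta))"
   then obtain u where z: "z = exp (Complex (- u) ta)" by blast
   show "z \<in> cosector s \<and> - z \<in> cosector sB" unfolding z
    by (intro conjI neg_cosector ta exp_in_cosector) (use n s in simp_all)
  qed
  from continuous_on_compose2[OF this e]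
  have "continuous_on UNIV (%u. P (exp (Complex (- u) ta)) (Res (exp (Complex (- u) ta)) (Phi nu ups v)))" by simp
  then have "continuous_on UNIV (%u. x' (P (exp (Complex (- u) ta)) (Res (exp (Complex (- u) ta)) (Phi nu ups v))))"
   by (rule bounded_linear.continuous_on[OF xl])
  then show ?thesis unfolding kernel_def[abs_def] by (intro continuous_intros e) simp
 qed
 have "cmod (integral {- m..- m + 2 * m} (kernel nu ta x' v)) \<le> K"
 proof (rule integral_bound_via_sums[OF cont])
  show "2 * m > 0" using m by simp
  have nn: "2 * (K1 * log_symbol.reg_bound sg1) * M \<ge> 0" "2 * (K2 * log_symbol.reg_bound sg2) * M \<ge> 0"
   using log_symbol.reg(2)[OF S1] log_symbol.reg(2)[OF S2] log_symbol.K[OF S1] log_symbol.K[OF S2] M by simp_all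
  have c: "c \<ge> 0" unfolding c_def
   by (rule mult_nonneg_nonneg[OF mult_nonneg_nonneg[OF mult_nonneg_nonneg[OF mult_nonneg_nonneg[OF _ nn(1)] nn(2)] B.M] norm_ge_zero]) simp
  show "onorm x' * c \<ge> 0" by (rule mult_nonneg_nonneg[OF onorm_pos_le[OF xl] c])
  show "cmod (\<Sum>k<n. x' (Phi nu2 (%z. sq_symbol \<phi> (cell (- m + real k * dl) (- m + real k * dl + dl)) z * regulariser z)
    (exp (Complex (- (- m + real k * dl)) ta) *\<^sub>C P (exp (Complex (- (- m + real k * dl)) ta))
     (Phi nu1 (%z. sq_symbol \<phi> (cell (- m + real k * dl) (- m + real k * dl + dl)) z * regulariser z) v)))) \<le> K"
   if "dl > 0" for n dl by (rule Q[OF that])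
  fix n :: nat and dl :: real
  assume d: "dl > 0"
  define F where "F k = Phi nu2 (%z. sq_symbol \<phi> (cell (- m + real k * dl) (- m + real k * dl + dl)) z * regulariser z)
    (exp (Complex (- (- m + real k * dl)) ta) *\<^sub>C P (exp (Complex (- (- m + real k * dl)) ta))
     (Phi nu1 (%z. sq_symbol \<phi> (cell (- m + real k * dl) (- m + real k * dl + dl)) z * regulariser z) v))" for k
  have each: "cmod (x' (F k) - dl *\<^sub>R kernel nu ta x' v (- m + real k * dl)) \<le> dl * dl * (onorm x' * c)" for k
  proof -
   define u where "u = - m + real k * dl"
   define G where "G = (- complex_of_real (exp (- u / 2)) * exp (Complex (- u) ta)) *\<^sub>C P (exp (Complex (- u) ta)) (Res (exp (Complex (- u) ta)) (Phi nu ups v))"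
   have sq: "Phi nu2 (%z. \<phi> (complex_of_real (exp u) * z) * regulariser z) (exp (Complex (- u) ta) *\<^sub>C P (exp (Complex (- u) ta))
     (Phi nu1 (%z. \<phi> (complex_of_real (exp u) * z) * regulariser z) v)) = G"
    unfolding G_def by (rule square_formula[OF S1 S2 nu1 nu2 nu ta]) (rule sqr)
   have "norm (F k - dl *\<^sub>R G) \<le> dl * dl * c"
    unfolding F_def c_def u_def[symmetric] sq[symmetric]
    by (rule cell_error(1)[OF S1 S2 nu1 nu2 d neg_cosector[OF ta(3)]])
   then have "onorm x' * norm (F k - dl *\<^sub>R G) \<le> onorm x' * (dl * dl * c)" by (rule mult_left_mono[OF _ onorm_pos_le[OF xl]])
   with onorm[OF xl, of "F k - dl *\<^sub>R G"] have "cmod (x' (F k - dl *\<^sub>R G)) \<le> onorm x' * (dl * dl * c)" by (rule order_trans)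
   moreover have "x' (F k - dl *\<^sub>R G) = x' (F k) - dl *\<^sub>R kernel nu ta x' v u"
    unfolding kernel_def bounded_clinear_diff[OF x'] linear_scale[OF bounded_linear.linear[OF xl]] G_def functional_scaleC[OF x'] ..
   ultimately show ?thesis by (simp add: u_def mult_ac)
  qed
  have "cmod ((\<Sum>k<n. x' (F k)) - dl *\<^sub>R (\<Sum>k<n. kernel nu ta x' v (- m + real k * dl)))
   = cmod (\<Sum>k<n. x' (F k) - dl *\<^sub>R kernel nu ta x' v (- m + real k * dl))"
   by (simp only: sum_subtractf scaleR_sum_right)
  also have "\<dots> \<le> (\<Sum>k<n. dl * dl * (onorm x' * c))" by (rule order_trans[OF norm_sum sum_mono[OF each]])
  also have "\<dots> = real n * (dl * dl * (onorm x' * c))" by simp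
  finally show "cmod ((\<Sum>k<n. x' (Phi nu2 (%z. sq_symbol \<phi> (cell (- m + real k * dl) (- m + real k * dl + dl)) z * regulariser z)
    (exp (Complex (- (- m + real k * dl)) ta) *\<^sub>C P (exp (Complex (- (- m + real k * dl)) ta))
     (Phi nu1 (%z. sq_symbol \<phi> (cell (- m + real k * dl) (- m + real k * dl + dl)) z * regulariser z) v))))
   - dl *\<^sub>R (\<Sum>k<n. kernel nu ta x' v (- m + real k * dl))) \<le> real n * (dl * dl * (onorm x' * c))" unfolding F_def .
 qed
 then show ?thesis by simp
qed

text \<open>The bilinear form of the square functions and their duals, separated by the \<open>\<gamma>\<close>-bounded
 operators \<open>z(z + B)\<^sup>-\<^sup>1\<close>.\<close>

theorem square_function_bound:
 assumes d: "closure DA = UNIV" "closure (A ` DA) = UNIV"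
  and S1: "log_symbol \<phi> sg1 (calc_angle DA A sg1) K1" and S2: "log_symbol \<phi> sg2 (calc_angle DA A sg2) K2"
  and nu1: "s < calc_angle DA A sg1" and nu2: "s < calc_angle DA A sg2"
  and ta: "\<bar>ta\<bar> < pi - sB"
  and sf: "\<And>x. gamma_radonifying (sq_op DA A sg1 \<phi> x)" "\<And>x. gamma_norm (sq_op DA A sg1 \<phi> x) \<le> C1 * norm x" "C1 \<ge> 0"
  and dsf: "\<And>x' g. bounded_clinear x' ==> g \<in> H_space ==>
    x' \<in> adjoint_dom (calc_dom DA A sg2 (sq_symbol \<phi> g)) (calc DA A sg2 (sq_symbol \<phi> g))"
   "\<And>x'. bounded_clinear x' ==> in_gamma_dual (dual_sq_op DA A sg2 \<phi> x')"
   "\<And>x'. bounded_clinear x' ==> gamma_dual_norm (dual_sq_op DA A sg2 \<phi> x') \<le> C2 * onorm x'" "C2 \<ge> 0"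
  and gB: "\<And>N l x. (\<And>n. n < N ==> l n \<in> cosector sB) ==>
   gauss_E N (%n. l n *\<^sub>C resolvent DB B (l n) (x n)) \<le> ennreal (CB\<^sup>2) * gauss_E N x" "CB \<ge> 0"
  and x': "bounded_clinear x'" and del: "dl > 0"
 shows "cmod (\<Sum>k<n. x' (Phi (calc_angle DA A sg2) (%z. sq_symbol \<phi> (cell (a + real k * dl) (a + real k * dl + dl)) z * regulariser z)
    (exp (Complex (- (a + real k * dl)) ta) *\<^sub>C P (exp (Complex (- (a + real k * dl)) ta))
     (Phi (calc_angle DA A sg1) (%z. sq_symbol \<phi> (cell (a + real k * dl) (a + real k * dl + dl)) z * regulariser z) v))))
  \<le> 4 * C2 * CB * C1 * onorm x' * norm (Psi (Psi v))"
proof -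
 \<comment> \<open>One \<open>Psi\<close> is used up by \<open>calc_Psi\<close> in the square
   function, the other, after commuting past \<open>P\<close>, by \<open>adjoint_calc_Psi\<close> in
   the dual one.\<close>
 define x where "x = Psi (Psi v)"
 define T where "T = sq_op DA A sg1 \<phi> x"
 define V where "V = dual_sq_op DA A sg2 \<phi> x'"
 define e where "e k = cell (a + real k * dl) (a + real k * dl + dl)" for k :: nat
 define l where "l k = exp (Complex (- (a + real k * dl)) ta)" for k :: nat
 define F1 where "F1 k = Phi (calc_angle DA A sg1) (%z. sq_symbol \<phi> (e k) z * regulariser z)" for k
 define F2 where "F2 k = Phi (calc_angle DA A sg2) (%z. sq_symbol \<phi> (e k) z * regulariser z)" for k
 have p1: "calc_angle DA A sg1 < pi" and p2: "calc_angle DA A sg2 < pi"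
  using log_symbol.sg[OF S1] log_symbol.sg[OF S2] by simp_all
 have ab: "a + real k * dl < a + real k * dl + dl" for k using del by simp
 note h1 = log_symbol.h0_ray_cell(1)[OF S1 ab, folded e_def]
 note h2 = log_symbol.h0_ray_cell(1)[OF S2 ab, folded e_def]
 have lB: "- l k \<in> cosector sB" for k unfolding l_def by (rule neg_cosector[OF ta])
 have eH: "e k \<in> H_space" for k unfolding e_def by (rule cell_H_space[OF ab])
 have eo: "H_ip (e i) (e j) = (if i = j then 1 else 0)" for i j unfolding e_def by (rule cell_orthonormal[OF del])
 have ec: "cnj (e j t) = e j t" for j t unfolding e_def by (rule cell_cnj)
 have Te: "T (e k) = Psi (F1 k v)" for k
  unfolding T_def sq_op_def x_def F1_def calc_Psi(1)[OF d(2) nu1 p1 h1] by (rule Phi_Psi[OF h1 nu1 p1])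
 define y where "y k = (- l k) *\<^sub>C resolvent DB B (- l k) (T (e k))" for k
 have yk: "y k = Psi (l k *\<^sub>C P (l k) (F1 k v))" for k
 proof -
  have "y k = l k *\<^sub>C P (l k) (Psi (F1 k v))" unfolding y_def Te P_def by (simp add: scaleC.minus_left scaleC.minus_right)
  then show ?thesis by (simp only: P_Psi[OF lB] bounded_clinear_scaleC[OF Psi_clinear])
 qed
 have Vy: "V (e k) (y k) = x' (F2 k (l k *\<^sub>C P (l k) (F1 k v)))" for k
  unfolding V_def dual_sq_op_def yk F2_def by (rule adjoint_calc_Psi[OF d nu2 p2 h2 dsf(1)[OF x' eH]])
 have rad: "gamma_radonifying T" unfolding T_def by (rule sf)
 note gn = gamma_norm_dominates[OF rad, of n e, OF eH eo]
 have gT: "gamma_norm T \<le> C1 * norm x" unfolding T_def by (rule sf)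
 obtain h0 S where onb: "H_onb h0" using rad unfolding gamma_radonifying_def by blast
 have ox: "onorm x' \<ge> 0" by (rule onorm_pos_le[OF bounded_clinear_imp_bounded_linear[OF x']])
 have res: "cmod (\<Sum>k<n. V (e k) (y k)) \<le> 4 * C2 * CB * C1 * onorm x' * norm x"
 proof (rule field_le_epsilon)
  fix ep :: real assume ep: "ep > 0"
  \<comment> \<open>\<open>gamma_dual_norm_dominates\<close> wants a strictly positive
    \<open>m\<close>, but the constants or \<open>x\<close> may vanish; the summand \<eta> repairs
    this and costs at most \<open>ep\<close>.\<close>
  define \<eta> where "\<eta> = ep / (2 * C2 * onorm x' + 1)"
  have pos: "2 * C2 * onorm x' + 1 > 0" using dsf(4) ox by (simp add: add_nonneg_pos)
  have \<eta>: "\<eta> > 0" using ep pos by (simp add: \<eta>_def)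
  define m where "m = 2 * CB * (C1 * norm x) + \<eta>"
  have g2: "2 * CB * gamma_norm T \<le> m" "2 * CB * gamma_norm T \<ge> 0"
   using mult_left_mono[OF gT, of "2 * CB"] gB(2) \<eta> gn(2) by (simp_all add: m_def)
  have m: "m > 0" using gB(2) sf(3) \<eta> unfolding m_def by (intro add_nonneg_pos) simp_all
  have "gauss_E n y \<le> ennreal (CB\<^sup>2) * gauss_E n (%k. T (e k))"
   unfolding y_def[abs_def] by (rule gB(1)) (rule lB)
  also have "\<dots> \<le> ennreal (CB\<^sup>2) * ennreal (2 * (gamma_norm T)\<^sup>2)" by (rule mult_left_mono[OF gn(1)]) simp
  also have "\<dots> = ennreal (CB\<^sup>2 * (2 * (gamma_norm T)\<^sup>2))" by (rule ennreal_mult[symmetric]) simp_all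
  also have "\<dots> \<le> ennreal (m\<^sup>2)"
  proof (rule ennreal_leI)
   have "CB\<^sup>2 * (2 * (gamma_norm T)\<^sup>2) \<le> (2 * CB * gamma_norm T)\<^sup>2"
    by (simp add: power_mult_distrib mult_right_mono)
   also have "\<dots> \<le> m\<^sup>2" by (rule power_mono[OF g2])
   finally show "CB\<^sup>2 * (2 * (gamma_norm T)\<^sup>2) \<le> m\<^sup>2" .
  qed
  finally have ge: "gauss_E n y \<le> ennreal (m\<^sup>2)" .
  have "in_gamma_dual V" unfolding V_def by (rule dsf(2)[OF x'])
  from gamma_dual_norm_dominates[OF onb this eH eo ec ge m]
  have "cmod (\<Sum>k<n. V (e k) (y k)) \<le> gamma_dual_norm V * (2 * m)" .
  also have "\<dots> \<le> C2 * onorm x' * (2 * m)" using dsf(3)[OF x'] m by (intro mult_right_mono) (simp_all add: V_def)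
  also have "\<dots> = 4 * C2 * CB * C1 * onorm x' * norm x + 2 * C2 * onorm x' * \<eta>" by (simp add: m_def algebra_simps)
  also have "2 * C2 * onorm x' * \<eta> \<le> (2 * C2 * onorm x' + 1) * \<eta>" using \<eta> by (intro mult_right_mono) simp_all
  also have "(2 * C2 * onorm x' + 1) * \<eta> = ep" using pos by (simp add: \<eta>_def)
  finally show "cmod (\<Sum>k<n. V (e k) (y k)) \<le> 4 * C2 * CB * C1 * onorm x' * norm x + ep" by simp
 qed
 show ?thesis using res[unfolded Vy, unfolded F1_def F2_def l_def e_def x_def] .
qed

end

section \<open>The operator sum\<close>

context two_ops
begin

definition J :: "real => real => 'a => real => 'a" where
 "J nu ta v r = (rt (rcis r ta) * cis ta) *\<^sub>C P (rcis r ta) (Res (rcis r ta) (Phi nu ups v))"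

lemma rt_rcis: "r > 0 ==> \<bar>ta\<bar> < pi ==> rt (rcis r ta) = exp (Complex (ln r) ta / 2)"
 using rt_exp[of "Complex (ln r) ta"] by (simp add: exp_Complex)

lemma ups_clinear:
 assumes "s < nu" "nu < pi"
 obtains C where "h0_ray C (3 / 2) nu ups"
 by (rule that[OF h0_imp_h0_ray[OF h0_ups[of "(nu + pi) / 2"]]]) (use assms s in simp_all)

text \<open>The root contributes r^(1/2) and \<open>P\<close> contributes 1/r. The uniform bound for
  \<open>Res\<close> after \<open>Phi nu ups\<close>, from \<open>ups_resolvent\<close>, gives
  integrability at 0, and the resolvent bound supplies a further 1/r at infinity.\<close>

lemma J_props:
 assumes nu: "s < nu" "nu < \<bar>ta\<bar>" and ta: "\<bar>ta\<bar> < pi - sB"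
 obtains C where "C \<ge> 0" "\<And>v. continuous_on {0<..} (J nu ta v)" "\<And>v. ray_decay (C * norm v) (1 / 2) (J nu ta v)"
proof -
 have th: "\<bar>ta\<bar> < pi" "nu < pi" using ta nu B.s by simp_all
 obtain C0 where C0: "h0_ray C0 (3 / 2) nu ups" by (rule ups_clinear[OF nu(1) th(2)])
 obtain D where D: "D \<ge> 0" "\<And>u. h0_ray D (1 / 2) nu (%z. ups z / (exp (Complex u ta) - z))"
  "\<And>u x. Res (exp (Complex u ta)) (Phi nu ups x) = Phi nu (%z. ups z / (exp (Complex u ta) - z)) x"
  by (rule ups_resolvent[OF nu order_refl th(1)]) blast
 define E where "E = max (M * (2 * C0 * M / (3 / 2))) (2 * D * M / (1 / 2))"
 have E0: "E \<ge> 0" using D(1) M by (simp add: E_def le_max_iff_disj)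
 have ray: "rcis r ta \<in> cosector s" "- rcis r ta \<in> cosector sB" if "r > 0" for r
  using rcis_in_cosector[of s ta r] neg_cosector[OF ta, of "ln r"] that nu s th by (simp_all add: exp_Complex)
 show ?thesis
 proof (rule that)
  show "MB * E \<ge> 0" using B.M E0 by simp
  fix v
  have "continuous_on {0<..} (%r. exp (Complex (ln r) ta / 2))"
   unfolding Complex_eq by (intro continuous_intros) auto
  then have "continuous_on {0<..} (%r. rt (rcis r ta))"
   by (rule continuous_on_eq) (simp add: rt_rcis th)
  moreover have "continuous_on {0<..} (%r. P (rcis r ta) (Res (rcis r ta) (Phi nu ups v)))"
  proof (rule continuous_on_compose2[OF continuous_on_PR[of "(%r. rcis r ta) ` {0<..}"]])
   show "continuous_on {0<..} (%r. rcis r ta)" by (auto simp: rcis_def intro!: continuous_intros)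
  qed (use ray in auto)
  ultimately show "continuous_on {0<..} (J nu ta v)"
   unfolding J_def[abs_def] by (intro scaleC.continuous_on continuous_on_mult continuous_on_const)
  show "ray_decay (MB * E * norm v) (1 / 2) (J nu ta v)"
   unfolding ray_decay_def
  proof (intro allI impI)
   fix r :: real assume r: "r > 0"
   define y where "y = Res (rcis r ta) (Phi nu ups v)"
   have nr: "cmod (rcis r ta) = r" using r by simp
   have "cmod (rt (rcis r ta)) = r powr (1 / 2)"
    unfolding rt_rcis[OF r th(1)] using r by (simp add: powr_def)
   then have n: "norm (J nu ta v r) = r powr (1 / 2) * norm (P (rcis r ta) y)"
    by (simp add: J_def norm_scaleC norm_mult y_def)
   have Pb: "norm (P (rcis r ta) y) \<le> MB * norm y / r"
    using P_bound[OF ray(2)[OF r], of y] r unfolding nr by (simp add: pos_le_divide_eq)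
   have y1: "norm y \<le> E * norm v"
   proof -
    have "y = Phi nu (%z. ups z / (exp (Complex (ln r) ta) - z)) v"
     using D(3)[of "ln r" v] r by (simp add: y_def exp_Complex)
    also have "norm \<dots> \<le> 2 * D * M / (1 / 2) * norm v" by (rule norm_Phi_le[OF D(2) nu(1) th(2)])
    also have "\<dots> \<le> E * norm v" by (intro mult_right_mono) (simp_all add: E_def)
    finally show ?thesis .
   qed
   have y2: "norm y \<le> E * norm v / r"
   proof -
    have "norm y \<le> M * norm (Phi nu ups v) / r"
     unfolding y_def using R_bound'[OF ray(1)[OF r], of "Phi nu ups v"] nr by simp
    also have "\<dots> \<le> M * (2 * C0 * M / (3 / 2) * norm v) / r"
     using norm_Phi_le[OF C0 nu(1) th(2), of v] M r by (intro divide_right_mono mult_left_mono) simp_all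
    also have "\<dots> = (M * (2 * C0 * M / (3 / 2))) * norm v / r" by (simp only: mult.assoc)
    also have "\<dots> \<le> E * norm v / r"
     using r by (intro divide_right_mono mult_right_mono) (simp_all add: E_def)
    finally show ?thesis .
   qed
   have a: "norm (J nu ta v r) \<le> r powr (1 / 2) * (MB * k / r)" if "norm y \<le> k" for k
    unfolding n using B.M r that
    by (intro mult_left_mono order_trans[OF Pb] divide_right_mono) simp_all
   have p: "r powr (1 / 2) / r = r powr (1 / 2 - 1)" "r powr (1 / 2 - 1) / r = r powr (- (1 / 2) - 1)"
    using r powr_diff[of r "1 / 2" 1] powr_diff[of r "1 / 2 - 1" 1] by simp_all
   have "norm (J nu ta v r) \<le> MB * E * norm v * (r powr (1 / 2) / r)" using a[OF y1] by (simp add: mult_ac)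
   moreover have "norm (J nu ta v r) \<le> MB * E * norm v * (r powr (1 / 2) / r / r)" using a[OF y2] by (simp add: mult_ac)
   ultimately show "norm (J nu ta v r) \<le> MB * E * norm v * r powr (1 / 2 - 1) \<and> norm (J nu ta v r) \<le> MB * E * norm v * r powr (- (1 / 2) - 1)"
    unfolding p by (rule conjI)
  qed
 qed
qed

lemma J_integral_clinear:
 assumes nu: "s < nu" "nu < \<bar>ta\<bar>" and ta: "\<bar>ta\<bar> < pi - sB"
 shows "bounded_clinear (%v. integral {0<..} (J nu ta v))"
proof -
 have th: "\<bar>ta\<bar> < pi" "nu < pi" using ta nu B.s by simp_all
 obtain C where C: "C \<ge> 0" "\<And>v. continuous_on {0<..} (J nu ta v)" "\<And>v. ray_decay (C * norm v) (1 / 2) (J nu ta v)"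
  by (rule J_props[OF assms]) blast
 have Cn: "C * norm v \<ge> 0" for v :: 'a using C(1) by simp
 note ri = ray_integral[OF C(2,3) _ Cn]
 have i: "J nu ta v integrable_on {0<..}" and b: "norm (integral {0<..} (J nu ta v)) \<le> 2 * (C * norm v) / (1 / 2)" for v
  by (rule ri; simp)+
 obtain C0 where C0: "h0_ray C0 (3 / 2) nu ups" by (rule ups_clinear[OF nu(1) th(2)])
 note U = Phi_clinear[OF C0 nu(1) th(2)]
 have ray: "bounded_clinear (Res (rcis r ta))" "bounded_clinear (P (rcis r ta))" if "r > 0" for r
  using rcis_in_cosector[of s ta r] neg_cosector[OF ta, of "ln r"] that nu s th
  by (simp_all add: exp_Complex R_clinear P_clinear)
 show ?thesis
 proof (rule bounded_clinearI)
  fix v w :: 'a and c :: complex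
  have "integral {0<..} (J nu ta (v + w)) = integral {0<..} (%r. J nu ta v r + J nu ta w r)"
   by (rule Henstock_Kurzweil_Integration.integral_cong)
    (simp add: J_def bounded_clinear_add[OF U] bounded_clinear_add[OF ray(1)] bounded_clinear_add[OF ray(2)] scaleC.add_right)
  then show "integral {0<..} (J nu ta (v + w)) = integral {0<..} (J nu ta v) + integral {0<..} (J nu ta w)"
   by (simp only: Henstock_Kurzweil_Integration.integral_add[OF i i])
  have "integral {0<..} (J nu ta (c *\<^sub>C v)) = integral {0<..} ((%x. c *\<^sub>C x) \<circ> J nu ta v)"
   by (rule Henstock_Kurzweil_Integration.integral_cong)
    (simp add: J_def bounded_clinear_scaleC[OF U] bounded_clinear_scaleC[OF ray(1)] bounded_clinear_scaleC[OF ray(2)] scaleC_scaleC mult.commute)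
  also have "\<dots> = c *\<^sub>C integral {0<..} (J nu ta v)" by (rule integral_linear[OF i scaleC.bounded_linear_right])
  finally show "integral {0<..} (J nu ta (c *\<^sub>C v)) = c *\<^sub>C integral {0<..} (J nu ta v)" .
  show "norm (integral {0<..} (J nu ta v)) \<le> (4 * C) * norm v" using b[of v] by simp
 qed
qed

text \<open>In the coordinate \<open>ln r\<close> the truncated ray integral is, up to a unimodular
  factor, the integral of \<open>kernel\<close> over a symmetric interval, so bounds uniform in
  \<open>m\<close> pass to the whole ray.\<close>

lemma functional_J:
 assumes nu: "s < nu" "nu < \<bar>ta\<bar>" and ta: "\<bar>ta\<bar> < pi - sB" and l: "bounded_clinear l"
 shows "l (integral {0<..} (J nu ta v)) = ray_int ta (%z. rt z * l (P z (Res z (Phi nu ups v))))"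
  and "(\<And>m. m > 0 ==> cmod (integral {- m..m} (kernel nu ta l v)) \<le> K) ==> cmod (l (integral {0<..} (J nu ta v))) \<le> K"
proof -
 have th: "\<bar>ta\<bar> < pi" "nu < pi" using ta nu B.s by simp_all
 have bl: "bounded_linear l" by (rule bounded_clinear_imp_bounded_linear[OF l])
 obtain C where C: "C \<ge> 0" "\<And>v. continuous_on {0<..} (J nu ta v)" "\<And>v. ray_decay (C * norm v) (1 / 2) (J nu ta v)"
  by (rule J_props[OF assms(1-3)]) blast
 have Cn: "C * norm v \<ge> 0" using C(1) by simp
 define F where "F z = rt z * l (P z (Res z (Phi nu ups v)))" for z
 have lJ: "l (J nu ta v r) = F (rcis r ta) * cis ta" for r
  by (simp add: J_def F_def functional_scaleC[OF l] mult_ac)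
 have "J nu ta v integrable_on {0<..}" by (rule ray_integral(1)[OF C(2,3) _ Cn]) simp
 from integral_linear[OF this bl]
 show eq: "l (integral {0<..} (J nu ta v)) = ray_int ta (%z. rt z * l (P z (Res z (Phi nu ups v))))"
  unfolding ray_int_def F_def[symmetric] by (simp add: comp_def lJ)
 assume K: "\<And>m. m > 0 ==> cmod (integral {- m..m} (kernel nu ta l v)) \<le> K"
 have FJ: "F (rcis r ta) = l (J nu ta v r) * cis (- ta)" for r
  unfolding lJ by (simp add: cis_mult mult.assoc)
 have Fc: "continuous_on {0<..} (%r. F (rcis r ta))"
  unfolding FJ by (intro continuous_on_mult continuous_on_const bounded_linear.continuous_on[OF bl] C(2))
 have ol: "onorm l \<ge> 0" by (rule onorm_pos_le[OF bl])
 have Fd: "ray_decay (onorm l * (C * norm v)) (1 / 2) (%r. F (rcis r ta))"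
  unfolding ray_decay_def
 proof (intro allI impI)
  fix r :: real assume r: "r > 0"
  have "cmod (F (rcis r ta)) \<le> onorm l * norm (J nu ta v r)"
   using onorm[OF bl, of "J nu ta v r"] by (simp add: FJ norm_mult)
  note f = order_trans[OF this mult_left_mono[OF _ ol]]
  show "cmod (F (rcis r ta)) \<le> onorm l * (C * norm v) * r powr (1 / 2 - 1) \<and> cmod (F (rcis r ta)) \<le> onorm l * (C * norm v) * r powr (- (1 / 2) - 1)"
   unfolding mult.assoc[of "onorm l" "C * norm v"]
   using C(3)[of v, unfolded ray_decay_def, rule_format, OF r] by (intro conjI f) (elim conjE, assumption)+
 qed
 have lim: "(%n. integral {- real n..real n} (%u. F (exp (Complex u ta)) * exp (Complex u ta))) \<longlonglongrightarrow> ray_int ta F"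
  by (rule ray_int_log_limit[OF Fc Fd _ mult_nonneg_nonneg[OF ol Cn]]) simp
 \<comment> \<open>The reflection \<open>u\<close> to \<open>- u\<close> is the substitution
   \<open>t = 1 / r\<close> between the radius on the ray and the parameter of the square
   function.\<close>
 have k: "F (exp (Complex u ta)) * exp (Complex u ta) = - cis (ta / 2) * kernel nu ta l v (- u)" for u
 proof -
  have "rt (exp (Complex u ta)) = exp (Complex u ta / 2)" using th by (intro rt_exp) simp
  also have "Complex u ta / 2 = Complex (u / 2) (ta / 2)" by (simp add: complex_eq_iff)
  finally show ?thesis by (simp add: F_def kernel_def exp_Complex_eq mult_ac)
 qed
 have b: "cmod (integral {- real n..real n} (%u. F (exp (Complex u ta)) * exp (Complex u ta))) \<le> K" if n: "n \<ge> 1" for n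
 proof -
  have "integral {- real n..- (- real n)} (%u. kernel nu ta l v (- u)) = integral {- real n..real n} (kernel nu ta l v)"
   by (rule Henstock_Kurzweil_Integration.integral_reflect_real[where f = "kernel nu ta l v" and a = "- real n" and b = "real n"])
  then have "integral {- real n..real n} (%u. F (exp (Complex u ta)) * exp (Complex u ta)) = - cis (ta / 2) * integral {- real n..real n} (kernel nu ta l v)"
   unfolding k by (simp only: integral_mult_right minus_minus)
  then show ?thesis using K[of "real n"] n by (simp add: norm_mult)
 qed
 have "cmod (ray_int ta F) \<le> K"
  by (rule LIMSEQ_le_const2[OF tendsto_norm[OF lim]]) (use b in blast)
 then show "cmod (l (integral {0<..} (J nu ta v))) \<le> K" unfolding eq F_def .
qed

text \<open>\<open>P\<close> is holomorphic on the sector of half-angle \<open>pi - sB\<close>,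
  which contains both rays together with everything between them, so no spectrum obstructs the
  rotation.\<close>

lemma P_rotate:
 assumes \<rho>: "0 < \<rho>" "\<rho> < pi - sB" and l: "bounded_clinear l"
 shows "ray_int (- \<rho>) (%z. chi z * l (P z b)) = ray_int \<rho> (%z. chi z * l (P z b))"
  and "ta \<in> {\<rho>, - \<rho>} ==> continuous_on {0<..} (%r. chi (rcis r ta) * l (P (rcis r ta) b))"
  and "\<exists>C\<ge>0. \<forall>ta\<in>{\<rho>, - \<rho>}. ray_decay C (1 / 2) (%r. chi (rcis r ta) * l (P (rcis r ta) b))"
proof -
 define \<beta> where "\<beta> = (\<rho> + (pi - sB)) / 2"
 have \<beta>: "0 < \<beta>" "\<rho> < \<beta>" "\<beta> < pi - sB" "\<beta> < pi" using \<rho> B.s by (simp_all add: \<beta>_def)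
 note ch = h0_chi[OF \<beta>(1,4)]
 define F where "F z = chi z * l (P z b)" for z
 define C where "C = 1 / gap (pi - \<beta>) * (onorm l * (MB * norm b))"
 have bl: "bounded_linear l" by (rule bounded_clinear_imp_bounded_linear[OF l])
 have C: "C \<ge> 0" using ch onorm_pos_le[OF bl] B.M unfolding C_def by (intro mult_nonneg_nonneg) (simp_all add: h0_def)
 have st: "- exp w \<in> cosector sB" if "w \<in> strip (- \<beta>) \<beta>" for w
  using neg_cosector[of "Im w" "Re w"] that \<beta> by (simp add: strip_def abs_less_iff)
 have "(%w. l (resolvent DB B (- exp w) b)) holomorphic_on strip (- \<beta>) \<beta>"
  by (rule holomorphic_on_compose_gen[OF _ B.holomorphic_on_R[OF l], unfolded comp_def]) (use st in \<open>auto intro!: holomorphic_intros\<close>)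
 then have "(%w. - l (resolvent DB B (- exp w) b)) holomorphic_on strip (- \<beta>) \<beta>" by (rule holomorphic_on_minus)
 then have "(%w. l (P (exp w) b)) holomorphic_on strip (- \<beta>) \<beta>" by (simp add: P_def bounded_clinear_minus[OF l])
 then have h: "(%w. F (exp w)) holomorphic_on strip (- \<beta>) \<beta>"
  unfolding F_def using ch by (intro holomorphic_on_mult) (simp_all add: h0_def)
 have ld: "log_decay C (1 / 2) F ta" if ta: "\<bar>ta\<bar> \<le> \<rho>" for ta
  unfolding log_decay_def
 proof
  fix u
  have t: "\<bar>ta\<bar> < \<beta>" "\<bar>ta\<bar> < pi - sB" using ta \<beta> by simp_all
  define z where "z = exp (Complex u ta)"
  have "cmod (l (P z b)) * exp u \<le> onorm l * norm (P z b) * exp u" by (rule mult_right_mono[OF onorm[OF bl]]) simp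
  also have "\<dots> = onorm l * (norm (P z b) * cmod z)" by (simp add: z_def)
  also have "\<dots> \<le> onorm l * (MB * norm b)"
   by (rule mult_left_mono[OF P_bound onorm_pos_le[OF bl]]) (use neg_cosector[OF t(2)] in \<open>simp add: z_def\<close>)
  finally have "cmod (l (P z b)) * exp u \<le> onorm l * (MB * norm b)" .
  from mult_mono[OF h0_bound[OF ch t(1), of u] this]
  show "cmod (F (exp (Complex u ta))) * exp u \<le> C * exp (- (1 / 2) * \<bar>u\<bar>)"
   using ch by (simp add: F_def z_def C_def norm_mult mult_ac h0_def)
 qed
 show c: "continuous_on {0<..} (%r. chi (rcis r ta) * l (P (rcis r ta) b))" if ta: "ta \<in> {\<rho>, - \<rho>}" for ta
  unfolding F_def[symmetric]
  by (rule continuous_on_rcis_exp[OF holomorphic_on_imp_continuous_on[OF h]]) (use ta \<beta> \<rho> in \<open>auto simp: strip_def\<close>)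
 show "ray_int (- \<rho>) (%z. chi z * l (P z b)) = ray_int \<rho> (%z. chi z * l (P z b))"
  unfolding F_def[symmetric]
  by (rule ray_int_rotate[OF h, of "- \<rho>" \<rho> C "1 / 2"]) (use \<beta> \<rho> C c in \<open>auto simp: F_def[symmetric] intro!: ld\<close>)
 show "\<exists>C\<ge>0. \<forall>ta\<in>{\<rho>, - \<rho>}. ray_decay C (1 / 2) (%r. chi (rcis r ta) * l (P (rcis r ta) b))"
  unfolding F_def[symmetric]
 proof (intro exI[of _ C] conjI ballI C)
  fix ta assume ta: "ta \<in> {\<rho>, - \<rho>}"
  show "ray_decay C (1 / 2) (%r. F (rcis r ta))"
   by (rule log_decay_ray_decay[OF ld _ C]) (use ta \<rho> in auto)
 qed
qed

text \<open>The contour formula for A (A + B)^(-1) multiplied by \<open>Psi\<close> twice; the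
  second factor \<open>Psi\<close> and the first are contained in \<open>ups\<close>.\<close>

definition L :: "real => real => 'a => 'a" where
 "L nu \<rho> v = (1 / (2 * complex_of_real pi * \<i>)) *\<^sub>C (integral {0<..} (J nu (- \<rho>) v) - integral {0<..} (J nu \<rho> v))"

text \<open>\<open>P z R(z,A)(A + B)y = R(z,A)y - P z y\<close>; subtracting \<open>y / (1 + z)\<close> from both terms restores
 integrability, and the \<open>B\<close> part vanishes by rotating the contour.\<close>

theorem L_sum:
 assumes nu: "s < nu" "nu < \<rho>" and \<rho>: "\<rho> < pi - sB" and y: "y \<in> DA" "y \<in> DB"
 shows "L nu \<rho> (A y + B y) = Psi (Psi (A y))"
proof -
 have \<rho>': "0 < \<rho>" "s < \<rho>" "\<rho> < pi" "nu < pi" using nu \<rho> s B.s by simp_all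
 define \<beta> where "\<beta> = (\<rho> + pi) / 2"
 have \<beta>: "0 < \<beta>" "\<rho> < \<beta>" "\<beta> < pi" "\<beta> \<le> pi" using \<rho>' by (simp_all add: \<beta>_def)
 define Cu where "Cu = 1 / gap (pi - \<beta>) ^ 4"
 have up: "h0 Cu (3 / 2) \<beta> ups" unfolding Cu_def by (rule h0_ups[OF \<beta>(1,3)])
 have upr: "h0_ray Cu (3 / 2) nu ups" by (rule h0_imp_h0_ray[OF up]) (use nu \<beta> s in simp)
 define Cc where "Cc = 1 / gap (pi - \<beta>)"
 have ch: "h0 Cc (1 / 2) \<beta> chi" unfolding Cc_def by (rule h0_chi[OF \<beta>(1,3)])
 have chr: "h0_ray Cc (1 / 2) \<rho> chi" by (rule h0_imp_h0_ray[OF ch]) (use \<rho>' \<beta> in simp)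
 note U = Phi_clinear[OF upr nu(1) \<rho>'(4)]
 \<comment> \<open>With these, \<open>Res z y1 = (1 + z) *\<^sub>C Res z y - y\<close> and
   \<open>P z y2 = (1 + z) *\<^sub>C P z y - y\<close>; the two terms \<open>- y\<close> cancel in
   the difference.\<close>
 define y1 y2 where "y1 = y + A y" and "y2 = y - B y"
 have key: "rt z *\<^sub>C P z (Res z (Phi nu ups (A y + B y))) = chi z *\<^sub>C (Res z (Phi nu ups y1) - P z (Phi nu ups y2))"
  if z: "z \<in> cosector s" "- z \<in> cosector sB" "1 + z \<noteq> 0" for z
 proof -
  note Pc = P_clinear[OF z(2)] and Rc = R_clinear[OF z(1)]
  have PB: "P z (B y) = y - z *\<^sub>C P z y"
   using B.resolvent_apply[OF z(2) y(2)] by (simp add: P_def scaleC.minus_left scaleC.minus_right)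
  have RA: "Res z (A y) = z *\<^sub>C Res z y - y" by (rule resolvent_apply[OF z(1) y(1)])
  have "P z (Res z (A y + B y)) = P z (Res z (A y)) + Res z (P z (B y))"
   by (simp only: bounded_clinear_add[OF Rc] bounded_clinear_add[OF Pc] P_R[OF z(2,1)])
  also have "\<dots> = Res z y - P z y"
   unfolding RA PB by (simp add: bounded_clinear_diff[OF Rc] bounded_clinear_diff[OF Pc] bounded_clinear_scaleC[OF Rc] bounded_clinear_scaleC[OF Pc] P_R[OF z(2,1)])
  finally have 1: "P z (Res z (A y + B y)) = Res z y - P z y" .
  have "Res z y1 - P z y2 = (1 + z) *\<^sub>C (Res z y - P z y)"
   unfolding y1_def y2_def bounded_clinear_add[OF Rc] bounded_clinear_diff[OF Pc] RA PB
   by (simp add: scaleC.add_left scaleC.diff_right)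
  then have "chi z *\<^sub>C (Res z y1 - P z y2) = rt z *\<^sub>C (Res z y - P z y)"
   using z(3) by (simp add: chi_def scaleC_scaleC)
  then have 2: "rt z *\<^sub>C P z (Res z (A y + B y)) = chi z *\<^sub>C (Res z y1 - P z y2)" unfolding 1 ..
  have UR: "Res z (Phi nu ups x) = Phi nu ups (Res z x)" for x by (rule Phi_R[OF upr nu(1) \<rho>'(4) z(1), symmetric])
  have UP: "P z (Phi nu ups x) = Phi nu ups (P z x)" for x by (rule P_Phi[OF z(2) upr nu(1) \<rho>'(4)])
  show ?thesis
   using arg_cong[OF 2, of "Phi nu ups"]
   unfolding UR UP bounded_clinear_scaleC[OF U] bounded_clinear_diff[OF U] .
 qed
 have "L nu \<rho> (A y + B y) = Phi \<rho> chi (Phi nu ups y1)"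
 proof (rule eq_functionalI)
  fix l :: "'a => complex" assume l: "bounded_clinear l"
  have bl: "bounded_linear l" by (rule bounded_clinear_imp_bounded_linear[OF l])
  note rot = P_rotate[where b = "Phi nu ups y2", OF \<rho>'(1) \<rho> l]
  obtain C where C: "C \<ge> 0" "\<And>ta. ta \<in> {\<rho>, - \<rho>} ==> ray_decay C (1 / 2) (%r. chi (rcis r ta) * l (P (rcis r ta) (Phi nu ups y2)))"
   using rot(3) by blast
  note fd = functional_ray_decay[where x = "Phi nu ups y1", OF chr \<rho>'(2,3) _ l]
  have split: "l (integral {0<..} (J nu ta (A y + B y))) = ray_int ta (%z. chi z * l (Res z (Phi nu ups y1))) + (- 1) * ray_int ta (%z. chi z * l (P z (Phi nu ups y2)))"
   if ta: "ta \<in> {\<rho>, - \<rho>}" for ta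
  proof -
   have a: "\<bar>ta\<bar> = \<rho>" using ta \<rho>' by auto
   have "l (integral {0<..} (J nu ta (A y + B y))) = ray_int ta (%z. rt z * l (P z (Res z (Phi nu ups (A y + B y)))))"
    by (rule functional_J(1)[OF nu(1) _ _ l]) (use a nu \<rho> in simp_all)
   also have "\<dots> = ray_int ta (%z. chi z * l (Res z (Phi nu ups y1)) + (- 1) * (chi z * l (P z (Phi nu ups y2))))"
    unfolding ray_int_def
   proof (rule Henstock_Kurzweil_Integration.integral_cong)
    fix r :: real assume "r \<in> {0<..}"
    then have r: "r > 0" by simp
    define z where "z = rcis r ta"
    have zc: "z \<in> cosector s" unfolding z_def by (rule angle_cosector'[OF \<rho>'(2,3) ta r])
    have ze: "z = exp (Complex (ln r) ta)" using r by (simp add: z_def exp_Complex)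
    have zB: "- z \<in> cosector sB" unfolding ze by (rule neg_cosector) (use a \<rho> in simp)
    have "Complex (ln r) ta \<in> strip (- \<beta>) \<beta>" using a \<beta> by (auto simp: strip_def)
    then have z1: "1 + z \<noteq> 0" unfolding ze by (rule one_plus_exp_nonzero[OF _ \<beta>(3)])
    have "rt z * l (P z (Res z (Phi nu ups (A y + B y)))) = l (chi z *\<^sub>C (Res z (Phi nu ups y1) - P z (Phi nu ups y2)))"
     unfolding key[OF zc zB z1, symmetric] functional_scaleC[OF l] ..
    also have "\<dots> = chi z * l (Res z (Phi nu ups y1)) + (- 1) * (chi z * l (P z (Phi nu ups y2)))"
     by (simp add: functional_scaleC[OF l] bounded_clinear_diff[OF l] right_diff_distrib)
    finally show "rt (rcis r ta) * l (P (rcis r ta) (Res (rcis r ta) (Phi nu ups (A y + B y)))) * cis ta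
     = (chi (rcis r ta) * l (Res (rcis r ta) (Phi nu ups y1)) + (- 1) * (chi (rcis r ta) * l (P (rcis r ta) (Phi nu ups y2)))) * cis ta"
     unfolding z_def by (simp only:)
   qed
   also have "\<dots> = ray_int ta (%z. chi z * l (Res z (Phi nu ups y1))) + (- 1) * ray_int ta (%z. chi z * l (P z (Phi nu ups y2)))"
    by (rule ray_int_lincomb[OF fd(1)[OF ta] fd(2)[OF ta] _ fd(3)[OF ta] rot(2)[OF ta] C(2)[OF ta] _ C(1)]) simp_all
   finally show ?thesis .
  qed
  have "l (L nu \<rho> (A y + B y)) = (1 / (2 * complex_of_real pi * \<i>)) *
    (ray_int (- \<rho>) (%z. chi z * l (Res z (Phi nu ups y1))) - ray_int \<rho> (%z. chi z * l (Res z (Phi nu ups y1))))"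
   unfolding L_def functional_scaleC[OF l] bounded_clinear_diff[OF l]
   using split[of \<rho>] split[of "- \<rho>"] rot(1) by (simp only: insertI1 insertI2 simp_thms) simp
  also have "\<dots> = l (Phi \<rho> chi (Phi nu ups y1))" by (rule functional_Phi[OF chr \<rho>'(2,3) l, symmetric])
  finally show "l (L nu \<rho> (A y + B y)) = l (Phi \<rho> chi (Phi nu ups y1))" .
 qed
 also have "Phi nu ups y1 = Phi \<rho> ups y1" by (rule Phi_angle_indep[OF up \<beta>(4)]) (use nu \<rho>' \<beta> in simp_all)
 also have "Phi \<rho> chi (Phi \<rho> ups y1) = Phi \<rho> (%z. chi z * ups z) y1" by (rule Phi_mult[OF ch up \<beta>(4) \<rho>'(2) \<beta>(2)])
 also have "\<dots> = Psi (Psi (A y))"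
 proof -
  define g where "g z = regulariser z * regulariser z" for z
  define Cr where "Cr = 1 / (gap (pi - \<beta>))\<^sup>2"
  have rg: "h0 Cr 1 \<beta> regulariser" unfolding Cr_def by (rule h0_regulariser[OF \<beta>(1,3)])
  have g: "h0 (Cr * Cr) (1 + 1) \<beta> g" unfolding g_def[abs_def] by (rule h0_mult[OF rg rg])
  have gr: "h0_ray (Cr * Cr) (1 + 1) \<rho> g" by (rule h0_imp_h0_ray[OF g]) (use \<rho>' \<beta> in simp)
  have Pg: "Phi \<rho> g x = Psi (Psi x)" for x
   unfolding g_def[abs_def] Phi_mult[OF rg rg \<beta>(4) \<rho>'(2) \<beta>(2), symmetric] Phi_eq_Psi[OF \<rho>'(2,3)] ..
  define b' where "b' = (\<rho> + \<beta>) / 2"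
  have b': "b' > 0" "b' \<le> \<beta>" "\<bar>\<rho>\<bar> < b'" "pi - b' > 0" "pi - b' \<le> \<bar>pi\<bar> - b'" "\<bar>pi\<bar> + b' \<le> 2 * pi - (pi - b')"
   using \<rho>' \<beta> by (simp_all add: b'_def)
  have m1: "exp (Complex 0 pi) = -1" by (rule exp_minus1)
  have gd: "h0_ray (Cr * Cr / (gap (pi - b') * exp 0)) (1 + 1) \<rho> (%z. g z / (- 1 - z))"
   using h0_imp_h0_ray[OF h0_div(1)[OF g b'(2,4,5,6,1), of 0] b'(3)] unfolding m1 .
  have "Phi \<rho> (%z. chi z * ups z) y1 = Phi \<rho> (%z. g z + 1 * (g z / (- 1 - z))) y1"
  proof (rule Phi_cong)
   fix r ta :: real assume r: "r > 0" and ta: "ta \<in> {\<rho>, - \<rho>}"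
   define z where "z = rcis r ta"
   have "Complex (ln r) ta \<in> strip (- \<beta>) \<beta>" using ta \<rho>' \<beta> by (auto simp: strip_def)
   from one_plus_exp_nonzero[OF this \<beta>(3)] have z1: "1 + z \<noteq> 0" using r by (simp add: z_def exp_Complex)
   have "chi z * ups z = (rt z * rt z) * g z / (1 + z)" by (simp add: chi_def ups_def g_def mult_ac)
   also have "\<dots> = z * g z / (1 + z)" unfolding rt_square ..
   also have "\<dots> = g z - g z / (1 + z)" using z1 by (simp add: field_simps)
   also have "g z / (1 + z) = - (g z / (- 1 - z))"
   proof -
    have "- 1 - z = - (1 + z)" by simp
    then show ?thesis by (simp only: minus_divide_right[symmetric] minus_minus)
   qed
   finally show "chi (rcis r ta) * ups (rcis r ta) = g (rcis r ta) + 1 * (g (rcis r ta) / (- 1 - rcis r ta))"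
    by (simp add: z_def)
  qed
  \<comment> \<open>The product \<open>chi z * ups z\<close> equals g z - g z / (1 + z), hence acts
    as \<open>Psi\<close> applied twice to \<open>y1 + Res (-1) y1\<close>. Since \<open>y1\<close>
    is (1 + A) y, this vector is \<open>A y\<close>.\<close>
  also have "\<dots> = Phi \<rho> g y1 + 1 *\<^sub>C Phi \<rho> (%z. g z / (- 1 - z)) y1" by (rule Phi_lincomb[OF gr gd \<rho>'(2,3)])
  also have "Phi \<rho> (%z. g z / (- 1 - z)) y1 = Res (-1) (Phi \<rho> g y1)"
   by (rule R_Phi[OF g \<beta>(4) \<rho>'(2) \<beta>(2) _ _ m1[symmetric], symmetric]) (use \<rho>' in simp_all)
  also have "Phi \<rho> g y1 + 1 *\<^sub>C Res (-1) (Phi \<rho> g y1) = Psi (Psi (y1 + Res (-1) y1))"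
  proof -
   have "Res (-1) (Psi x) = Psi (Res (-1) x)" for x
    by (rule Psi_commute[OF R_clinear[OF minus1_cosector] R_commute[OF minus1_cosector]])
   then show ?thesis by (simp only: Pg scaleC_one bounded_clinear_add[OF Psi_clinear])
  qed
  also have "y1 + Res (-1) y1 = A y"
   unfolding y1_def bounded_clinear_add[OF R_clinear[OF minus1_cosector]] resolvent_apply[OF minus1_cosector y(1)]
   by (simp add: scaleC_minus1)
  finally show ?thesis .
 qed
 finally show ?thesis .
qed

text \<open>By Hahn-Banach it suffices to test with functionals of norm at most 1. The two rays
  contribute equally, and 1 / (2 \<pi>) is below 1/2.\<close>

lemma L_bound:
 assumes nu: "s < nu" "nu < \<rho>" and \<rho>: "\<rho> < pi - sB"
  and est: "\<And>ta x' v m. ta \<in> {\<rho>, - \<rho>} ==> bounded_clinear x' ==> m > 0 ==>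
   cmod (integral {- m..m} (kernel nu ta x' v)) \<le> K * onorm x' * norm (Psi (Psi v))" and K: "K \<ge> 0"
 shows "norm (L nu \<rho> v) \<le> K * norm (Psi (Psi v))"
proof (rule norm_functional_leI)
 have \<rho>': "0 < \<rho>" "\<rho> < pi" "nu < pi" using nu \<rho> s B.s by simp_all
 define c where "c = 1 / (2 * complex_of_real pi * \<i>)"
  fix f :: "'a => complex" assume f: "bounded_clinear f" and f1: "\<And>x. cmod (f x) \<le> norm x"
  define k where "k = K * norm (Psi (Psi v))"
  have k: "k \<ge> 0" using K by (simp add: k_def)
  have b: "cmod (f (integral {0<..} (J nu ta v))) \<le> k" if ta: "ta \<in> {\<rho>, - \<rho>}" for ta
  proof (rule functional_J(2)[OF nu(1) _ _ f])
   show "nu < \<bar>ta\<bar>" "\<bar>ta\<bar> < pi - sB" using ta nu \<rho> \<rho>' by auto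
   fix m :: real assume m: "m > 0"
   have "K * onorm f * norm (Psi (Psi v)) \<le> K * 1 * norm (Psi (Psi v))"
    using functional_onorm_le[of f, OF f1] K by (intro mult_right_mono mult_left_mono) simp_all
   with est[OF ta f m, of v] show "cmod (integral {- m..m} (kernel nu ta f v)) \<le> k" by (simp add: k_def)
  qed
  have "cmod (f (L nu \<rho> v)) = cmod c * cmod (f (integral {0<..} (J nu (- \<rho>) v)) - f (integral {0<..} (J nu \<rho> v)))"
   by (simp add: L_def c_def functional_scaleC[OF f] bounded_clinear_diff[OF f] norm_mult norm_divide)
  also have "\<dots> \<le> 1 / 2 * (k + k)"
  proof (rule mult_mono)
   show "cmod c \<le> 1 / 2" using pi_ge_two by (simp add: c_def norm_divide norm_mult field_simps)
   show "cmod (f (integral {0<..} (J nu (- \<rho>) v)) - f (integral {0<..} (J nu \<rho> v))) \<le> k + k"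
    by (rule order_trans[OF norm_triangle_ineq4 add_mono[OF b b]]) simp_all
  qed simp_all
  finally show "cmod (f (L nu \<rho> v)) \<le> K * norm (Psi (Psi v))" by (simp add: k_def)
 qed

lemma Psi_Psi_clinear: "bounded_clinear (%v. Psi (Psi v))"
 by (rule bounded_clinear_compose[OF Psi_clinear Psi_clinear])

lemma L_clinear:
 assumes nu: "s < nu" "nu < \<rho>" and \<rho>: "\<rho> < pi - sB"
  and est: "\<And>ta x' v m. ta \<in> {\<rho>, - \<rho>} ==> bounded_clinear x' ==> m > 0 ==>
   cmod (integral {- m..m} (kernel nu ta x' v)) \<le> K * onorm x' * norm (Psi (Psi v))" and K: "K \<ge> 0"
 shows "bounded_clinear (L nu \<rho>)"
proof -
 have \<rho>': "0 < \<rho>" "\<rho> < pi" "nu < pi" using nu \<rho> s B.s by simp_all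
 have Jc: "bounded_clinear (%v. integral {0<..} (J nu ta v))" if "ta \<in> {\<rho>, - \<rho>}" for ta
  by (rule J_integral_clinear[OF nu(1)]) (use that nu \<rho> \<rho>' in auto)
 note Pb = bounded_clinear_onorm[OF Psi_Psi_clinear]
 have a1: "bounded_clinear (%v. integral {0<..} (J nu \<rho> v))" by (rule Jc) (rule insertI1)
 have a2: "bounded_clinear (%v. integral {0<..} (J nu (- \<rho>) v))" by (rule Jc) (rule insertI2, rule insertI1)
 note a = a1 a2
 show ?thesis
 proof (rule bounded_clinearI)
  show "L nu \<rho> (x + y) = L nu \<rho> x + L nu \<rho> y" for x y
   unfolding L_def bounded_clinear_add[OF a(1)] bounded_clinear_add[OF a(2)] by (simp only: add_diff_add scaleC.add_right)
  show "L nu \<rho> (k *\<^sub>C x) = k *\<^sub>C L nu \<rho> x" for k x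
   unfolding L_def bounded_clinear_scaleC[OF a(1)] bounded_clinear_scaleC[OF a(2)] scaleC.diff_right[symmetric] scaleC_scaleC
   by (simp only: mult.commute)
  show "norm (L nu \<rho> x) \<le> (K * onorm (%v. Psi (Psi v))) * norm x" for x
   using order_trans[OF L_bound[OF nu \<rho> est K] mult_left_mono[OF Pb K]] by (simp only: mult.assoc)
 qed
qed

lemma L_commute:
 assumes nu: "s < nu" "nu < \<rho>" and \<rho>: "\<rho> < pi - sB"
 shows "L nu \<rho> (Psi (Psi w)) = Psi (Psi (L nu \<rho> w))"
 proof -
 have \<rho>': "0 < \<rho>" "\<rho> < pi" "nu < pi" using nu \<rho> s B.s by simp_all

  define T where "T = (%v. Psi (Psi v))"
  have T: "bounded_clinear T" unfolding T_def by (rule Psi_Psi_clinear)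
  have TJ: "integral {0<..} (J nu ta (T w)) = T (integral {0<..} (J nu ta w))" if ta: "ta \<in> {\<rho>, - \<rho>}" for ta
  proof -
   have a: "nu < \<bar>ta\<bar>" "\<bar>ta\<bar> < pi - sB" using ta nu \<rho> \<rho>' by auto
   obtain C where C: "C \<ge> 0" "\<And>v. continuous_on {0<..} (J nu ta v)" "\<And>v. ray_decay (C * norm v) (1 / 2) (J nu ta v)"
    by (rule J_props[OF nu(1) a]) blast
   have i: "J nu ta w integrable_on {0<..}" by (rule ray_integral(1)[OF C(2,3)]) (use C(1) in simp_all)
   obtain C0 where C0: "h0_ray C0 (3 / 2) nu ups" by (rule ups_clinear[OF nu(1) \<rho>'(3)])
   have "integral {0<..} (J nu ta (T w)) = integral {0<..} (T \<circ> J nu ta w)"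
   proof (rule Henstock_Kurzweil_Integration.integral_cong)
    fix r :: real assume "r \<in> {0<..}"
    then have r: "r > 0" by simp
    have z1: "rcis r ta \<in> cosector s" by (rule angle_cosector'[OF _ \<rho>'(2) ta r]) (use nu in simp)
    have z2: "- rcis r ta \<in> cosector sB" using neg_cosector[OF a(2), of "ln r"] r by (simp add: exp_Complex)
    have Rp: "Res (rcis r ta) (Psi x) = Psi (Res (rcis r ta) x)" for x
     by (rule Psi_commute[OF R_clinear[OF z1] R_commute[OF z1]])
    show "J nu ta (T w) r = (T \<circ> J nu ta w) r"
     by (simp add: J_def T_def Phi_Psi[OF C0 nu(1) \<rho>'(3)] Rp P_Psi[OF z2] bounded_clinear_scaleC[OF Psi_clinear])
   qed
   also have "\<dots> = T (integral {0<..} (J nu ta w))" by (rule integral_linear[OF i bounded_clinear_imp_bounded_linear[OF T]])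
   finally show ?thesis .
  qed
  have "L nu \<rho> (T w) = T (L nu \<rho> w)"
   unfolding L_def bounded_clinear_scaleC[OF T] bounded_clinear_diff[OF T] TJ[OF insertI1] TJ[OF insertI2[OF insertI1]] ..
  then show ?thesis unfolding T_def .
 qed

text \<open>\<open>L_bound\<close> lets \<open>L\<close> factor as \<open>S\<close> after the
  doubled \<open>Psi\<close>. Commutation on the dense range also gives \<open>L\<close> as the
  doubled \<open>Psi\<close> after \<open>S\<close>, and injectivity of \<open>Psi\<close> then
  cancels the regularisers in \<open>L_sum\<close>.\<close>

theorem bounded_solution:
 assumes d: "closure DA = UNIV" "closure (A ` DA) = UNIV"
  and nu: "s < nu" "nu < \<rho>" and \<rho>: "\<rho> < pi - sB"
  and est: "\<And>ta x' v m. ta \<in> {\<rho>, - \<rho>} ==> bounded_clinear x' ==> m > 0 ==>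
   cmod (integral {- m..m} (kernel nu ta x' v)) \<le> K * onorm x' * norm (Psi (Psi v))" and K: "K \<ge> 0"
 shows "\<exists>S. bounded_clinear S \<and> (\<forall>y\<in>DA \<inter> DB. S (A y + B y) = A y)"
proof -
 note PP = Psi_Psi_clinear and LP = L_commute[OF nu \<rho>]
 have Lc: "bounded_clinear (L nu \<rho>)" by (rule L_clinear[OF nu \<rho> _ K]) (rule est)
 have Lb: "norm (L nu \<rho> v) \<le> K * norm (Psi (Psi v))" for v by (rule L_bound[OF nu \<rho> _ K]) (rule est)
 note Pl = bounded_clinear_imp_bounded_linear[OF Psi_clinear]
 have dP: "closure (range (%v. Psi (Psi v))) = UNIV"
  by (rule dense_range_compose[of Psi Psi, OF Pl dense_Psi[OF d] dense_Psi[OF d]])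
 from dense_extension[OF PP dP Lc Lb] obtain S where S': "bounded_clinear S \<and> (\<forall>w. S (Psi (Psi w)) = L nu \<rho> w)"
  by (rule exE)
 note S = conjunct1[OF S'] spec[OF conjunct2[OF S']]
 have comm: "L nu \<rho> x = Psi (Psi (S x))" for x
 proof -
  have "closed {x. L nu \<rho> x = Psi (Psi (S x))}"
   by (intro closed_Collect_eq linear_continuous_on bounded_clinear_imp_bounded_linear Lc bounded_clinear_compose[OF PP S(1)])
  moreover have "range (%v. Psi (Psi v)) \<subseteq> {x. L nu \<rho> x = Psi (Psi (S x))}"
   by (rule image_subsetI) (simp only: mem_Collect_eq S(2) LP)
  ultimately have "closure (range (%v. Psi (Psi v))) \<subseteq> {x. L nu \<rho> x = Psi (Psi (S x))}"
   by (rule closure_minimal[rotated])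
  then have "x \<in> {x. L nu \<rho> x = Psi (Psi (S x))}" unfolding dP by (rule subsetD) (rule UNIV_I)
  then show ?thesis by (rule CollectD)
 qed
 have "S (A y + B y) = A y" if "y \<in> DA \<inter> DB" for y
 proof -
  have "Psi (Psi (S (A y + B y))) = Psi (Psi (A y))"
   unfolding comm[symmetric] by (rule L_sum[OF nu \<rho>]) (use that in simp_all)
  then show ?thesis by (rule inj_Psi_eq[OF d(2) inj_Psi_eq[OF d(2)]])
 qed
 then show ?thesis by (intro exI[of _ S] conjI ballI S(1))
qed

end

text \<open>If x_n and (A + B) x_n converge, then A x_n = S (A + B) x_n converges as well, and so
  does B x_n; closedness of \<open>A\<close> and of \<open>B\<close> identifies the limits. If (A +
  B) z = 0, then A z = S 0 = 0.\<close>

lemma closed_sum: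
 fixes A B :: "'a::complex_banach => 'a"
 assumes A: "closed_op DA A" and B: "closed_op DB B" and S: "bounded_clinear S"
  and SA: "\<And>y. y \<in> DA \<inter> DB ==> S (A y + B y) = A y"
  and inj: "\<And>y. y \<in> DA ==> A y = 0 ==> y = 0"
 shows "closed_op (DA \<inter> DB) (%x. A x + B x)" "inj_on (%x. A x + B x) (DA \<inter> DB)"
proof -
 have lA: "linear_op DA A" and lB: "linear_op DB B" and cA: "closed {(x, A x) |x. x \<in> DA}" and cB: "closed {(x, B x) |x. x \<in> DB}"
  using A B unfolding closed_op_def by simp_all
 have a: "0 \<in> DA" "x \<in> DA ==> y \<in> DA ==> x + y \<in> DA" "x \<in> DA ==> y \<in> DA ==> A (x + y) = A x + A y"
  "x \<in> DA ==> c *\<^sub>C x \<in> DA" "x \<in> DA ==> A (c *\<^sub>C x) = c *\<^sub>C A x" for x y c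
  using lA unfolding linear_op_def by simp_all
 have b: "0 \<in> DB" "x \<in> DB ==> y \<in> DB ==> x + y \<in> DB" "x \<in> DB ==> y \<in> DB ==> B (x + y) = B x + B y"
  "x \<in> DB ==> c *\<^sub>C x \<in> DB" "x \<in> DB ==> B (c *\<^sub>C x) = c *\<^sub>C B x" for x y c
  using lB unfolding linear_op_def by simp_all
 have lin: "linear_op (DA \<inter> DB) (%x. A x + B x)"
  unfolding linear_op_def by (simp add: a b scaleC.add_right)
 have S0: "S 0 = 0" using bounded_clinear_diff[OF S, of 0 0] by simp
 show "inj_on (%x. A x + B x) (DA \<inter> DB)"
 proof (rule inj_onI)
  fix x y assume x: "x \<in> DA \<inter> DB" and y: "y \<in> DA \<inter> DB" and eq: "A x + B x = A y + B y"
  define z where "z = x + (- 1) *\<^sub>C y"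
  have my: "(- 1) *\<^sub>C y \<in> DA" "(- 1) *\<^sub>C y \<in> DB" using y a(4) b(4) by blast+
  have z: "z \<in> DA \<inter> DB" using x my a(2) b(2) unfolding z_def by blast
  have Az: "A z = A x - A y"
  proof -
   have "A z = A x + A ((- 1) *\<^sub>C y)" unfolding z_def by (rule a(3)) (use x my(1) in blast)+
   also have "A ((- 1) *\<^sub>C y) = (- 1) *\<^sub>C A y" by (rule a(5)) (use y in blast)
   finally show ?thesis by (simp only: scaleC_minus1 diff_conv_add_uminus)
  qed
  have Bz: "B z = B x - B y"
  proof -
   have "B z = B x + B ((- 1) *\<^sub>C y)" unfolding z_def by (rule b(3)) (use x my(2) in blast)+
   also have "B ((- 1) *\<^sub>C y) = (- 1) *\<^sub>C B y" by (rule b(5)) (use y in blast)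
   finally show ?thesis by (simp only: scaleC_minus1 diff_conv_add_uminus)
  qed
  have "A z + B z = (A x + B x) - (A y + B y)" unfolding Az Bz by (rule add_diff_add[symmetric])
  then have "A z + B z = 0" unfolding eq by simp
  with SA[OF z] S0 have "A z = 0" by simp
  moreover have "z \<in> DA" using z by simp
  ultimately have "z = 0" by (rule inj[rotated])
  then show "x = y" unfolding z_def scaleC_minus1 by simp
 qed
 have "closed {(x, A x + B x) |x. x \<in> DA \<inter> DB}"
  unfolding closed_sequential_limits
 proof (intro allI impI)
  fix p :: "nat => 'a \<times> 'a" and q
  assume "(\<forall>n. p n \<in> {(x, A x + B x) |x. x \<in> DA \<inter> DB}) \<and> p \<longlonglongrightarrow> q"
  then have p: "p n \<in> {(x, A x + B x) |x. x \<in> DA \<inter> DB}" and pq: "p \<longlonglongrightarrow> q" for n by simp_all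
  define x where "x n = fst (p n)" for n
  define y where "y n = snd (p n)" for n
  have xy: "x n \<in> DA \<inter> DB" "y n = A (x n) + B (x n)" for n using p[of n] unfolding x_def y_def by auto
  have xl: "x \<longlonglongrightarrow> fst q" and yl: "y \<longlonglongrightarrow> snd q"
   unfolding x_def[abs_def] y_def[abs_def] by (intro tendsto_fst tendsto_snd pq)+
  have Al: "(%n. A (x n)) \<longlonglongrightarrow> S (snd q)"
   using bounded_linear.tendsto[OF bounded_clinear_imp_bounded_linear[OF S] yl] by (simp only: xy(2) SA[OF xy(1)])
  have Bl: "(%n. B (x n)) \<longlonglongrightarrow> snd q - S (snd q)"
   using tendsto_diff[OF yl Al] by (simp add: xy(2))
  have "(fst q, S (snd q)) \<in> {(x, A x) |x. x \<in> DA}"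
   by (rule closed_sequentially[OF cA _ tendsto_Pair[OF xl Al]]) (use xy(1) in auto)
  then have 1: "fst q \<in> DA" "A (fst q) = S (snd q)" by auto
  have "(fst q, snd q - S (snd q)) \<in> {(x, B x) |x. x \<in> DB}"
   by (rule closed_sequentially[OF cB _ tendsto_Pair[OF xl Bl]]) (use xy(1) in auto)
  then have 2: "fst q \<in> DB" "B (fst q) = snd q - S (snd q)" by auto
  have "snd q = A (fst q) + B (fst q)" unfolding 1 2 by simp
  then have "q = (fst q, A (fst q) + B (fst q))" by (simp add: prod_eq_iff)
  then show "q \<in> {(x, A x + B x) |x. x \<in> DA \<inter> DB}" using 1(1) 2(1) by blast
 qed
 with lin show "closed_op (DA \<inter> DB) (%x. A x + B x)" unfolding closed_op_def by (rule conjI)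
qed

text \<open>Only the square of \<open>csqrt\<close> enters, so its branch plays no part; the fourth
  root squares to \<open>rt\<close> because the argument stays below \<pi>.\<close>

lemma phi_fun_square:
 assumes r: "r > 0" and tu: "\<bar>tu\<bar> < pi"
 shows "phi_fun ta (complex_of_real (exp a) * rcis r tu) * phi_fun ta (complex_of_real (exp a) * rcis r tu)
  = complex_of_real (exp (- a / 2)) * (rt (rcis r tu) / (rcis r tu - exp (Complex (- a) ta)))"
proof -
 define w where "w = Complex (ln r + a) tu"
 have w: "complex_of_real (exp a) * rcis r tu = exp w"
  using r by (simp add: w_def exp_Complex_eq rcis_def exp_add)
 have p: "exp w powr c = exp (c * w)" for c using tu by (simp add: powr_def w_def)
 have "phi_fun ta (exp w) * phi_fun ta (exp w) = exp (1 / 4 * w) * exp (1 / 4 * w) / (csqrt (- cis ta + exp w) * csqrt (- cis ta + exp w))"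
  by (simp add: phi_fun_def p)
 also have "csqrt (- cis ta + exp w) * csqrt (- cis ta + exp w) = exp w - cis ta"
  by (simp only: power2_csqrt flip: power2_eq_square) simp
 also have "exp (1 / 4 * w) * exp (1 / 4 * w) = exp (w / 2)" by (simp flip: exp_add)
 also have "w / 2 = complex_of_real (a / 2) + Complex (ln r) tu / 2" by (simp add: w_def complex_eq_iff add_divide_distrib)
 also have "exp \<dots> = complex_of_real (exp (a / 2)) * rt (rcis r tu)"
 proof -
  have "rt (exp (Complex (ln r) tu)) = exp (Complex (ln r) tu / 2)" using tu by (intro rt_exp) simp
  then have e: "rt (rcis r tu) = exp (Complex (ln r) tu / 2)" using r by (simp add: exp_Complex)
  show ?thesis unfolding exp_add exp_of_real e ..
 qed
 also have "exp w - cis ta = complex_of_real (exp a) * (rcis r tu - exp (Complex (- a) ta))"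
 proof -
  have "complex_of_real (exp a) * exp (Complex (- a) ta) = complex_of_real (exp a * exp (- a)) * cis ta"
   unfolding exp_Complex_eq of_real_mult by (simp only: mult.assoc)
  also have "exp a * exp (- a) = 1" by (simp flip: exp_add)
  finally show ?thesis unfolding w[symmetric] right_diff_distrib by simp
 qed
 also have "complex_of_real (exp (a / 2)) * rt (rcis r tu) / (complex_of_real (exp a) * (rcis r tu - exp (Complex (- a) ta)))
   = complex_of_real (exp (a / 2) / exp a) * (rt (rcis r tu) / (rcis r tu - exp (Complex (- a) ta)))"
  by (simp only: of_real_divide times_divide_times_eq)
 also have "exp (a / 2) / exp a = exp (- a / 2)" by (simp flip: exp_diff)
 finally show ?thesis unfolding w .
qed

text \<open>\<open>\<phi>\<close> is unbounded near its singularity \<open>cis ta\<close>.\<close>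

lemma phi_fun_H0inf:
 assumes \<phi>: "phi_fun ta \<in> H0inf sg" and ta: "0 < \<bar>ta\<bar>" "\<bar>ta\<bar> < pi" and sg: "sg < pi"
 shows "sg \<le> \<bar>ta\<bar>"
proof (rule ccontr)
 assume n: "\<not> sg \<le> \<bar>ta\<bar>"
 then have n: "\<bar>ta\<bar> < sg" by simp
 obtain K where K: "K \<ge> 0" "\<And>w. w \<in> strip (- sg) sg ==> cmod (phi_fun ta (exp w)) \<le> K"
  by (rule H0inf_log[OF \<phi> ta(1) n sg]) blast
 \<comment> \<open>On the ray through the singularity the distance from it is \<open>r - 1\<close>,
   so this radius makes the squared modulus of \<open>phi_fun\<close> at least
   \<open>K\<^sup>2 + 1\<close>.\<close>
 define r where "r = 1 + 1 / (K\<^sup>2 + 1)"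
 have k1: "K\<^sup>2 + 1 > 0" by (simp add: add_nonneg_pos)
 then have r: "r > 1" by (simp add: r_def)
 have r0: "r > 0" using r by simp
 define z where "z = rcis r ta"
 have ze: "z = exp (Complex (ln r) ta)" using r0 by (simp add: z_def exp_Complex)
 have "Complex (ln r) ta \<in> strip (- sg) sg" using n by (auto simp: strip_def)
 from K(2)[OF this] have b: "cmod (phi_fun ta z) \<le> K" unfolding ze .
 have "phi_fun ta z * phi_fun ta z = rt z / (z - cis ta)"
  using phi_fun_square[OF r0 ta(2), of ta 0] by (simp add: z_def exp_Complex_eq)
 then have "cmod (phi_fun ta z) * cmod (phi_fun ta z) = cmod (rt z) / cmod (z - cis ta)"
  by (simp only: norm_mult[symmetric] norm_divide[symmetric])
 also have "cmod (z - cis ta) = r - 1"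
 proof -
  have "z - cis ta = complex_of_real (r - 1) * cis ta" by (simp add: z_def rcis_def left_diff_distrib)
  then show ?thesis using r by (simp add: norm_mult del: of_real_diff)
 qed
 also have "r - 1 = 1 / (K\<^sup>2 + 1)" by (simp add: r_def)
 finally have e: "cmod (phi_fun ta z) * cmod (phi_fun ta z) = cmod (rt z) * (K\<^sup>2 + 1)" by simp
 have "cmod (rt z) * cmod (rt z) = r" unfolding norm_mult[symmetric] rt_square using r0 by (simp add: z_def)
 then have "cmod (rt z) \<ge> 1"
  using r mult_strict_mono[of "cmod (rt z)" 1 "cmod (rt z)" 1] by (cases "cmod (rt z) < 1") simp_all
 then have "1 * (K\<^sup>2 + 1) \<le> cmod (rt z) * (K\<^sup>2 + 1)" using k1 by (intro mult_right_mono) simp_all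
 also have "\<dots> \<le> K * K" unfolding e[symmetric] by (rule mult_mono[OF b b K(1)]) simp
 finally show False by (simp add: power2_eq_square)
qed

text \<open>Unpacks the \<open>SOME\<close> in \<open>calc_angle\<close>. The angle lies above some
  angle of sectoriality, not necessarily the one given with the operator, and this angle is
  therefore returned as well.\<close>

lemma admissible_angle_log_symbol:
 assumes a: "admissible_angle D A \<phi> sg"
 obtains K \<omega> where "log_symbol \<phi> sg (calc_angle D A sg) K" "sectorial D A \<omega>" "\<omega> < calc_angle D A sg"
proof -
 obtain \<omega>0 where \<omega>0: "\<omega>0 < sg" "sectorial D A \<omega>0" and sg: "sg < pi" and \<phi>: "\<phi> \<in> H0inf sg"
  using a unfolding admissible_angle_def by blast
 have "\<exists>nu. \<exists>\<omega>. sectorial D A \<omega> \<and> \<omega> < nu \<and> nu < sg"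
  using \<omega>0 by (intro exI[of _ "(\<omega>0 + sg) / 2"] exI[of _ \<omega>0]) simp
 from someI_ex[OF this] obtain \<omega> where \<omega>: "sectorial D A \<omega>" "\<omega> < calc_angle D A sg" "calc_angle D A sg < sg"
  unfolding calc_angle_def[symmetric] by blast
 have "0 \<le> \<omega>" using \<omega>(1) unfolding sectorial_def by blast
 then have nu: "0 < calc_angle D A sg" using \<omega>(2) by simp
 obtain K where K: "K \<ge> 0" "(%w. \<phi> (exp w)) holomorphic_on strip (- sg) sg"
  "\<And>w. w \<in> strip (- sg) sg ==> cmod (\<phi> (exp w)) \<le> K"
  "\<And>u v ta. ta \<in> {calc_angle D A sg, - calc_angle D A sg} ==> cmod (\<phi> (exp (Complex u ta)) - \<phi> (exp (Complex v ta))) \<le> K * \<bar>u - v\<bar>"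
  by (rule H0inf_log[OF \<phi> nu \<omega>(3) sg]) blast
 have "log_symbol \<phi> sg (calc_angle D A sg) K"
  by (rule log_symbol.intro[OF nu \<omega>(3) sg K(1,2)]) (rule K(3), assumption, rule K(4), assumption)
 then show ?thesis by (rule that[OF _ \<omega>(1,2)])
qed

lemma square_function_data:
 assumes "square_function_estimates D A \<phi>"
 obtains sg K \<omega> C where "log_symbol \<phi> sg (calc_angle D A sg) K" "sectorial D A \<omega>" "\<omega> < calc_angle D A sg" "\<phi> \<in> H0inf sg" "C \<ge> 0"
  "\<And>x. gamma_radonifying (sq_op D A sg \<phi> x)" "\<And>x. gamma_norm (sq_op D A sg \<phi> x) \<le> C * norm x"
proof -
 obtain sg C where sg: "admissible_angle D A \<phi> sg"
  and C: "\<And>x. gamma_radonifying (sq_op D A sg \<phi> x)" "\<And>x. gamma_norm (sq_op D A sg \<phi> x) \<le> C * norm x"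
  using assms unfolding square_function_estimates_def by blast
 obtain K \<omega> where K: "log_symbol \<phi> sg (calc_angle D A sg) K" "sectorial D A \<omega>" "\<omega> < calc_angle D A sg"
  by (rule admissible_angle_log_symbol[OF sg])
 have h: "\<phi> \<in> H0inf sg" using sg unfolding admissible_angle_def by blast
 have "gamma_norm (sq_op D A sg \<phi> x) \<le> max C 0 * norm x" for x
  by (rule order_trans[OF C(2)]) (simp add: mult_right_mono)
 then show ?thesis by (rule that[OF K h max.cobounded2 C(1)])
qed

lemma dual_square_function_data:
 assumes "dual_square_function_estimates D A \<phi>"
 obtains sg K \<omega> C where "log_symbol \<phi> sg (calc_angle D A sg) K" "sectorial D A \<omega>" "\<omega> < calc_angle D A sg" "\<phi> \<in> H0inf sg" "C \<ge> 0"
  "\<And>x' g. bounded_clinear x' ==> g \<in> H_space ==> x' \<in> adjoint_dom (calc_dom D A sg (sq_symbol \<phi> g)) (calc D A sg (sq_symbol \<phi> g))"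
  "\<And>x'. bounded_clinear x' ==> in_gamma_dual (dual_sq_op D A sg \<phi> x')"
  "\<And>x'. bounded_clinear x' ==> gamma_dual_norm (dual_sq_op D A sg \<phi> x') \<le> C * onorm x'"
proof -
 obtain sg C where sg: "admissible_angle D A \<phi> sg"
  and C: "\<And>x'. bounded_clinear x' ==>
     (\<forall>g\<in>H_space. x' \<in> adjoint_dom (calc_dom D A sg (sq_symbol \<phi> g)) (calc D A sg (sq_symbol \<phi> g))) \<and>
     in_gamma_dual (dual_sq_op D A sg \<phi> x') \<and> gamma_dual_norm (dual_sq_op D A sg \<phi> x') \<le> C * onorm x'"
  using assms unfolding dual_square_function_estimates_def by blast
 obtain K \<omega> where K: "log_symbol \<phi> sg (calc_angle D A sg) K" "sectorial D A \<omega>" "\<omega> < calc_angle D A sg"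
  by (rule admissible_angle_log_symbol[OF sg])
 have h: "\<phi> \<in> H0inf sg" using sg unfolding admissible_angle_def by blast
 show ?thesis
 proof (rule that[OF K h, of "max C 0"])
  fix x' :: "'a => complex" assume x': "bounded_clinear x'"
  note c = C[OF x']
  show "in_gamma_dual (dual_sq_op D A sg \<phi> x')" using c by blast
  have "gamma_dual_norm (dual_sq_op D A sg \<phi> x') \<le> C * onorm x'" using c by blast
  also have "\<dots> \<le> max C 0 * onorm x'"
   by (rule mult_right_mono[OF _ onorm_pos_le[OF bounded_clinear_imp_bounded_linear[OF x']]]) simp
  finally show "gamma_dual_norm (dual_sq_op D A sg \<phi> x') \<le> max C 0 * onorm x'" .
  show "x' \<in> adjoint_dom (calc_dom D A sg (sq_symbol \<phi> g)) (calc D A sg (sq_symbol \<phi> g))" if "g \<in> H_space" for g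
   using c that by blast
 qed simp
qed

text \<open>The estimates for the two rays arrive with different contour angles, whereas
  \<open>L\<close> uses a single angle for both.\<close>

lemma (in two_ops) kernel_angle_indep:
 assumes "s < nu1" "nu1 < pi" "s < nu2" "nu2 < pi"
 shows "kernel nu1 = kernel nu2"
proof -
 define b where "b = (max nu1 nu2 + pi) / 2"
 have b: "0 < b" "b < pi" "nu1 < b" "nu2 < b" using assms s by (simp_all add: b_def)
 have "Phi nu1 ups v = Phi nu2 ups v" for v
  by (rule Phi_angle_indep[OF h0_ups[OF b(1,2)]]) (use assms b in simp_all)
 then show ?thesis by (intro ext) (simp only: kernel_def)
qed

text \<open>The ray of angle \<open>\<rho>\<close> is estimated with \<open>phi_fun \<rho>\<close>,
  the other one with \<open>phi_fun (- \<rho>)\<close>. \<open>S\<close> is defined on the whole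
  space and agrees with A (A + B)^(-1) on the range of the sum, where injectivity gives the inverse
  a meaning. What remains is to find angles that fit all four estimates at once.\<close>

theorem theorem5p1:
  fixes A B :: "'a::complex_banach \<Rightarrow> 'a"
    and DA DB :: "'a set"
    and \<omega>A \<omega>B \<omega>\<gamma>A \<omega>\<gamma>B \<rho> :: real
  assumes "sectorial DA A \<omega>A" and "sectorial DB B \<omega>B"
    and "closure DA = UNIV" and "closure (A ` DA) = UNIV"
    and "closure DB = UNIV" and "closure (B ` DB) = UNIV"
    and "\<omega>A + \<omega>B < pi"
    and "commuting_resolvents DA A DB B"
    and "gamma_sectorial DA A \<omega>\<gamma>A" and "gamma_sectorial DB B \<omega>\<gamma>B"
    and "\<omega>\<gamma>A + \<omega>\<gamma>B < pi"
    and "\<rho> \<in> {\<omega>\<gamma>A <..< pi - \<omega>\<gamma>B}"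
    and "square_function_estimates DA A (phi_fun \<rho>)"
    and "square_function_estimates DA A (phi_fun (- \<rho>))"
    and "dual_square_function_estimates DA A (phi_fun \<rho>)"
    and "dual_square_function_estimates DA A (phi_fun (- \<rho>))"
  shows "closed_op (DA \<inter> DB) (\<lambda>x. A x + B x) \<and>
         inj_on (\<lambda>x. A x + B x) (DA \<inter> DB) \<and>
         (\<exists>S. bounded_clinear S \<and>
            (\<forall>y \<in> (\<lambda>x. A x + B x) ` (DA \<inter> DB).
               S y = A (inv_into (DA \<inter> DB) (\<lambda>x. A x + B x) y)))"
proof -
 note d = assms(3,4)
 have \<rho>: "0 < \<rho>" "\<rho> < pi - \<omega>\<gamma>B" "\<rho> < pi" "0 \<le> \<omega>\<gamma>B"
  using assms(9,10,12) unfolding gamma_sectorial_def by simp_all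
 have cA: "closed_op DA A" and cB: "closed_op DB B" using assms(1,2) unfolding sectorial_def by blast+
 obtain sg1 K1 \<omega>1 C1 where S1: "log_symbol (phi_fun \<rho>) sg1 (calc_angle DA A sg1) K1" "sectorial DA A \<omega>1" "\<omega>1 < calc_angle DA A sg1"
   "phi_fun \<rho> \<in> H0inf sg1" "C1 \<ge> 0"
  and Q1: "\<And>x. gamma_radonifying (sq_op DA A sg1 (phi_fun \<rho>) x)" "\<And>x. gamma_norm (sq_op DA A sg1 (phi_fun \<rho>) x) \<le> C1 * norm x"
  by (rule square_function_data[OF assms(13)]) blast
 obtain sg3 K3 \<omega>3 C3 where S3: "log_symbol (phi_fun (- \<rho>)) sg3 (calc_angle DA A sg3) K3" "sectorial DA A \<omega>3" "\<omega>3 < calc_angle DA A sg3"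
   "phi_fun (- \<rho>) \<in> H0inf sg3" "C3 \<ge> 0"
  and Q3: "\<And>x. gamma_radonifying (sq_op DA A sg3 (phi_fun (- \<rho>)) x)" "\<And>x. gamma_norm (sq_op DA A sg3 (phi_fun (- \<rho>)) x) \<le> C3 * norm x"
  by (rule square_function_data[OF assms(14)]) blast
 obtain sg2 K2 \<omega>2 C2 where S2: "log_symbol (phi_fun \<rho>) sg2 (calc_angle DA A sg2) K2" "sectorial DA A \<omega>2" "\<omega>2 < calc_angle DA A sg2"
   "phi_fun \<rho> \<in> H0inf sg2" "C2 \<ge> 0"
  and Q2: "\<And>x' g. bounded_clinear x' ==> g \<in> H_space ==> x' \<in> adjoint_dom (calc_dom DA A sg2 (sq_symbol (phi_fun \<rho>) g)) (calc DA A sg2 (sq_symbol (phi_fun \<rho>) g))"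
   "\<And>x'. bounded_clinear x' ==> in_gamma_dual (dual_sq_op DA A sg2 (phi_fun \<rho>) x')"
   "\<And>x'. bounded_clinear x' ==> gamma_dual_norm (dual_sq_op DA A sg2 (phi_fun \<rho>) x') \<le> C2 * onorm x'"
  by (rule dual_square_function_data[OF assms(15)]) blast
 obtain sg4 K4 \<omega>4 C4 where S4: "log_symbol (phi_fun (- \<rho>)) sg4 (calc_angle DA A sg4) K4" "sectorial DA A \<omega>4" "\<omega>4 < calc_angle DA A sg4"
   "phi_fun (- \<rho>) \<in> H0inf sg4" "C4 \<ge> 0"
  and Q4: "\<And>x' g. bounded_clinear x' ==> g \<in> H_space ==> x' \<in> adjoint_dom (calc_dom DA A sg4 (sq_symbol (phi_fun (- \<rho>)) g)) (calc DA A sg4 (sq_symbol (phi_fun (- \<rho>)) g))"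
   "\<And>x'. bounded_clinear x' ==> in_gamma_dual (dual_sq_op DA A sg4 (phi_fun (- \<rho>)) x')"
   "\<And>x'. bounded_clinear x' ==> gamma_dual_norm (dual_sq_op DA A sg4 (phi_fun (- \<rho>)) x') \<le> C4 * onorm x'"
  by (rule dual_square_function_data[OF assms(16)]) blast
 have two: "\<exists>\<omega>. sectorial DA A \<omega> \<and> \<omega> < min a b"
  if "\<exists>\<omega>. sectorial DA A \<omega> \<and> \<omega> < a" "\<exists>\<omega>. sectorial DA A \<omega> \<and> \<omega> < b" for a b
  using that unfolding min_def by (simp only: if_True split: if_split) simp
 \<comment> \<open>The four estimates may come with four calculus angles. \<open>s\<close> is placed
   below all of them and above some angle of sectoriality, so one resolvent locale covers every
   contour.\<close>
 define \<mu> where "\<mu> = min (min (calc_angle DA A sg1) (calc_angle DA A sg2)) (min (calc_angle DA A sg3) (calc_angle DA A sg4))"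
 have "\<exists>\<omega>. sectorial DA A \<omega> \<and> \<omega> < \<mu>"
  unfolding \<mu>_def using S1(2,3) S2(2,3) S3(2,3) S4(2,3) by (intro two exI conjI)
 then obtain \<omega> where \<omega>: "sectorial DA A \<omega>" "\<omega> < \<mu>" by (elim exE conjE)
 define s where "s = (\<omega> + \<mu>) / 2"
 have s: "\<omega> < s" "s < \<mu>" using \<omega>(2) by (simp_all add: s_def)
 have nu: "s < calc_angle DA A sg1" "s < calc_angle DA A sg2" "s < calc_angle DA A sg3" "s < calc_angle DA A sg4"
  using s(2) unfolding \<mu>_def by simp_all
 have sg: "calc_angle DA A sg1 < sg1" "sg1 < pi" "calc_angle DA A sg2 < sg2" "sg2 < pi" "calc_angle DA A sg3 < sg3" "sg3 < pi" "calc_angle DA A sg4 < sg4" "sg4 < pi"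
  using log_symbol.sg[OF S1(1)] log_symbol.sg[OF S2(1)] log_symbol.sg[OF S3(1)] log_symbol.sg[OF S4(1)] by simp_all
 \<comment> \<open>An admissible sector cannot contain the singularity of \<open>phi_fun\<close>;
   hence the calculus contours stay inside the rays of angles \<open>\<rho>\<close> and
   \<open>- \<rho>\<close>.\<close>
 have sg\<rho>: "sg1 \<le> \<bar>\<rho>\<bar>" "sg2 \<le> \<bar>\<rho>\<bar>" "sg3 \<le> \<bar>- \<rho>\<bar>" "sg4 \<le> \<bar>- \<rho>\<bar>"
  by (rule phi_fun_H0inf[OF S1(4)] phi_fun_H0inf[OF S2(4)] phi_fun_H0inf[OF S3(4)] phi_fun_H0inf[OF S4(4)]; use \<rho> sg in simp)+
 have "s < pi" using nu(1) sg(1,2) by simp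
 then obtain M where opA: "sect_op DA A s M" by (rule sectorial_sect_op[OF \<omega>(1) s(1)])
 \<comment> \<open>Midway between the \<gamma>-angle of \<open>B\<close> and
   \<open>pi - \<rho>\<close>: above the former for the \<gamma>-bounds, below the latter so that
   the negatives of both rays lie in \<open>cosector sB\<close>.\<close>
 define sB where "sB = (\<omega>\<gamma>B + (pi - \<rho>)) / 2"
 have sB: "\<omega>\<gamma>B < sB" "sB < pi" "\<rho> < pi - sB" using \<rho> by (simp_all add: sB_def field_simps)
 obtain CB where CB: "CB \<ge> 0" "sect_op DB B sB CB"
  "\<And>N l x. (\<And>n. n < N ==> l n \<in> cosector sB) ==>
   gauss_E N (%n. l n *\<^sub>C resolvent DB B (l n) (x n)) \<le> ennreal (CB\<^sup>2) * gauss_E N x"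
  using cB unfolding closed_op_def by (elim conjE) (rule gamma_sectorial_sect_op[OF assms(10) sB(1,2)], blast+)
 interpret two_ops DA A s M DB B sB CB
  by (rule two_ops.intro[OF opA CB(2)]) (rule two_ops_axioms.intro[OF assms(8)])
 define nup where "nup = min (calc_angle DA A sg1) (calc_angle DA A sg2)"
 define num where "num = min (calc_angle DA A sg3) (calc_angle DA A sg4)"
 have nup: "s < nup" "nup < pi" "nup < \<rho>" "s < num" "num < pi"
 proof -
  have "nup \<le> calc_angle DA A sg1" "num \<le> calc_angle DA A sg3" by (simp_all add: nup_def num_def)
  moreover have "sg1 \<le> \<rho>" using sg\<rho>(1) \<rho>(1) by simp
  ultimately show "nup < pi" "nup < \<rho>" "num < pi" using sg by linarith+
  show "s < nup" "s < num" unfolding nup_def num_def using nu by (simp_all only: min_less_iff_conj simp_thms)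
 qed
 define K where "K = max (4 * C2 * CB * C1) (4 * C4 * CB * C3)"
 have K: "K \<ge> 0" using S1(5) S2(5) CB(1) by (simp add: K_def le_max_iff_disj)
 have \<rho>B: "\<bar>\<rho>\<bar> < pi - sB" "\<bar>- \<rho>\<bar> < pi - sB" using sB \<rho> by simp_all
 have Kmono: "c \<le> K ==> c * onorm x' * norm (Psi (Psi v)) \<le> K * onorm x' * norm (Psi (Psi v))" if "bounded_clinear x'"
  for c v and x' :: "'a => complex"
  by (intro mult_right_mono onorm_pos_le bounded_clinear_imp_bounded_linear[OF that]) simp_all
 have est: "cmod (integral {- m..m} (kernel nup ta x' v)) \<le> K * onorm x' * norm (Psi (Psi v))"
  if ta: "ta \<in> {\<rho>, - \<rho>}" and x': "bounded_clinear x'" and m: "m > 0" for ta x' v m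
 proof (cases "ta = \<rho>")
  case True
  have "cmod (integral {- m..m} (kernel nup \<rho> x' v)) \<le> 4 * C2 * CB * C1 * onorm x' * norm (Psi (Psi v))"
  proof (rule kernel_estimate[OF S1(1) S2(1) nu(1,2) nup_def sg\<rho>(1,2) \<rho>B(1) _ x' m])
   show "phi_fun \<rho> (complex_of_real (exp a) * rcis r tu) * phi_fun \<rho> (complex_of_real (exp a) * rcis r tu)
    = complex_of_real (exp (- a / 2)) * (rt (rcis r tu) / (rcis r tu - exp (Complex (- a) \<rho>)))"
    if "r > 0" "tu \<in> {nup, - nup}" for a r tu
    by (rule phi_fun_square[OF that(1)]) (use that(2) nup opA[THEN sect_op.axioms(1), THEN sect_resolvent.s(1)] in auto)
  qed (rule square_function_bound[OF d S1(1) S2(1) nu(1,2) \<rho>B(1) Q1 S1(5) Q2 S2(5) CB(3,1) x'], assumption+)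
  also have "\<dots> \<le> K * onorm x' * norm (Psi (Psi v))" by (rule Kmono[OF x']) (simp add: K_def)
  finally show ?thesis using True by simp
 next
  case False
  then have th: "ta = - \<rho>" using ta by simp
  have "cmod (integral {- m..m} (kernel num (- \<rho>) x' v)) \<le> 4 * C4 * CB * C3 * onorm x' * norm (Psi (Psi v))"
  proof (rule kernel_estimate[OF S3(1) S4(1) nu(3,4) num_def sg\<rho>(3,4) \<rho>B(2) _ x' m])
   show "phi_fun (- \<rho>) (complex_of_real (exp a) * rcis r tu) * phi_fun (- \<rho>) (complex_of_real (exp a) * rcis r tu)
    = complex_of_real (exp (- a / 2)) * (rt (rcis r tu) / (rcis r tu - exp (Complex (- a) (- \<rho>))))"
    if "r > 0" "tu \<in> {num, - num}" for a r tu
    by (rule phi_fun_square[OF that(1)]) (use that(2) nup opA[THEN sect_op.axioms(1), THEN sect_resolvent.s(1)] in auto)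
  qed (rule square_function_bound[OF d S3(1) S4(1) nu(3,4) \<rho>B(2) Q3 S3(5) Q4 S4(5) CB(3,1) x'], assumption+)
  also have "\<dots> \<le> K * onorm x' * norm (Psi (Psi v))" by (rule Kmono[OF x']) (simp add: K_def)
  finally show ?thesis unfolding th kernel_angle_indep[OF nup(1,2,4,5)] .
 qed
 have "\<exists>S. bounded_clinear S \<and> (\<forall>y\<in>DA \<inter> DB. S (A y + B y) = A y)"
  by (rule bounded_solution[OF d nup(1,3) sB(3) _ K]) (rule est)
 then obtain S where S': "bounded_clinear S \<and> (\<forall>y\<in>DA \<inter> DB. S (A y + B y) = A y)" by (rule exE)
 note S = conjunct1[OF S'] bspec[OF conjunct2[OF S']]
 note cl = closed_sum[OF cA cB S injective[OF d(2)]]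
 have "S y = A (inv_into (DA \<inter> DB) (%x. A x + B x) y)" if "y \<in> (%x. A x + B x) ` (DA \<inter> DB)" for y
 proof -
  define x where "x = inv_into (DA \<inter> DB) (%x. A x + B x) y"
  have "x \<in> DA \<inter> DB" unfolding x_def by (rule inv_into_into[OF that])
  moreover have "A x + B x = y" unfolding x_def by (rule f_inv_into_f[OF that])
  ultimately show ?thesis using S(2)[of x] unfolding x_def[symmetric] by simp
 qed
 then show ?thesis using cl S(1) by (intro conjI exI[of _ S] ballI)
qed

end
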